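(* Write $(\theta;t)=(\theta_1,\dots,\theta_m;t)$ and let $D=\gamma_1\times\cdots\times\gamma_{m+1}\subset T$, where $T\subset\mathbb{C}^{m+1}$ is a domain and each $\gamma_k$ is a smooth simple curve in $\mathbb{C}$ independent of the positive parameter $\lambda$. Let $p(\theta;t)$, $f(\theta;t)$, $q(\theta;t)$ be independent of $\lambda$, single-valued and holomorphic in $T$, and consider $$I(\lambda)=\mathrm{P.V.}\int_De^{-\lambda p(\theta;t)-\sqrt\lambda f(\theta;t)}\frac{q(\theta;t)}{t}\,d^m\theta\,dt .$$ Suppose that $(\theta;t)=(0;0)$ is an interior point of $D$ such that the following hold: (i) $\alpha:=\frac{\partial p(0;0)}{\partial t}\ne0$ and $\nabla_\theta p(0;0)=\big(\frac{\partial p(0;0)}{\partial\theta_1},\dots,\frac{\partial p(0;0)}{\partial\theta_m}\big)=0$; write $\eta:=\nabla_\theta f(0;0)$. (ii) The Hessian matrix $A=\Big(\frac{\partial^2p(0;0)}{\partial\theta_k\partial\theta_j}\Big)_{1\le k,j\le m}$ in the first $m$ variables satisfies $\det A\ne0$. (iii) There exists $\lambda_0>0$ such that for every $\lambda\ge\lambda_0$, $I(\lambda)$ converges absolutely throughout its range except for one neighbourhood of $(0;0)$. (iv) For every $\varepsilon>0$, with $D_\varepsilon=\{(\theta;t)\in D:\max\{|\theta_1|,\dots,|\theta_m|,|t|\}<\varepsilon\}$, there exists $\lambda_1>0$ such that $$\inf\Big\{\mathrm{Re}\Big(p(\theta;t)-p(0;0)+\frac{f(\theta;t)-f(0;0)}{\sqrt\lambda}\Big):(\theta;t)\in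 D\setminus D_\varepsilon,\ \lambda\ge\lambda_1\Big\}>0 .$$ (v) $q(0;0)\ne0$. Then as $\lambda\to\infty$ $$I(\lambda)\sim i\pi\,(2\pi/\lambda)^{m/2}\,q(0;0)\,e^{-\lambda p(0;0)-\sqrt\lambda f(0;0)}\,e^{\frac12\eta A^{-1}\eta^T}\,\frac{\epsilon(\alpha,A)}{\sqrt{\det A}},$$ where $\epsilon(\alpha,A)$ equals $1$ or $-1$, depending on the argument of $\alpha$ and the choice of the sign of $\sqrt{\det A}$.
   Context: Vectors such as $\eta$ are row vectors and $^T$ denotes transpose (no complex conjugation). $\mathrm{P.V.}$ denotes the Cauchy principal value with respect to the simple pole at $t=0$. $F(\lambda)\sim G(\lambda)$ means $F(\lambda)/G(\lambda)\to1$. *)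

theory Defs
  imports "HOL-Analysis.Analysis" "HOL-Library.Landau_Symbols"
begin

text \<open>
  A curve is a parameter interval together with a parametrisation.  The interval may be bounded
  or unbounded, and may or may not contain its end points.
\<close>

type_synonym curve = "real set \<times> (real \<Rightarrow> complex)"

abbreviation curve_trace :: "curve \<Rightarrow> complex set" where
  "curve_trace \<gamma> \<equiv> snd \<gamma> ` fst \<gamma>"

text \<open>
  Smooth: continuously differentiable with nowhere vanishing derivative (one-sided at end
  points).  Simple: either an arc or a Jordan curve.  For an arc, mere injectivity would be too
  weak on a non-compact parameter interval, since the curve could then accumulate at one of its
  own points; hence the homeomorphism.
\<close>

definition smooth_simple_curve :: "curve \<Rightarrow> bool" where
  "smooth_simple_curve \<gamma> \<longleftrightarrow> (case \<gamma> of (J, c) \<Rightarrow>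
     is_interval J \<and> interior J \<noteq> {} \<and>
     (\<exists>c'. continuous_on J c' \<and>
        (\<forall>s\<in>J. (c has_vector_derivative c' s) (at s within J) \<and> c' s \<noteq> 0) \<and>
        ((\<exists>g. homeomorphism J (c ` J) c g) \<or>
         (\<exists>a b. J = {a..b} \<and> inj_on c {a..<b} \<and> c a = c b \<and> c' a = c' b))))"

definition interior_point :: "curve \<Rightarrow> complex \<Rightarrow> bool" where
  "interior_point \<gamma> z \<longleftrightarrow> z \<in> snd \<gamma> ` interior (fst \<gamma>)"

text \<open>Speed of a curve; the derivative is one-sided at end points.\<close>

definition speed :: "curve \<Rightarrow> real \<Rightarrow> complex" where
  "speed \<gamma> s = vector_derivative (snd \<gamma>) (at s within fst \<gamma>)"

text \<open>
  Points of $\mathbb{C}^{m+1}$ are pairs \<open>(\<theta>, t)\<close>; the index type \<open>'m\<close> has $m$ elements.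
  The set $D$ is the product of the traces of the curves \<open>\<Gamma> k\<close> (for $\theta_k$) and
  \<open>\<gamma>\<close> (for $t$).
\<close>

definition theta_set :: "('m::finite \<Rightarrow> curve) \<Rightarrow> (complex ^ 'm) set" where
  "theta_set \<Gamma> = {\<theta>. \<forall>k. \<theta> $ k \<in> curve_trace (\<Gamma> k)}"

definition curve_product :: "('m::finite \<Rightarrow> curve) \<Rightarrow> curve \<Rightarrow> ((complex ^ 'm) \<times> complex) set" where
  "curve_product \<Gamma> \<gamma> = theta_set \<Gamma> \<times> curve_trace \<gamma>"

text \<open>
  Integration of \<open>h d\<^sup>m\<theta>\<close> and of \<open>h d\<^sup>m\<theta> dt\<close> over subsets of the product of the
  traces is Lebesgue integration of the pull-back under the product parametrisation.
\<close>

definition theta_param :: "('m::finite \<Rightarrow> curve) \<Rightarrow> real ^ 'm \<Rightarrow> complex ^ 'm" where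
  "theta_param \<Gamma> x = (\<chi> k. snd (\<Gamma> k) (x $ k))"

definition theta_preimage :: "('m::finite \<Rightarrow> curve) \<Rightarrow> (complex ^ 'm) set \<Rightarrow> (real ^ 'm) set" where
  "theta_preimage \<Gamma> S = {x. (\<forall>k. x $ k \<in> fst (\<Gamma> k)) \<and> theta_param \<Gamma> x \<in> S}"

definition preimage ::
  "('m::finite \<Rightarrow> curve) \<Rightarrow> curve \<Rightarrow> ((complex ^ 'm) \<times> complex) set \<Rightarrow> ((real ^ 'm) \<times> real) set" where
  "preimage \<Gamma> \<gamma> S = {(x, s). (\<forall>k. x $ k \<in> fst (\<Gamma> k)) \<and> s \<in> fst \<gamma> \<and>
                            (theta_param \<Gamma> x, snd \<gamma> s) \<in> S}"

definition theta_pullback ::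
  "('m::finite \<Rightarrow> curve) \<Rightarrow> (complex ^ 'm \<Rightarrow> complex) \<Rightarrow> real ^ 'm \<Rightarrow> complex" where
  "theta_pullback \<Gamma> h x = h (theta_param \<Gamma> x) * (\<Prod>k\<in>UNIV. speed (\<Gamma> k) (x $ k))"

definition pullback ::
  "('m::finite \<Rightarrow> curve) \<Rightarrow> curve \<Rightarrow> ((complex ^ 'm) \<times> complex \<Rightarrow> complex)
     \<Rightarrow> (real ^ 'm) \<times> real \<Rightarrow> complex" where
  "pullback \<Gamma> \<gamma> h = (\<lambda>(x, s). h (theta_param \<Gamma> x, snd \<gamma> s) *
                       (\<Prod>k\<in>UNIV. speed (\<Gamma> k) (x $ k)) * speed \<gamma> s)"

definition theta_abs_integrable ::
  "('m::finite \<Rightarrow> curve) \<Rightarrow> (complex ^ 'm) set \<Rightarrow> (complex ^ 'm \<Rightarrow> complex) \<Rightarrow> bool" where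
  "theta_abs_integrable \<Gamma> S h \<longleftrightarrow>
     set_integrable lborel (theta_preimage \<Gamma> S) (theta_pullback \<Gamma> h)"

definition abs_integrable ::
  "('m::finite \<Rightarrow> curve) \<Rightarrow> curve \<Rightarrow> ((complex ^ 'm) \<times> complex) set
     \<Rightarrow> ((complex ^ 'm) \<times> complex \<Rightarrow> complex) \<Rightarrow> bool" where
  "abs_integrable \<Gamma> \<gamma> S h \<longleftrightarrow>
     set_integrable lborel (preimage \<Gamma> \<gamma> S) (pullback \<Gamma> \<gamma> h)"

definition product_integral ::
  "('m::finite \<Rightarrow> curve) \<Rightarrow> curve \<Rightarrow> ((complex ^ 'm) \<times> complex) set
     \<Rightarrow> ((complex ^ 'm) \<times> complex \<Rightarrow> complex) \<Rightarrow> complex" where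
  "product_integral \<Gamma> \<gamma> S h =
     set_lebesgue_integral lborel (preimage \<Gamma> \<gamma> S) (pullback \<Gamma> \<gamma> h)"

text \<open>
  \<open>has_pv_integral \<Gamma> \<gamma> h L\<close>: the integral of \<open>h (\<theta>, t) / t\<close> over $D$ has the Cauchy principal
  value \<open>L\<close> with respect to the pole at $t = 0$, i.e. the integrals over
  $\{(\theta;t) \in D : |t| \ge r\}$ converge to \<open>L\<close> as $r \to 0+$.
\<close>

definition has_pv_integral ::
  "('m::finite \<Rightarrow> curve) \<Rightarrow> curve \<Rightarrow> ((complex ^ 'm) \<times> complex \<Rightarrow> complex) \<Rightarrow> complex \<Rightarrow> bool" where
  "has_pv_integral \<Gamma> \<gamma> h L \<longleftrightarrow>
     (\<forall>r>0. abs_integrable \<Gamma> \<gamma> {(\<theta>, t) \<in> curve_product \<Gamma> \<gamma>. r \<le> cmod t} (\<lambda>(\<theta>, t). h (\<theta>, t) / t)) \<and>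
     ((\<lambda>r. product_integral \<Gamma> \<gamma> {(\<theta>, t) \<in> curve_product \<Gamma> \<gamma>. r \<le> cmod t}
              (\<lambda>(\<theta>, t). h (\<theta>, t) / t)) \<longlongrightarrow> L) (at_right 0)"

definition pv_integral ::
  "('m::finite \<Rightarrow> curve) \<Rightarrow> curve \<Rightarrow> ((complex ^ 'm) \<times> complex \<Rightarrow> complex) \<Rightarrow> complex" where
  "pv_integral \<Gamma> \<gamma> h = (THE L. has_pv_integral \<Gamma> \<gamma> h L)"

text \<open>The neighbourhood $D_\varepsilon$ of the origin in $D$ (maximum norm).\<close>

definition origin_box :: "('m::finite \<Rightarrow> curve) \<Rightarrow> curve \<Rightarrow> real \<Rightarrow> ((complex ^ 'm) \<times> complex) set" where
  "origin_box \<Gamma> \<gamma> \<epsilon> = {(\<theta>, t) \<in> curve_product \<Gamma> \<gamma>. (\<forall>k. cmod (\<theta> $ k) < \<epsilon>) \<and> cmod t < \<epsilon>}"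

text \<open>
  Absolute convergence, away from some neighbourhood $D_\varepsilon$ of the origin, of the principal
  value integral of \<open>h (\<theta>, t) / t\<close> over $D$.  Outside a neighbourhood of $(0;0)$ the set $D$
  still meets the polar set $t = 0$, where $h/t$ itself is not Lebesgue integrable.  For $|t| < \varepsilon$
  we therefore split off the pole,
  $h(\theta;t)/t = (h(\theta;t) - h(\theta;0))/t + h(\theta;0)/t$,
  and require the regular part to be absolutely integrable in $(\theta;t)$ and the residue
  $h(\theta;0)$ to be absolutely integrable in $\theta$ (the principal value of $\int dt/t$ being
  a finite constant).  For $|t| \ge \varepsilon$ the integrand itself has to be absolutely integrable.
  The compactness condition only says that $\varepsilon$ is so small that $D_\varepsilon$ stays away from
  infinity and from missing end points of the curves; it holds for all small $\varepsilon$.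
\<close>

definition pv_abs_convergent_away_from_origin ::
  "('m::finite \<Rightarrow> curve) \<Rightarrow> curve \<Rightarrow> ((complex ^ 'm) \<times> complex \<Rightarrow> complex) \<Rightarrow> bool" where
  "pv_abs_convergent_away_from_origin \<Gamma> \<gamma> h \<longleftrightarrow>
     (\<exists>\<epsilon>>0.
        compact {(\<theta>, t) \<in> curve_product \<Gamma> \<gamma>. (\<forall>k. cmod (\<theta> $ k) \<le> \<epsilon>) \<and> cmod t \<le> \<epsilon>} \<and>
        abs_integrable \<Gamma> \<gamma> (curve_product \<Gamma> \<gamma> - origin_box \<Gamma> \<gamma> \<epsilon>)
          (\<lambda>(\<theta>, t). if cmod t < \<epsilon> then (h (\<theta>, t) - h (\<theta>, 0)) / t else h (\<theta>, t) / t) \<and>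
        theta_abs_integrable \<Gamma> {\<theta> \<in> theta_set \<Gamma>. (\<theta>, 0) \<notin> origin_box \<Gamma> \<gamma> \<epsilon>} (\<lambda>\<theta>. h (\<theta>, 0)))"

text \<open>
  Holomorphy in several variables: at every point of the (open) set the function is Frechet
  differentiable with complex linear derivative.
\<close>

definition holomorphic_several ::
  "((complex ^ 'm::finite) \<times> complex \<Rightarrow> complex) \<Rightarrow> ((complex ^ 'm) \<times> complex) set \<Rightarrow> bool" where
  "holomorphic_several g T \<longleftrightarrow>
     (\<forall>z\<in>T. \<exists>L. (g has_derivative L) (at z) \<and> (\<forall>a v w. L (a *s v, a * w) = a * L (v, w)))"

definition partial_theta ::
  "'m::finite \<Rightarrow> ((complex ^ 'm) \<times> complex \<Rightarrow> complex) \<Rightarrow> (complex ^ 'm) \<times> complex \<Rightarrow> complex" where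
  "partial_theta k g = (\<lambda>(\<theta>, t). deriv (\<lambda>z. g (\<theta> + axis k z, t)) 0)"

definition partial_t ::
  "((complex ^ 'm::finite) \<times> complex \<Rightarrow> complex) \<Rightarrow> (complex ^ 'm) \<times> complex \<Rightarrow> complex" where
  "partial_t g = (\<lambda>(\<theta>, t). deriv (\<lambda>z. g (\<theta>, z)) t)"

definition grad_theta ::
  "((complex ^ 'm::finite) \<times> complex \<Rightarrow> complex) \<Rightarrow> (complex ^ 'm) \<times> complex \<Rightarrow> complex ^ 'm" where
  "grad_theta g z = (\<chi> k. partial_theta k g z)"

definition hessian_theta ::
  "((complex ^ 'm::finite) \<times> complex \<Rightarrow> complex) \<Rightarrow> (complex ^ 'm) \<times> complex \<Rightarrow> complex ^ 'm ^ 'm" where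
  "hessian_theta g z = (\<chi> k j. partial_theta k (partial_theta j g) z)"

text \<open>The bilinear form $u B v^T$, without complex conjugation.\<close>

definition bilin :: "complex ^ 'm::finite \<Rightarrow> complex ^ 'm ^ 'm \<Rightarrow> complex ^ 'm \<Rightarrow> complex" where
  "bilin u B v = (\<Sum>k\<in>UNIV. \<Sum>j\<in>UNIV. u $ k * B $ k $ j * v $ j)"

text \<open>The integrand of $I(\lambda)$ without the factor $1/t$.\<close>

definition numerator ::
  "((complex ^ 'm::finite) \<times> complex \<Rightarrow> complex) \<Rightarrow> ((complex ^ 'm) \<times> complex \<Rightarrow> complex)
     \<Rightarrow> ((complex ^ 'm) \<times> complex \<Rightarrow> complex) \<Rightarrow> real \<Rightarrow> (complex ^ 'm) \<times> complex \<Rightarrow> complex" where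
  "numerator p f q lam z = exp (- of_real lam * p z - of_real (sqrt lam) * f z) * q z"

end

theory Submission
  imports Defs "HOL-Complex_Analysis.Cauchy_Integral_Formula" "HOL-Real_Asymp.Real_Asymp" "HOL-Probability.Distributions"
begin

text \<open>
  Subtract \<open>p (0, 0)\<close> and \<open>f (0, 0)\<close>.  By (iv), \<open>Re p\<close> has a strict minimum on \<open>D\<close> at the origin, so the
  curve \<open>\<gamma>\<close> crosses the pole with \<open>\<alpha> \<gamma>'(s0) = \<i> \<beta>\<close>, \<open>\<beta>\<close> real.  For small \<open>\<theta>\<close> the \<open>t\<close>-contour near the
  pole is moved to the side where \<open>Re p\<close> increases; there the integrand is exponentially small, and only
  the half residue \<open>- \<i> \<pi> sgn \<beta> h (\<theta>, 0)\<close> remains.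

  The \<open>\<theta>\<close>-integral of the residue is evaluated by Laplace's method.  As \<open>Re A\<close> may be degenerate along the
  curves, the box is first deformed by \<open>\<theta> \<mapsto> \<theta> + \<kappa> E \<theta>\<close> with \<open>E \<theta> = cnj (A \<theta>)\<close> on tangent vectors, which
  increases \<open>Re p\<close> by a multiple of \<open>\<kappa> |\<theta>|\<^sup>2\<close> at the cost of exponentially small boundary terms.

  Hypothesis (iii) only gives finiteness of the tails for each single parameter.  Baire's theorem turns
  this into a bound that is uniform on an interval, and (iv) propagates it to exponential decay.
\<close>

section \<open>Exponentially small tails\<close>

text \<open>With \<open>s = sqrt lam\<close> the exponent is \<open>s^2 P + s F\<close>, a quadratic
  polynomial in \<open>s\<close>; the control of the tails rests on this. The obstacle there is that
  the regular part is the difference \<open>h (\<theta>, t) - h (\<theta>, 0)\<close> of two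
  exponentials, divided by \<open>t\<close>. Only the difference is integrable near
  \<open>t = 0\<close>, so neither exponential may be estimated alone, and no monotonicity in
  \<open>s\<close> carries a bound from one parameter to another. Along an arithmetic progression of
  parameters, however, the difference has the form \<open>a1 r1^n c1^N - a0 r0^n c0^N\<close> with
  \<open>N = n (n - 1) / 2\<close>, and its first three values control all later ones.

  At the saddle the real part of the quadratic form may be only semidefinite on the tangent
  directions, so the Gaussian integral there need not converge absolutely. The tilted one does, and
  its value keeps the sign of the square root of \<open>det A\<close> that the square of the
  integral forgets. The tilts are linear, so that the Jacobian is the single number
  \<open>det (pert E z)\<close>, which can be differentiated in \<open>z\<close>.\<close>

lemma norm_power_diff_le:
  fixes z w :: complex
  assumes "cmod z <= b" "cmod w <= b"
  shows "cmod (z ^ n - w ^ n) <= real n * b ^ (n - 1) * cmod (z - w)"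
proof (induction n)
  case (Suc n)
  have b: "0 <= b" using assms norm_ge_zero order_trans by blast
  have "z ^ Suc n - w ^ Suc n = z ^ n * (z - w) + (z ^ n - w ^ n) * w"
    by (simp add: algebra_simps)
  also have "cmod \<dots> <= cmod z ^ n * cmod (z - w) + cmod (z ^ n - w ^ n) * cmod w"
    by (metis norm_triangle_ineq norm_mult norm_power)
  also have "\<dots> <= b ^ n * cmod (z - w) + (real n * b ^ (n - 1) * cmod (z - w)) * b"
    using assms Suc b by (intro add_mono mult_mono power_mono) auto
  also have "\<dots> = real (Suc n) * b ^ (Suc n - 1) * cmod (z - w)"
    by (cases n) (simp_all add: algebra_simps)
  finally show ?case .
qed simp

text \<open>In the application \<open>N = n (n - 1) / 2\<close>, and the three differences on the
  right are those of \<open>a r^n c^N\<close> at steps 0, 1, 2. The factors \<open>a1\<close> and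
  \<open>a0\<close> can be huge compared with the right-hand side, so a change of \<open>r\<close>
  or \<open>c\<close> is only measured after multiplication by \<open>a0\<close> or
  \<open>a0 r0^2\<close>. The gain is the power \<open>b^(N - 2)\<close>, with \<open>N\<close>
  quadratic in \<open>n\<close>.\<close>

lemma diff_geometric_gaussian_bound:
  fixes a1 a0 r1 r0 c1 c0 :: complex
  assumes r: "cmod r1 <= 1" "cmod r0 <= 1" and c: "cmod c1 <= b" "cmod c0 <= b" and b: "b <= 1"
    and n: "2 <= n" "2 <= N"
  shows "cmod (a1 * r1 ^ n * c1 ^ N - a0 * r0 ^ n * c0 ^ N) <= (real n + 3 * real N) * b ^ (N - 2) *
     (cmod (a1 - a0) + cmod (a1 * r1 - a0 * r0) + cmod (a1 * r1\<^sup>2 * c1 - a0 * r0\<^sup>2 * c0))"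
proof -
  define S where "S = cmod (a1 - a0) + cmod (a1 * r1 - a0 * r0) + cmod (a1 * r1\<^sup>2 * c1 - a0 * r0\<^sup>2 * c0)"
  have b0: "0 <= b" using c norm_ge_zero order_trans by blast
  have norm_triangle3: "cmod (x + y + z) <= cmod x + cmod y + cmod z" for x y z :: complex
    by (meson add_mono norm_triangle_ineq order_refl order_trans)
  have le1: "x * y <= x" if "0 <= x" "y <= 1" for x y :: real
    using that by (simp add: mult_left_le)
  have dr: "cmod a0 * cmod (r1 - r0) <= cmod (a1 - a0) + cmod (a1 * r1 - a0 * r0)"
  proof -
    have "a0 * (r1 - r0) = (a1 * r1 - a0 * r0) - (a1 - a0) * r1"
      by (simp add: algebra_simps)
    then have "cmod a0 * cmod (r1 - r0) <= cmod (a1 * r1 - a0 * r0) + cmod (a1 - a0) * cmod r1"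
      by (metis norm_mult norm_triangle_ineq4)
    with le1[of "cmod (a1 - a0)" "cmod r1"] r show ?thesis by simp
  qed
  have dr2: "cmod (a1 * r1\<^sup>2 - a0 * r0\<^sup>2) <= cmod (a1 - a0) + 2 * (cmod (a1 - a0) + cmod (a1 * r1 - a0 * r0))"
  proof -
    have "a1 * r1\<^sup>2 - a0 * r0\<^sup>2 = (a1 - a0) * r1\<^sup>2 + a0 * (r1 - r0) * (r1 + r0)"
      by (simp add: algebra_simps power2_eq_square)
    then have "cmod (a1 * r1\<^sup>2 - a0 * r0\<^sup>2) <= cmod (a1 - a0) * cmod r1 ^ 2 + cmod a0 * cmod (r1 - r0) * cmod (r1 + r0)"
      by (metis norm_mult norm_triangle_ineq norm_power)
    also have "\<dots> <= cmod (a1 - a0) * 1 + (cmod (a1 - a0) + cmod (a1 * r1 - a0 * r0)) * 2"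
      using r dr norm_triangle_ineq[of r1 r0] by (intro add_mono mult_mono) (auto intro: power_le_one)
    finally show ?thesis by simp
  qed
  have dc: "cmod (a0 * r0\<^sup>2) * cmod (c1 - c0) <= 3 * S"
  proof -
    have "a0 * r0\<^sup>2 * (c1 - c0) = (a1 * r1\<^sup>2 * c1 - a0 * r0\<^sup>2 * c0) - (a1 * r1\<^sup>2 - a0 * r0\<^sup>2) * c1"
      by (simp add: algebra_simps)
    then have "cmod (a0 * r0\<^sup>2) * cmod (c1 - c0) <= cmod (a1 * r1\<^sup>2 * c1 - a0 * r0\<^sup>2 * c0) + cmod (a1 * r1\<^sup>2 - a0 * r0\<^sup>2) * cmod c1"
      by (metis norm_mult norm_triangle_ineq4)
    also have "\<dots> <= 3 * S"
    proof -
      have "cmod (a1 * r1\<^sup>2 - a0 * r0\<^sup>2) * cmod c1 <= cmod (a1 * r1\<^sup>2 - a0 * r0\<^sup>2)"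
        using c b by (intro le1) auto
      moreover have "X + y <= 3 * (da + db + X)" if "A <= da + 2 * (da + db)" "0 <= X" "0 <= db" "y <= A" for X y da db A :: real
        using that by (simp add: algebra_simps)
      ultimately show ?thesis unfolding S_def using dr2 norm_ge_zero by blast
    qed
    finally show ?thesis .
  qed
  obtain k where k: "n = k + 2" using n by (metis le_add_diff_inverse2)
  obtain l where l: "N = l + 2" using n by (metis le_add_diff_inverse2)
  have S0: "0 <= S" by (simp add: S_def)
  have yr: "cmod (a0 * r0\<^sup>2) <= cmod a0"
    using r le1[of "cmod a0" "cmod r0 ^ 2"] by (simp add: norm_mult norm_power power_le_one)
  have yc: "cmod (a0 * r0\<^sup>2 * c0) <= cmod (a0 * r0\<^sup>2)"
    using c b le1[of "cmod (a0 * r0\<^sup>2)" "cmod c0"] by (simp add: norm_mult)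
  \<comment> \<open>Telescoping: the block \<open>a r^2 c\<close> is exchanged first, because its
    difference is one of the three given ones; then the \<open>k\<close> further powers of
    \<open>r\<close>, then the \<open>l + 1\<close> further powers of \<open>c\<close>.\<close>
  have "a1 * r1 ^ n * c1 ^ N - a0 * r0 ^ n * c0 ^ N =
     (a1 * r1\<^sup>2 * c1 - a0 * r0\<^sup>2 * c0) * (r1 ^ k * c1 ^ (l+1)) +
     (a0 * r0\<^sup>2 * c0) * ((r1 ^ k - r0 ^ k) * c1 ^ (l+1)) + (a0 * r0\<^sup>2 * c0) * (r0 ^ k * (c1 ^ (l+1) - c0 ^ (l+1)))"
    unfolding k l by (simp add: algebra_simps power_add power2_eq_square)
  also have "cmod \<dots> <= cmod (a1 * r1\<^sup>2 * c1 - a0 * r0\<^sup>2 * c0) * (cmod r1 ^ k * cmod c1 ^ (l+1)) +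
     cmod (a0 * r0\<^sup>2 * c0) * (cmod (r1 ^ k - r0 ^ k) * cmod c1 ^ (l+1)) +
     cmod (a0 * r0\<^sup>2 * c0) * (cmod r0 ^ k * cmod (c1 ^ (l+1) - c0 ^ (l+1)))"
    using norm_triangle3 by (simp only: norm_mult[symmetric] norm_power[symmetric])
  also have "\<dots> <= S * (1 * b ^ l) + cmod a0 * ((real k * 1 ^ (k - 1) * cmod (r1 - r0)) * b ^ l) +
     cmod (a0 * r0\<^sup>2) * (1 * (real (l+1) * b ^ (l + 1 - 1) * cmod (c1 - c0)))"
  proof (intro add_mono mult_mono norm_power_diff_le r c)
    show "cmod (a1 * r1\<^sup>2 * c1 - a0 * r0\<^sup>2 * c0) <= S" by (simp add: S_def)
    show "cmod c1 ^ (l + 1) <= b ^ l" "cmod c1 ^ (l + 1) <= b ^ l"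
      using c b b0 by (metis power_mono power_decreasing le_add1 norm_ge_zero order_trans)+
  qed (use r c b b0 yr yc S0 in \<open>auto intro: power_le_one\<close>)
  also have "\<dots> = S * b ^ l + real k * b ^ l * (cmod a0 * cmod (r1 - r0)) + real (l + 1) * b ^ l * (cmod (a0 * r0\<^sup>2) * cmod (c1 - c0))"
    by (simp add: algebra_simps)
  also have "\<dots> <= S * b ^ l + real k * b ^ l * S + real (l + 1) * b ^ l * (3 * S)"
  proof -
      have "cmod a0 * cmod (r1 - r0) <= S" using dr unfolding S_def by (rule order_trans) simp
      then show ?thesis using dc b0 S0 by (intro add_mono mult_left_mono) auto
    qed
  also have "\<dots> <= (real n + 3 * real N) * b ^ (N - 2) * S"
    using mult_nonneg_nonneg[OF S0 zero_le_power[OF b0, of l]] unfolding k l by (simp add: algebra_simps)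
  finally show ?thesis unfolding S_def .
qed

lemma geometric_times_polynomial_tendsto_0:
  fixes b u d :: real
  assumes b: "0 < b" "b < 1" and u: "0 < u" and d: "0 < d"
  shows "(%n. (u + real n * d) ^ k * (4 * real n ^ 2) * b ^ (n - 2)) \<longlonglongrightarrow> 0"
proof (rule Lim_null_comparison)
  have "(%n. 4 * (u + d) ^ k / b\<^sup>2 * (real n ^ (k + 2) * b ^ n)) \<longlonglongrightarrow> 4 * (u + d) ^ k / b\<^sup>2 * 0"
    using b by (intro tendsto_intros) real_asymp
  then show "(%n. 4 * (u + d) ^ k / b\<^sup>2 * (real n ^ (k + 2) * b ^ n)) \<longlonglongrightarrow> 0" by simp
  show "\<forall>\<^sub>F n in sequentially. norm ((u + real n * d) ^ k * (4 * real n ^ 2) * b ^ (n - 2))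
     <= 4 * (u + d) ^ k / b\<^sup>2 * (real n ^ (k + 2) * b ^ n)"
    using eventually_ge_at_top[of 2]
  proof eventually_elim
    case (elim n)
    have "u + real n * d <= (u + d) * real n"
      using elim u mult_left_mono[of 1 "real n" u] by (simp add: algebra_simps)
    then have "(u + real n * d) ^ k <= (u + d) ^ k * real n ^ k"
      using u d by (simp add: power_mult_distrib[symmetric] power_mono)
    then have "(u + real n * d) ^ k * (4 * real n ^ 2) * b ^ (n - 2) <= (u + d) ^ k * real n ^ k * (4 * real n ^ 2) * b ^ (n - 2)"
      using b by (intro mult_right_mono) auto
    also have "\<dots> = 4 * (u + d) ^ k / b\<^sup>2 * (real n ^ (k + 2) * b ^ n)"
      using elim b by (simp add: power_add power_diff field_simps power2_eq_square)
    finally show ?case using u d b by (simp add: abs_mult)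
  qed
qed

text \<open>Baire's theorem makes the pointwise finiteness uniform on some interval; every large parameter
  is then reached from three parameters in that interval by an arithmetic progression.\<close>

lemma pole_difference_tail_decay:
  fixes P1 F1 Q1 P0 F0 Q0 :: "'a => complex" and W :: "'a => real" and M :: "'a measure"
  defines "g \<equiv> %s \<omega>. W \<omega> * cmod (Q1 \<omega> * exp (- of_real (s\<^sup>2) * P1 \<omega> - of_real s * F1 \<omega>) -
                                     Q0 \<omega> * exp (- of_real (s\<^sup>2) * P0 \<omega> - of_real s * F0 \<omega>))"
  assumes meas [measurable]: "P1 \<in> borel_measurable M" "F1 \<in> borel_measurable M" "Q1 \<in> borel_measurable M"
      "P0 \<in> borel_measurable M" "F0 \<in> borel_measurable M" "Q0 \<in> borel_measurable M" "W \<in> borel_measurable M"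
    and W: "!!\<omega>. 0 <= W \<omega>" and s1: "0 < s1" and \<delta>: "0 < \<delta>"
    and pos1: "!!\<omega> s. \<omega> \<in> space M ==> W \<omega> ~= 0 ==> s1 <= s ==> \<delta> <= Re (P1 \<omega> + F1 \<omega> / of_real s)"
    and pos0: "!!\<omega> s. \<omega> \<in> space M ==> W \<omega> ~= 0 ==> s1 <= s ==> \<delta> <= Re (P0 \<omega> + F0 \<omega> / of_real s)"
    and fin: "!!s. s1 <= s ==> (\<integral>\<^sup>+\<omega>. ennreal (g s \<omega>) \<partial>M) < \<infinity>"
  shows "((%s. s ^ k * (\<integral>\<omega>. g s \<omega> \<partial>M)) \<longlongrightarrow> 0) at_top"
proof -
  define NN where "NN = (%s. \<integral>\<^sup>+\<omega>. ennreal (g s \<omega>) \<partial>M)"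
  have gm [measurable]: "g s \<in> borel_measurable M" for s
    unfolding g_def by measurable
  have g0: "0 <= g s \<omega>" for s \<omega> unfolding g_def using W by simp
  define S where "S = {s1..s1+1}"
  define C where "C = (%n::nat. {s\<in>S. NN s <= of_nat n})"
  \<comment> \<open>By Fatou's lemma the tail integral is lower semicontinuous in \<open>s\<close>,
    so its sublevel sets are closed.\<close>
  have closed: "closed (C n)" for n
  proof (unfold closed_sequential_limits, intro allI impI, elim conjE)
    fix x l assume x: "\<forall>i. x i \<in> C n" and l: "x \<longlonglongrightarrow> l"
    have "l \<in> S"
      using x l closed_sequentially[of S x l] by (auto simp: S_def C_def)
    moreover have "NN l <= of_nat n"
    proof -
      have lim: "(%i. ennreal (g (x i) \<omega>)) \<longlonglongrightarrow> ennreal (g l \<omega>)" for \<omega>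
        unfolding g_def by (intro tendsto_intros tendsto_ennrealI l)
      have "NN l = (\<integral>\<^sup>+\<omega>. liminf (%i. ennreal (g (x i) \<omega>)) \<partial>M)"
        unfolding NN_def using lim_imp_Liminf[OF _ lim] by simp
      also have "\<dots> <= liminf (%i. NN (x i))"
        unfolding NN_def by (rule nn_integral_liminf) measurable
      also have "\<dots> <= of_nat n"
        using x by (intro Liminf_le) (auto simp: C_def)
      finally show ?thesis .
    qed
    ultimately show "l \<in> C n" by (simp add: C_def)
  qed
  have cover: "\<exists>n. s \<in> C n" if "s \<in> S" for s
  proof -
    have "NN s < \<infinity>" using fin that by (auto simp: NN_def S_def)
    then have "NN s < top" by simp
    then obtain n where "NN s < of_nat n" using ennreal_Ex_less_of_nat by blast
    then show ?thesis using that by (auto simp: C_def intro: less_imp_le)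
  qed
  \<comment> \<open>If no \<open>C n\<close> had interior in \<open>S\<close>, their complements
    would be open and dense, and Baire's theorem would make the intersection of the complements
    dense; by \<open>cover\<close> it is empty.\<close>
  obtain u v n0 where uv: "u < v" "s1 <= u" "{u..v} \<subseteq> C n0"
  proof -
    have "\<exists>n. \<not> S \<subseteq> closure (S - C n)"
    proof (rule ccontr)
      assume "\<not> ?thesis"
      then have dense: "S \<subseteq> closure (S - C n)" for n by blast
      have "openin (top_of_set S) (S - C n)" for n
        by (metis Diff_eq Int_commute closed open_Compl openin_open_Int)
      then have "S \<subseteq> closure (\<Inter>(range (%n. S - C n)))"
        using dense by (intro Baire) (auto simp: S_def)
      moreover have "\<Inter>(range (%n. S - C n)) = {}" using cover by auto
      ultimately have "S = {}" by (metis closure_empty subset_empty)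
      then show False by (simp add: S_def)
    qed
    then obtain n x where x: "x \<in> S" "x \<notin> closure (S - C n)" by blast
    then obtain e where e: "e > 0" "!!y. y \<in> S ==> dist y x < e ==> y \<in> C n"
      unfolding closure_approachable by blast
    define e' where "e' = min (e/2) (1/4)"
    have e': "0 < e'" "e' < e" "e' <= 1/4" using e by (auto simp: e'_def)
    \<comment> \<open>Keep the half of the neighbourhood of \<open>x\<close> that stays inside
      \<open>S\<close>.\<close>
    show ?thesis
    proof (cases "x <= s1 + 1/2")
      case True
      show ?thesis by (rule that[of x "x+e'" n]) (use e e' x True in \<open>auto simp: S_def dist_real_def\<close>)
    next
      case False
      show ?thesis by (rule that[of "x-e'" x n]) (use e e' x False in \<open>auto simp: S_def dist_real_def\<close>)
    qed
  qed
  \<comment> \<open>A step \<open>d <= d0\<close> keeps \<open>u\<close>, \<open>u + d\<close> and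
    \<open>u + 2 d\<close> inside \<open>{u..v}\<close>. The rounding in \<open>nn\<close> also
    gives \<open>d >= d0 / 2\<close>, so the modulus \<open>exp (- 2 d^2 Re P)\<close> of the
    Gaussian ratio is at most \<open>b\<close>.\<close>
  define d0 where "d0 = (v - u) / 2"
  define b where "b = exp (- (d0\<^sup>2 * \<delta> / 2))"
  have d0: "0 < d0" using uv by (simp add: d0_def)
  have b: "0 < b" "b < 1" using d0 \<delta> by (auto simp: b_def)
  have u0: "0 < u" using uv s1 by linarith
  define nn where "nn = (%s. nat \<lceil>(s - u) / d0\<rceil>)"
  have key: "(\<integral>\<omega>. g s \<omega> \<partial>M) <= (4 * real (nn s) ^ 2) * b ^ (nn s - 2) * (3 * real n0)"
    if s: "u + 3 * d0 <= s" for s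
  proof -
    define n where "n = nn s"
    define N where "N = n * (n - 1) div 2"
    define d where "d = (s - u) / n"
    have n3: "3 <= n" using s d0 unfolding n_def nn_def by (simp add: le_nat_iff le_ceiling_iff pos_less_divide_eq)
    have nr: "(s - u) / d0 <= real n" "real n < (s - u) / d0 + 1"
      using n3 unfolding n_def nn_def by linarith+
    have d_le: "d <= d0" using nr d0 n3 unfolding d_def by (simp add: field_simps)
    have d_ge: "d0 / 2 <= d"
    proof -
      have "real n <= 2 * ((s - u) / d0)" using nr n3 by linarith
      then have "real n * d0 <= 2 * (s - u)" using d0 by (simp add: field_simps)
      then show ?thesis using n3 unfolding d_def by (simp add: field_simps)
    qed
    have d_pos: "0 < d" using d_ge d0 by linarith
    have s_eq: "s = u + real n * d" using n3 unfolding d_def by simp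
    have N2: "2 * N = n * (n - 1)" unfolding N_def by (cases "even n") (auto intro!: dvd_mult_div_cancel)
    have N2r: "2 * real N = real n * (real n - 1)"
    proof -
      have "real (2 * N) = real (n * (n - 1))" using N2 by simp
      then show ?thesis using n3 by (simp add: of_nat_diff)
    qed
    have Nn: "n <= N"
    proof -
      have "n * 2 <= n * (n - 1)" using n3 by (intro mult_le_mono) auto
      then show ?thesis using N2 by linarith
    qed
    have incl: "u + j * d \<in> {u..v}" if "0 <= j" "j <= 2" for j
    proof -
      have "j * d <= 2 * d0" using that d_le d_pos d0 by (intro mult_mono) auto
      then show ?thesis using that d_pos by (auto simp: d0_def)
    qed
    have ptw: "g s \<omega> <= (real n + 3 * real N) * b ^ (N - 2) * (g u \<omega> + g (u + d) \<omega> + g (u + 2 * d) \<omega>)"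
      if om: "\<omega> \<in> space M" for \<omega>
    proof (cases "W \<omega> = 0")
      case True then show ?thesis by (simp add: g_def)
    next
      case False
      define a where "a = (%Q P F. Q * exp (- of_real (u\<^sup>2) * P - of_real u * F) :: complex)"
      define r where "r = (%P F. exp (- (of_real (2*u*d + d\<^sup>2) * P + of_real d * F)) :: complex)"
      define c where "c = (%P. exp (- (of_real (2*d\<^sup>2) * P)) :: complex)"
      \<comment> \<open>Expand the exponent at \<open>u + j d\<close> and replace \<open>j^2\<close>
        by \<open>j + 2 l\<close>: the terms with \<open>j\<close> form \<open>r^j\<close>, those
        with \<open>l\<close> form \<open>c^l\<close>.\<close>
      have y: "Q * exp (- of_real ((u + real j * d)\<^sup>2) * P - of_real (u + real j * d) * F) = a Q P F * r P F ^ j * c P ^ l"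
        if "2 * real l = real j * (real j - 1)" for j l Q P F
      proof -
        have "real (j + 2 * l) = real (j * j)" using that by (simp add: algebra_simps)
        then have "of_nat (j + 2 * l) = (of_nat (j * j) :: complex)" by (simp only: of_nat_eq_iff)
        then have l: "of_nat l = (of_nat j * (of_nat j - 1) / 2 :: complex)" by (simp add: field_simps)
        have "- complex_of_real ((u + real j * d)\<^sup>2) * P - of_real (u + real j * d) * F =
            (- of_real (u\<^sup>2) * P - of_real u * F) + of_nat j * (- (of_real (2*u*d + d\<^sup>2) * P + of_real d * F))
            + of_nat l * (- (of_real (2*d\<^sup>2) * P))"
          unfolding l by (simp add: power2_eq_square field_simps)
        then show ?thesis
          unfolding a_def r_def c_def exp_of_nat_mult[symmetric] by (simp only: exp_add mult.assoc)
      qed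
      have small: "cmod (r P F) <= 1 \<and> cmod (c P) <= b" if "!!s. s1 <= s ==> \<delta> <= Re (P + F / of_real s)" for P F
      proof
        \<comment> \<open>The exponent of \<open>r\<close> is
          \<open>- d (2 u + d) (P + F / (2 u + d))\<close>, so the gap at the single parameter
          \<open>2 u + d\<close> bounds the ratio by 1. For \<open>c\<close> the gap is used in the
          limit of large parameters, where the \<open>F\<close> term disappears.\<close>
        have "\<delta> <= Re (P + F / of_real (2*u+d))" using uv d_pos u0 by (intro that) linarith
        then have "0 <= (2*u*d+d\<^sup>2) * (Re P + Re F / (2*u+d))" 
          using \<delta> u0 d_pos by (intro mult_nonneg_nonneg) (auto simp: Re_divide_of_real)
        also have "\<dots> = (2*u*d+d\<^sup>2) * Re P + d * Re F"
          using u0 d_pos by (simp add: field_simps power2_eq_square)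
        finally show "cmod (r P F) <= 1" unfolding r_def by simp
        have lim: "((%s. Re P + Re F / s) \<longlongrightarrow> Re P + 0) at_top"
          by real_asymp
        have "\<delta> <= Re P + 0"
          by (rule tendsto_lowerbound[OF lim])
             (use that in \<open>auto simp: Re_divide_of_real eventually_at_top_linorder intro!: exI[of _ s1]\<close>)
        then have "(d0/2)\<^sup>2 * 2 * \<delta> <= d\<^sup>2 * 2 * Re P"
          using d_ge d0 \<delta> by (intro mult_mono power_mono) auto
        then show "cmod (c P) <= b" unfolding c_def b_def by (simp add: power2_eq_square)
      qed
      note sm1 = small[OF pos1[OF om False]] note sm0 = small[OF pos0[OF om False]]
      have gj: "g (u + real j * d) \<omega> = W \<omega> * cmod (a (Q1 \<omega>) (P1 \<omega>) (F1 \<omega>) * r (P1 \<omega>) (F1 \<omega>) ^ j * c (P1 \<omega>) ^ l -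
          a (Q0 \<omega>) (P0 \<omega>) (F0 \<omega>) * r (P0 \<omega>) (F0 \<omega>) ^ j * c (P0 \<omega>) ^ l)"
        if "2 * real l = real j * (real j - 1)" for j l
        unfolding g_def y[OF that] ..
      show ?thesis
        using mult_left_mono[OF diff_geometric_gaussian_bound[of "r (P1 \<omega>) (F1 \<omega>)" "r (P0 \<omega>) (F0 \<omega>)" "c (P1 \<omega>)" b "c (P0 \<omega>)" n N
            "a (Q1 \<omega>) (P1 \<omega>) (F1 \<omega>)" "a (Q0 \<omega>) (P0 \<omega>) (F0 \<omega>)"] W[of \<omega>]] sm1 sm0 b n3 Nn
          gj[of 0 0] gj[of 0 1] gj[of 1 2] gj[OF N2r] s_eq
        by (simp add: algebra_simps)
    qed
    have intg: "integrable M (g (u + j * d)) \<and> (\<integral>\<omega>. g (u + j * d) \<omega> \<partial>M) <= real n0" if "0 <= j" "j <= 2" for j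
    proof -
      have *: "NN (u + j * d) <= ennreal (real n0)" proof -
        have "u + j * d \<in> C n0" using incl[OF that] uv(3) by blast
        then show ?thesis by (simp add: C_def ennreal_of_nat_eq_real_of_nat)
      qed
      then have "integrable M (g (u + j * d))"
        by (intro integrableI_nonneg) (auto simp: g0 NN_def ennreal_of_nat_eq_real_of_nat top_unique less_top[symmetric] intro: le_less_trans)
      moreover have "(\<integral>\<omega>. g (u + j * d) \<omega> \<partial>M) <= real n0"
        using * g0 by (subst integral_eq_nn_integral) (auto simp: NN_def intro!: enn2real_leI)
      ultimately show ?thesis ..
    qed
    note int0 = intg[of 0, simplified] and int1 = intg[of 1, simplified] and int2 = intg[of 2, simplified]
    define K where "K = (real n + 3 * real N) * b ^ (N - 2)"
    have "(\<integral>\<omega>. g s \<omega> \<partial>M) <= (\<integral>\<omega>. K * (g u \<omega> + g (u + d) \<omega> + g (u + 2 * d) \<omega>) \<partial>M)"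
    proof (rule integral_mono')
      show "g s \<omega> <= K * (g u \<omega> + g (u + d) \<omega> + g (u + 2 * d) \<omega>)" if "\<omega> \<in> space M" for \<omega>
        using ptw[OF that] unfolding K_def .
      show "0 <= K * (g u \<omega> + g (u + d) \<omega> + g (u + 2 * d) \<omega>)" for \<omega>
        unfolding K_def using b g0 by (simp add: add_nonneg_nonneg)
    qed (use int0 int1 int2 in auto)
    also have "\<dots> = K * ((\<integral>\<omega>. g u \<omega> \<partial>M) + (\<integral>\<omega>. g (u+d) \<omega> \<partial>M) + (\<integral>\<omega>. g (u + 2 * d) \<omega> \<partial>M))"
      using int0 int1 int2 by simp
    also have "\<dots> <= K * (3 * real n0)"
      using int0 int1 int2 b by (intro mult_left_mono) (auto simp: K_def)
    also have "K <= (4 * real n ^ 2) * b ^ (n - 2)"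
      unfolding K_def
    proof (intro mult_mono)
      have "n <= n * n" by simp
      moreover have "2 * N <= n * n" using N2 by simp
      ultimately have "n + 3 * N <= 4 * (n * n)" by linarith
      then have "real (n + 3 * N) <= real (4 * (n * n))" by (rule of_nat_mono)
      then show "real n + 3 * real N <= 4 * (real n)\<^sup>2" by (simp add: power2_eq_square)
      show "b ^ (N - 2) <= b ^ (n - 2)" using Nn b by (intro power_decreasing) auto
    qed (use b in auto)
    finally show ?thesis unfolding n_def by (simp add: mult_right_mono)
  qed
  have nn_lim: "filterlim nn at_top at_top"
    unfolding nn_def using d0 by real_asymp
  have lim: "((%s. (u + real (nn s) * d0) ^ k * (4 * real (nn s) ^ 2) * b ^ (nn s - 2) * (3 * real n0)) \<longlongrightarrow> 0 * (3 * real n0)) at_top"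
    by (intro tendsto_intros filterlim_compose[OF geometric_times_polynomial_tendsto_0[OF b u0 d0] nn_lim])
  show ?thesis
  proof (rule tendsto_sandwich[OF _ _ tendsto_const])
    show "((%s. (u + real (nn s) * d0) ^ k * (4 * real (nn s) ^ 2) * b ^ (nn s - 2) * (3 * real n0)) \<longlongrightarrow> 0) at_top"
      using lim by simp
    show "\<forall>\<^sub>F s in at_top. 0 <= s ^ k * (\<integral>\<omega>. g s \<omega> \<partial>M)"
      using eventually_ge_at_top[of 0] by eventually_elim (auto intro!: mult_nonneg_nonneg integral_nonneg simp: g0)
    show "\<forall>\<^sub>F s in at_top. s ^ k * (\<integral>\<omega>. g s \<omega> \<partial>M) <= (u + real (nn s) * d0) ^ k * (4 * real (nn s) ^ 2) * b ^ (nn s - 2) * (3 * real n0)"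
      using eventually_ge_at_top[of "u + 3 * d0"]
    proof eventually_elim
      case (elim s)
      have "(s - u) / d0 <= real (nn s)" unfolding nn_def by linarith
      then have "s <= u + real (nn s) * d0" using d0 by (simp add: field_simps)
      then have "s ^ k * (\<integral>\<omega>. g s \<omega> \<partial>M) <= (u + real (nn s) * d0) ^ k * ((4 * real (nn s) ^ 2) * b ^ (nn s - 2) * (3 * real n0))"
        using key[OF elim] elim u0 d0 by (intro mult_mono power_mono integral_nonneg) (auto simp: g0)
      then show ?case by (simp add: mult.assoc)
    qed
  qed
qed

section \<open>Smooth simple curves\<close>

text \<open>Both \<open>f s\<close> and the increment \<open>f t - f s\<close> deviate from a
  nonnegative multiple of \<open>v\<close> by at most a quarter of its length. Their inner product
  is therefore nonnegative, with constant 7/16 = 1 - 1/4 - 1/4 - 1/16, and adding the nonzero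
  increment enlarges the norm.\<close>

lemma norm_strict_mono_near_line:
  fixes f :: "real => complex"
  assumes f0: "f 0 = 0" and v: "v ~= 0"
    and near: "!!s t. 0 <= s ==> s < t ==> t <= d ==> cmod (f t - f s - of_real (t - s) * v) <= cmod v / 4 * (t - s)"
    and st: "0 <= s" "s < t" "t <= d"
  shows "cmod (f s) < cmod (f t)"
proof -
  define n where "n = cmod v"
  have n: "0 < n" using v by (simp add: n_def)
  define e2 where "e2 = f t - f s - of_real (t - s) * v"
  define e1 where "e1 = f s - of_real s * v"
  have e2: "cmod e2 <= n / 4 * (t - s)" unfolding e2_def n_def by (rule near) (use st in auto)
  have e1: "cmod e1 <= n / 4 * s"
  proof (cases "s = 0")
    case False
    then show ?thesis using near[of 0 s] st f0 unfolding e1_def n_def by simp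
  qed (simp add: e1_def f0)
  have t: "f t = of_real t * v + (e1 + e2)" by (simp add: e1_def e2_def algebra_simps)
  define u where "u = f s"
  define w where "w = f t - f s"
  have u: "u = of_real s * v + e1" and w: "w = of_real (t - s) * v + e2"
    by (auto simp: u_def w_def e1_def e2_def algebra_simps)
  have inner: "u \<bullet> w \<ge> 0"
  proof -
    have 1: "(of_real s * v) \<bullet> (of_real (t - s) * v) = s * (t - s) * n\<^sup>2"
      unfolding scaleR_conv_of_real[symmetric] inner_scaleR_left inner_scaleR_right n_def power2_norm_eq_inner by simp
    have 2: "\<bar>(of_real s * v) \<bullet> e2\<bar> <= s * n * (n / 4 * (t - s))"
    proof -
      have "\<bar>(of_real s * v) \<bullet> e2\<bar> <= cmod (of_real s * v) * cmod e2" by (rule Cauchy_Schwarz_ineq2)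
      also have "\<dots> = s * n * cmod e2" using st by (simp add: norm_mult n_def)
      also have "\<dots> <= s * n * (n / 4 * (t - s))" using st n e1 e2 by (intro mult_left_mono) auto
      finally show ?thesis .
    qed
    have 3: "\<bar>e1 \<bullet> (of_real (t - s) * v)\<bar> <= n / 4 * s * ((t - s) * n)"
    proof -
      have "\<bar>e1 \<bullet> (of_real (t - s) * v)\<bar> <= cmod e1 * cmod (of_real (t - s) * v)" by (rule Cauchy_Schwarz_ineq2)
      also have "\<dots> = cmod e1 * ((t - s) * n)" using st by (simp add: norm_mult n_def del: of_real_diff)
      also have "\<dots> <= n / 4 * s * ((t - s) * n)" using st n e1 e2 by (intro mult_right_mono) auto
      finally show ?thesis .
    qed
    have 4: "\<bar>e1 \<bullet> e2\<bar> <= n / 4 * s * (n / 4 * (t - s))"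
      using order_trans[OF Cauchy_Schwarz_ineq2 mult_mono[OF e1 e2]] st n by simp
    have "u \<bullet> w = (of_real s * v) \<bullet> (of_real (t - s) * v) + (of_real s * v) \<bullet> e2 + e1 \<bullet> (of_real (t - s) * v) + e1 \<bullet> e2"
      unfolding u w by (simp only: inner_add_left inner_add_right)
    also have "\<dots> \<ge> s * (t - s) * n\<^sup>2 - s * n * (n / 4 * (t - s)) - n / 4 * s * ((t - s) * n) - n / 4 * s * (n / 4 * (t - s))"
      using 1 2 3 4 by linarith
    also have "s * (t - s) * n\<^sup>2 - s * n * (n / 4 * (t - s)) - n / 4 * s * ((t - s) * n) - n / 4 * s * (n / 4 * (t - s)) = 7 / 16 * (s * (t - s) * n\<^sup>2)"
      proof -
      have "s * n * (n / 4 * (t - s)) = s * (t - s) * n\<^sup>2 / 4" "n / 4 * s * ((t - s) * n) = s * (t - s) * n\<^sup>2 / 4"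
        "n / 4 * s * (n / 4 * (t - s)) = s * (t - s) * n\<^sup>2 / 16"
        by (simp_all add: power2_eq_square)
      moreover have "X - X / 4 - X / 4 - X / 16 = 7 / 16 * X" for X :: real by simp
      ultimately show ?thesis by (simp only:)
    qed
    finally have "7 / 16 * (s * (t - s) * n\<^sup>2) <= u \<bullet> w" by simp
    moreover have "0 <= 7 / 16 * (s * (t - s) * n\<^sup>2)" using st by simp
    ultimately show ?thesis by (rule order_trans[rotated])
  qed
  have w0: "w ~= 0"
  proof
    assume "w = 0"
    then have "cmod e2 = (t - s) * n" using w st by (metis add_eq_0_iff norm_minus_cancel norm_mult norm_of_real abs_of_pos diff_gt_0_iff_gt n_def)
    then have "(t - s) * n <= n / 4 * (t - s)" using e2 by simp
    moreover have "0 < (t - s) * n" using st n by simp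
    ultimately show False by (simp add: mult.commute)
  qed
  have sq: "(cmod (u + w))\<^sup>2 = (cmod u)\<^sup>2 + 2 * (u \<bullet> w) + (cmod w)\<^sup>2"
    by (simp add: power2_norm_eq_inner inner_add_left inner_add_right inner_commute)
  have "(cmod u)\<^sup>2 < (cmod (u + w))\<^sup>2"
  proof -
    have "0 < (cmod w)\<^sup>2" using w0 by simp
    then show ?thesis using inner sq by linarith
  qed
  then have "cmod u < cmod (u + w)" by (rule power_less_imp_less_base) simp
  then show ?thesis by (simp add: u_def w_def)
qed

text \<open>The curve does not return to one of its interior points. For an arc this is continuity
  of the inverse; for a Jordan curve the distance has a positive minimum on the compact set of
  remaining parameters, by injectivity.\<close>

lemma smooth_simple_curve_far_from_point:
  assumes c: "smooth_simple_curve (J, c)" and s0: "s0 \<in> interior J" and d: "0 < d"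
  obtains e where "0 < e" "!!s. s \<in> J ==> cmod (c s - c s0) < e ==> \<bar>s - s0\<bar> < d"
proof -
  have s0J: "s0 \<in> J" using s0 interior_subset by blast
  obtain c' where c': "!!s. s \<in> J ==> (c has_vector_derivative c' s) (at s within J)"
    and alt: "(\<exists>g. homeomorphism J (c ` J) c g) \<or> (\<exists>a b. J = {a..b} \<and> inj_on c {a..<b} \<and> c a = c b)"
    using c unfolding smooth_simple_curve_def by auto
  have cont: "continuous_on J c"
    using c' by (meson continuous_on_eq_continuous_within has_vector_derivative_continuous)
  from alt show ?thesis
  proof
    assume "\<exists>g. homeomorphism J (c ` J) c g"
    then obtain g where g: "homeomorphism J (c ` J) c g" by blast
    then have "continuous (at (c s0) within c ` J) g"
      using s0J by (meson continuous_on_eq_continuous_within homeomorphism_def imageI)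
    then obtain e where "0 < e" "!!z. z \<in> c ` J ==> dist z (c s0) < e ==> dist (g z) (g (c s0)) < d"
      using d unfolding continuous_within_eps_delta by metis
    moreover have "g (c s) = s" if "s \<in> J" for s using g that by (simp add: homeomorphism_def)
    ultimately show ?thesis using that[of e] s0J by (metis dist_norm imageI real_norm_def)
  next
    assume "\<exists>a b. J = {a..b} \<and> inj_on c {a..<b} \<and> c a = c b"
    then obtain a b where J: "J = {a..b}" and inj: "inj_on c {a..<b}" and ab: "c a = c b" by blast
    have s0ab: "a < s0" "s0 < b" using s0 J by (auto simp: interior_atLeastAtMost_real)
    define K where "K = {a..b} - {s0-d<..<s0+d}"
    have K: "compact K" unfolding K_def by (simp add: compact_diff)
    show ?thesis
    proof (cases "K = {}")
      case True
      show ?thesis by (rule that[of 1]) (use True J in \<open>force simp: K_def\<close>)+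
    next
      case False
      have "continuous_on K (%s. cmod (c s - c s0))"
        by (intro continuous_intros continuous_on_subset[OF cont]) (auto simp: K_def J)
      then obtain m where m: "m \<in> K" "!!s. s \<in> K ==> cmod (c m - c s0) <= cmod (c s - c s0)"
        using continuous_attains_inf[OF K False] by blast
      have "c m ~= c s0"
      proof
        assume eq: "c m = c s0"
        \<comment> \<open>Injectivity is only given on the half-open interval, so the end point
          \<open>b\<close> is traded for \<open>a\<close>, which has the same image.\<close>
        define m' where "m' = (if m = b then a else m)"
        have "c m' = c s0" using eq ab by (auto simp: m'_def)
        moreover have "m' \<in> {a..<b}" "s0 \<in> {a..<b}" using m s0ab by (auto simp: m'_def K_def)
        ultimately have "m' = s0" using inj by (auto dest: inj_onD)
        then show False using m s0ab d by (auto simp: m'_def K_def split: if_splits)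
      qed
      then have pos: "0 < cmod (c m - c s0)" by simp
      show ?thesis
      proof (rule that[OF pos])
        fix s assume "s \<in> J" "cmod (c s - c s0) < cmod (c m - c s0)"
        then have "s \<notin> K" using m by force
        then show "\<bar>s - s0\<bar> < d" using \<open>s \<in> J\<close> J by (auto simp: K_def)
      qed
    qed
  qed
qed

text \<open>\<open>speed\<close> selects a derivative by \<open>vector_derivative\<close>. It agrees
  with the continuous derivative of the definition because one-sided derivatives are unique, every
  point of a nondegenerate interval being a limit point of it.\<close>

lemma smooth_simple_curve_speed:
  assumes c: "smooth_simple_curve \<gamma>"
  shows "continuous_on (fst \<gamma>) (speed \<gamma>)"
    and "!!s. s \<in> fst \<gamma> ==> (snd \<gamma> has_vector_derivative speed \<gamma> s) (at s within fst \<gamma>)"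
    and "!!s. s \<in> fst \<gamma> ==> speed \<gamma> s ~= 0"
    and "is_interval (fst \<gamma>)"
proof -
  obtain J c where g: "\<gamma> = (J, c)" by (cases \<gamma>)
  obtain c' where c': "continuous_on J c'" "!!s. s \<in> J ==> (c has_vector_derivative c' s) (at s within J)"
     "!!s. s \<in> J ==> c' s ~= 0" and J: "is_interval J" "interior J ~= {}"
    using c unfolding smooth_simple_curve_def g by auto
  have lim: "at s within J ~= bot" if "s \<in> J" for s
  proof -
    have "infinite J" using J(2) empty_interior_finite by blast
    then have "s islimpt J"
      using that J(1) by (intro connected_imp_perfect) (auto simp: is_interval_connected_1)
    then show ?thesis by (simp add: trivial_limit_within)
  qed
  have eq: "speed \<gamma> s = c' s" if "s \<in> J" for s
    unfolding speed_def g snd_conv fst_conv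
    using vector_derivative_unique_within[OF lim[OF that] _ c'(2)[OF that]] c'(2)[OF that] vector_derivative_works
    by (metis differentiableI_vector)
  show "continuous_on (fst \<gamma>) (speed \<gamma>)"
    using c'(1) eq by (metis continuous_on_cong fst_conv g)
  show "!!s. s \<in> fst \<gamma> ==> (snd \<gamma> has_vector_derivative speed \<gamma> s) (at s within fst \<gamma>)"
    using c'(2) eq by (simp add: g)
  show "!!s. s \<in> fst \<gamma> ==> speed \<gamma> s ~= 0" using c'(3) eq by (simp add: g)
  show "is_interval (fst \<gamma>)" using J g by simp
qed

lemma smooth_simple_curve_continuous:
  assumes "smooth_simple_curve \<gamma>" shows "continuous_on (fst \<gamma>) (snd \<gamma>)"
  using smooth_simple_curve_speed(2)[OF assms]
  by (meson continuous_on_eq_continuous_within has_vector_derivative_continuous)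

text \<open>The mean value inequality for the curve minus its tangent line. The estimate is needed
  for two arbitrary parameters, not only against \<open>s0\<close>, because the modulus is to be
  shown monotone.\<close>

lemma smooth_simple_curve_near_tangent:
  assumes c: "smooth_simple_curve \<gamma>" and s0: "s0 \<in> interior (fst \<gamma>)" and w: "0 < w"
  obtains d where "0 < d" "{s0-d..s0+d} \<subseteq> interior (fst \<gamma>)"
    "!!s t. \<bar>s - s0\<bar> <= d ==> \<bar>t - s0\<bar> <= d ==> 
       cmod (snd \<gamma> t - snd \<gamma> s - of_real (t - s) * speed \<gamma> s0) <= w * \<bar>t - s\<bar>"
proof -
  note sp = smooth_simple_curve_speed[OF c]
  obtain d1 where d1: "0 < d1" "cball s0 d1 \<subseteq> interior (fst \<gamma>)"
    using s0 open_contains_cball open_interior by metis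
  have "isCont (speed \<gamma>) s0"
    using sp(1) s0 by (meson continuous_on_interior)
  then obtain d2 where d2: "0 < d2" "!!s. dist s s0 < d2 ==> dist (speed \<gamma> s) (speed \<gamma> s0) < w"
    using w unfolding continuous_at_eps_delta by metis
  define d where "d = min d1 (d2/2)"
  have d: "0 < d" "d <= d1" "d < d2" using d1 d2 by (auto simp: d_def)
  have sub: "{s0-d..s0+d} \<subseteq> interior (fst \<gamma>)" using d1(2) d by (intro order_trans[OF _ d1(2)]) (auto simp: dist_real_def)
  show ?thesis
  proof (rule that[OF d(1) sub])
    fix s t assume st: "\<bar>s - s0\<bar> <= d" "\<bar>t - s0\<bar> <= d"
    have der: "((%x. snd \<gamma> x - of_real x * speed \<gamma> s0) has_derivative (%h. h *\<^sub>R (speed \<gamma> x - speed \<gamma> s0))) (at x within {s0-d..s0+d})"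
      if "x \<in> {s0-d..s0+d}" for x
    proof -
      have "(snd \<gamma> has_vector_derivative speed \<gamma> x) (at x within {s0-d..s0+d})"
        using sp(2) that sub interior_subset by (meson has_vector_derivative_within_subset subset_iff)
      then show ?thesis
        unfolding has_vector_derivative_def
        by (auto intro!: derivative_eq_intros simp: scaleR_conv_of_real algebra_simps)
    qed
    have "norm ((snd \<gamma> t - of_real t * speed \<gamma> s0) - (snd \<gamma> s - of_real s * speed \<gamma> s0)) <= w * norm (t - s)"
    proof (rule differentiable_bound[OF _ der])
      show "onorm (%h. h *\<^sub>R (speed \<gamma> x - speed \<gamma> s0)) <= w" if "x \<in> {s0-d..s0+d}" for x
      proof (rule onorm_le)
        fix h :: real
        have "dist x s0 < d2" using that d by (auto simp: dist_real_def)
        then have "norm (speed \<gamma> x - speed \<gamma> s0) <= w" using d2(2) by (force simp: dist_norm)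
        then show "norm (h *\<^sub>R (speed \<gamma> x - speed \<gamma> s0)) <= w * norm h"
          by (simp add: mult.commute[of w] mult_left_mono)
      qed
    qed (use st in auto)
    then show "cmod (snd \<gamma> t - snd \<gamma> s - of_real (t - s) * speed \<gamma> s0) <= w * \<bar>t - s\<bar>"
      by (simp add: algebra_simps)
  qed
qed

text \<open>On either side of \<open>s0\<close> the modulus is strictly monotone, and parameters
  farther away cannot come back near 0; hence a small disc about the pole cuts out a single
  parameter interval. This lets cut-off integrals be computed from values of a primitive at two end
  points.\<close>

lemma smooth_simple_curve_window:
  assumes c: "smooth_simple_curve \<gamma>" and s0: "s0 \<in> interior (fst \<gamma>)" and z: "snd \<gamma> s0 = 0" and d: "0 < d"
  obtains \<rho> where "0 < \<rho>" "!!r. 0 < r ==> r <= \<rho> ==>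
    \<exists>a b. s0 - d < a \<and> a < s0 \<and> s0 < b \<and> b < s0 + d \<and> {a..b} \<subseteq> interior (fst \<gamma>) \<and>
      cmod (snd \<gamma> a) = r \<and> cmod (snd \<gamma> b) = r \<and>
      {s \<in> fst \<gamma>. cmod (snd \<gamma> s) < r} = {a<..<b} \<and> {s \<in> fst \<gamma>. cmod (snd \<gamma> s) <= r} = {a..b}"
proof -
  define v where "v = speed \<gamma> s0"
  have s0J: "s0 \<in> fst \<gamma>" using s0 interior_subset by blast
  have v: "v ~= 0" using smooth_simple_curve_speed(3)[OF c s0J] by (simp add: v_def)
  obtain d1 where d1: "0 < d1" "{s0-d1..s0+d1} \<subseteq> interior (fst \<gamma>)"
    and near: "!!s t. \<bar>s - s0\<bar> <= d1 ==> \<bar>t - s0\<bar> <= d1 ==> 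
       cmod (snd \<gamma> t - snd \<gamma> s - of_real (t - s) * v) <= cmod v / 4 * \<bar>t - s\<bar>"
    using smooth_simple_curve_near_tangent[OF c s0, of "cmod v / 4"] v unfolding v_def by auto
  define d2 where "d2 = min d1 (d/2)"
  have d2: "0 < d2" "d2 <= d1" "d2 < d" using d1 d by (auto simp: d2_def)
  have sub: "{s0-d2..s0+d2} \<subseteq> interior (fst \<gamma>)" using d1 d2 by force
  have subJ: "{s0-d2..s0+d2} \<subseteq> fst \<gamma>" using sub interior_subset by blast
  have right: "cmod (snd \<gamma> s) < cmod (snd \<gamma> t)" if "s0 <= s" "s < t" "t <= s0 + d2" for s t
  proof -
    have "cmod (snd \<gamma> (s0 + q) - snd \<gamma> (s0 + p) - of_real (q - p) * v) <= cmod v / 4 * (q - p)"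
      if "0 <= p" "p < q" "q <= d2" for p q
      using near[of "s0 + p" "s0 + q"] that d2 by (simp add: algebra_simps)
    then show ?thesis
      using norm_strict_mono_near_line[of "%u. snd \<gamma> (s0 + u)" v d2 "s - s0" "t - s0"] z v that by simp
  qed
  have left: "cmod (snd \<gamma> s) < cmod (snd \<gamma> t)" if "s <= s0" "t < s" "s0 - d2 <= t" for s t
  proof -
    have "cmod (snd \<gamma> (s0 - q) - snd \<gamma> (s0 - p) - of_real (q - p) * (-v)) <= cmod (-v) / 4 * (q - p)"
      if "0 <= p" "p < q" "q <= d2" for p q
      using near[of "s0 - p" "s0 - q"] that d2 by (simp add: algebra_simps)
    then show ?thesis
      using norm_strict_mono_near_line[of "%u. snd \<gamma> (s0 - u)" "-v" d2 "s0 - s" "s0 - t"] z v that by simp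
  qed
  obtain e where e: "0 < e" "!!s. s \<in> fst \<gamma> ==> cmod (snd \<gamma> s - snd \<gamma> s0) < e ==> \<bar>s - s0\<bar> < d2"
    using smooth_simple_curve_far_from_point[of "fst \<gamma>" "snd \<gamma>" s0 d2] c s0 d2 by auto
  \<comment> \<open>Below \<open>e\<close> no far parameter interferes; below the moduli at
    \<open>s0 + d2\<close> and \<open>s0 - d2\<close> the intermediate value theorem yields both end
    points.\<close>
  define \<rho> where "\<rho> = min (e/2) (min (cmod (snd \<gamma> (s0 + d2))) (cmod (snd \<gamma> (s0 - d2))) / 2)"
  have "0 < cmod (snd \<gamma> (s0 + d2))" "0 < cmod (snd \<gamma> (s0 - d2))"
    using right[of s0 "s0 + d2"] left[of s0 "s0 - d2"] d2 z by auto
  then have \<rho>: "0 < \<rho>" "\<rho> < e" "\<rho> < cmod (snd \<gamma> (s0 + d2))" "\<rho> < cmod (snd \<gamma> (s0 - d2))"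
    using e(1) unfolding \<rho>_def by linarith+
  show ?thesis
  proof (rule that[OF \<rho>(1)])
    fix r assume r: "0 < r" "r <= \<rho>"
    have cont: "continuous_on {s0-d2..s0+d2} (%s. cmod (snd \<gamma> s))"
      by (intro continuous_intros continuous_on_subset[OF smooth_simple_curve_continuous[OF c] subJ])
    have "\<exists>b. s0 <= b \<and> b <= s0 + d2 \<and> cmod (snd \<gamma> b) = r"
      using r \<rho> z d2 by (intro IVT' continuous_on_subset[OF cont]) auto
    then obtain b where b: "s0 <= b" "b <= s0 + d2" "cmod (snd \<gamma> b) = r" by blast
    have "\<exists>a. s0 - d2 <= a \<and> a <= s0 \<and> cmod (snd \<gamma> a) = r"
      using r \<rho> z d2 by (intro IVT2' continuous_on_subset[OF cont]) auto
    then obtain a where a: "s0 - d2 <= a" "a <= s0" "cmod (snd \<gamma> a) = r" by blast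
    have a': "a < s0" "s0 < b" using a b r z by (metis less_eq_real_def norm_zero less_irrefl)+
    have inside: "cmod (snd \<gamma> s) < r" if "a < s" "s < b" for s
      using right[of s b] left[of s a] that a b by (cases "s0 <= s") auto
    have J: "s \<in> fst \<gamma>" if "a <= s" "s <= b" for s using that a b subJ by auto
    have outside: "r < cmod (snd \<gamma> s)" if "s \<in> fst \<gamma>" "s < a \<or> b < s" for s
    proof (rule ccontr)
      assume neg: "\<not> ?thesis"
      then have "\<bar>s - s0\<bar> < d2" using e(2)[OF that(1)] z r \<rho> by auto
      then show False using neg that(2) right[of b s] left[of a s] a b by auto
    qed
    show "\<exists>a b. s0 - d < a \<and> a < s0 \<and> s0 < b \<and> b < s0 + d \<and> {a..b} \<subseteq> interior (fst \<gamma>) \<and>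
      cmod (snd \<gamma> a) = r \<and> cmod (snd \<gamma> b) = r \<and>
      {s \<in> fst \<gamma>. cmod (snd \<gamma> s) < r} = {a<..<b} \<and> {s \<in> fst \<gamma>. cmod (snd \<gamma> s) <= r} = {a..b}"
    proof (rule exI[of _ a], rule exI[of _ b], intro conjI)
      show "{s \<in> fst \<gamma>. cmod (snd \<gamma> s) < r} = {a<..<b}"
      proof (intro equalityI subsetI)
        fix s assume "s \<in> {s \<in> fst \<gamma>. cmod (snd \<gamma> s) < r}"
        then have "s \<in> fst \<gamma>" "cmod (snd \<gamma> s) < r" by auto
        moreover then have "s ~= a" "s ~= b" "\<not> (s < a \<or> b < s)" using a b outside[of s] by auto
        ultimately show "s \<in> {a<..<b}" by auto
      qed (use inside J in auto)
      show "{s \<in> fst \<gamma>. cmod (snd \<gamma> s) <= r} = {a..b}"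
      proof (intro equalityI subsetI)
        fix s assume "s \<in> {s \<in> fst \<gamma>. cmod (snd \<gamma> s) <= r}"
        then show "s \<in> {a..b}" using outside[of s] by force
      next
        fix s assume s: "s \<in> {a..b}"
        then have "s = a \<or> s = b \<or> (a < s \<and> s < b)" by auto
        then show "s \<in> {s \<in> fst \<gamma>. cmod (snd \<gamma> s) <= r}" using inside[of s] J s a b by auto
      qed
      show "{a..b} \<subseteq> interior (fst \<gamma>)" using sub a b by auto
    qed (use a b a' d2 in auto)
  qed
qed

section \<open>Holomorphic functions of several variables\<close>

lemma norm_vector_scalar_mult: "norm (c *s v) = cmod c * norm (v :: complex ^ 'n)"
  unfolding norm_vec_def L2_set_def vector_scalar_mult_def
  by (simp add: norm_mult power_mult_distrib sum_distrib_left[symmetric] real_sqrt_mult)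

lemma continuous_on_vector_scalar_mult [continuous_intros]:
  fixes v :: "'a::topological_space => complex ^ 'n"
  assumes "continuous_on S c" "continuous_on S v"
  shows "continuous_on S (%x. c x *s v x)"
  using assms unfolding vector_scalar_mult_def
  by (intro continuous_on_vec_lambda continuous_intros continuous_on_component)

lemma axis_eq_scalar_mult: "axis k z = z *s (axis k 1 :: complex ^ 'n)"
  by (auto simp: axis_def vec_eq_iff)

lemma axis_zero: "axis k 0 = 0"
  by (simp add: axis_def vec_eq_iff)

text \<open>Cauchy's formula turns the derivative into an integral over one fixed circle, whose
  integrand is jointly continuous in the point and the parameter.\<close>

lemma continuous_on_deriv_parameter:
  fixes F :: "complex => 'b::topological_space => complex"
  assumes cont: "continuous_on (cball z0 r \<times> X) (%(z, x). F z x)"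
    and hol: "!!x. x \<in> X ==> (%z. F z x) holomorphic_on ball z0 r"
  shows "continuous_on (ball z0 r \<times> X) (%(z, x). deriv (%z. F z x) z)"
proof (cases "r > 0")
  case True
  define k where "k = (%(z, x) t. F (circlepath z0 r t) x / (circlepath z0 r t - z)\<^sup>2 * vector_derivative (circlepath z0 r) (at t))"
  have eq: "deriv (%z. F z x) z = integral (cbox 0 1) (k (z, x)) / (2 * pi * \<i>)" if "z \<in> ball z0 r" "x \<in> X" for z x
  proof -
    have "continuous_on (cball z0 r) (%z. F z x)"
      using that(2) by (intro continuous_on_compose2[OF cont, of _ "%z. (z, x)", simplified]) (auto intro!: continuous_intros)
    from Cauchy_contour_integral_circlepath_2[OF this hol[OF that(2)] that(1)]
    show ?thesis by (simp add: contour_integral_integral k_def)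
  qed
  have "continuous_on (ball z0 r \<times> X) (%p. integral (cbox 0 1) (k p))"
  proof (rule integral_continuous_on_param)
    have ne: "circlepath z0 r t ~= z" if "z \<in> ball z0 r" for z t
      using that True by (auto simp: circlepath dist_norm norm_mult)
    have 1: "continuous_on ((ball z0 r \<times> X) \<times> cbox 0 1) (%p. F (circlepath z0 r (snd p)) (snd (fst p)))"
      using True by (intro continuous_on_compose2[OF cont, of _ "%p. (circlepath z0 r (snd p), snd (fst p))", simplified])
        (auto intro!: continuous_intros simp: circlepath dist_norm norm_mult)
    have 2: "continuous_on ((ball z0 r \<times> X) \<times> cbox 0 1) (%p. circlepath z0 r (snd p) - fst (fst p))"
      unfolding circlepath by (intro continuous_intros)
    have 4: "continuous_on ((ball z0 r \<times> X) \<times> cbox 0 1) (%p. circlepath z0 r (snd p))"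
      unfolding circlepath by (intro continuous_intros)
    have 3: "continuous_on ((ball z0 r \<times> X) \<times> cbox 0 1) (%p. vector_derivative (circlepath z0 r) (at (snd p)))"
      unfolding vector_derivative_circlepath by (intro continuous_intros)
    show "continuous_on ((ball z0 r \<times> X) \<times> cbox 0 1) (%(p, t). k p t)"
      unfolding k_def split_beta using 1 2 3 4 ne by (intro continuous_intros) auto
  qed
  then have "continuous_on (ball z0 r \<times> X) (%p. integral (cbox 0 1) (k p) / (2 * pi * \<i>))"
    by (intro continuous_intros) auto
  then show ?thesis by (rule continuous_on_eq) (auto simp: eq)
qed (auto simp: not_less ball_empty)

text \<open>The derivative is an integral over a circle, so Leibniz' rule gives the holomorphy in the other variable.\<close>

lemma
  fixes F :: "complex => complex => complex"
  assumes r: "0 < r" and cont: "continuous_on (cball 0 r \<times> cball 0 r) (%(z, w). F z w)"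
    and holz: "!!w. w \<in> cball 0 r ==> (%z. F z w) holomorphic_on ball 0 r"
    and holw: "!!z. z \<in> cball 0 r ==> (%w. F z w) holomorphic_on ball 0 r"
  shows holomorphic_partial_derivative: "(%z. deriv (%w. F z w) 0) field_differentiable at 0"
    and mixed_partial_derivatives: "deriv (%z. deriv (%w. F z w) 0) 0 = deriv (%w. deriv (%z. F z w) 0) 0"
proof -
  define c where "c = circlepath 0 r"
  define k where "k = (%t. vector_derivative c (at t) / (c t)\<^sup>2 / (2 * pi * \<i>))"
  have cn: "cmod (c t) = r" for t using r by (simp add: c_def circlepath norm_mult)
  have c0: "c t ~= 0" for t using cn[of t] r by auto
  have cc: "continuous_on S c" for S unfolding c_def circlepath by (intro continuous_intros)
  have "continuous_on S (%t. vector_derivative c (at t))" for S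
    unfolding c_def vector_derivative_circlepath by (intro continuous_intros)
  then have kc: "continuous_on S k" for S
    unfolding k_def using c0 cc by (intro continuous_on_divide continuous_on_power continuous_on_const) simp_all
  have der: "deriv f 0 = integral (cbox 0 1) (%t. f (c t) * k t)"
    if "continuous_on (cball 0 r) f" "f holomorphic_on ball 0 r" for f
  proof -
    have "(%t. f (c t) * k t) = (%t. f (c t) / (c t - 0)\<^sup>2 * vector_derivative c (at t) / (2 * pi * \<i>))"
      by (simp add: k_def fun_eq_iff)
    then have "integral (cbox 0 1) (%t. f (c t) * k t) = integral (cbox 0 1) (%t. f (c t) / (c t - 0)\<^sup>2 * vector_derivative c (at t)) / (2 * pi * \<i>)"
      by (simp only: integral_divide)
    also have "\<dots> = deriv f 0"
      using Cauchy_contour_integral_circlepath_2[OF that, of 0] r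
      by (simp add: contour_integral_integral c_def)
    finally show ?thesis ..
  qed
  have c2: "continuous_on S (%p. c (snd p))" and k2: "continuous_on S (%p. k (snd p))" for S :: "(complex \<times> real) set"
    by (rule continuous_on_compose2[OF cc[of UNIV]] continuous_on_compose2[OF kc[of UNIV]]; auto intro!: continuous_intros)+
  \<comment> \<open>Stated for an arbitrary \<open>F\<close> because it is used a second time with
    the two variables exchanged.\<close>
  have gen: "(%z. deriv (%w. F z w) 0) holomorphic_on ball 0 r \<and>
      deriv (%z. deriv (%w. F z w) 0) 0 = integral (cbox 0 1) (%t. deriv (%z. F z (c t)) 0 * k t) \<and>
      continuous_on (cball 0 r) (%z. deriv (%w. F z w) 0)"
    if cont: "continuous_on (cball 0 r \<times> cball 0 r) (%(z, w). F z w)"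
    and holz: "!!w. w \<in> cball 0 r ==> (%z. F z w) holomorphic_on ball 0 r"
    and holw: "!!z. z \<in> cball 0 r ==> (%w. F z w) holomorphic_on ball 0 r" for F :: "complex => complex => complex"
  proof -
    have contw: "continuous_on (cball 0 r) (%w. F z w)" if "z \<in> cball 0 r" for z
    proof -
      have "continuous_on (cball 0 r) (%w. (%(z, w). F z w) (z, w))"
        by (rule continuous_on_compose2[OF cont]) (use that in \<open>auto intro!: continuous_intros\<close>)
      then show ?thesis by simp
    qed
    have Fc: "continuous_on (cball 0 r \<times> cbox 0 1) (%(z, t). F z (c t) * k t)"
      unfolding split_beta
    proof (rule continuous_on_mult[OF _ k2])
      have "continuous_on (cball 0 r \<times> cbox 0 1) (%p. (%(z, w). F z w) (fst p, c (snd p)))"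
        by (rule continuous_on_compose2[OF cont]) (use cn in \<open>auto intro!: continuous_intros c2\<close>)
      then show "continuous_on (cball 0 r \<times> cbox 0 1) (%p. F (fst p) (c (snd p)))" by simp
    qed
    have eq: "deriv (%w. F z w) 0 = integral (cbox 0 1) (%t. F z (c t) * k t)" if "z \<in> cball 0 r" for z
      by (rule der[OF contw[OF that] holw[OF that]])
    have dz: "((%z. F z (c t) * k t) has_field_derivative deriv (%z. F z (c t)) z * k t) (at z within ball 0 r)"
      if "z \<in> ball 0 r" for z t
      using cn by (intro DERIV_cmult_right has_field_derivative_at_within[OF holomorphic_derivI[OF holz open_ball that]]) simp
    have int: "(%t. F z (c t) * k t) integrable_on cbox 0 1" if "z \<in> ball 0 r" for z
    proof (rule integrable_continuous)
      have "continuous_on (cbox 0 1) (%t. (%(z, t). F z (c t) * k t) (z, t))"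
        by (rule continuous_on_compose2[OF Fc]) (use that in \<open>auto intro!: continuous_intros\<close>)
      then show "continuous_on (cbox 0 1) (%t. F z (c t) * k t)" by simp
    qed
    have dcont: "continuous_on (ball 0 r \<times> cbox 0 1) (%(z, t). deriv (%z. F z (c t)) z * k t)"
    proof -
      have "continuous_on (ball 0 r \<times> cball 0 r) (%(z, w). deriv (%z. F z w) z)"
        by (rule continuous_on_deriv_parameter[OF cont holz])
      then have "continuous_on (ball 0 r \<times> cbox 0 1) (%p. (%(z, w). deriv (%z. F z w) z) (fst p, c (snd p)))"
        by (rule continuous_on_compose2) (use cn in \<open>auto intro!: continuous_intros c2\<close>)
      then show ?thesis unfolding split_beta by (intro continuous_on_mult[OF _ k2]) simp
    qed
    have L: "((%z. integral (cbox 0 1) (%t. F z (c t) * k t)) has_field_derivative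
        integral (cbox 0 1) (%t. deriv (%z. F z (c t)) z * k t)) (at z)" if "z \<in> ball 0 r" for z
      using leibniz_rule_field_derivative[OF dz int dcont that] that by (simp add: at_within_open[OF _ open_ball])
    have L': "((%z. deriv (%w. F z w) 0) has_field_derivative
        integral (cbox 0 1) (%t. deriv (%z. F z (c t)) z * k t)) (at z)" if "z \<in> ball 0 r" for z
      by (rule has_field_derivative_transform_within_open[OF L[OF that] open_ball that]) (simp add: eq)
    have "continuous_on (cball 0 r) (%z. integral (cbox 0 1) (%t. F z (c t) * k t))"
      by (rule integral_continuous_on_param[OF Fc])
    then have "continuous_on (cball 0 r) (%z. deriv (%w. F z w) 0)"
      by (rule continuous_on_eq) (simp add: eq)
    moreover have "(%z. deriv (%w. F z w) 0) holomorphic_on ball 0 r"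
      unfolding holomorphic_on_open[OF open_ball] using L' by blast
    ultimately show ?thesis using DERIV_imp_deriv[OF L'[of 0]] r by simp
  qed
  note g1 = gen[OF cont holz holw]
  have "continuous_on (cball 0 r \<times> cball 0 r) (%(z, w). F w z)"
  proof -
    have "continuous_on (cball 0 r \<times> cball 0 r) (%p. (%(z, w). F z w) (snd p, fst p))"
      by (rule continuous_on_compose2[OF cont]) (auto intro!: continuous_intros)
    then show ?thesis by (simp add: split_beta)
  qed
  note g2 = gen[OF this holw holz]
  show "(%z. deriv (%w. F z w) 0) field_differentiable at 0"
    using conjunct1[OF g1] r holomorphic_on_imp_differentiable_at[OF _ open_ball] by (metis centre_in_ball)
  show "deriv (%z. deriv (%w. F z w) 0) 0 = deriv (%w. deriv (%z. F z w) 0) 0"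
    using der[of "%w. deriv (%z. F z w) 0"] g1 g2 by simp
qed

definition holomorphic_vec :: "(complex ^ 'm::finite => complex) => (complex ^ 'm) set => bool" where
  "holomorphic_vec g S \<longleftrightarrow> (\<forall>z\<in>S. \<exists>L. (g has_derivative L) (at z) \<and> (\<forall>a v. L (a *s v) = a * L v))"

abbreviation dir_deriv :: "(complex ^ 'm::finite => complex) => complex ^ 'm => complex ^ 'm => complex" where
  "dir_deriv g z \<equiv> frechet_derivative g (at z)"

lemma holomorphic_vec_derivative:
  assumes "holomorphic_vec g S" "z \<in> S"
  shows "(g has_derivative dir_deriv g z) (at z)" "dir_deriv g z (a *s v) = a * dir_deriv g z v"
    "dir_deriv g z v = (\<Sum>k\<in>UNIV. v $ k * dir_deriv g z (axis k 1))"
proof -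
  obtain L where L: "(g has_derivative L) (at z)" "!!a v. L (a *s v) = a * L v"
    using assms unfolding holomorphic_vec_def by blast
  have eq: "dir_deriv g z = L" using frechet_derivative_at[OF L(1)] by simp
  show "(g has_derivative dir_deriv g z) (at z)" using L eq by simp
  show s: "dir_deriv g z (a *s v) = a * dir_deriv g z v" for a v using L eq by simp
  have lin: "linear (dir_deriv g z)" using L(1) eq has_derivative_linear by blast
  have "v = (\<Sum>k\<in>UNIV. v $ k *s axis k 1)" by (simp add: basis_expansion)
  then have "dir_deriv g z v = (\<Sum>k\<in>UNIV. dir_deriv g z (v $ k *s axis k 1))"
    by (metis (no_types) linear_sum[OF lin])
  then show "dir_deriv g z v = (\<Sum>k\<in>UNIV. v $ k * dir_deriv g z (axis k 1))" by (simp add: s)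
qed

lemma holomorphic_vec_continuous: "holomorphic_vec g S ==> continuous_on S g"
  by (meson continuous_at_imp_continuous_on has_derivative_continuous holomorphic_vec_derivative(1))

lemma holomorphic_vec_chain:
  assumes "holomorphic_vec g S" "f x \<in> S" "(f has_vector_derivative f') (at x within X)"
  shows "((%x. g (f x)) has_vector_derivative dir_deriv g (f x) f') (at x within X)"
proof -
  have "((%x. g (f x)) has_derivative (%h. dir_deriv g (f x) (h *\<^sub>R f'))) (at x within X)"
    using has_derivative_compose[OF assms(3)[unfolded has_vector_derivative_def] holomorphic_vec_derivative(1)[OF assms(1,2)]] .
  moreover have "linear (dir_deriv g (f x))"
    using holomorphic_vec_derivative(1)[OF assms(1,2)] has_derivative_linear by blast
  ultimately show ?thesis unfolding has_vector_derivative_def by (simp add: linear_cmul)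
qed

lemma has_derivative_scalar_mult_vec: "((%w. w *s (v :: complex ^ 'n)) has_derivative (%h. h *s v)) (at w within S)"
proof (rule bounded_linear_imp_has_derivative)
  show "bounded_linear (%h. h *s v)"
    by (rule bounded_linear_intro[where K="norm v"])
      (auto simp: vector_sadd_rdistrib norm_vector_scalar_mult vec_eq_iff)
qed

lemma holomorphic_vec_line:
  assumes "holomorphic_vec g S" "a + w *s v \<in> S"
  shows "((%w. g (a + w *s v)) has_field_derivative dir_deriv g (a + w *s v) v) (at w)"
proof -
  have "((%w. a + w *s v) has_derivative (%h. h *s v)) (at w)"
    using has_derivative_add[OF has_derivative_const has_derivative_scalar_mult_vec] by simp
  from has_derivative_compose[OF this holomorphic_vec_derivative(1)[OF assms]]
  have "((%w. g (a + w *s v)) has_derivative (%h. h * dir_deriv g (a + w *s v) v)) (at w)"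
    by (simp only: holomorphic_vec_derivative(2)[OF assms])
  moreover have "(%h. h * dir_deriv g (a + w *s v) v) = (*) (dir_deriv g (a + w *s v) v)"
    by (simp add: fun_eq_iff mult.commute)
  ultimately show ?thesis unfolding has_field_derivative_def by simp
qed

lemma holomorphic_vec_on_line:
  assumes "holomorphic_vec g S" "open X" "!!w. w \<in> X ==> a + w *s v \<in> S"
  shows "(%w. g (a + w *s v)) holomorphic_on X"
  using assms holomorphic_vec_line by (metis holomorphic_on_open)

text \<open>The first derivative along a direction is linear in that direction; applying this twice
  gives the quadratic form, with the order of differentiation exchanged in between. \<open>A\<close>
  is written with iterated \<open>deriv\<close> to match \<open>hessian_theta\<close>, so
  differentiability of the inner derivative has to be supplied by \<open>diff\<close> before a sum
  can be pulled out.\<close>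

lemma
  fixes g :: "complex ^ 'm::finite => complex"
  defines "A \<equiv> (\<chi> k j. deriv (%z. deriv (%w. g (axis k z + axis j w)) 0) 0)"
  assumes g: "holomorphic_vec g (ball 0 R)" and R: "0 < R"
  shows second_derivative_line: "deriv (deriv (%z. g (z *s v))) 0 = bilin v A v"
    and hessian_symmetric: "transpose A = A"
proof -
  \<comment> \<open>The radius is chosen such that \<open>z *s v + w *s u\<close> has norm at most
    \<open>R / 2\<close> for all \<open>z\<close>, \<open>w\<close> in the closed disc; the added 1
    avoids division by zero.\<close>
  have lines: "continuous_on (cball 0 (R / (2 * (norm u + norm v + 1))) \<times> cball 0 (R / (2 * (norm u + norm v + 1)))) (%(z, w). g (z *s v + w *s u)) \<and>
     (\<forall>w\<in>cball 0 (R / (2 * (norm u + norm v + 1))). (%z. g (z *s v + w *s u)) holomorphic_on ball 0 (R / (2 * (norm u + norm v + 1)))) \<and>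
     (\<forall>z\<in>cball 0 (R / (2 * (norm u + norm v + 1))). (%w. g (z *s v + w *s u)) holomorphic_on ball 0 (R / (2 * (norm u + norm v + 1)))) \<and>
     0 < R / (2 * (norm u + norm v + 1))" for u v :: "complex ^ 'm"
  proof -
    define r where "r = R / (2 * (norm u + norm v + 1))"
    have r: "0 < r" using R by (simp add: r_def add_nonneg_pos)
    have in_ball: "z *s v + w *s u \<in> ball 0 R" if "z \<in> cball 0 r" "w \<in> cball 0 r" for z w
    proof -
      have "norm (z *s v + w *s u) <= cmod z * norm v + cmod w * norm u"
        by (metis norm_triangle_ineq norm_vector_scalar_mult)
      also have "\<dots> <= r * norm v + r * norm u"
        using that by (intro add_mono mult_right_mono) auto
      also have "\<dots> <= r * (norm u + norm v + 1)" using r by (simp add: algebra_simps)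
      also have "\<dots> = R / 2"
      proof -
        define C where "C = norm u + norm v + 1"
        have "C > 0" by (simp add: C_def add_nonneg_pos)
        then show ?thesis unfolding r_def C_def[symmetric] by simp
      qed
      finally show ?thesis using R by simp
    qed
    have "continuous_on (cball 0 r \<times> cball 0 r) (%p. g (fst p *s v + snd p *s u))"
      by (rule continuous_on_compose2[OF holomorphic_vec_continuous[OF g]])
        (use in_ball in \<open>auto intro!: continuous_intros\<close>)
    moreover have "(%z. g (z *s v + w *s u)) holomorphic_on ball 0 r" if "w \<in> cball 0 r" for w
      using holomorphic_vec_on_line[OF g, of "ball 0 r" "w *s u" v] in_ball that by (simp add: add.commute)
    moreover have "(%w. g (z *s v + w *s u)) holomorphic_on ball 0 r" if "z \<in> cball 0 r" for z
      using holomorphic_vec_on_line[OF g, of "ball 0 r" "z *s v" u] in_ball that by simp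
    ultimately show ?thesis using r unfolding r_def by (simp add: split_beta)
  qed
  have mixed: "deriv (%z. deriv (%w. g (z *s v + w *s u)) 0) 0 = deriv (%w. deriv (%z. g (z *s v + w *s u)) 0) 0" for u v
    by (rule mixed_partial_derivatives[of "R / (2 * (norm u + norm v + 1))"]; use lines[of u v] in blast)
  have diff: "(%z. deriv (%w. g (z *s v + w *s u)) 0) field_differentiable at 0" for u v
    by (rule holomorphic_partial_derivative[of "R / (2 * (norm u + norm v + 1))"]; use lines[of u v] in blast)
  have first: "deriv (%z. g (z *s v + a)) 0 = (\<Sum>k\<in>UNIV. v $ k * deriv (%z. g (z *s axis k 1 + a)) 0)"
    if "a \<in> ball 0 R" for v a
  proof -
    have d: "deriv (%z. g (z *s v + a)) 0 = dir_deriv g a v" for v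
      using DERIV_imp_deriv[OF holomorphic_vec_line[OF g, of a 0 v]] that by (simp add: add.commute)
    show ?thesis unfolding d using holomorphic_vec_derivative(3)[OF g that, of v] .
  qed
  have Akj: "A $ k $ j = deriv (%z. deriv (%w. g (z *s axis k 1 + w *s axis j 1)) 0) 0" for k j
    by (simp add: A_def axis_eq_scalar_mult[symmetric])
  show "transpose A = A"
  proof -
    have "A $ j $ k = A $ k $ j" for j k
      unfolding Akj by (subst mixed) (simp only: add.commute)
    then show ?thesis by (simp add: vec_eq_iff transpose_def)
  qed
  show "deriv (deriv (%z. g (z *s v))) 0 = bilin v A v"
  proof -
    have near: "eventually (%z. z *s u \<in> ball 0 R) (nhds 0)" for u :: "complex ^ 'm"
    proof -
      have "continuous_on UNIV (%z. z *s u)" by (intro continuous_intros)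
      from open_vimage[OF open_ball this] have "open ((%z. z *s u) -` ball 0 R)" by simp
      then show ?thesis using R by (auto simp: eventually_nhds intro!: exI[of _ "(%z. z *s u) -` ball 0 R"])
    qed
    have "deriv (deriv (%z. g (z *s v))) 0 = deriv (%z. \<Sum>j\<in>UNIV. v $ j * deriv (%w. g (z *s v + w *s axis j 1)) 0) 0"
    proof (rule deriv_cong_ev[OF _ refl], rule eventually_mono[OF near[of v]])
      fix z assume z: "z *s v \<in> ball 0 R"
      have "deriv (%z. g (z *s v)) z = deriv (%w. g (w *s v + z *s v)) 0"
        using deriv_shift_0[of "%z. g (z *s v)" z] by (simp only: comp_def vector_sadd_rdistrib add.commute)
      also have "\<dots> = (\<Sum>j\<in>UNIV. v $ j * deriv (%w. g (w *s axis j 1 + z *s v)) 0)"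
        by (rule first[OF z])
      finally show "deriv (%z. g (z *s v)) z = (\<Sum>j\<in>UNIV. v $ j * deriv (%w. g (z *s v + w *s axis j 1)) 0)"
        by (simp only: add.commute[of _ "z *s v"])
    qed
    also have "\<dots> = (\<Sum>j\<in>UNIV. v $ j * deriv (%z. deriv (%w. g (z *s v + w *s axis j 1)) 0) 0)"
      by (intro DERIV_imp_deriv DERIV_sum DERIV_cmult) (simp add: DERIV_deriv_iff_field_differentiable diff)
    also have "\<dots> = (\<Sum>j\<in>UNIV. v $ j * (\<Sum>k\<in>UNIV. v $ k * A $ j $ k))"
    proof (rule sum.cong[OF refl])
      fix j
      have "deriv (%z. deriv (%w. g (z *s v + w *s axis j 1)) 0) 0 = deriv (%w. deriv (%z. g (z *s v + w *s axis j 1)) 0) 0"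
        by (rule mixed)
      also have "\<dots> = deriv (%w. \<Sum>k\<in>UNIV. v $ k * deriv (%z. g (w *s axis j 1 + z *s axis k 1)) 0) 0"
      proof (rule deriv_cong_ev[OF _ refl], rule eventually_mono[OF near[of "axis j 1"]])
        fix w :: complex assume w: "w *s axis j 1 \<in> ball (0::complex^'m) R"
        show "deriv (%z. g (z *s v + w *s axis j 1)) 0 = (\<Sum>k\<in>UNIV. v $ k * deriv (%z. g (w *s axis j 1 + z *s axis k 1)) 0)"
          using first[OF w, of v] by (simp only: add.commute[of "w *s axis j 1"])
      qed
      also have "\<dots> = (\<Sum>k\<in>UNIV. v $ k * deriv (%w. deriv (%z. g (w *s axis j 1 + z *s axis k 1)) 0) 0)"
        by (intro DERIV_imp_deriv DERIV_sum DERIV_cmult) (simp add: DERIV_deriv_iff_field_differentiable diff)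
      also have "\<dots> = (\<Sum>k\<in>UNIV. v $ k * A $ j $ k)" by (simp add: Akj)
      finally show "v $ j * deriv (%z. deriv (%w. g (z *s v + w *s axis j 1)) 0) 0 = v $ j * (\<Sum>k\<in>UNIV. v $ k * A $ j $ k)" by simp
    qed
    also have "\<dots> = bilin v A v"
      unfolding bilin_def by (simp add: sum_distrib_left mult_ac)
    finally show ?thesis .
  qed
qed

text \<open>One-variable Taylor expansion on each complex line through a unit vector. Cauchy's
  estimate bounds the third derivative uniformly in the direction, and homogeneity carries the
  estimate to all \<open>\<theta>\<close>.\<close>

lemma second_order_expansion:
  fixes g :: "complex ^ 'm::finite => complex"
  defines "A \<equiv> (\<chi> k j. deriv (%z. deriv (%w. g (axis k z + axis j w)) 0) 0)"
  assumes g: "holomorphic_vec g (ball 0 R)" and R: "0 < R" and g0: "g 0 = 0"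
    and grad: "!!k. deriv (%z. g (axis k z)) 0 = 0"
  obtains K r where "0 < r" "0 <= K" "!!\<theta>. norm \<theta> <= r ==> cmod (g \<theta> - bilin \<theta> A \<theta> / 2) <= K * norm \<theta> ^ 3"
proof -
  have "continuous_on (cball 0 (R/2)) g"
    using R by (intro continuous_on_subset[OF holomorphic_vec_continuous[OF g]]) auto
  then have "bounded (g ` cball 0 (R/2))" by (intro compact_imp_bounded compact_continuous_image) auto
  then obtain M where "\<forall>y\<in>g ` cball 0 (R/2). norm y <= M"
    unfolding bounded_iff by blast
  then have M: "cmod (g \<theta>) <= M" if "norm \<theta> <= R/2" for \<theta> using that by auto
  \<comment> \<open>Cauchy's estimate for the third derivative on discs of radius
    \<open>R / 4\<close> about points of modulus at most \<open>R / 4\<close>; these discs stay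
    where \<open>M\<close> bounds the function.\<close>
  define B where "B = fact 3 * M / (R/4) ^ 3"
  have M0: "0 <= M" using M[of 0] R g0 by simp
  have unit: "cmod (g (z *s v) - bilin v A v / 2 * z\<^sup>2) <= B / 2 * cmod z ^ 3"
    if v: "norm v = 1" and z: "cmod z <= R/4" for v z
  proof -
    define \<phi> where "\<phi> = (%z. g (z *s v))"
    have hol: "\<phi> holomorphic_on ball 0 R"
      using holomorphic_vec_on_line[OF g open_ball, of 0 R 0 v] v by (simp add: \<phi>_def norm_vector_scalar_mult)
    have hn: "(deriv ^^ i) \<phi> holomorphic_on ball 0 R" for i
      by (rule holomorphic_higher_deriv[OF hol]) simp
    have bnd: "cmod ((deriv ^^ 3) \<phi> x) <= B" if "x \<in> cball 0 (R/4)" for x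
      unfolding B_def
    proof (rule Cauchy_inequality)
      have sub: "cball x (R/4) \<subseteq> ball 0 R"
      proof
        fix y assume "y \<in> cball x (R/4)"
        then have "cmod (x - y) <= R/4" by (simp add: dist_norm)
        then have "cmod y <= R/4 + cmod x" using norm_triangle_ineq2[of y x] by (simp add: norm_minus_commute)
        then show "y \<in> ball 0 R" using that R by simp
      qed
      show "\<phi> holomorphic_on ball x (R/4)" using sub by (intro holomorphic_on_subset[OF hol]) auto
      show "continuous_on (cball x (R/4)) \<phi>"
        using sub by (intro continuous_on_subset[OF holomorphic_on_imp_continuous_on[OF hol]]) auto
      show "0 < R/4" using R by simp
      fix y assume "cmod (x - y) = R/4"
      then have "cmod y <= R/4 + cmod x" using norm_triangle_ineq2[of y x] by (simp add: norm_minus_commute)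
      then show "cmod (\<phi> y) <= M" unfolding \<phi>_def using that v by (intro M) (simp add: norm_vector_scalar_mult)
    qed
    have "cmod ((deriv ^^ 0) \<phi> z - (\<Sum>i\<le>2. (deriv ^^ i) \<phi> 0 * (z - 0) ^ i / fact i)) <= B * cmod (z - 0) ^ (Suc 2) / fact 2"
    proof (rule complex_Taylor[where S="cball 0 (R/4)" and f="%i. (deriv ^^ i) \<phi>"])
      show "((deriv ^^ i) \<phi> has_field_derivative (deriv ^^ Suc i) \<phi> x) (at x within cball 0 (R/4))"
        if "x \<in> cball 0 (R/4)" for i x
        using holomorphic_derivI[OF hn[of i] open_ball, of x] that R by (auto intro!: has_field_derivative_at_within)
      show "cmod ((deriv ^^ Suc 2) \<phi> x) <= B" if "x \<in> cball 0 (R/4)" for x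
        using bnd[OF that] by (simp add: eval_nat_numeral)
    qed (use z R in auto)
    moreover have "deriv \<phi> 0 = 0"
    proof -
      have "0 \<in> ball (0::complex^'m) R" using R by simp
      have "deriv \<phi> 0 = dir_deriv g 0 v"
        unfolding \<phi>_def using DERIV_imp_deriv[OF holomorphic_vec_line[OF g, of 0 0 v]] R by simp
      also have "\<dots> = (\<Sum>k\<in>UNIV. v $ k * dir_deriv g 0 (axis k 1))"
        using R by (intro holomorphic_vec_derivative(3)[OF g]) auto
      also have "\<dots> = 0"
      proof (rule sum.neutral, rule ballI)
        fix k :: 'm
        have "((%w. g (0 + w *s axis k 1)) has_field_derivative dir_deriv g (0 + 0 *s axis k 1) (axis k 1)) (at 0)"
          using R by (intro holomorphic_vec_line[OF g]) simp
        then have "deriv (%w. g (0 + w *s axis k 1)) 0 = dir_deriv g 0 (axis k 1)"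
          by (intro DERIV_imp_deriv) simp
        moreover have "(%w. g (0 + w *s axis k 1)) = (%w. g (axis k w))"
          by (intro ext) (subst (2) axis_eq_scalar_mult, simp)
        ultimately show "v $ k * dir_deriv g 0 (axis k 1) = 0" using grad[of k] by simp
      qed
      finally show ?thesis .
    qed
    moreover have "deriv (deriv \<phi>) 0 = bilin v A v"
      unfolding \<phi>_def A_def by (rule second_derivative_line[OF g R])
    ultimately show ?thesis using g0 by (simp add: \<phi>_def eval_nat_numeral algebra_simps)
  qed
  show ?thesis
  proof (rule that[of "R/4" "B/2"])
    show "0 < R/4" using R by simp
    show "0 <= B / 2" using M0 R by (simp add: B_def)
    fix \<theta> :: "complex ^ 'm" assume \<theta>: "norm \<theta> <= R/4"
    show "cmod (g \<theta> - bilin \<theta> A \<theta> / 2) <= B / 2 * norm \<theta> ^ 3"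
    proof (cases "\<theta> = 0")
      case True then show ?thesis by (simp add: g0 bilin_def)
    next
      case False
      define v where "v = (of_real (1 / norm \<theta>) :: complex) *s \<theta>"
      have v: "norm v = 1" using False by (simp add: v_def norm_vector_scalar_mult norm_divide)
      have t: "of_real (norm \<theta>) *s v = \<theta>" using False by (simp add: v_def vec_eq_iff)
      have "bilin \<theta> A \<theta> = (of_real (norm \<theta>))\<^sup>2 * bilin v A v"
        by (subst (1 2) t[symmetric]) (simp add: bilin_def sum_distrib_left power2_eq_square mult_ac)
      then show ?thesis using unit[OF v, of "of_real (norm \<theta>)"] \<theta> t by (simp add: mult.commute)
    qed
  qed
qed

section \<open>Linear algebra\<close>

definition pert :: "complex ^ 'n::finite ^ 'n => complex => complex ^ 'n ^ 'n" where
  "pert E z = (\<chi> i j. (if i = j then 1 else 0) + z * E $ i $ j)"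

lemma pert_mult_vec: "pert E z *v x = x + z *s (E *v x)"
proof -
  have row: "(\<Sum>j\<in>UNIV. ((if i = j then 1 else 0) + z * E $ i $ j) * x $ j) = x $ i + z * (\<Sum>j\<in>UNIV. E $ i $ j * x $ j)" for i
  proof -
    have "(\<Sum>j\<in>UNIV. ((if i = j then 1 else 0) + z * E $ i $ j) * x $ j) =
       (\<Sum>j\<in>UNIV. (if i = j then x $ j else 0) + z * (E $ i $ j * x $ j))"
      by (rule sum.cong) (auto simp: algebra_simps)
    then show ?thesis by (simp add: sum.distrib sum_distrib_left)
  qed
  then show ?thesis
    unfolding vec_eq_iff pert_def matrix_vector_mult_def vector_scalar_mult_def vec_lambda_beta vector_add_component
    by (intro allI row)
qed

lemma matrix_inv_left_right:
  fixes A :: "complex ^ 'n ^ 'n"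
  assumes "det A ~= 0"
  shows "matrix_inv A ** A = mat 1" "A ** matrix_inv A = mat 1"
proof -
  have "\<exists>A'. A ** A' = mat 1 \<and> A' ** A = mat 1"
    using assms invertible_det_nz[of A] unfolding invertible_def by blast
  from someI_ex[OF this] show "matrix_inv A ** A = mat 1" "A ** matrix_inv A = mat 1"
    by (simp_all add: matrix_inv_def)
qed

text \<open>The factorisation \<open>1 + (z + w) E = (1 + z E) (1 + w (1 + z E)^-1 E)\<close> moves
  differentiation of the determinant at \<open>z\<close> to differentiation at 0.\<close>

lemma pert_add:
  fixes E :: "complex ^ 'n::finite ^ 'n"
  assumes "det (pert E z) ~= 0"
  shows "pert E (z + w) = pert E z ** pert (matrix_inv (pert E z) ** E) w"
proof -
  have "pert E z ** pert (matrix_inv (pert E z) ** E) w *v x = pert E (z + w) *v x" for x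
  proof -
    have "pert E z *v (w *s y) = w *s (pert E z *v y)" for y
      by (simp add: vector_scalar_commute)
    then have "pert E z ** pert (matrix_inv (pert E z) ** E) w *v x = pert E z *v x + w *s (pert E z *v ((matrix_inv (pert E z) ** E) *v x))"
      by (simp add: matrix_vector_mul_assoc[symmetric] pert_mult_vec[of "matrix_inv (pert E z) ** E"] matrix_vector_right_distrib)
    also have "pert E z *v ((matrix_inv (pert E z) ** E) *v x) = E *v x"
      by (simp add: matrix_vector_mul_assoc matrix_mul_assoc matrix_inv_left_right[OF assms])
    finally show ?thesis by (simp add: pert_mult_vec vector_sadd_rdistrib)
  qed
  then show ?thesis by (metis matrix_eq)
qed

text \<open>A permutation other than the identity moves at least two indices. Differentiating one
  factor of its term in the Leibniz expansion leaves an off-diagonal factor, which vanishes at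
  \<open>z = 0\<close>; only the diagonal product contributes.\<close>

lemma det_pert_derivative_0:
  fixes E :: "complex ^ 'n::finite ^ 'n"
  shows "((%z. det (pert E z)) has_field_derivative trace E) (at 0)"
proof -
  define f where "f = (%p z. \<Prod>i\<in>UNIV. pert E z $ i $ (p i))"
  have entry: "((%z. pert E z $ i $ j) has_field_derivative E $ i $ j) (at 0)" for i j
    unfolding pert_def by (auto intro!: derivative_eq_intros)
  have f': "(f p has_field_derivative (\<Sum>i\<in>UNIV. E $ i $ p i * (\<Prod>j\<in>UNIV-{i}. pert E 0 $ j $ p j))) (at 0)" for p
    unfolding f_def by (rule has_field_derivative_prod[OF entry])
  have "((%z. \<Sum>p\<in>{p. p permutes (UNIV :: 'n set)}. of_int (sign p) * f p z) has_field_derivative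
      (\<Sum>p\<in>{p. p permutes (UNIV :: 'n set)}. of_int (sign p) * (\<Sum>i\<in>UNIV. E $ i $ p i * (\<Prod>j\<in>UNIV-{i}. pert E 0 $ j $ p j)))) (at 0)"
    by (intro DERIV_sum DERIV_cmult f')
  moreover have "(\<Sum>p\<in>{p. p permutes (UNIV :: 'n set)}. of_int (sign p) * (\<Sum>i\<in>UNIV. E $ i $ p i * (\<Prod>j\<in>UNIV-{i}. pert E 0 $ j $ p j)))
     = (\<Sum>p\<in>{id}. of_int (sign p) * (\<Sum>i\<in>UNIV. E $ i $ p i * (\<Prod>j\<in>UNIV-{i}. pert E 0 $ j $ p j)))"
  proof (rule sum.mono_neutral_right)
    show "\<forall>p\<in>{p. p permutes (UNIV :: 'n set)} - {id}. of_int (sign p) * (\<Sum>i\<in>UNIV. E $ i $ p i * (\<Prod>j\<in>UNIV-{i}. pert E 0 $ j $ p j)) = 0"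
    proof
      fix p assume p: "p \<in> {p. p permutes (UNIV :: 'n set)} - {id}"
      then have inj: "inj p" using permutes_inj by auto
      have "\<exists>j. j ~= i \<and> p j ~= j" for i
      proof (rule ccontr)
        assume *: "\<not> ?thesis"
        then have "p j = j" if "j ~= i" for j using that by blast
        moreover have "p i = i" using * inj by (metis injD)
        ultimately have "p = id" by (metis eq_id_iff)
        then show False using p by simp
      qed
      then have zero: "(\<Prod>j\<in>UNIV-{i}. pert E 0 $ j $ p j) = 0" for i
      proof -
        obtain j where "j ~= i" "p j ~= j" using \<open>!!i. \<exists>j. j ~= i \<and> p j ~= j\<close> by blast
        then have "\<exists>j\<in>UNIV-{i}. pert E 0 $ j $ p j = 0" by (intro bexI[of _ j]) (auto simp: pert_def)
        then show ?thesis by (intro prod_zero) auto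
      qed
      show "of_int (sign p) * (\<Sum>i\<in>UNIV. E $ i $ p i * (\<Prod>j\<in>UNIV-{i}. pert E 0 $ j $ p j)) = 0"
        by (simp only: zero mult_zero_right sum.neutral_const)
    qed
  qed (auto simp: permutes_id)
  moreover have "\<dots> = trace E"
    by (simp add: pert_def trace_def sign_id)
  ultimately show ?thesis unfolding det_def f_def by simp
qed

text \<open>Jacobi's formula. Its trace will cancel against the trace produced by differentiating a
  Gaussian integral, and form a divergence in the deformation argument.\<close>

lemma det_pert_derivative:
  fixes E :: "complex ^ 'n::finite ^ 'n"
  assumes "det (pert E z) ~= 0"
  shows "((%z. det (pert E z)) has_field_derivative det (pert E z) * trace (matrix_inv (pert E z) ** E)) (at z)"
proof -
  have "((%w. det (pert E z) * det (pert (matrix_inv (pert E z) ** E) w)) has_field_derivative det (pert E z) * trace (matrix_inv (pert E z) ** E)) (at 0)"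
    by (rule DERIV_cmult[OF det_pert_derivative_0])
  then have "((%w. det (pert E (z + w))) has_field_derivative det (pert E z) * trace (matrix_inv (pert E z) ** E)) (at 0)"
    by (simp add: pert_add[OF assms] det_mul)
  then show ?thesis
    using DERIV_shift[of "%z. det (pert E z)" _ 0 z] by (simp add: add.commute)
qed

lemma continuous_on_pert: "continuous_on S (%z. pert E z $ i $ j)"
  unfolding pert_def by (simp add: continuous_on_add continuous_on_mult_right)

lemma continuous_on_det [continuous_intros]:
  fixes A :: "'a::topological_space => complex ^ 'n::finite ^ 'n"
  assumes "!!i j. continuous_on S (%z. A z $ i $ j)"
  shows "continuous_on S (%z. det (A z))"
  unfolding det_def by (intro continuous_intros assms)

lemma bilin_eq_sum: "bilin u B v = (\<Sum>k\<in>UNIV. u $ k * (B *v v) $ k)"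
  by (simp add: bilin_def matrix_vector_mult_def sum_distrib_left mult.assoc)

lemma bilin_transpose: "bilin u B v = bilin v (transpose B) u"
  unfolding bilin_def by (subst sum.swap) (simp add: transpose_def mult_ac)

lemma bilin_mult_vec:
  fixes U V A :: "complex ^ 'n::finite ^ 'n"
  shows "bilin (U *v x) A (V *v y) = bilin x (transpose U ** A ** V) y"
proof -
  have "bilin (U *v x) B z = bilin x (transpose U ** B) z" for B :: "complex ^ 'n ^ 'n" and z
  proof -
    define w where "w = B *v z"
    have "bilin (U *v x) B z = (\<Sum>k\<in>UNIV. \<Sum>i\<in>UNIV. x $ i * (U $ k $ i * w $ k))"
      unfolding bilin_eq_sum w_def[symmetric] by (simp add: matrix_vector_mult_def sum_distrib_right sum_distrib_left mult_ac)
    also have "\<dots> = (\<Sum>i\<in>UNIV. x $ i * (transpose U *v w) $ i)"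
      by (subst sum.swap) (simp add: matrix_vector_mult_def transpose_def sum_distrib_left)
    finally show ?thesis by (simp add: bilin_eq_sum w_def matrix_vector_mul_assoc)
  qed
  moreover have "bilin x B (V *v y) = bilin x (B ** V) y" for B :: "complex ^ 'n ^ 'n"
    by (simp add: bilin_eq_sum matrix_vector_mul_assoc)
  ultimately show ?thesis by simp
qed

lemma bilin_add_left: "bilin (u + u') B v = bilin u B v + bilin u' B v"
  by (simp add: bilin_eq_sum distrib_right sum.distrib)

lemma bilin_add_right: "bilin u B (v + v') = bilin u B v + bilin u B v'"
  by (simp add: bilin_eq_sum distrib_left sum.distrib matrix_vector_right_distrib)

lemma bilin_scale_left: "bilin (c *s u) B v = c * bilin u B v"
  by (simp add: bilin_def sum_distrib_left mult_ac)

lemma bilin_scale_right: "bilin u B (c *s v) = c * bilin u B v"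
  by (simp add: bilin_def sum_distrib_left mult_ac)

lemma bilin_bound: "cmod (bilin u B v) <= (\<Sum>k\<in>UNIV. \<Sum>j\<in>UNIV. cmod (B $ k $ j)) * norm u * norm v"
proof -
  have "cmod (bilin u B v) <= (\<Sum>k\<in>UNIV. \<Sum>j\<in>UNIV. cmod (u $ k * B $ k $ j * v $ j))"
    unfolding bilin_def by (intro order_trans[OF norm_sum] sum_mono) simp
  also have "\<dots> <= (\<Sum>k\<in>UNIV. \<Sum>j\<in>UNIV. cmod (B $ k $ j) * norm u * norm v)"
  proof (intro sum_mono)
    fix k j
    have "cmod (u $ k) * cmod (v $ j) <= norm u * norm v"
      by (intro mult_mono Finite_Cartesian_Product.norm_nth_le) auto
    from mult_left_mono[OF this, of "cmod (B $ k $ j)"]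
    show "cmod (u $ k * B $ k $ j * v $ j) <= cmod (B $ k $ j) * norm u * norm v"
      by (simp add: norm_mult mult_ac)
  qed
  also have "\<dots> = (\<Sum>k\<in>UNIV. \<Sum>j\<in>UNIV. cmod (B $ k $ j)) * norm u * norm v"
    by (simp add: sum_distrib_right)
  finally show ?thesis .
qed

lemma trace_mul_inv_bilin:
  fixes A B :: "complex ^ 'n::finite ^ 'n"
  shows "trace (A ** B) = (\<Sum>i\<in>UNIV. \<Sum>j\<in>UNIV. A $ i $ j * B $ j $ i)"
  by (simp add: trace_def matrix_matrix_mult_def)

section \<open>Differentiation under the integral sign and real Gaussian integrals\<close>

lemma has_vector_derivative_iff_tendsto:
  "(f has_vector_derivative D) (at x within S) \<longleftrightarrow> ((%s. (f s - f x) /\<^sub>R (s - x)) \<longlongrightarrow> D) (at x within S)"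
proof -
  have "norm (f y - f x - (y - x) *\<^sub>R D) / norm (y - x) = norm ((f y - f x) /\<^sub>R (y - x) - D)" if "y ~= x" for y
  proof -
    have "(f y - f x) /\<^sub>R (y - x) - D = (f y - f x - (y - x) *\<^sub>R D) /\<^sub>R (y - x)"
      using that by (simp add: scaleR_diff_right)
    then show ?thesis by (simp add: divide_inverse mult.commute)
  qed
  then have "((%y. norm (f y - f x - (y - x) *\<^sub>R D) / norm (y - x)) \<longlongrightarrow> 0) (at x within S) \<longleftrightarrow>
     ((%y. norm ((f y - f x) /\<^sub>R (y - x) - D)) \<longlongrightarrow> 0) (at x within S)"
    by (intro filterlim_cong refl) (auto simp: eventually_at_filter)
  also have "\<dots> \<longleftrightarrow> ((%s. (f s - f x) /\<^sub>R (s - x)) \<longlongrightarrow> D) (at x within S)"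
    by (simp only: tendsto_norm_zero_iff Lim_null[symmetric])
  finally show ?thesis
    unfolding has_vector_derivative_def has_derivative_iff_norm by (simp add: bounded_linear_scaleR_left)
qed

text \<open>By the mean value inequality \<open>g\<close> dominates all difference quotients, so
  dominated convergence applies along every sequence tending to \<open>s0\<close>.\<close>

lemma has_vector_derivative_lborel_integral:
  fixes f f' :: "real => 'a => complex" and g :: "'a => real"
  assumes r: "0 < r"
    and der: "!!s y. \<bar>s - s0\<bar> < r ==> y \<in> space M ==> ((%s. f s y) has_vector_derivative f' s y) (at s)"
    and bnd: "!!s y. \<bar>s - s0\<bar> < r ==> y \<in> space M ==> cmod (f' s y) <= g y"
    and g: "integrable M g"
    and int: "!!s. \<bar>s - s0\<bar> < r ==> integrable M (f s)"
  shows "((%s. \<integral>y. f s y \<partial>M) has_vector_derivative (\<integral>y. f' s0 y \<partial>M)) (at s0)" and "integrable M (f' s0)"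
proof -
  \<comment> \<open>One concrete sequence inside the radius: \<open>f' s0\<close> is the pointwise
    limit of the difference quotients along it, which yields its integrability.\<close>
  define X where "X = (%n::nat. s0 + r / 2 / real (Suc n))"
  have Xs: "X n ~= s0" "\<bar>X n - s0\<bar> < r" for n
  proof -
    have "0 < r / 2 / real (Suc n)" using r by simp
    moreover have "r / 2 / real (Suc n) <= r / 2 / 1" using r by (intro divide_left_mono) auto
    moreover have "r / 2 / 1 < r" using r by simp
    moreover have "X n = s0 + r / 2 / real (Suc n)" by (simp only: X_def)
    ultimately show "X n ~= s0" "\<bar>X n - s0\<bar> < r" by linarith+
  qed
  have Xl: "X \<longlonglongrightarrow> s0"
  proof -
    have "(%n. s0 + r / 2 * inverse (real (Suc n))) \<longlonglongrightarrow> s0 + r / 2 * 0"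
      by (intro tendsto_intros LIMSEQ_inverse_real_of_nat)
    moreover have "X = (%n. s0 + r / 2 * inverse (real (Suc n)))"
      unfolding X_def by (intro ext arg_cong2[where f="(+)"] refl divide_inverse)
    ultimately show ?thesis by simp
  qed
  have quot: "(%n. (f (Y n) y - f s0 y) /\<^sub>R (Y n - s0)) \<longlonglongrightarrow> f' s0 y"
    if "y \<in> space M" "Y \<longlonglongrightarrow> s0" "!!n. Y n ~= s0" for y and Y :: "nat => real"
  proof -
    have "((%s. f s y) has_vector_derivative f' s0 y) (at s0)" using der[of s0 y] r that by simp
    then have "((%s. (f s y - f s0 y) /\<^sub>R (s - s0)) \<longlongrightarrow> f' s0 y) (at s0)"
      by (simp only: has_vector_derivative_iff_tendsto)
    then show ?thesis using that unfolding tendsto_at_iff_sequentially by (auto simp: comp_def)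
  qed
  have mv: "cmod ((f s y - f s0 y) /\<^sub>R (s - s0)) <= g y" if "y \<in> space M" "s ~= s0" "\<bar>s - s0\<bar> < r" for s y
  proof -
    have "norm (f s y - f s0 y) <= g y * norm (s - s0)"
    proof (rule differentiable_bound[where S="{s0-\<bar>s-s0\<bar>..s0+\<bar>s-s0\<bar>}" and f'="%x h. h *\<^sub>R f' x y"])
      fix x assume x: "x \<in> {s0-\<bar>s-s0\<bar>..s0+\<bar>s-s0\<bar>}"
      then have xr: "\<bar>x - s0\<bar> < r" using that by auto
      show "((%s. f s y) has_derivative (%h. h *\<^sub>R f' x y)) (at x within {s0-\<bar>s-s0\<bar>..s0+\<bar>s-s0\<bar>})"
        using der[OF xr that(1)] unfolding has_vector_derivative_def by (rule has_derivative_at_withinI)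
      show "onorm (%h. h *\<^sub>R f' x y) <= g y"
        using bnd[OF xr that(1)] by (intro onorm_le) (simp add: mult.commute[of "g y"] mult_left_mono)
    qed auto
    then have "norm (f s y - f s0 y) / \<bar>s - s0\<bar> <= g y" using that by (simp add: divide_le_eq)
    then show ?thesis by (simp add: divide_inverse mult.commute del: scaleR_right_diff_distrib)
  qed
  have lim: "(%n. \<integral>y. (f (Y n) y - f s0 y) /\<^sub>R (Y n - s0) \<partial>M) \<longlonglongrightarrow> (\<integral>y. f' s0 y \<partial>M)"
    and int': "integrable M (f' s0)"
    if Y: "Y \<longlonglongrightarrow> s0" "!!n. Y n ~= s0" "!!n. \<bar>Y n - s0\<bar> < r" for Y
  proof -
    have m: "(%y. (f (Y n) y - f s0 y) /\<^sub>R (Y n - s0)) \<in> borel_measurable M" for n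
      using int[OF Y(3)] int[of s0] r by (intro borel_measurable_scaleR borel_measurable_diff) (auto dest: borel_measurable_integrable)
    have m': "f' s0 \<in> borel_measurable M"
      by (rule borel_measurable_LIMSEQ_metric[where f="%n y. (f (Y n) y - f s0 y) /\<^sub>R (Y n - s0)", OF m]) (use quot Y in auto)
    show "(%n. \<integral>y. (f (Y n) y - f s0 y) /\<^sub>R (Y n - s0) \<partial>M) \<longlonglongrightarrow> (\<integral>y. f' s0 y \<partial>M)"
      by (rule integral_dominated_convergence[where s="%n y. (f (Y n) y - f s0 y) /\<^sub>R (Y n - s0)", OF m' m g]) (use quot mv Y in auto)
    show "integrable M (f' s0)"
      by (rule integrable_dominated_convergence[where s="%n y. (f (Y n) y - f s0 y) /\<^sub>R (Y n - s0)", OF m' m g]) (use quot mv Y in auto)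
  qed
  show "integrable M (f' s0)" by (rule int'[OF Xl Xs])
  have "((%s. ((\<integral>y. f s y \<partial>M) - (\<integral>y. f s0 y \<partial>M)) /\<^sub>R (s - s0)) \<longlongrightarrow> (\<integral>y. f' s0 y \<partial>M)) (at s0)"
    unfolding tendsto_at_iff_sequentially comp_def
  proof (intro allI impI)
    fix Y assume Y: "\<forall>i. Y i \<in> UNIV - {s0}" "Y \<longlonglongrightarrow> s0"
    have "\<forall>\<^sub>F n in sequentially. dist (Y n) s0 < r" using Y r by (auto simp: tendsto_iff)
    then obtain N where N: "!!n. n \<ge> N ==> \<bar>Y n - s0\<bar> < r" by (auto simp: eventually_sequentially dist_real_def)
    have "(%n. \<integral>y. (f (Y (n + N)) y - f s0 y) /\<^sub>R (Y (n + N) - s0) \<partial>M) \<longlonglongrightarrow> (\<integral>y. f' s0 y \<partial>M)"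
      by (rule lim) (use Y N LIMSEQ_ignore_initial_segment in auto)
    moreover have "(\<integral>y. (f (Y (n + N)) y - f s0 y) /\<^sub>R (Y (n + N) - s0) \<partial>M) = ((\<integral>y. f (Y (n + N)) y \<partial>M) - (\<integral>y. f s0 y \<partial>M)) /\<^sub>R (Y (n + N) - s0)" for n
      using int[OF N[of "n + N"]] int[of s0] r by simp
    ultimately have "(%n. ((\<integral>y. f (Y (n + N)) y \<partial>M) - (\<integral>y. f s0 y \<partial>M)) /\<^sub>R (Y (n + N) - s0)) \<longlonglongrightarrow> (\<integral>y. f' s0 y \<partial>M)" by (simp only:)
    then show "(%n. ((\<integral>y. f (Y n) y \<partial>M) - (\<integral>y. f s0 y \<partial>M)) /\<^sub>R (Y n - s0)) \<longlonglongrightarrow> (\<integral>y. f' s0 y \<partial>M)"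
      by (rule LIMSEQ_offset)
  qed
  then show "((%s. \<integral>y. f s y \<partial>M) has_vector_derivative (\<integral>y. f' s0 y \<partial>M)) (at s0)"
    by (simp only: has_vector_derivative_iff_tendsto)
qed

text \<open>Translation invariance of Lebesgue measure replaces integration by parts.\<close>

lemma integral_directional_derivative_zero:
  fixes G G' :: "'a::euclidean_space => complex" and v :: 'a
  assumes G: "integrable lborel G"
    and der: "!!y s. \<bar>s\<bar> < 1 ==> ((%s. G (y + s *\<^sub>R v)) has_vector_derivative G' (y + s *\<^sub>R v)) (at s)"
    and bnd: "!!y s. \<bar>s\<bar> < 1 ==> cmod (G' (y + s *\<^sub>R v)) <= g y" and g: "integrable lborel g"
  shows "(\<integral>y. G' y \<partial>lborel) = 0" "integrable lborel G'"
proof -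
  have tr: "integrable lborel (%y. G (y + a))" "(\<integral>y. G (y + a) \<partial>lborel) = (\<integral>y. G y \<partial>lborel)" for a
  proof -
    have m: "(+) a \<in> measurable lborel borel" by simp
    have Gm: "G \<in> borel_measurable borel" using G borel_measurable_integrable by force
    show "integrable lborel (%y. G (y + a))"
      using G integrable_distr_eq[OF m Gm] unfolding lborel_distr_plus[of a] by (simp add: add.commute)
    show "(\<integral>y. G (y + a) \<partial>lborel) = (\<integral>y. G y \<partial>lborel)"
      using integral_distr[OF m Gm] unfolding lborel_distr_plus[of a] by (simp add: add.commute)
  qed
  have d: "((%s. \<integral>y. G (y + s *\<^sub>R v) \<partial>lborel) has_vector_derivative (\<integral>y. G' (y + 0 *\<^sub>R v) \<partial>lborel)) (at 0)"
    and i: "integrable lborel (%y. G' (y + 0 *\<^sub>R v))"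
    using has_vector_derivative_lborel_integral[of 1 0 lborel "%s y. G (y + s *\<^sub>R v)" "%s y. G' (y + s *\<^sub>R v)" g] der bnd g tr
    by auto
  show "integrable lborel G'" using i by simp
  have "((%s::real. \<integral>y. G y \<partial>lborel) has_vector_derivative 0) (at 0)" by simp
  with d show "(\<integral>y. G' y \<partial>lborel) = 0"
    unfolding tr by (simp add: vector_derivative_unique_at)
qed

lemma
  fixes h :: "real => real"
  assumes h: "integrable lborel h"
  shows integrable_lborel_prod_vec: "integrable lborel (%y :: real ^ 'n::finite. \<Prod>k\<in>UNIV. h (y $ k))"
    and integral_lborel_prod_vec: "(\<integral>y. (\<Prod>k\<in>UNIV. h ((y :: real ^ 'n) $ k)) \<partial>lborel) = (\<integral>x. h x \<partial>lborel) ^ CARD('n)"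
proof -
  interpret product_sigma_finite "%_ :: real ^ 'n. lborel :: real measure" by standard
  have bij: "bij_betw (%k. axis k 1) (UNIV :: 'n set) (Basis :: (real ^ 'n) set)"
    unfolding bij_betw_def Basis_vec_def by (auto simp: inj_on_def axis_eq_axis)
  have eq: "(\<Prod>k\<in>UNIV. h (y $ k)) = (\<Prod>b\<in>Basis. h (y \<bullet> b))" for y :: "real ^ 'n"
    using prod.reindex_bij_betw[OF bij, of "%b. h (y \<bullet> b)"] by (simp add: inner_axis)
  note L = lborel_eq[where 'a="real ^ 'n"]
  have m: "(%f. \<Sum>b\<in>Basis. f b *\<^sub>R b) \<in> measurable (\<Pi>\<^sub>M b\<in>(Basis :: (real ^ 'n) set). lborel) borel"
    by measurable
  have hm: "(%y :: real ^ 'n. \<Prod>b\<in>Basis. h (y \<bullet> b)) \<in> borel_measurable borel"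
    using h by (intro borel_measurable_prod measurable_compose[of "%y. y \<bullet> _" borel borel h]) (auto dest: borel_measurable_integrable)
  have comp: "(\<Prod>b\<in>Basis. h ((\<Sum>b\<in>Basis. f b *\<^sub>R b) \<bullet> b)) = (\<Prod>b\<in>Basis. h (f b))" for f :: "real ^ 'n => real"
    by (rule prod.cong[OF refl]) (simp only: inner_sum_left_Basis)
  show "integrable lborel (%y :: real ^ 'n. \<Prod>k\<in>UNIV. h (y $ k))"
    unfolding eq by (subst L, unfold integrable_distr_eq[OF m hm] comp, rule product_integrable_prod) (use h in auto)
  show "(\<integral>y. (\<Prod>k\<in>UNIV. h ((y :: real ^ 'n) $ k)) \<partial>lborel) = (\<integral>x. h x \<partial>lborel) ^ CARD('n)"
    unfolding eq by (subst L, unfold integral_distr[OF m hm] comp, subst product_integral_prod) (use h in auto)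
qed

lemma integrable_gaussian_real:
  assumes "0 < c"
  shows "integrable lborel (%x::real. exp (- c * x\<^sup>2))"
proof -
  have eq: "exp (- c * x\<^sup>2) = sqrt (pi / c) * normal_density 0 (sqrt (1 / (2 * c))) x" for x
    using assms by (simp add: normal_density_def real_sqrt_divide field_simps)
  show ?thesis
    unfolding eq using assms by (intro integrable_mult_right integrable_normal_density) simp
qed

lemma integral_gaussian_real: "(\<integral>x. exp (- x\<^sup>2 / 2) \<partial>lborel) = sqrt (2 * pi)"
proof -
  have eq: "exp (- x\<^sup>2 / 2) = sqrt (2 * pi) * std_normal_density x" for x
    by (simp add: std_normal_density_def)
  show ?thesis
    unfolding eq by (simp add: integral_normal_density)
qed

lemma gaussian_norm:
  assumes "0 < c"
  shows "integrable lborel (%y :: real ^ 'n::finite. exp (- c * (norm y)\<^sup>2))"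
    "(\<integral>y. exp (- (norm (y :: real ^ 'n))\<^sup>2 / 2) \<partial>lborel) = sqrt (2 * pi) ^ CARD('n)"
proof -
  have sq: "(norm y)\<^sup>2 = (\<Sum>k\<in>UNIV. (y $ k)\<^sup>2)" for y :: "real ^ 'n"
    by (simp add: norm_vec_def L2_set_def sum_nonneg)
  have eq: "exp (- c * (norm y)\<^sup>2) = (\<Prod>k\<in>UNIV. exp (- c * (y $ k)\<^sup>2))" for y :: "real ^ 'n" and c
    unfolding sq by (simp add: sum_distrib_left exp_sum)
  show "integrable lborel (%y :: real ^ 'n::finite. exp (- c * (norm y)\<^sup>2))"
    unfolding eq by (rule integrable_lborel_prod_vec[OF integrable_gaussian_real[OF assms]])
  have "(\<integral>y. exp (- (1/2) * (norm (y :: real ^ 'n))\<^sup>2) \<partial>lborel) = sqrt (2 * pi) ^ CARD('n)"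
    unfolding eq using integral_lborel_prod_vec[where 'n='n, OF integrable_gaussian_real[of "1/2"]] integral_gaussian_real by simp
  then show "(\<integral>y. exp (- (norm (y :: real ^ 'n))\<^sup>2 / 2) \<partial>lborel) = sqrt (2 * pi) ^ CARD('n)" by simp
qed

section \<open>Gaussian integrals\<close>

definition cvec :: "real ^ 'n => complex ^ 'n" where
  "cvec y = (\<chi> k. of_real (y $ k))"

lemma cvec_simps [simp]: "cvec y $ k = of_real (y $ k)" "cvec (x + y) = cvec x + cvec y"
  "cvec (s *\<^sub>R y) = of_real s *s cvec y" "cvec (axis k 1) = axis k 1" "norm (cvec y) = norm y"
  by (simp_all add: cvec_def vec_eq_iff axis_def norm_vec_def L2_set_def vector_scalar_mult_def)

lemma continuous_on_cvec [continuous_intros]: "continuous_on S f ==> continuous_on S (%x. cvec (f x))"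
  unfolding cvec_def by (intro continuous_intros continuous_on_vec_lambda)

lemma continuous_on_bilin [continuous_intros]:
  "continuous_on S u ==> continuous_on S v ==> continuous_on S (%x. bilin (u x) B (v x))"
  unfolding bilin_def by (intro continuous_intros)

definition gauss_exp :: "complex ^ 'n::finite ^ 'n => complex ^ 'n => real ^ 'n => complex" where
  "gauss_exp B b y = exp (- bilin (cvec y) B (cvec y) / 2 - (\<Sum>k\<in>UNIV. b $ k * of_real (y $ k)))"

lemma continuous_gauss_exp: "continuous_on S (gauss_exp B b)"
  unfolding gauss_exp_def by (intro continuous_intros) auto

text \<open>The polynomial is absorbed by \<open>(1 + u)^2 <= exp (2 u)\<close>, and the linear
  exponent by completing the square. A single dominating function thus serves for all moments up to
  order two.\<close>

lemma gauss_poly_bound: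
  fixes c \<beta> u :: real
  assumes "0 < c" "0 <= u"
  shows "(1 + u)\<^sup>2 * exp (- c * u\<^sup>2 / 2 + \<beta> * u) <= exp ((\<beta> + 2)\<^sup>2 / c) * exp (- c * u\<^sup>2 / 4)"
proof -
  have "(1 + u)\<^sup>2 <= (exp u)\<^sup>2" using assms by (intro power_mono exp_ge_add_one_self) auto
  then have "(1 + u)\<^sup>2 * exp (- c * u\<^sup>2 / 2 + \<beta> * u) <= (exp u)\<^sup>2 * exp (- c * u\<^sup>2 / 2 + \<beta> * u)"
    by (rule mult_right_mono) simp
  also have "\<dots> = exp (- c * u\<^sup>2 / 2 + (\<beta> + 2) * u)"
    by (simp add: exp_double[symmetric] exp_add[symmetric] algebra_simps)
  also have "\<dots> <= exp ((\<beta> + 2)\<^sup>2 / c + (- c * u\<^sup>2 / 4))"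
  proof (subst exp_le_cancel_iff)
    have "0 <= (c * u / 2 - (\<beta> + 2))\<^sup>2 / c" using assms by simp
    also have "\<dots> = c * u\<^sup>2 / 4 - (\<beta> + 2) * u + (\<beta> + 2)\<^sup>2 / c"
      using assms by (simp add: power2_diff field_simps power2_eq_square)
    finally show "- c * u\<^sup>2 / 2 + (\<beta> + 2) * u <= (\<beta> + 2)\<^sup>2 / c + (- c * u\<^sup>2 / 4)" by simp
  qed
  finally show ?thesis unfolding exp_add[of "(\<beta> + 2)\<^sup>2 / c"] .
qed

lemma gauss_dominated:
  fixes H :: "real ^ 'n::finite => complex"
  assumes c: "0 < c" and C: "0 <= C"
    and H: "!!y. cmod (H y) <= C * ((1 + norm y)\<^sup>2 * exp (- c * (norm y)\<^sup>2 / 2 + \<beta> * norm y))"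
  shows "cmod (H y) <= C * exp ((\<beta> + 2)\<^sup>2 / c) * exp (- (c / 4) * (norm y)\<^sup>2)"
    and "norm v <= 1 ==> \<bar>s\<bar> < 1 ==> cmod (H (y + s *\<^sub>R v)) <= C * exp ((\<beta> + 2)\<^sup>2 / c + c / 4) * exp (- (c / 8) * (norm y)\<^sup>2)"
    and "H \<in> borel_measurable borel ==> integrable lborel H"
proof -
  show 1: "cmod (H y) <= C * exp ((\<beta> + 2)\<^sup>2 / c) * exp (- (c / 4) * (norm y)\<^sup>2)" for y
  proof -
    have "C * ((1 + norm y)\<^sup>2 * exp (- c * (norm y)\<^sup>2 / 2 + \<beta> * norm y)) <= C * (exp ((\<beta> + 2)\<^sup>2 / c) * exp (- c * (norm y)\<^sup>2 / 4))"
      by (intro mult_left_mono gauss_poly_bound c C norm_ge_zero)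
    then show ?thesis using H[of y] by (simp add: mult.assoc)
  qed
  show "cmod (H (y + s *\<^sub>R v)) <= C * exp ((\<beta> + 2)\<^sup>2 / c + c / 4) * exp (- (c / 8) * (norm y)\<^sup>2)"
    if "norm v <= 1" "\<bar>s\<bar> < 1"
  proof -
    \<comment> \<open>A shift by less than a unit vector costs half of the quadratic exponent, by
      \<open>(u + 1)^2 <= 2 u^2 + 2\<close>. This makes the bound uniform in \<open>s\<close>, as
      differentiation under the integral requires.\<close>
    define u where "u = norm (y + s *\<^sub>R v)"
    have "norm y <= u + norm (s *\<^sub>R v)" unfolding u_def by (metis add_diff_cancel_right' norm_triangle_ineq4)
    also have "norm (s *\<^sub>R v) <= 1" using that by (simp add: mult_le_one)
    finally have "(norm y)\<^sup>2 <= (u + 1)\<^sup>2" by (intro power_mono) auto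
    also have "\<dots> <= 2 * u\<^sup>2 + 2"
      using zero_le_power2[of "u - 1"] by (simp add: power2_eq_square algebra_simps)
    finally have "- (c / 4) * u\<^sup>2 <= c / 4 + (- (c / 8) * (norm y)\<^sup>2)"
      using c mult_left_mono[of "(norm y)\<^sup>2" "2 * u\<^sup>2 + 2" "c / 8"] by (simp add: algebra_simps)
    then have "exp (- (c / 4) * u\<^sup>2) <= exp (c / 4) * exp (- (c / 8) * (norm y)\<^sup>2)"
      by (simp only: exp_add[symmetric] exp_le_cancel_iff)
    from mult_left_mono[OF this, of "C * exp ((\<beta> + 2)\<^sup>2 / c)"] C
    have "C * exp ((\<beta> + 2)\<^sup>2 / c) * exp (- (c / 4) * u\<^sup>2) <= C * exp ((\<beta> + 2)\<^sup>2 / c + c / 4) * exp (- (c / 8) * (norm y)\<^sup>2)"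
      by (simp add: exp_add mult.assoc)
    then show ?thesis using 1[of "y + s *\<^sub>R v"] unfolding u_def by linarith
  qed
  show "integrable lborel H" if "H \<in> borel_measurable borel"
  proof (rule Bochner_Integration.integrable_bound)
    show "integrable lborel (%y::real^'n. C * exp ((\<beta> + 2)\<^sup>2 / c) * exp (- (c / 4) * (norm y)\<^sup>2))"
      using c by (intro integrable_mult_right gaussian_norm) auto
    show "AE y in lborel. norm (H y) <= norm (C * exp ((\<beta> + 2)\<^sup>2 / c) * exp (- (c / 4) * (norm y)\<^sup>2))"
      using 1 C by simp
  qed (use that in simp)
qed

lemma gauss_exp_bound:
  assumes B: "!!y. c * (norm y)\<^sup>2 <= Re (bilin (cvec y) B (cvec y))"
    and b: "(\<Sum>k\<in>UNIV. cmod (b $ k)) <= \<beta>"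
  shows "cmod (gauss_exp B b y) <= exp (- c * (norm y)\<^sup>2 / 2 + \<beta> * norm y)"
proof -
  have "- Re (\<Sum>k\<in>UNIV. b $ k * of_real (y $ k)) <= cmod (\<Sum>k\<in>UNIV. b $ k * of_real (y $ k))"
    by (metis abs_Re_le_cmod abs_le_D2)
  also have "\<dots> <= (\<Sum>k\<in>UNIV. cmod (b $ k) * norm y)"
    by (intro order_trans[OF norm_sum] sum_mono)
      (use component_le_norm_cart[of y] in \<open>auto simp: norm_mult intro!: mult_left_mono\<close>)
  also have "\<dots> <= \<beta> * norm y" using b by (simp add: sum_distrib_right[symmetric] mult_right_mono)
  finally show ?thesis using B[of y] by (simp add: gauss_exp_def)
qed

lemma gauss_exp_derivative:
  assumes sym: "transpose B = B"
  shows "((%s. gauss_exp B b (y + s *\<^sub>R axis k 1)) has_vector_derivative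
     - ((B *v cvec (y + s *\<^sub>R axis k 1)) $ k + b $ k) * gauss_exp B b (y + s *\<^sub>R axis k 1)) (at s)"
proof -
  define q0 where "q0 = bilin (cvec y) B (cvec y)"
  define q1 where "q1 = bilin (axis k 1) B (cvec y)"
  define q2 where "q2 = bilin (axis k 1) B (axis k 1)"
  define l where "l = (\<Sum>k\<in>UNIV. b $ k * of_real (y $ k))"
  have q1': "bilin (cvec y) B (axis k 1) = q1" using bilin_transpose[of "cvec y" B] sym by (simp add: q1_def)
  have ax: "bilin (axis k 1) B v = (B *v v) $ k" for v
    unfolding bilin_eq_sum by (simp add: axis_def if_distrib[of "%x. x * _"] cong: if_cong)
  have quad: "bilin (cvec (y + s *\<^sub>R axis k 1)) B (cvec (y + s *\<^sub>R axis k 1)) = q0 + 2 * of_real s * q1 + (of_real s)\<^sup>2 * q2" for s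
    by (simp add: bilin_add_left bilin_add_right bilin_scale_left bilin_scale_right q0_def[symmetric] q1_def[symmetric] q1' q2_def[symmetric] power2_eq_square algebra_simps)
  have lin: "(\<Sum>j\<in>UNIV. b $ j * of_real ((y + s *\<^sub>R axis k 1) $ j)) = l + of_real s * b $ k" for s
  proof -
    have "(\<Sum>j\<in>UNIV. b $ j * of_real ((y + s *\<^sub>R axis k 1) $ j)) = (\<Sum>j\<in>UNIV. b $ j * of_real (y $ j) + (if j = k then of_real s * b $ j else 0))"
      by (rule sum.cong) (auto simp: axis_def algebra_simps)
    then show ?thesis by (simp add: sum.distrib l_def)
  qed
  have der: "(B *v cvec (y + s *\<^sub>R axis k 1)) $ k = q1 + of_real s * q2" for s
    unfolding ax[symmetric] by (simp add: bilin_add_right bilin_scale_right q1_def q2_def)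
  have d: "((%z. - (q0 + 2 * z * q1 + z\<^sup>2 * q2) / 2 - (l + z * b $ k)) has_field_derivative
      - ((q1 + of_real s * q2) + b $ k)) (at (of_real s))"
    by (auto intro!: derivative_eq_intros simp: field_simps)
  have "((%z. exp (- (q0 + 2 * z * q1 + z\<^sup>2 * q2) / 2 - (l + z * b $ k))) has_field_derivative
      - ((q1 + of_real s * q2) + b $ k) * exp (- (q0 + 2 * of_real s * q1 + (of_real s)\<^sup>2 * q2) / 2 - (l + of_real s * b $ k))) (at (of_real s))"
    using DERIV_fun_exp[OF d] by (simp only: mult.commute)
  from has_vector_derivative_real_field[OF this]
  show ?thesis unfolding gauss_exp_def quad lin der .
qed

text \<open>The last two claims are integrations by parts: the derivatives along
  \<open>axis k\<close> of \<open>gauss_exp B b\<close> and of \<open>y $ j\<close> times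
  \<open>gauss_exp B 0\<close> have integral zero. The first identity governs the dependence on
  \<open>b\<close>, the second gives the covariances.\<close>

lemma gauss_exp_parts:
  fixes B :: "complex ^ 'n::finite ^ 'n"
  assumes sym: "transpose B = B" and c: "0 < c" and B: "!!y. c * (norm y)\<^sup>2 <= Re (bilin (cvec y) B (cvec y))"
  shows "integrable lborel (gauss_exp B b)"
    and "integrable lborel (%y. of_real (y $ j) * gauss_exp B b y)"
    and "integrable lborel (%y. of_real (y $ j) * of_real (y $ k) * gauss_exp B b y)"
    and "(\<integral>y. (B *v cvec y) $ k * gauss_exp B b y \<partial>lborel) = - b $ k * (\<integral>y. gauss_exp B b y \<partial>lborel)"
    and "(\<integral>y. of_real (y $ j) * (B *v cvec y) $ k * gauss_exp B 0 y \<partial>lborel) = (if j = k then 1 else 0) * (\<integral>y. gauss_exp B 0 y \<partial>lborel)"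
proof -
  define \<beta> where "\<beta> = (%b :: complex ^ 'n. \<Sum>k\<in>UNIV. cmod (b $ k))"
  note bnd = gauss_exp_bound[OF B order_refl]
  have poly: "cmod (P y * gauss_exp B b y) <= C * ((1 + norm y)\<^sup>2 * exp (- c * (norm y)\<^sup>2 / 2 + \<beta> b * norm y))"
    if "cmod (P y) <= C * (1 + norm y)\<^sup>2" for P y C and b :: "complex ^ 'n"
    using mult_mono[OF that bnd[of b y]] by (simp add: norm_mult \<beta>_def mult.assoc order_trans[OF norm_ge_zero that])
  have int: "integrable lborel (%y. P y * gauss_exp B b y)"
    if "!!y. cmod (P y) <= C * (1 + norm y)\<^sup>2" "0 <= C" "P \<in> borel_measurable borel" for P C and b :: "complex ^ 'n"
    by (rule gauss_dominated(3)[where H="%y. P y * gauss_exp B b y", OF c that(2) poly[of P _ C, OF that(1)]])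
      (use that(3) borel_measurable_continuous_onI[OF continuous_gauss_exp[of UNIV B b]] in simp)
  have n1: "\<bar>y $ j\<bar> <= 1 + norm y" for y :: "real ^ 'n" and j
    using component_le_norm_cart[of y j] by simp
  have n0: "1 <= (1 + norm y)\<^sup>2" "1 + norm y <= (1 + norm y)\<^sup>2" for y :: "real ^ 'n"
    by (simp_all add: power2_eq_square mult_left_mono mult_le_cancel_right1 algebra_simps)
  have n2: "\<bar>y $ j\<bar> <= (1 + norm y)\<^sup>2" "\<bar>y $ j\<bar> * \<bar>y $ k\<bar> <= (1 + norm y)\<^sup>2" for y :: "real ^ 'n" and j k
    using n1[of y j] n0(2)[of y] mult_mono[OF n1[of y j] n1[of y k]] by (simp_all add: power2_eq_square)
  show i0: "integrable lborel (gauss_exp B b)" for b using int[of "%_. 1" 1 b] n0 by simp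
  show i1: "integrable lborel (%y. of_real (y $ j) * gauss_exp B b y)" for j b
    by (rule int[of _ 1]) (use n2 in auto)
  show i2: "integrable lborel (%y. of_real (y $ j) * of_real (y $ k) * gauss_exp B b y)" for j k b
    by (rule int[of _ 1]) (use n2 in \<open>auto simp: norm_mult\<close>)
  define C1 where "C1 = (\<Sum>k\<in>UNIV. \<Sum>j\<in>UNIV. cmod (B $ k $ j))"
  have C1: "0 <= C1" unfolding C1_def by (intro sum_nonneg) simp
  have Bk: "cmod ((B *v cvec y) $ k) <= C1 * norm y" for y k
  proof -
    have "(B *v cvec y) $ k = bilin (axis k 1) B (cvec y)"
      unfolding bilin_eq_sum by (simp add: axis_def if_distrib[of "%x. x * _"] cong: if_cong)
    then show ?thesis using bilin_bound[of "axis k 1" B "cvec y"] by (simp add: C1_def)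
  qed
  have axn: "norm (axis k (1::real) :: real ^ 'n) <= 1" for k by simp
  have mB: "(%y. (B *v cvec y) $ k) \<in> borel_measurable borel" for k
    unfolding matrix_vector_mult_def by (intro borel_measurable_continuous_onI) (auto intro!: continuous_intros)
  have dom_int: "integrable lborel (%y :: real ^ 'n. K * exp (- (c / 8) * (norm y)\<^sup>2))" for K
    using c by (intro integrable_mult_right gaussian_norm) auto
  show "(\<integral>y. (B *v cvec y) $ k * gauss_exp B b y \<partial>lborel) = - b $ k * (\<integral>y. gauss_exp B b y \<partial>lborel)" for k b
  proof -
    \<comment> \<open>The factor by which differentiation along \<open>axis k\<close> multiplies
      \<open>gauss_exp\<close>.\<close>
    define P where "P = (%y. - ((B *v cvec y) $ k + b $ k))"
    have P: "cmod (P y) <= (C1 + cmod (b $ k)) * (1 + norm y)\<^sup>2" for y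
    proof -
      have "cmod (P y) <= C1 * norm y + cmod (b $ k) * 1"
        unfolding P_def norm_minus_cancel using norm_triangle_ineq[of "(B *v cvec y) $ k" "b $ k"] Bk[where y=y and k=k] by simp
      also have "\<dots> <= C1 * (1 + norm y)\<^sup>2 + cmod (b $ k) * (1 + norm y)\<^sup>2"
        using C1 n0[of y] by (intro add_mono mult_left_mono) auto
      finally show ?thesis by (simp add: algebra_simps)
    qed
    have C: "0 <= C1 + cmod (b $ k)" using C1 by simp
    have 0: "(\<integral>y. P y * gauss_exp B b y \<partial>lborel) = 0"
      using integral_directional_derivative_zero(1)[OF i0[of b] _ _ dom_int, of "axis k 1" "%y. P y * gauss_exp B b y"]
        gauss_exp_derivative[OF sym] gauss_dominated(2)[where H="%y. P y * gauss_exp B b y", OF c C poly[of P, OF P] axn] unfolding P_def by blast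
    have iB: "integrable lborel (%y. (B *v cvec y) $ k * gauss_exp B b y)"
    proof (rule int[OF _ C1 mB])
      fix y
      have "cmod ((B *v cvec y) $ k) <= C1 * norm y" by (rule Bk)
      also have "\<dots> <= C1 * (1 + norm y)\<^sup>2" using C1 n0[of y] by (intro mult_left_mono) auto
      finally show "cmod ((B *v cvec y) $ k) <= C1 * (1 + norm y)\<^sup>2" .
    qed
    have "(\<integral>y. P y * gauss_exp B b y \<partial>lborel) = (\<integral>y. - ((B *v cvec y) $ k * gauss_exp B b y) + (- b $ k) * gauss_exp B b y \<partial>lborel)"
      by (simp add: P_def algebra_simps)
    also have "\<dots> = - (\<integral>y. (B *v cvec y) $ k * gauss_exp B b y \<partial>lborel) + (- b $ k) * (\<integral>y. gauss_exp B b y \<partial>lborel)"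
      by (subst Bochner_Integration.integral_add) (use iB i0[of b] in auto)
    finally show ?thesis using 0 by (simp add: algebra_simps)
  qed
  show "(\<integral>y. of_real (y $ j) * (B *v cvec y) $ k * gauss_exp B 0 y \<partial>lborel) = (if j = k then 1 else 0) * (\<integral>y. gauss_exp B 0 y \<partial>lborel)"
  proof -
    define \<delta> where "\<delta> = (if j = k then 1 else 0 :: complex)"
    \<comment> \<open>The same factor for \<open>y $ j\<close> times the Gaussian: the product rule
      adds the Kronecker delta.\<close>
    define P where "P = (%y. \<delta> - of_real (y $ j) * (B *v cvec y) $ k)"
    have yB: "cmod (of_real (y $ j) * (B *v cvec y) $ k) <= C1 * (1 + norm y)\<^sup>2" for y
    proof -
      have "cmod (of_real (y $ j) * (B *v cvec y) $ k) <= (1 + norm y) * (C1 * (1 + norm y))"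
        unfolding norm_mult using n1[of y j] Bk[where y=y and k=k] C1
        by (intro mult_mono) (auto intro: order_trans simp: algebra_simps)
      then show ?thesis by (simp add: power2_eq_square mult_ac)
    qed
    have P: "cmod (P y) <= (1 + C1) * (1 + norm y)\<^sup>2" for y
    proof -
      have "cmod (P y) <= cmod \<delta> + C1 * (1 + norm y)\<^sup>2"
        unfolding P_def using norm_triangle_ineq4[of \<delta> "of_real (y $ j) * (B *v cvec y) $ k"] yB[of y] by linarith
      also have "cmod \<delta> <= (1 + norm y)\<^sup>2" using n0(1)[of y] by (auto simp: \<delta>_def intro: order_trans[of 0 1])
      finally show ?thesis by (simp add: algebra_simps)
    qed
    have C: "0 <= 1 + C1" using C1 by simp
    have der: "((%s. of_real ((y + s *\<^sub>R axis k 1) $ j) * gauss_exp B 0 (y + s *\<^sub>R axis k 1)) has_vector_derivative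
        P (y + s *\<^sub>R axis k 1) * gauss_exp B 0 (y + s *\<^sub>R axis k 1)) (at s)" for y s
    proof -
      have 1: "((%s. complex_of_real ((y + s *\<^sub>R axis k 1) $ j)) has_vector_derivative \<delta>) (at s)"
      proof -
        have "((%z. of_real (y $ j) + z * \<delta>) has_field_derivative \<delta>) (at (of_real s))"
          by (auto intro!: derivative_eq_intros)
        from has_vector_derivative_real_field[OF this]
        have "((%s. of_real (y $ j) + of_real s * \<delta>) has_vector_derivative \<delta>) (at s)" .
        moreover have "complex_of_real ((y + s *\<^sub>R axis k 1) $ j) = of_real (y $ j) + of_real s * \<delta>" for s
          by (simp add: \<delta>_def axis_def)
        ultimately show ?thesis by (simp only:)
      qed
      show ?thesis
        by (rule has_vector_derivative_eq_rhs[OF has_vector_derivative_mult[OF 1 gauss_exp_derivative[OF sym]]])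
           (simp add: P_def algebra_simps)
    qed
    have 0: "(\<integral>y. P y * gauss_exp B 0 y \<partial>lborel) = 0"
      using integral_directional_derivative_zero(1)[OF i1[of j 0] _ _ dom_int, of "axis k 1" "%y. P y * gauss_exp B 0 y"]
        der gauss_dominated(2)[where H="%y. P y * gauss_exp B 0 y", OF c C poly[of P, OF P] axn] by blast
    have iB: "integrable lborel (%y. of_real (y $ j) * (B *v cvec y) $ k * gauss_exp B 0 y)"
      by (rule int[OF yB C1]) (use mB in simp)
    have "(\<integral>y. P y * gauss_exp B 0 y \<partial>lborel) = (\<integral>y. \<delta> * gauss_exp B 0 y - of_real (y $ j) * (B *v cvec y) $ k * gauss_exp B 0 y \<partial>lborel)"
      by (simp add: P_def algebra_simps)
    also have "\<dots> = \<delta> * (\<integral>y. gauss_exp B 0 y \<partial>lborel) - (\<integral>y. of_real (y $ j) * (B *v cvec y) $ k * gauss_exp B 0 y \<partial>lborel)"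
      by (subst Bochner_Integration.integral_diff) (use iB i0[of 0] in auto)
    finally show ?thesis using 0 by (simp add: \<delta>_def)
  qed
qed


text \<open>Write a kernel vector as \<open>x + \<i> y\<close> and pair it with \<open>x\<close> and
  with \<open>y\<close>. By symmetry the two mixed terms agree and cancel, so the values of the form
  at \<open>x\<close> and \<open>y\<close> add up to 0, although both have real part at least
  \<open>c\<close> times a squared norm.\<close>

lemma det_nonzero_if_Re_pos:
  fixes B :: "complex ^ 'n::finite ^ 'n"
  assumes sym: "transpose B = B" and c: "0 < c" and B: "!!y. c * (norm y)\<^sup>2 <= Re (bilin (cvec y) B (cvec y))"
  shows "det B ~= 0"
proof -
  have "v = 0" if v: "B *v v = 0" for v
  proof -
    define x where "x = (\<chi> k. Re (v $ k))"
    define y where "y = (\<chi> k. Im (v $ k))"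
    have vxy: "v = cvec x + \<i> *s cvec y"
      by (simp add: vec_eq_iff x_def y_def complex_eq_iff)
    have 0: "bilin u B v = 0" for u by (simp add: bilin_eq_sum v)
    define m where "m = bilin (cvec x) B (cvec y)"
    have m': "bilin (cvec y) B (cvec x) = m" using bilin_transpose[of "cvec y" B] sym by (simp add: m_def)
    have "bilin (cvec x) B (cvec x) + \<i> * m = 0" "m + \<i> * bilin (cvec y) B (cvec y) = 0"
      using 0[of "cvec x"] 0[of "cvec y"] unfolding vxy by (simp_all add: bilin_add_right bilin_scale_right m_def[symmetric] m')
    then have "bilin (cvec x) B (cvec x) + bilin (cvec y) B (cvec y) = 0"
      by (simp add: complex_eq_iff)
    then have "Re (bilin (cvec x) B (cvec x)) + Re (bilin (cvec y) B (cvec y)) = 0"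
      by (metis plus_complex.sel(1) zero_complex.sel(1))
    then have "c * ((norm x)\<^sup>2 + (norm y)\<^sup>2) <= 0" using B[of x] B[of y] by (simp add: distrib_left)
    then have "(norm x)\<^sup>2 + (norm y)\<^sup>2 <= 0" using c by (simp add: mult_le_0_iff)
    then have "x = 0" "y = 0" by (simp_all add: sum_power2_le_zero_iff)
    then show "v = 0" unfolding vxy by (simp add: vec_eq_iff)
  qed
  then show ?thesis
    using invertible_det_nz[of B] matrix_left_invertible_ker[of B] invertible_left_inverse[of B] by blast
qed

text \<open>Instead of completing the square by a complex translation, \<open>b\<close> is scaled by
  a real \<open>s\<close>. Integration by parts gives \<open>Z' s = s \<beta> Z s\<close> with
  \<open>\<beta> = bilin b (matrix_inv B) b\<close>, hence
  \<open>Z s = exp (s^2 \<beta> / 2) Z 0\<close>.\<close>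

lemma gauss_shift:
  fixes B :: "complex ^ 'n::finite ^ 'n"
  assumes sym: "transpose B = B" and c: "0 < c" and B: "!!y. c * (norm y)\<^sup>2 <= Re (bilin (cvec y) B (cvec y))"
  shows "(\<integral>y. gauss_exp B b y \<partial>lborel) = exp (bilin b (matrix_inv B) b / 2) * (\<integral>y. gauss_exp B 0 y \<partial>lborel)"
proof -
  define N where "N = matrix_inv B"
  have NB: "N ** B = mat 1" using matrix_inv_left_right[OF det_nonzero_if_Re_pos[OF assms]] by (simp add: N_def)
  define \<beta> where "\<beta> = bilin b N b"
  define Z where "Z = (%s::real. \<integral>y. gauss_exp B (of_real s *s b) y \<partial>lborel)"
  define L where "L = (%y. \<Sum>k\<in>UNIV. b $ k * complex_of_real (y $ k))"
  have ge: "gauss_exp B (of_real s *s b) y = exp (- bilin (cvec y) B (cvec y) / 2 - of_real s * L y)" for s y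
    by (simp add: gauss_exp_def L_def sum_distrib_left mult.assoc)
  have L_int: "integrable lborel (%y. L y * gauss_exp B b' y)" for b'
    unfolding L_def sum_distrib_right mult.assoc
    by (intro Bochner_Integration.integrable_sum integrable_mult_right gauss_exp_parts(2)[OF assms])
  have L_eq: "(\<integral>y. L y * gauss_exp B (of_real s *s b) y \<partial>lborel) = - of_real s * \<beta> * Z s" for s
  proof -
    \<comment> \<open>The row vector \<open>b N\<close>. It rewrites the linear form
      \<open>L\<close> in the components of \<open>B *v cvec y\<close>, for which the integration by
      parts identity is available.\<close>
    define w where "w = (\<chi> k. \<Sum>l\<in>UNIV. b $ l * N $ l $ k)"
    have LB: "L y = (\<Sum>k\<in>UNIV. w $ k * (B *v cvec y) $ k)" for y
    proof -
      have "L y = bilin b (mat 1) (cvec y)"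
        by (simp add: bilin_eq_sum L_def)
      also have "\<dots> = bilin b N (B *v cvec y)"
        unfolding NB[symmetric] by (simp add: bilin_eq_sum matrix_vector_mul_assoc)
      also have "\<dots> = (\<Sum>k\<in>UNIV. w $ k * (B *v cvec y) $ k)"
        unfolding bilin_def by (subst sum.swap) (simp add: w_def sum_distrib_right)
      finally show ?thesis .
    qed
    have iB: "integrable lborel (%y. (B *v cvec y) $ k * gauss_exp B b' y)" for k b'
      unfolding matrix_vector_mult_def vec_lambda_beta sum_distrib_right cvec_simps mult.assoc
      by (intro Bochner_Integration.integrable_sum integrable_mult_right gauss_exp_parts(2)[OF assms])
    have "(\<integral>y. L y * gauss_exp B (of_real s *s b) y \<partial>lborel) = (\<Sum>k\<in>UNIV. w $ k * (\<integral>y. (B *v cvec y) $ k * gauss_exp B (of_real s *s b) y \<partial>lborel))"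
      unfolding LB sum_distrib_right mult.assoc
      by (subst Bochner_Integration.integral_sum) (auto intro: iB integrable_mult_right)
    also have "\<dots> = (\<Sum>k\<in>UNIV. w $ k * (- of_real s * b $ k * Z s))"
      unfolding gauss_exp_parts(4)[OF assms] Z_def by simp
    also have "\<dots> = - of_real s * (\<Sum>k\<in>UNIV. w $ k * b $ k) * Z s"
      by (simp add: sum_distrib_left sum_distrib_right sum_negf mult_ac)
    also have "(\<Sum>k\<in>UNIV. w $ k * b $ k) = \<beta>"
      unfolding \<beta>_def bilin_def by (subst sum.swap) (simp add: w_def sum_distrib_right)
    finally show ?thesis .
  qed
  have dZ: "(Z has_vector_derivative of_real s * \<beta> * Z s) (at s)" for s
  proof -
    define bb where "bb = (\<Sum>k\<in>UNIV. cmod (b $ k))"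
    have bb: "0 <= bb" unfolding bb_def by (intro sum_nonneg) simp
    \<comment> \<open>A coefficient of the linear exponent that is valid for all parameters within
      distance 1 of \<open>s\<close>.\<close>
    define \<beta>' where "\<beta>' = (\<bar>s\<bar> + 1) * bb"
    have Lb: "cmod (L y) <= bb * norm y" for y
      unfolding L_def bb_def sum_distrib_right
      by (intro order_trans[OF norm_sum] sum_mono)
        (use component_le_norm_cart[of y] in \<open>auto simp: norm_mult intro!: mult_left_mono\<close>)
    have ub: "cmod (- L y * gauss_exp B (of_real t *s b) y) <= bb * exp ((\<beta>' + 2)\<^sup>2 / c) * exp (- (c / 4) * (norm y)\<^sup>2)"
      if "\<bar>t - s\<bar> < 1" for t y
    proof (rule gauss_dominated(1)[OF c bb])
      fix y
      have "(\<Sum>k\<in>UNIV. cmod ((of_real t *s b) $ k)) = \<bar>t\<bar> * bb"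
        by (simp add: bb_def sum_distrib_left norm_mult)
      also have "\<dots> <= \<beta>'" unfolding \<beta>'_def using that bb by (intro mult_right_mono) auto
      finally have 1: "cmod (gauss_exp B (of_real t *s b) y) <= exp (- c * (norm y)\<^sup>2 / 2 + \<beta>' * norm y)"
        by (rule gauss_exp_bound[OF B])
      have "norm y <= (1 + norm y)\<^sup>2" by (simp add: power2_eq_square algebra_simps)
      then have 2: "cmod (L y) <= bb * (1 + norm y)\<^sup>2"
        using Lb[of y] mult_left_mono[OF _ bb] by (meson order_trans)
      show "cmod (- L y * gauss_exp B (of_real t *s b) y) <= bb * ((1 + norm y)\<^sup>2 * exp (- c * (norm y)\<^sup>2 / 2 + \<beta>' * norm y))"
        using mult_mono[OF 2 1] bb by (simp add: norm_mult mult.assoc)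
    qed
    have "((%s. \<integral>y. gauss_exp B (of_real s *s b) y \<partial>lborel) has_vector_derivative (\<integral>y. - L y * gauss_exp B (of_real s *s b) y \<partial>lborel)) (at s)"
    proof (rule has_vector_derivative_lborel_integral(1)[OF zero_less_one _ ub])
      show "((%s. gauss_exp B (of_real s *s b) y) has_vector_derivative - L y * gauss_exp B (of_real t *s b) y) (at t)" for t y
      proof -
        have d: "((%z. - bilin (cvec y) B (cvec y) / 2 - z * L y) has_field_derivative - L y) (at (of_real t))"
          by (auto intro!: derivative_eq_intros)
        have "((%z. exp (- bilin (cvec y) B (cvec y) / 2 - z * L y)) has_field_derivative - L y * exp (- bilin (cvec y) B (cvec y) / 2 - of_real t * L y)) (at (of_real t))"
          using DERIV_fun_exp[OF d] by (simp only: mult.commute)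
        from has_vector_derivative_real_field[OF this] show ?thesis unfolding ge .
      qed
      show "integrable lborel (%y :: real ^ 'n. bb * exp ((\<beta>' + 2)\<^sup>2 / c) * exp (- (c / 4) * (norm y)\<^sup>2))"
        using c by (intro integrable_mult_right gaussian_norm) auto
    qed (use gauss_exp_parts(1)[OF assms] in auto)
    moreover have "(\<integral>y. - L y * gauss_exp B (of_real s *s b) y \<partial>lborel) = of_real s * \<beta> * Z s"
      using L_eq[of s] by simp
    ultimately show ?thesis unfolding Z_def by simp
  qed
  have "((%s. Z s * exp (- (of_real s)\<^sup>2 * \<beta> / 2)) has_derivative (%h. 0)) (at s within UNIV)" for s
  proof -
    have d: "((%z. - z\<^sup>2 * \<beta> / 2) has_field_derivative - of_real s * \<beta>) (at (complex_of_real s))"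
      by (auto intro!: derivative_eq_intros)
    have "((%z. exp (- z\<^sup>2 * \<beta> / 2)) has_field_derivative - of_real s * \<beta> * exp (- (of_real s)\<^sup>2 * \<beta> / 2)) (at (of_real s))"
      using DERIV_fun_exp[OF d] by (simp only: mult.commute)
    from has_vector_derivative_mult[OF dZ has_vector_derivative_real_field[OF this]]
    have "((%s. Z s * exp (- (of_real s)\<^sup>2 * \<beta> / 2)) has_vector_derivative 0) (at s)"
      by (rule has_vector_derivative_eq_rhs) (simp add: algebra_simps)
    then show ?thesis by (simp add: has_vector_derivative_def)
  qed
  from has_derivative_zero_unique[OF convex_UNIV this, of 0 1]
  have "Z 1 * exp (- \<beta> / 2) = Z 0" by simp
  then have "Z 1 = exp (\<beta> / 2) * Z 0"
    by (metis (no_types, lifting) exp_minus_inverse minus_divide_left mult.commute mult.left_commute mult.right_neutral)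
  then show ?thesis by (simp add: Z_def \<beta>_def N_def)
qed

text \<open>Connect \<open>B\<close> with the identity by \<open>P s = 1 + s E\<close>. Since
  \<open>Z' = - tr (P^-1 E) Z / 2\<close> and \<open>det' = tr (P^-1 E) det\<close>, the product
  \<open>Z^2 det P\<close> is constant, and at \<open>s = 0\<close> it is a product of real
  Gaussians. Squaring avoids a choice of branch.\<close>

lemma gauss_square:
  fixes B :: "complex ^ 'n::finite ^ 'n"
  assumes sym: "transpose B = B" and c: "0 < c" and B: "!!y. c * (norm y)\<^sup>2 <= Re (bilin (cvec y) B (cvec y))"
  shows "(\<integral>y. gauss_exp B 0 y \<partial>lborel)\<^sup>2 * det B = (2 * pi) ^ CARD('n)"
proof -
  define E where "E = B - mat 1"
  define K where "K = (\<Sum>k\<in>UNIV. \<Sum>j\<in>UNIV. cmod (E $ k $ j))"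
  define c' where "c' = min 1 c"
  define K1 where "K1 = K + 1"
  \<comment> \<open>The derivatives at 0 and 1 are two-sided, so positivity is needed a little
    beyond the unit interval. There the form changes by at most \<open>\<eta> K\<close>, half of the
    lower bound \<open>c'\<close> that holds on the interval itself; \<open>c' <= 1\<close> makes
    \<open>c'\<close> a lower bound at the identity as well.\<close>
  define \<eta> where "\<eta> = c' / (2 * K1)"
  have K: "0 <= K" unfolding K_def by (intro sum_nonneg) simp
  have c': "0 < c'" "c' <= 1" "c' <= c" using c by (auto simp: c'_def)
  have \<eta>: "0 < \<eta>" "\<eta> * K <= c' / 2" 
  proof -
    have K1: "0 < K1" using K by (simp add: K1_def)
    then show "0 < \<eta>" using c' by (simp add: \<eta>_def)
    then have "\<eta> * K <= \<eta> * K1" by (simp add: K1_def)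
    also have "\<dots> = c' / 2" using K1 by (simp add: \<eta>_def)
    finally show "\<eta> * K <= c' / 2" .
  qed
  define P where "P = (%s::real. pert E (of_real s))"
  define Z where "Z = (%s. \<integral>y. gauss_exp (P s) 0 y \<partial>lborel)"
  have Ent: "P s $ k $ j = (if k = j then 1 else 0) + of_real s * (B $ k $ j - (if k = j then 1 else 0))" for s k j
    by (simp add: P_def pert_def E_def mat_def)
  have bP: "bilin u (P s) u = bilin u (mat 1) u + of_real s * bilin u E u" for u s
    unfolding bilin_eq_sum P_def pert_mult_vec
    by (simp add: distrib_left sum.distrib sum_distrib_left mult.left_commute)
  have b1: "Re (bilin (cvec y) (mat 1) (cvec y)) = (norm y)\<^sup>2" for y
    unfolding bilin_eq_sum by (simp add: norm_vec_def L2_set_def sum_nonneg power2_eq_square)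
  have bE: "\<bar>Re (bilin (cvec y) E (cvec y))\<bar> <= K * (norm y)\<^sup>2" for y
    using order_trans[OF abs_Re_le_cmod bilin_bound[of "cvec y" E "cvec y"]] by (simp add: K_def power2_eq_square mult.assoc)
  have bE': "Re (bilin (cvec y) E (cvec y)) \<ge> (c' - 1) * (norm y)\<^sup>2" for y
  proof -
    have "bilin (cvec y) B (cvec y) = bilin (cvec y) (mat 1) (cvec y) + bilin (cvec y) E (cvec y)"
      by (simp add: E_def bilin_eq_sum matrix_vector_mult_diff_rdistrib sum.distrib[symmetric] algebra_simps)
    moreover have "c' * (norm y)\<^sup>2 <= c * (norm y)\<^sup>2" using c' by (intro mult_right_mono) auto
    ultimately show ?thesis using B[of y] b1[of y] by (simp add: algebra_simps)
  qed
  have Ppos: "c' / 2 * (norm y)\<^sup>2 <= Re (bilin (cvec y) (P s) (cvec y))" if "- \<eta> < s" "s < 1 + \<eta>" for s y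
  proof -
    define s' where "s' = max 0 (min 1 s)"
    have s': "0 <= s'" "s' <= 1" "\<bar>s - s'\<bar> <= \<eta>" using that \<eta> by (auto simp: s'_def)
    define e where "e = Re (bilin (cvec y) E (cvec y))"
    have "\<bar>(s - s') * e\<bar> <= \<eta> * (K * (norm y)\<^sup>2)"
      unfolding abs_mult e_def using s' \<eta> bE by (intro mult_mono) auto
    also have "\<dots> <= c' / 2 * (norm y)\<^sup>2" using mult_right_mono[OF \<eta>(2), of "(norm y)\<^sup>2"] by (simp add: mult_ac)
    finally have 1: "- (c' / 2 * (norm y)\<^sup>2) <= (s - s') * e" by linarith
    have "s' * ((c' - 1) * (norm y)\<^sup>2) <= s' * e" unfolding e_def using s' bE' by (intro mult_left_mono) auto
    moreover have "s' * ((1 - c') * (norm y)\<^sup>2) <= 1 * ((1 - c') * (norm y)\<^sup>2)" using s' c' by (intro mult_right_mono) auto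
    ultimately have 2: "c' * (norm y)\<^sup>2 <= (norm y)\<^sup>2 + s' * e" by (simp add: algebra_simps)
    have "Re (bilin (cvec y) (P s) (cvec y)) = (norm y)\<^sup>2 + s' * e + (s - s') * e"
      by (simp add: bP b1 e_def algebra_simps)
    with 1 2 show ?thesis by (simp add: algebra_simps)
  qed
  have Psym: "transpose (P s) = P s" for s
  proof -
    have "B $ j $ k = B $ k $ j" for j k using arg_cong[OF sym, of "%A. A $ k $ j"] by (simp add: transpose_def)
    then show ?thesis by (simp add: vec_eq_iff transpose_def Ent)
  qed
  have c2: "0 < c' / 2" using c' by simp
  have dZ: "(Z has_vector_derivative - trace (matrix_inv (P s) ** E) / 2 * Z s) (at s)" if s: "0 <= s" "s <= 1" for s
  proof -
    have rng: "- \<eta> < t" "t < 1 + \<eta>" if "\<bar>t - s\<bar> < \<eta>" for t using that s by auto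
    note parts = gauss_exp_parts[OF Psym c2 Ppos]
    define q where "q = (%y. bilin (cvec y) E (cvec y))"
    have ge: "gauss_exp (P t) 0 y = exp (- (bilin (cvec y) (mat 1) (cvec y) + of_real t * q y) / 2)" for t y
      by (simp add: gauss_exp_def bP q_def)
    have ub: "cmod (- q y / 2 * gauss_exp (P t) 0 y) <= K * exp ((0 + 2)\<^sup>2 / (c' / 2)) * exp (- (c' / 2 / 4) * (norm y)\<^sup>2)"
      if t: "\<bar>t - s\<bar> < \<eta>" for t y
    proof (rule gauss_dominated(1)[OF c2 K])
      fix y
      have 1: "cmod (gauss_exp (P t) 0 y) <= exp (- (c' / 2) * (norm y)\<^sup>2 / 2 + 0 * norm y)"
        by (rule gauss_exp_bound[OF Ppos[OF rng[OF t]]]) simp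
      have "cmod (q y) <= K * (norm y)\<^sup>2"
        using bilin_bound[of "cvec y" E "cvec y"] by (simp add: q_def K_def power2_eq_square mult.assoc)
      also have "\<dots> <= K * (1 + norm y)\<^sup>2" using K by (intro mult_left_mono power_mono) auto
      finally have "cmod (q y) <= K * (1 + norm y)\<^sup>2" .
      moreover have "cmod (- q y / 2) = cmod (q y) / 2" by (simp add: norm_divide)
      ultimately have "cmod (- q y / 2) <= K * (1 + norm y)\<^sup>2" using norm_ge_zero[of "q y"] by linarith
      from mult_mono[OF this 1] show "cmod (- q y / 2 * gauss_exp (P t) 0 y) <= K * ((1 + norm y)\<^sup>2 * exp (- (c' / 2) * (norm y)\<^sup>2 / 2 + 0 * norm y))"
        using K by (simp add: norm_mult norm_divide mult.assoc)
    qed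
    have "((%s. \<integral>y. gauss_exp (P s) 0 y \<partial>lborel) has_vector_derivative (\<integral>y. - q y / 2 * gauss_exp (P s) 0 y \<partial>lborel)) (at s)"
    proof (rule has_vector_derivative_lborel_integral(1)[OF \<eta>(1) _ ub])
      show "((%s. gauss_exp (P s) 0 y) has_vector_derivative - q y / 2 * gauss_exp (P t) 0 y) (at t)" for t y
      proof -
        have d: "((%z. - (bilin (cvec y) (mat 1) (cvec y) + z * q y) / 2) has_field_derivative - q y / 2) (at (of_real t))"
          by (auto intro!: derivative_eq_intros)
        have "((%z. exp (- (bilin (cvec y) (mat 1) (cvec y) + z * q y) / 2)) has_field_derivative - q y / 2 * exp (- (bilin (cvec y) (mat 1) (cvec y) + of_real t * q y) / 2)) (at (of_real t))"
          using DERIV_fun_exp[OF d] by (simp only: mult.commute)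
        from has_vector_derivative_real_field[OF this] show ?thesis unfolding ge .
      qed
      show "integrable lborel (%y :: real ^ 'n. K * exp ((0 + 2)\<^sup>2 / (c' / 2)) * exp (- (c' / 2 / 4) * (norm y)\<^sup>2))"
        using c2 by (intro integrable_mult_right gaussian_norm) auto
    qed (use parts(1)[OF rng] in auto)
    moreover have "(\<integral>y. - q y / 2 * gauss_exp (P s) 0 y \<partial>lborel) = - trace (matrix_inv (P s) ** E) / 2 * Z s"
    proof -
      have s': "- \<eta> < s" "s < 1 + \<eta>" using s \<eta> by auto
      note parts = gauss_exp_parts[OF Psym c2 Ppos[OF s']]
      define N where "N = matrix_inv (P s)"
      have NP: "N ** P s = mat 1"
        using matrix_inv_left_right[OF det_nonzero_if_Re_pos[OF Psym c2 Ppos[OF s']]] by (simp add: N_def)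
      \<comment> \<open>Recover \<open>y $ l\<close> from \<open>P s *v cvec y\<close> through the
        inverse \<open>N\<close>; the covariance identity then leaves a single entry of
        \<open>N\<close>.\<close>
      have mom: "(\<integral>y. of_real (y $ j) * of_real (y $ l) * gauss_exp (P s) 0 y \<partial>lborel) = N $ l $ j * Z s" for j l
      proof -
        have yl: "of_real (y $ l) = (\<Sum>k\<in>UNIV. N $ l $ k * (P s *v cvec y) $ k)" for y :: "real ^ 'n"
          using arg_cong[OF matrix_vector_mul_assoc[of N "P s" "cvec y"], of "%v. v $ l"]
          by (simp add: NP matrix_vector_mult_def[of N])
        have iP: "integrable lborel (%y. of_real (y $ j) * (P s *v cvec y) $ k * gauss_exp (P s) 0 y)" for k
        proof -
          have "integrable lborel (%y. \<Sum>i\<in>UNIV. P s $ k $ i * (of_real (y $ j) * of_real (y $ i) * gauss_exp (P s) 0 y))"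
            by (intro Bochner_Integration.integrable_sum integrable_mult_right parts(3))
          then show ?thesis by (simp add: matrix_vector_mult_def sum_distrib_left sum_distrib_right mult_ac)
        qed
        have "(\<integral>y. of_real (y $ j) * of_real (y $ l) * gauss_exp (P s) 0 y \<partial>lborel) =
           (\<integral>y. (\<Sum>k\<in>UNIV. N $ l $ k * (of_real (y $ j) * (P s *v cvec y) $ k * gauss_exp (P s) 0 y)) \<partial>lborel)"
          unfolding yl by (simp add: sum_distrib_left sum_distrib_right mult_ac)
        also have "\<dots> = (\<Sum>k\<in>UNIV. N $ l $ k * (\<integral>y. of_real (y $ j) * (P s *v cvec y) $ k * gauss_exp (P s) 0 y \<partial>lborel))"
          by (subst Bochner_Integration.integral_sum) (auto intro: iP integrable_mult_right)
        also have "\<dots> = (\<Sum>k\<in>UNIV. if j = k then N $ l $ k * Z s else 0)"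
          unfolding parts(5) Z_def by (intro sum.cong) auto
        also have "\<dots> = N $ l $ j * Z s" by simp
        finally show ?thesis .
      qed
      have "(\<integral>y. q y * gauss_exp (P s) 0 y \<partial>lborel) = (\<integral>y. (\<Sum>j\<in>UNIV. \<Sum>l\<in>UNIV. E $ j $ l * (of_real (y $ j) * of_real (y $ l) * gauss_exp (P s) 0 y)) \<partial>lborel)"
        by (simp add: q_def bilin_def sum_distrib_right sum_distrib_left mult_ac)
      also have "\<dots> = (\<Sum>j\<in>UNIV. \<Sum>l\<in>UNIV. E $ j $ l * (N $ l $ j * Z s))"
        unfolding mom[symmetric]
        by (subst Bochner_Integration.integral_sum, (intro Bochner_Integration.integrable_sum integrable_mult_right parts(3)),
            rule sum.cong[OF refl], subst Bochner_Integration.integral_sum, (intro integrable_mult_right parts(3)), simp)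
      also have "\<dots> = trace (E ** N) * Z s"
        by (simp add: trace_mul_inv_bilin sum_distrib_right mult.assoc)
      finally show ?thesis using trace_mul_sym[of E N] by (simp add: N_def)
    qed
    ultimately show ?thesis unfolding Z_def by simp
  qed
  have const: "((%s. (Z s * Z s) * det (P s)) has_derivative (%h. 0)) (at s within {0..1})" if s: "s \<in> {0..1}" for s
  proof -
    have s': "- \<eta> < s" "s < 1 + \<eta>" using s \<eta> by auto
    have "((%s. det (P s)) has_vector_derivative det (P s) * trace (matrix_inv (P s) ** E)) (at s)"
      using has_vector_derivative_real_field[OF det_pert_derivative] det_nonzero_if_Re_pos[OF Psym c2 Ppos[OF s']]
      unfolding P_def by blast
    then have d: "((%s. (Z s * Z s) * det (P s)) has_vector_derivative
        Z s * Z s * (det (P s) * trace (matrix_inv (P s) ** E)) +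
        (Z s * (- trace (matrix_inv (P s) ** E) / 2 * Z s) + - trace (matrix_inv (P s) ** E) / 2 * Z s * Z s) * det (P s)) (at s)"
      using s by (intro has_vector_derivative_mult dZ) auto
    have "((%s. (Z s * Z s) * det (P s)) has_vector_derivative 0) (at s)"
      by (rule has_vector_derivative_eq_rhs[OF d]) (simp add: field_simps)
    then show ?thesis by (simp add: has_vector_derivative_def has_derivative_at_withinI)
  qed
  from has_derivative_zero_unique[OF convex_real_interval(5) const, of 1 0]
  have "(Z 1)\<^sup>2 * det (P 1) = (Z 0)\<^sup>2 * det (P 0)" by (simp add: power2_eq_square)
  moreover have "P 1 = B" "P 0 = mat 1" by (simp_all add: vec_eq_iff Ent mat_def)
  moreover have "Z 0 = of_real (sqrt (2 * pi) ^ CARD('n))"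
  proof -
    have ge0: "gauss_exp (P 0) 0 y = of_real (exp (- (norm y)\<^sup>2 / 2))" for y :: "real ^ 'n"
    proof -
      have "bilin (cvec y) (mat 1) (cvec y) = of_real ((norm y)\<^sup>2)"
        unfolding bilin_eq_sum by (simp add: norm_vec_def L2_set_def sum_nonneg power2_eq_square)
      then show ?thesis by (simp add: gauss_exp_def bP exp_of_real[symmetric])
    qed
    have "Z 0 = (\<integral>y. of_real (exp (- (norm (y :: real ^ 'n))\<^sup>2 / 2)) \<partial>lborel)" by (simp only: Z_def ge0[symmetric])
    also have "\<dots> = of_real (\<integral>y. exp (- (norm (y :: real ^ 'n))\<^sup>2 / 2) \<partial>lborel)" by (rule integral_complex_of_real)
    finally show ?thesis by (simp only: gaussian_norm(2)[OF zero_less_one])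
  qed
  ultimately have "(Z 1)\<^sup>2 * det B = (of_real (sqrt (2 * pi) ^ CARD('n)))\<^sup>2" by simp
  also have "\<dots> = of_real ((sqrt (2 * pi) ^ CARD('n))\<^sup>2)" by simp
  also have "(sqrt (2 * pi) ^ CARD('n))\<^sup>2 = (2 * pi) ^ CARD('n)"
    by (simp add: power_mult[symmetric] mult.commute[of _ 2]) (simp add: power_mult)
  finally show ?thesis using \<open>P 1 = B\<close> by (simp add: Z_def)
qed

section \<open>Linear deformation of a box\<close>

definition vupd :: "real ^ 'm => 'm => real => real ^ 'm" where
  "vupd x k s = (\<chi> j. if j = k then s else x $ j)"

lemma vupd_nth [simp]: "vupd x k s $ j = (if j = k then s else x $ j)"
  by (simp add: vupd_def)

lemma continuous_on_vupd: "continuous_on S (vupd x k)"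
  unfolding vupd_def
proof (rule continuous_on_vec_lambda)
  show "continuous_on S (%s. if j = k then s else x $ j)" for j
    by (cases "j = k") auto
qed

lemma vupd_mem_cbox:
  fixes a b x :: "real ^ 'm"
  assumes x: "x \<in> cbox a b"
  shows "vupd x k s \<in> cbox a b \<longleftrightarrow> s \<in> {a $ k..b $ k}"
proof
  assume "vupd x k s \<in> cbox a b"
  then have "a $ k <= vupd x k s $ k \<and> vupd x k s $ k <= b $ k" unfolding mem_box_cart by blast
  then show "s \<in> {a $ k..b $ k}" by simp
next
  assume s: "s \<in> {a $ k..b $ k}"
  show "vupd x k s \<in> cbox a b" unfolding mem_box_cart
  proof
    fix j show "a $ j <= vupd x k s $ j \<and> vupd x k s $ j <= b $ j"
      using x s unfolding mem_box_cart by (cases "j = k") auto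
  qed
qed

text \<open>Fubini for one coordinate, in the only form needed: a bound on all one-dimensional slices
  bounds the integral.\<close>

lemma norm_integral_cbox_le_slices:
  fixes f :: "real ^ 'm::finite => complex"
  assumes cont: "continuous_on (cbox a b) f"
    and K: "0 <= K" and ab: "!!j. a $ j <= b $ j"
    and slice: "!!x. x \<in> cbox a b ==> cmod (integral {a $ k..b $ k} (%s. f (vupd x k s))) <= K"
  shows "cmod (integral (cbox a b) f) <= K * (\<Prod>j\<in>UNIV - {k}. b $ j - a $ j)"
proof -
  interpret product_sigma_finite "%_ :: real ^ 'm. lborel :: real measure" by standard
  define i where "i = (axis k 1 :: real ^ 'm)"
  define I where "I = Basis - {i}"
  have iB: "i \<in> Basis" by (simp add: i_def)
  have I: "finite I" "i \<notin> I" "insert i I = Basis" using iB by (auto simp: I_def)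
  define T where "T = (%\<phi>. \<Sum>b\<in>Basis. \<phi> b *\<^sub>R (b :: real ^ 'm))"
  have Tn: "T \<phi> $ j = \<phi> (axis j 1)" for \<phi> j
  proof -
    have "T \<phi> $ j = T \<phi> \<bullet> axis j 1" by (simp add: inner_axis)
    also have "\<dots> = \<phi> (axis j 1)" unfolding T_def by (rule inner_sum_left_Basis) simp
    finally show ?thesis .
  qed
  define g where "g = (%x. indicator (cbox a b) x *\<^sub>R f x)"
  have gi: "integrable lborel g"
    unfolding g_def by (rule borel_integrable_compact[OF compact_cbox cont])
  have gm: "g \<in> borel_measurable borel" using gi by (auto dest: borel_measurable_integrable)
  have Tm: "T \<in> measurable (\<Pi>\<^sub>M b\<in>(Basis :: (real ^ 'm) set). lborel) borel"
    unfolding T_def by measurable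
  have L: "(lborel :: (real ^ 'm) measure) = distr (\<Pi>\<^sub>M b\<in>Basis. lborel) borel T"
    unfolding T_def by (rule lborel_eq)
  have gTi: "integrable (Pi\<^sub>M (insert i I) (%_. lborel)) (%\<phi>. g (T \<phi>))"
    using gi integrable_distr_eq[OF Tm gm] L I(3) by simp
  have "integral (cbox a b) f = (\<integral>x. g x \<partial>lborel)"
    using set_borel_integral_eq_integral(2)[of "cbox a b" f] gi
    unfolding set_lebesgue_integral_def set_integrable_def g_def by simp
  also have "\<dots> = (\<integral>\<phi>. g (T \<phi>) \<partial>Pi\<^sub>M (insert i I) (%_. lborel))"
    using integral_distr[OF Tm gm] L I(3) by simp
  also have "\<dots> = (\<integral>\<phi>. (\<integral>y. g (T (\<phi>(i := y))) \<partial>lborel) \<partial>Pi\<^sub>M I (%_. lborel))"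
    by (rule product_integral_insert[OF I(1,2) gTi])
  finally have eq: "integral (cbox a b) f = (\<integral>\<phi>. (\<integral>y. g (T (\<phi>(i := y))) \<partial>lborel) \<partial>Pi\<^sub>M I (%_. lborel))" .
  \<comment> \<open>Outside the box \<open>S\<close> of the remaining coordinates the slice of
    \<open>g\<close> vanishes, so \<open>K\<close> is integrated only over a set whose measure is
    the product of the other side lengths.\<close>
  define S where "S = (\<Pi>\<^sub>E b'\<in>I. {a \<bullet> b'..b \<bullet> b'})"
  have inner: "cmod (\<integral>y. g (T (\<phi>(i := y))) \<partial>lborel) <= K * indicator S \<phi>"
    if sp: "\<phi> \<in> space (Pi\<^sub>M I (%_. lborel))" for \<phi>
  proof (cases "\<phi> \<in> S")
    case True
    define x where "x = T (\<phi>(i := a $ k))"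
    have xj: "x $ j = (if j = k then a $ k else \<phi> (axis j 1))" for j
      by (auto simp: x_def Tn i_def axis_eq_axis)
    have up: "T (\<phi>(i := y)) = vupd x k y" for y
      unfolding vec_eq_iff by (intro allI) (simp add: Tn xj i_def axis_eq_axis)
    have xin: "x \<in> cbox a b"
      unfolding mem_box_cart
    proof
      fix j
      show "a $ j <= x $ j \<and> x $ j <= b $ j"
      proof (cases "j = k")
        case False
        then have "axis j 1 \<in> I" by (auto simp: I_def i_def axis_eq_axis)
        then have "\<phi> (axis j 1) \<in> {a \<bullet> axis j 1..b \<bullet> axis j 1}" using True unfolding S_def by (rule PiE_mem[rotated])
        then show ?thesis using False by (simp add: xj inner_axis)
      qed (use ab in \<open>simp add: xj\<close>)
    qed
    have mem: "vupd x k y \<in> cbox a b \<longleftrightarrow> y \<in> {a $ k..b $ k}" for y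
      by (rule vupd_mem_cbox[OF xin])
    have "continuous_on {a $ k..b $ k} (%y. f (vupd x k y))"
      by (rule continuous_on_compose2[OF cont continuous_on_vupd]) (simp only: image_subset_iff mem, blast)
    then have "integrable lborel (%y. indicator {a $ k..b $ k} y *\<^sub>R f (vupd x k y))"
      by (intro borel_integrable_compact) auto
    then have "(\<integral>y. indicator {a $ k..b $ k} y *\<^sub>R f (vupd x k y) \<partial>lborel) = integral {a $ k..b $ k} (%s. f (vupd x k s))"
      using set_borel_integral_eq_integral(2)[of "{a $ k..b $ k}" "%y. f (vupd x k y)"]
      unfolding set_lebesgue_integral_def set_integrable_def by simp
    moreover have "g (T (\<phi>(i := y))) = indicator {a $ k..b $ k} y *\<^sub>R f (vupd x k y)" for y
      unfolding up g_def using mem[of y] by (simp add: indicator_def)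
    ultimately show ?thesis using slice[OF xin] True by simp
  next
    case False
    have "g (T (\<phi>(i := y))) = 0" for y
    proof -
      have "T (\<phi>(i := y)) \<notin> cbox a b"
      proof
        assume in_box: "T (\<phi>(i := y)) \<in> cbox a b"
        have "\<phi> \<in> S" unfolding S_def
        proof (rule PiE_I)
          fix b' assume b': "b' \<in> I"
          then obtain j where j: "b' = axis j 1" by (auto simp: I_def Basis_vec_def)
          then have "j ~= k" using b' by (auto simp: I_def i_def)
          then have "T (\<phi>(i := y)) $ j = \<phi> b'" using j by (auto simp: Tn i_def axis_eq_axis)
          then show "\<phi> b' \<in> {a \<bullet> b'..b \<bullet> b'}" using in_box unfolding mem_box_cart j by (simp add: inner_axis) metis
        next
          fix b' assume "b' \<notin> I"
          then show "\<phi> b' = undefined" using sp by (auto simp: space_PiM)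
        qed
        then show False using False by simp
      qed
      then show ?thesis by (simp add: g_def)
    qed
    then show ?thesis using False by simp
  qed
  have Sm: "S \<in> sets (Pi\<^sub>M I (%_. lborel))" unfolding S_def by (rule sets_PiM_I_finite[OF I(1)]) simp
  have ab': "a \<bullet> b' <= b \<bullet> b'" if "b' \<in> I" for b'
    using that ab by (auto simp: I_def Basis_vec_def inner_axis)
  have emS: "emeasure (Pi\<^sub>M I (%_. lborel)) S = ennreal (\<Prod>b'\<in>I. b \<bullet> b' - a \<bullet> b')"
    unfolding S_def using ab' by (subst emeasure_PiM[OF I(1)]) (auto simp: prod_ennreal)
  have "bij_betw (%j. axis j 1 :: real ^ 'm) (UNIV - {k}) I"
    by (auto simp: bij_betw_def inj_on_def I_def i_def axis_eq_axis Basis_vec_def)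
  from prod.reindex_bij_betw[OF this, of "%b'. b \<bullet> b' - a \<bullet> b'"]
  have vol: "(\<Prod>b'\<in>I. b \<bullet> b' - a \<bullet> b') = (\<Prod>j\<in>UNIV - {k}. b $ j - a $ j)"
    by (simp add: inner_axis)
  have vol0: "0 <= (\<Prod>b'\<in>I. b \<bullet> b' - a \<bullet> b')" using ab' by (intro prod_nonneg) auto
  have Si: "integrable (Pi\<^sub>M I (%_. lborel)) (%\<phi>. K * indicator S \<phi>)"
    using Sm emS by (intro integrable_mult_right integrable_real_indicator) auto
  have "cmod (integral (cbox a b) f) <= (\<integral>\<phi>. cmod (\<integral>y. g (T (\<phi>(i := y))) \<partial>lborel) \<partial>Pi\<^sub>M I (%_. lborel))"
    unfolding eq by (rule integral_norm_bound)
  also have "\<dots> <= (\<integral>\<phi>. K * indicator S \<phi> \<partial>Pi\<^sub>M I (%_. lborel))"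
    by (rule integral_mono'[OF Si]) (use inner K in auto)
  also have "\<dots> = K * (\<Prod>j\<in>UNIV - {k}. b $ j - a $ j)"
    using Sm emS vol vol0 by (simp add: measure_def)
  finally show ?thesis .
qed

text \<open>A directional derivative is a one-variable complex derivative along a line with the base
  point as parameter. The available radius is shared: half for the base point, half for the movement
  along the line.\<close>

lemma continuous_on_dir_deriv:
  assumes h: "holomorphic_vec h S" and S: "open S"
  shows "continuous_on S (%\<theta>. dir_deriv h \<theta> v)"
proof (rule continuous_at_imp_continuous_on, rule ballI)
  fix \<theta>0 assume "\<theta>0 \<in> S"
  then obtain r where r: "0 < r" "cball \<theta>0 r \<subseteq> S" using S open_contains_cball by metis
  define X where "X = ball \<theta>0 (r / 2)"
  define \<rho> where "\<rho> = r / 2 / (norm v + 1)"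
  have nv: "0 < norm v + 1" using norm_ge_zero[of v] by linarith
  have \<rho>: "0 < \<rho>" using r nv by (simp add: \<rho>_def)
  have inS: "\<theta> + w *s v \<in> S" if "w \<in> cball 0 \<rho>" "\<theta> \<in> X" for w \<theta>
  proof -
    have "norm (w *s v) <= \<rho> * (norm v + 1)"
      unfolding norm_vector_scalar_mult using that \<rho> by (intro mult_mono) auto
    also have "\<dots> = r / 2"
    proof -
      define C where "C = norm v + 1"
      have "0 < C" using nv by (simp add: C_def)
      then show ?thesis by (simp add: \<rho>_def C_def[symmetric])
    qed
    finally have "norm (w *s v) <= r / 2" .
    moreover have "norm (\<theta>0 - \<theta>) < r / 2" using that by (simp add: X_def dist_norm)
    ultimately have "norm (\<theta>0 - (\<theta> + w *s v)) <= r"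
      using norm_triangle_ineq4[of "\<theta>0 - \<theta>" "w *s v"] by (simp add: algebra_simps)
    then show ?thesis using r by (auto simp: dist_norm)
  qed
  have "continuous_on (cball 0 \<rho> \<times> X) (%p. h (snd p + fst p *s v))"
    by (rule continuous_on_compose2[OF holomorphic_vec_continuous[OF h]]) (use inS in \<open>auto intro!: continuous_intros\<close>)
  then have "continuous_on (ball 0 \<rho> \<times> X) (%(w, \<theta>). deriv (%w. h (\<theta> + w *s v)) w)"
    using inS by (intro continuous_on_deriv_parameter holomorphic_vec_on_line[OF h]) (auto simp: split_beta)
  then have "continuous_on X (%\<theta>. (%(w, \<theta>). deriv (%w. h (\<theta> + w *s v)) w) (0, \<theta>))"
    by (rule continuous_on_compose2) (use \<rho> in \<open>auto intro!: continuous_intros\<close>)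
  moreover have "deriv (%w. h (\<theta> + w *s v)) 0 = dir_deriv h \<theta> v" if "\<theta> \<in> X" for \<theta>
    using DERIV_imp_deriv[OF holomorphic_vec_line[OF h, of \<theta> 0 v]] inS[of 0 \<theta>] that \<rho> by simp
  ultimately have "continuous_on X (%\<theta>. dir_deriv h \<theta> v)" by (simp cong: continuous_on_cong)
  then show "isCont (%\<theta>. dir_deriv h \<theta> v) \<theta>0"
    using r by (auto simp: X_def continuous_on_eq_continuous_at)
qed

lemma continuous_on_matrix_vector_mult [continuous_intros]:
  fixes f :: "'a::topological_space => complex ^ 'n::finite"
  shows "continuous_on S f ==> continuous_on S (%x. A *v f x)"
  unfolding matrix_vector_mult_def by (intro continuous_on_vec_lambda continuous_intros)

lemma matrix_vector_mult_axis:
  fixes M :: "complex ^ 'n::finite ^ 'n"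
  shows "(M *v axis k 1) $ i = M $ i $ k"
  by (simp add: matrix_vector_mult_def axis_def if_distrib[of "%x. _ * x"] cong: if_cong)

lemma norm_matrix_vector_mult_le:
  fixes A :: "complex ^ 'n::finite ^ 'n"
  obtains K where "0 <= K" "!!v. norm (A *v v) <= K * norm v"
proof -
  have lin: "linear ((*v) A)"
  proof (rule linearI)
    show "A *v (x + y) = A *v x + A *v y" for x y by (rule matrix_vector_right_distrib)
    show "A *v (r *\<^sub>R x) = r *\<^sub>R (A *v x)" for r x
      by (simp add: matrix_vector_mult_def vec_eq_iff scaleR_sum_right)
  qed
  obtain K where "0 < K" "!!v. norm (A *v v) <= K * norm v" using linear_bounded_pos[OF lin] by blast
  then show ?thesis using that[of K] by simp
qed

text \<open>The perturbation moves each vector by at most half its length, so the image keeps at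
  least half of it.\<close>

lemma pert_invertible:
  fixes E :: "complex ^ 'n::finite ^ 'n"
  assumes E: "!!v. norm (E *v v) <= N * norm v" and z: "cmod z * N <= 1 / 2"
  shows "det (pert E z) ~= 0" "norm (matrix_inv (pert E z) *v v) <= 2 * norm v"
proof -
  have low: "norm v <= 2 * norm (pert E z *v v)" for v
  proof -
    have "norm (z *s (E *v v)) <= cmod z * (N * norm v)"
      unfolding norm_vector_scalar_mult by (intro mult_left_mono E) auto
    also have "\<dots> <= 1 / 2 * norm v" using mult_right_mono[OF z, of "norm v"] by (simp add: mult_ac)
    finally have "norm (z *s (E *v v)) <= norm v / 2" by simp
    moreover have "norm v <= norm (v + z *s (E *v v)) + norm (z *s (E *v v))"
      by (metis add_diff_cancel_right' norm_triangle_ineq4)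
    ultimately show ?thesis by (simp add: pert_mult_vec)
  qed
  have "v = 0" if "pert E z *v v = 0" for v using low[of v] that by simp
  then show d: "det (pert E z) ~= 0"
    using invertible_det_nz[of "pert E z"] matrix_left_invertible_ker[of "pert E z"] invertible_left_inverse[of "pert E z"] by blast
  have "pert E z *v (matrix_inv (pert E z) *v v) = v"
    by (simp add: matrix_vector_mul_assoc matrix_inv_left_right[OF d])
  then show "norm (matrix_inv (pert E z) *v v) <= 2 * norm v" using low[of "matrix_inv (pert E z) *v v"] by simp
qed

lemma pert_0: "pert E 0 = mat 1"
  by (simp add: pert_def mat_def vec_eq_iff)

text \<open>A compact piece of the product of curves, cut out by a parameter box. Derivatives are
  taken within the closed side intervals, so that the fundamental theorem applies up to the
  faces.\<close>

locale arc_box =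
  fixes c c' :: "'m::finite => real => complex" and a b :: "real ^ 'm"
  assumes ab: "!!k. a $ k < b $ k"
    and der: "!!k x. x \<in> {a $ k..b $ k} ==> (c k has_vector_derivative c' k x) (at x within {a $ k..b $ k})"
    and cont': "!!k. continuous_on {a $ k..b $ k} (c' k)"
begin

definition arc :: "real ^ 'm => complex ^ 'm" where "arc x = (\<chi> k. c k (x $ k))"

definition jac :: "real ^ 'm => complex" where "jac x = (\<Prod>k\<in>UNIV. c' k (x $ k))"

lemma continuous_on_arc: "continuous_on (cbox a b) arc"
  unfolding arc_def
proof (rule continuous_on_vec_lambda)
  fix k
  have "continuous_on {a $ k..b $ k} (c k)"
    using der by (meson continuous_on_eq_continuous_within has_vector_derivative_continuous)
  then show "continuous_on (cbox a b) (%x. c k (x $ k))"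
    by (rule continuous_on_compose2) (auto simp: mem_box_cart intro!: continuous_intros)
qed

lemma continuous_on_jac: "continuous_on (cbox a b) jac"
  unfolding jac_def
  by (intro continuous_on_prod continuous_on_compose2[OF cont']) (auto simp: mem_box_cart intro!: continuous_intros)

lemma arc_vupd_derivative:
  assumes "s \<in> {a $ k..b $ k}"
  shows "((%s. arc (vupd x k s)) has_vector_derivative c' k s *s axis k 1) (at s within {a $ k..b $ k})"
proof -
  have eq: "arc (vupd x k s) = (\<chi> j. if j = k then 0 else c j (x $ j)) + c k s *s axis k 1" for s
    by (auto simp: vec_eq_iff arc_def axis_def)
  have "((%s. c k s *s axis k 1) has_vector_derivative c' k s *s (axis k 1 :: complex ^ 'm)) (at s within {a $ k..b $ k})"
  proof -
    have "(%x. (x *\<^sub>R c' k s) *s (axis k 1 :: complex ^ 'm)) = (%x. x *\<^sub>R (c' k s *s axis k 1))"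
      by (auto simp: fun_eq_iff vec_eq_iff)
    then show ?thesis
      using has_derivative_compose[OF der[OF assms, unfolded has_vector_derivative_def] has_derivative_scalar_mult_vec[of "axis k 1" "c k s" UNIV]]
      unfolding has_vector_derivative_def by (simp only:)
  qed
  then show ?thesis unfolding eq by (auto intro!: derivative_eq_intros)
qed

text \<open>Along a coordinate line only one factor of \<open>jac\<close> varies, and it is the
  chain rule factor of \<open>\<Psi>\<close>; the remaining product is constant. \<open>D\<close> is
  therefore the \<open>k\<close>-th summand of a divergence, and its slice integral consists of
  values of \<open>\<Psi>\<close> on the two faces.\<close>

lemma boundary_slice:
  fixes h :: "complex ^ 'm => complex" and U M :: "complex ^ 'm ^ 'm" and k :: 'm
  assumes h: "holomorphic_vec h S" and S: "!!x. x \<in> cbox a b ==> U *v arc x \<in> S" and x: "x \<in> cbox a b"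
  defines "\<Psi> \<equiv> %x. (M *v arc x) $ k * h (U *v arc x)"
  defines "D \<equiv> %x. M $ k $ k * h (U *v arc x) + (M *v arc x) $ k * dir_deriv h (U *v arc x) (U *v axis k 1)"
  shows "integral {a $ k..b $ k} (%s. D (vupd x k s) * jac (vupd x k s)) =
     (\<Prod>j\<in>UNIV - {k}. c' j (x $ j)) * (\<Psi> (vupd x k (b $ k)) - \<Psi> (vupd x k (a $ k)))"
proof -
  define \<pi> where "\<pi> = (\<Prod>j\<in>UNIV - {k}. c' j (x $ j))"
  have jac: "jac (vupd x k s) = c' k s * \<pi>" for s
    unfolding jac_def \<pi>_def by (subst prod.remove[of UNIV k]) (auto intro!: prod.cong)
  have "((%s. \<Psi> (vupd x k s)) has_vector_derivative D (vupd x k s) * c' k s) (at s within {a $ k..b $ k})"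
    if s: "s \<in> {a $ k..b $ k}" for s
  proof -
    have in_box: "vupd x k s \<in> cbox a b" using vupd_mem_cbox[OF x] s by simp
    have linA: "bounded_linear (%v. A *v v)" for A :: "complex ^ 'm ^ 'm"
    proof -
      obtain K where "!!v. norm (A *v v) <= K * norm v" using norm_matrix_vector_mult_le by blast
      then have "norm (A *v v) <= norm v * K" for v by (simp add: mult.commute)
      moreover have "A *v (r *\<^sub>R x) = r *\<^sub>R (A *v x)" for r x
        by (simp add: matrix_vector_mult_def vec_eq_iff scaleR_sum_right)
      ultimately show ?thesis
        by (intro bounded_linear_intro[of _ K] matrix_vector_right_distrib)
    qed
    have dA: "((%s. A *v arc (vupd x k s)) has_vector_derivative c' k s *s (A *v axis k 1)) (at s within {a $ k..b $ k})" for A :: "complex ^ 'm ^ 'm"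
      using bounded_linear.has_vector_derivative[OF linA[of A] arc_vupd_derivative[OF s, of x]]
      by (simp add: vector_scalar_commute)
    have 1: "((%s. (M *v arc (vupd x k s)) $ k) has_vector_derivative c' k s * M $ k $ k) (at s within {a $ k..b $ k})"
    proof -
      have "(M *v axis k 1) $ k = M $ k $ k"
        by (rule matrix_vector_mult_axis)
      then show ?thesis
        using bounded_linear.has_vector_derivative[OF bounded_linear_vec_nth dA[of M], of k] by simp
    qed
    have 2: "((%s. h (U *v arc (vupd x k s))) has_vector_derivative c' k s * dir_deriv h (U *v arc (vupd x k s)) (U *v axis k 1)) (at s within {a $ k..b $ k})"
      using holomorphic_vec_chain[OF h S[OF in_box] dA[of U]] holomorphic_vec_derivative(2)[OF h S[OF in_box]] by simp
    show ?thesis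
      unfolding \<Psi>_def
      by (rule has_vector_derivative_eq_rhs[OF has_vector_derivative_mult[OF 1 2]]) (simp add: D_def algebra_simps)
  qed
  then have "((%s. D (vupd x k s) * c' k s) has_integral \<Psi> (vupd x k (b $ k)) - \<Psi> (vupd x k (a $ k))) {a $ k..b $ k}"
    using ab[of k] by (intro fundamental_theorem_of_calculus) auto
  from integral_unique[OF has_integral_mult_right[OF this, of \<pi>]]
  show ?thesis unfolding jac \<pi>_def[symmetric] by (simp add: mult_ac)
qed

text \<open>Along \<open>z \<mapsto> pert E z\<close> the derivative of the deformed integral is the integral of a divergence,
  hence a sum of boundary terms.\<close>

lemma linear_deformation_error:
  fixes E :: "complex ^ 'm ^ 'm"
  assumes N: "0 <= N" "!!v. norm (E *v v) <= N * norm v" and \<kappa>: "0 < \<kappa>" "\<kappa> * N <= 1 / 2"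
  obtains K where "0 <= K"
    "!!h S \<epsilon> t. holomorphic_vec h S ==> open S ==> (!!z x. cmod z <= \<kappa> ==> x \<in> cbox a b ==> pert E z *v arc x \<in> S) ==>
      (!!z x k. cmod z <= \<kappa> ==> x \<in> cbox a b ==> x $ k = a $ k \<or> x $ k = b $ k ==> cmod (h (pert E z *v arc x)) <= \<epsilon>) ==>
      0 <= t ==> t < \<kappa> ==>
      cmod (det (pert E (of_real t)) * integral (cbox a b) (%x. h (pert E (of_real t) *v arc x) * jac x)
            - integral (cbox a b) (%x. h (arc x) * jac x)) <= K * \<epsilon>"
proof -
  have a_in: "a \<in> cbox a b" using ab by (simp add: mem_box_cart less_imp_le)
  then have cne: "cbox a b ~= {}" by blast
  have "bounded (arc ` cbox a b)" by (intro compact_imp_bounded compact_continuous_image continuous_on_arc compact_cbox)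
  then obtain R where R: "!!x. x \<in> cbox a b ==> norm (arc x) <= R" unfolding bounded_iff by blast
  have R0: "0 <= R" using R cne norm_ge_zero order_trans by blast
  have "bounded (c' k ` {a $ k..b $ k})" for k by (intro compact_imp_bounded compact_continuous_image cont' compact_Icc)
  then have "\<forall>k. \<exists>B. \<forall>s\<in>{a $ k..b $ k}. cmod (c' k s) <= B" unfolding bounded_iff by blast
  then obtain B where B: "!!k s. s \<in> {a $ k..b $ k} ==> cmod (c' k s) <= B k" by metis
  have "bounded ((%z. det (pert E z)) ` cball 0 \<kappa>)"
    by (intro compact_imp_bounded compact_continuous_image continuous_on_det continuous_on_pert compact_cball)
  then obtain \<Delta> where "\<forall>y\<in>(%z. det (pert E z)) ` cball 0 \<kappa>. cmod y <= \<Delta>" unfolding bounded_iff by blast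
  then have \<Delta>: "cmod (det (pert E z)) <= \<Delta>" if "cmod z <= \<kappa>" for z using that by simp
  have \<Delta>0: "0 <= \<Delta>" using order_trans[OF norm_ge_zero \<Delta>[of 0]] \<kappa> by simp
  define \<pi> where "\<pi> = (%k. \<Prod>j\<in>UNIV - {k}. B j)"
  define V where "V = (%k. \<Prod>j\<in>UNIV - {k}. b $ j - a $ j)"
  have B0: "0 <= B k" for k using order_trans[OF norm_ge_zero B[of "a $ k" k]] ab[of k] by simp
  have \<pi>0: "0 <= \<pi> k" for k unfolding \<pi>_def by (intro prod_nonneg ballI B0)
  have V0: "0 <= V k" for k unfolding V_def by (intro prod_nonneg) (use ab in \<open>auto intro: less_imp_le\<close>)
  \<comment> \<open>The factors: \<open>\<Delta>\<close> bounds the determinant,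
    \<open>\<pi> k\<close> the speeds of the other coordinates, \<open>2 N R\<close> the vector
    \<open>M *v arc x\<close>, once for each of two faces; \<open>V k\<close> is the volume of the
    other coordinates and \<open>\<kappa>\<close> bounds the length of the path.\<close>
  define K where "K = \<Delta> * (\<Sum>k\<in>UNIV. \<pi> k * (2 * (2 * N * R)) * V k) * \<kappa>"
  show ?thesis
  proof (rule that[of K])
    show "0 <= K" unfolding K_def using \<Delta>0 \<pi>0 V0 N R0 \<kappa> by (intro mult_nonneg_nonneg sum_nonneg) auto
    fix h :: "complex ^ 'm => complex" and S \<epsilon> and t :: real
    assume h: "holomorphic_vec h S" and oS: "open S" and inS: "!!z x. cmod z <= \<kappa> ==> x \<in> cbox a b ==> pert E z *v arc x \<in> S"
      and face: "!!z x k. cmod z <= \<kappa> ==> x \<in> cbox a b ==> x $ k = a $ k \<or> x $ k = b $ k ==> cmod (h (pert E z *v arc x)) <= \<epsilon>"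
      and t: "0 <= t" "t < \<kappa>"
    have \<epsilon>0: "0 <= \<epsilon>"
      using order_trans[OF norm_ge_zero face[of 0 a undefined]] a_in \<kappa> by simp
    note hc = holomorphic_vec_continuous[OF h]
    define J where "J = (%z. integral (cbox a b) (%x. h (pert E z *v arc x) * jac x))"
    define J' where "J' = (%z. integral (cbox a b) (%x. dir_deriv h (pert E z *v arc x) (E *v arc x) * jac x))"
    have cU: "continuous_on (X \<times> cbox a b) (%p. pert E (fst p) *v arc (snd p))" for X
    proof -
      have "continuous_on (X \<times> cbox a b) (%p. arc (snd p))"
        by (rule continuous_on_compose2[OF continuous_on_arc]) (auto intro!: continuous_intros)
      then show ?thesis unfolding pert_mult_vec by (intro continuous_intros)
    qed
    have dJ: "(J has_field_derivative J' z) (at z)" if z: "z \<in> ball 0 \<kappa>" for z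
    proof -
      have 1: "((%z. h (pert E z *v arc x) * jac x) has_field_derivative dir_deriv h (pert E z *v arc x) (E *v arc x) * jac x) (at z within ball 0 \<kappa>)"
        if "z \<in> ball 0 \<kappa>" "x \<in> cbox a b" for z x
      proof -
        have "cmod z <= \<kappa>" using that by simp
        from inS[OF this that(2)] have "arc x + z *s (E *v arc x) \<in> S" by (simp only: pert_mult_vec)
        from holomorphic_vec_line[OF h this]
        show ?thesis unfolding pert_mult_vec by (rule DERIV_cmult_right[OF has_field_derivative_at_within])
      qed
      have 2: "(%x. h (pert E z *v arc x) * jac x) integrable_on cbox a b" if "z \<in> ball 0 \<kappa>" for z
      proof (intro integrable_continuous continuous_on_mult continuous_on_jac)
        have "continuous_on (cbox a b) (%x. pert E z *v arc x)" by (intro continuous_on_matrix_vector_mult continuous_on_arc)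
        then show "continuous_on (cbox a b) (%x. h (pert E z *v arc x))"
          by (rule continuous_on_compose2[OF hc]) (use that in \<open>simp add: image_subset_iff inS\<close>)
      qed
      have 3: "continuous_on (ball 0 \<kappa> \<times> cbox a b) (%(z, x). dir_deriv h (pert E z *v arc x) (E *v arc x) * jac x)"
      proof -
        have "continuous_on (ball 0 \<kappa> \<times> cbox a b) (%p. \<Sum>k\<in>UNIV. (E *v arc (snd p)) $ k * dir_deriv h (pert E (fst p) *v arc (snd p)) (axis k 1))"
        proof (intro continuous_on_sum continuous_on_mult)
          fix k
          show "continuous_on (ball 0 \<kappa> \<times> cbox a b) (%p. dir_deriv h (pert E (fst p) *v arc (snd p)) (axis k 1))"
            by (rule continuous_on_compose2[OF continuous_on_dir_deriv[OF h oS] cU]) (simp add: image_subset_iff inS)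
          show "continuous_on (ball 0 \<kappa> \<times> cbox a b) (%p. (E *v arc (snd p)) $ k)"
            by (intro continuous_on_component continuous_intros continuous_on_compose2[OF continuous_on_arc]) (auto intro!: continuous_intros)
        qed
        moreover have "continuous_on (ball 0 \<kappa> \<times> cbox a b) (%p. jac (snd p))"
          by (rule continuous_on_compose2[OF continuous_on_jac]) (auto intro!: continuous_intros)
        ultimately have "continuous_on (ball 0 \<kappa> \<times> cbox a b) (%p. (\<Sum>k\<in>UNIV. (E *v arc (snd p)) $ k * dir_deriv h (pert E (fst p) *v arc (snd p)) (axis k 1)) * jac (snd p))"
          by (rule continuous_on_mult)
        then show ?thesis
        proof (rule continuous_on_eq)
          fix p :: "complex \<times> (real ^ 'm)" assume p: "p \<in> ball 0 \<kappa> \<times> cbox a b"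
          then have "pert E (fst p) *v arc (snd p) \<in> S" by (intro inS) auto
          from holomorphic_vec_derivative(3)[OF h this, of "E *v arc (snd p)"]
          show "(\<Sum>k\<in>UNIV. (E *v arc (snd p)) $ k * dir_deriv h (pert E (fst p) *v arc (snd p)) (axis k 1)) * jac (snd p) =
              (%(z, x). dir_deriv h (pert E z *v arc x) (E *v arc x) * jac x) p"
            by (simp add: split_beta)
        qed
      qed
      show ?thesis
        using leibniz_rule_field_derivative[OF 1 2 3 z convex_ball] z
        unfolding J_def J'_def by (simp add: at_within_open[OF _ open_ball])
    qed
    have dD: "((%z. det (pert E z) * J z) has_field_derivative det (pert E z) * (trace (matrix_inv (pert E z) ** E) * J z + J' z)) (at z)"
      if z: "z \<in> ball 0 \<kappa>" for z
    proof -
      have "cmod z * N <= 1 / 2" using z \<kappa> N mult_right_mono[of "cmod z" \<kappa> N] by simp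
      from DERIV_mult[OF det_pert_derivative[OF pert_invertible(1)[OF N(2) this]] dJ[OF z]]
      show ?thesis by (rule DERIV_cong) (simp add: algebra_simps)
    qed
    have bound: "cmod (det (pert E z) * (trace (matrix_inv (pert E z) ** E) * J z + J' z)) <= \<Delta> * (\<Sum>k\<in>UNIV. \<pi> k * (2 * (2 * N * R)) * V k) * \<epsilon>"
      if z: "z \<in> ball 0 \<kappa>" for z
    proof -
      have zN: "cmod z * N <= 1 / 2" using z \<kappa> N mult_right_mono[of "cmod z" \<kappa> N] by simp
      note inv = pert_invertible[OF N(2) zN]
      have z\<kappa>: "cmod z <= \<kappa>" using z by simp
      define U where "U = pert E z"
      \<comment> \<open>\<open>U M = E\<close>, so \<open>M *v arc x\<close> consists of the
        coordinates of the velocity \<open>E *v arc x\<close> in the deformed frame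
        \<open>U *v axis k 1\<close>. In \<open>sumD\<close> the trace of \<open>M\<close> comes
        from the moving determinant and the derivative of \<open>h\<close> from the moving
        points.\<close>
      define M where "M = matrix_inv U ** E"
      have UM: "U *v (M *v v) = E *v v" for v
        using matrix_inv_left_right[OF inv(1)] by (simp add: M_def U_def matrix_vector_mul_assoc matrix_mul_assoc)
      define D where "D = (%k x. M $ k $ k * h (U *v arc x) + (M *v arc x) $ k * dir_deriv h (U *v arc x) (U *v axis k 1))"
      have US: "U *v arc x \<in> S" if "x \<in> cbox a b" for x using inS[OF z\<kappa> that] by (simp add: U_def)
      have cUa: "continuous_on (cbox a b) (%x. U *v arc x)" by (intro continuous_intros continuous_on_arc)
      have chU: "continuous_on (cbox a b) (%x. h (U *v arc x))"
        by (rule continuous_on_compose2[OF hc cUa]) (simp add: image_subset_iff US)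
      have cD: "continuous_on (cbox a b) (%x. D k x * jac x)" for k
        unfolding D_def
        by (intro continuous_intros continuous_on_jac continuous_on_arc chU continuous_on_component continuous_on_compose2[OF continuous_on_dir_deriv[OF h oS] cUa])
          (simp_all add: image_subset_iff US)
      have cJ': "continuous_on (cbox a b) (%x. dir_deriv h (U *v arc x) (E *v arc x) * jac x)"
      proof -
        have "continuous_on (cbox a b) (%x. (\<Sum>k\<in>UNIV. (E *v arc x) $ k * dir_deriv h (U *v arc x) (axis k 1)) * jac x)"
          by (intro continuous_intros continuous_on_jac continuous_on_arc continuous_on_component continuous_on_compose2[OF continuous_on_dir_deriv[OF h oS] cUa])
            (simp_all add: image_subset_iff US)
        then show ?thesis 
        proof (rule continuous_on_eq)
          fix x assume "x \<in> cbox a b"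
          from holomorphic_vec_derivative(3)[OF h US[OF this], of "E *v arc x"]
          show "(\<Sum>k\<in>UNIV. (E *v arc x) $ k * dir_deriv h (U *v arc x) (axis k 1)) * jac x = dir_deriv h (U *v arc x) (E *v arc x) * jac x"
            by simp
        qed
      qed
      have sumD: "(\<Sum>k\<in>UNIV. D k x) = trace M * h (U *v arc x) + dir_deriv h (U *v arc x) (E *v arc x)" if x: "x \<in> cbox a b" for x
      proof -
        define w where "w = M *v arc x"
        have lin: "linear (dir_deriv h (U *v arc x))" using holomorphic_vec_derivative(1)[OF h US[OF x]] has_derivative_linear by blast
        have "U *v w = (\<Sum>k\<in>UNIV. w $ k *s (U *v axis k 1))"
          by (simp add: vec_eq_iff matrix_vector_mult_axis sum_component mult.commute) (simp add: matrix_vector_mult_def mult.commute)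
        then have "dir_deriv h (U *v arc x) (U *v w) = (\<Sum>k\<in>UNIV. w $ k * dir_deriv h (U *v arc x) (U *v axis k 1))"
          by (simp add: linear_sum[OF lin] holomorphic_vec_derivative(2)[OF h US[OF x]])
        then show ?thesis unfolding D_def by (simp add: sum.distrib sum_distrib_right[symmetric] trace_def w_def UM)
      qed
      have "trace M * J z + J' z = integral (cbox a b) (%x. \<Sum>k\<in>UNIV. D k x * jac x)"
      proof -
        have "trace M * J z + J' z = integral (cbox a b) (%x. trace M * (h (U *v arc x) * jac x)) + integral (cbox a b) (%x. dir_deriv h (U *v arc x) (E *v arc x) * jac x)"
          unfolding J_def J'_def U_def[symmetric] by simp
        also have "\<dots> = integral (cbox a b) (%x. trace M * (h (U *v arc x) * jac x) + dir_deriv h (U *v arc x) (E *v arc x) * jac x)"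
          by (intro integral_add[symmetric] integrable_continuous cJ' continuous_intros chU continuous_on_jac)
        also have "\<dots> = integral (cbox a b) (%x. \<Sum>k\<in>UNIV. D k x * jac x)"
          by (rule integral_cong) (simp add: sum_distrib_right[symmetric] sumD algebra_simps)
        finally show ?thesis .
      qed
      also have "\<dots> = (\<Sum>k\<in>UNIV. integral (cbox a b) (%x. D k x * jac x))"
        by (intro integral_sum integrable_continuous cD) auto
      also have "cmod \<dots> <= (\<Sum>k\<in>UNIV. (\<pi> k * (2 * (2 * N * R) * \<epsilon>)) * V k)"
      proof (intro order_trans[OF norm_sum] sum_mono)
        fix k
        show "cmod (integral (cbox a b) (%x. D k x * jac x)) <= (\<pi> k * (2 * (2 * N * R) * \<epsilon>)) * V k"
          unfolding V_def
        proof (rule norm_integral_cbox_le_slices[OF cD])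
          show "0 <= \<pi> k * (2 * (2 * N * R) * \<epsilon>)" using \<pi>0 N R0 \<epsilon>0 by simp
          show "a $ j <= b $ j" for j using ab[of j] by simp
          fix x assume x: "x \<in> cbox a b"
          define \<Psi> where "\<Psi> = (%x. (M *v arc x) $ k * h (U *v arc x))"
          have fb: "cmod (\<Psi> y) <= 2 * N * R * \<epsilon>" if y: "y \<in> cbox a b" "y $ k = a $ k \<or> y $ k = b $ k" for y
          proof -
            have "cmod ((M *v arc y) $ k) <= norm (M *v arc y)" by (rule Finite_Cartesian_Product.norm_nth_le)
            also have "\<dots> <= 2 * norm (E *v arc y)" unfolding M_def U_def using inv(2)[of "E *v arc y"] by (simp add: matrix_vector_mul_assoc)
            also have "\<dots> <= 2 * (N * R)"
              using N(2)[of "arc y"] mult_left_mono[OF R[OF y(1)] N(1)] by simp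
            finally show ?thesis
              unfolding \<Psi>_def norm_mult using face[OF z\<kappa> y] N R0 U_def by (intro mult_mono) auto
          qed
          have "cmod (\<Psi> (vupd x k (b $ k)) - \<Psi> (vupd x k (a $ k))) <= 2 * N * R * \<epsilon> + 2 * N * R * \<epsilon>"
            using ab[of k] vupd_mem_cbox[OF x] by (intro order_trans[OF norm_triangle_ineq4] add_mono fb) auto
          moreover have "cmod (\<Prod>j\<in>UNIV - {k}. c' j (x $ j)) <= \<pi> k"
            unfolding \<pi>_def prod_norm[symmetric] using x B by (intro prod_mono) (auto simp: mem_box_cart)
          ultimately have "cmod ((\<Prod>j\<in>UNIV - {k}. c' j (x $ j)) * (\<Psi> (vupd x k (b $ k)) - \<Psi> (vupd x k (a $ k)))) <= \<pi> k * (2 * (2 * N * R) * \<epsilon>)"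
            unfolding norm_mult using \<pi>0 by (intro mult_mono) auto
          moreover have "integral {a $ k..b $ k} (%s. D k (vupd x k s) * jac (vupd x k s)) =
              (\<Prod>j\<in>UNIV - {k}. c' j (x $ j)) * (\<Psi> (vupd x k (b $ k)) - \<Psi> (vupd x k (a $ k)))"
            using boundary_slice[OF h US x, where k=k and M=M] unfolding D_def \<Psi>_def .
          ultimately show "cmod (integral {a $ k..b $ k} (%s. D k (vupd x k s) * jac (vupd x k s))) <= \<pi> k * (2 * (2 * N * R) * \<epsilon>)"
            by (simp only:)
        qed
      qed
      finally have "cmod (trace M * J z + J' z) <= (\<Sum>k\<in>UNIV. (\<pi> k * (2 * (2 * N * R) * \<epsilon>)) * V k)" .
      then have "cmod (det U * (trace M * J z + J' z)) <= \<Delta> * (\<Sum>k\<in>UNIV. (\<pi> k * (2 * (2 * N * R) * \<epsilon>)) * V k)"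
        unfolding norm_mult using \<Delta>[OF z\<kappa>] \<Delta>0 by (intro mult_mono) (auto simp: U_def)
      also have "\<dots> = \<Delta> * (\<Sum>k\<in>UNIV. \<pi> k * (2 * (2 * N * R)) * V k) * \<epsilon>"
        by (simp add: sum_distrib_left sum_distrib_right mult_ac)
      finally show ?thesis by (simp add: U_def M_def)
    qed
    have "cmod (det (pert E (of_real t)) * J (of_real t) - det (pert E 0) * J 0) <= (\<Delta> * (\<Sum>k\<in>UNIV. \<pi> k * (2 * (2 * N * R)) * V k) * \<epsilon>) * cmod (of_real t - 0)"
      using t by (intro field_differentiable_bound[of "ball 0 \<kappa>", OF _ has_field_derivative_at_within[OF dD] bound]) auto
    also have "\<dots> <= (\<Delta> * (\<Sum>k\<in>UNIV. \<pi> k * (2 * (2 * N * R)) * V k) * \<epsilon>) * \<kappa>"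
      using t \<Delta>0 \<pi>0 V0 N R0 \<epsilon>0 by (intro mult_left_mono mult_nonneg_nonneg sum_nonneg) auto
    also have "\<dots> = K * \<epsilon>" by (simp add: K_def)
    finally show "cmod (det (pert E (of_real t)) * integral (cbox a b) (%x. h (pert E (of_real t) *v arc x) * jac x)
            - integral (cbox a b) (%x. h (arc x) * jac x)) <= K * \<epsilon>"
      by (simp add: J_def pert_0)
  qed
qed

end

section \<open>Laplace's method\<close>

text \<open>Deformations must be complex linear, while conjugation is not. On the line of real
  multiples of \<open>v $ j\<close>, conjugation agrees with multiplication by
  \<open>cnj (v $ j) / v $ j\<close>; the matrix applies this in each coordinate before
  \<open>cnj A\<close>.\<close>

definition rotation_gen :: "complex ^ 'm::finite ^ 'm => complex ^ 'm => complex ^ 'm ^ 'm" where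
  "rotation_gen A v = (\<chi> k j. cnj (A $ k $ j) * (cnj (v $ j) / v $ j))"

definition diag_mat :: "complex ^ 'm::finite => complex ^ 'm ^ 'm" where
  "diag_mat v = (\<chi> k j. if k = j then v $ k else 0)"

lemma diag_mat_mult_vec: "diag_mat v *v x = (\<chi> k. v $ k * x $ k)"
proof -
  have "(\<Sum>j\<in>UNIV. (if i = j then v $ i else 0) * x $ j) = (\<Sum>j\<in>UNIV. if i = j then v $ i * x $ j else 0)" for i
    by (rule sum.cong) auto
  then show ?thesis by (simp add: diag_mat_def matrix_vector_mult_def vec_eq_iff)
qed

lemma det_diag_mat: "det (diag_mat v) = (\<Prod>k\<in>UNIV. v $ k)"
  by (subst det_diagonal) (auto simp: diag_mat_def)

text \<open>The direction \<open>rotation_gen A v\<close> is chosen such that \<open>E \<theta> = cnj (A \<theta>)\<close> on the real span of the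
  tangent directions; there the real part of the quadratic form grows like \<open>|A \<theta>|\<^sup>2\<close>.\<close>

lemma rotation_increases_Re:
  fixes A :: "complex ^ 'm::finite ^ 'm" and P :: "complex ^ 'm => complex"
  assumes P: "holomorphic_vec P (ball 0 R)" and R: "0 < R"
    and exp: "!!\<theta>. norm \<theta> <= r ==> cmod (P \<theta> - bilin \<theta> A \<theta> / 2) <= K * norm \<theta> ^ 3" and r: "0 < r" and K: "0 <= K"
    and sym: "transpose A = A" and det: "det A ~= 0"
  obtains \<omega> r0 c \<kappa> where "0 < \<omega>" "0 < r0" "0 < c" "0 < \<kappa>"
    "!!\<theta> t. norm \<theta> <= r0 ==> (!!k. cmod (cnj (v $ k) / v $ k * \<theta> $ k - cnj (\<theta> $ k)) <= \<omega> * cmod (\<theta> $ k)) ==> 0 <= t ==> t <= \<kappa> ==>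
      Re (P \<theta>) + t * c * (norm \<theta>)\<^sup>2 <= Re (P (pert (rotation_gen A v) (of_real t) *v \<theta>))"
proof -
  define E where "E = rotation_gen A v"
  obtain NA where NA: "0 <= NA" "!!u. norm (A *v u) <= NA * norm u" using norm_matrix_vector_mult_le by blast
  obtain NE where NE: "0 <= NE" "!!u. norm (E *v u) <= NE * norm u" using norm_matrix_vector_mult_le by blast
  obtain NI where NI: "0 <= NI" "!!u. norm (matrix_inv A *v u) <= NI * norm u" using norm_matrix_vector_mult_le by blast
  define CA where "CA = NI + 1"
  have CA: "0 < CA" using NI by (simp add: CA_def)
  have lowA: "norm u <= CA * norm (A *v u)" for u
  proof -
    have "matrix_inv A *v (A *v u) = u" by (simp add: matrix_vector_mul_assoc matrix_inv_left_right[OF det])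
    then have "norm u <= NI * norm (A *v u)" using NI(2)[of "A *v u"] by simp
    also have "\<dots> <= CA * norm (A *v u)" by (simp add: CA_def mult_right_mono)
    finally show ?thesis .
  qed
  define SA where "SA = (\<Sum>k\<in>UNIV. \<Sum>j\<in>UNIV. cmod (A $ k $ j))"
  have SA: "0 <= SA" unfolding SA_def by (intro sum_nonneg) simp
  define n where "n = real CARD('m)"
  define a0 where "a0 = 1 / CA\<^sup>2"
  have a0: "0 < a0" using CA by (simp add: a0_def)
  define L1 where "L1 = n * NA * SA + 1"
  have L1: "0 < L1" using NA SA by (simp add: L1_def n_def add_nonneg_pos)
  \<comment> \<open>\<open>a0 |\<theta>|^2\<close> is a lower bound for
    \<open>|A \<theta>|^2\<close>. Deviation from the tangent directions may use up half of it;
    \<open>\<kappa>\<close> and \<open>r0\<close> below limit the term quadratic in \<open>t\<close>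
    and the cubic remainder to an eighth each, which leaves \<open>a0 / 4\<close>. The summand 1 in
    \<open>L1\<close>, \<open>L2\<close>, \<open>L3\<close> makes division by them safe.\<close>
  define \<omega> where "\<omega> = a0 / (2 * L1)"
  define \<rho> where "\<rho> = 1 / (NE + 1)"
  have \<rho>: "0 < \<rho>" using NE by (simp add: \<rho>_def)
  define L2 where "L2 = SA * NE\<^sup>2 + 1"
  have L2: "0 < L2" using SA by (simp add: L2_def add_nonneg_pos)
  define L3 where "L3 = 16 * K / \<rho> + 1"
  have L3: "0 < L3" using K \<rho> by (simp add: L3_def add_nonneg_pos)
  define \<kappa> where "\<kappa> = min (\<rho> / 4) (a0 / (4 * L2))"
  define r0 where "r0 = min (min r (R / 2) / 2) (a0 / (8 * L3))"
  have \<omega>: "0 < \<omega>" using a0 L1 by (simp add: \<omega>_def)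
  have \<kappa>: "0 < \<kappa>" "\<kappa> <= \<rho> / 4" "\<kappa> * L2 <= a0 / 4"
  proof -
    show "0 < \<kappa>" using \<rho> a0 L2 by (simp add: \<kappa>_def)
    show "\<kappa> <= \<rho> / 4" by (simp add: \<kappa>_def)
    have "\<kappa> <= a0 / (4 * L2)" by (simp add: \<kappa>_def)
    then have "\<kappa> * L2 <= a0 / (4 * L2) * L2" using L2 by (intro mult_right_mono) auto
    then show "\<kappa> * L2 <= a0 / 4" using L2 by simp
  qed
  have r0: "0 < r0" "2 * r0 <= r" "2 * r0 < R" "r0 * L3 <= a0 / 8"
  proof -
    show "0 < r0" using r R a0 L3 by (simp add: r0_def)
    have "r0 <= min r (R / 2) / 2" unfolding r0_def by (rule min.cobounded1)
    then show "2 * r0 <= r" "2 * r0 < R" using R by linarith+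
    have "r0 <= a0 / (8 * L3)" unfolding r0_def by (rule min.cobounded2)
    then have "r0 * L3 <= a0 / (8 * L3) * L3" using L3 by (intro mult_right_mono) auto
    then show "r0 * L3 <= a0 / 8" using L3 by simp
  qed
  show ?thesis
  proof (rule that[of \<omega> r0 "a0 / 4" \<kappa>])
    fix \<theta> :: "complex ^ 'm" and t :: real
    assume \<theta>: "norm \<theta> <= r0" and near: "!!k. cmod (cnj (v $ k) / v $ k * \<theta> $ k - cnj (\<theta> $ k)) <= \<omega> * cmod (\<theta> $ k)"
      and t: "0 <= t" "t <= \<kappa>"
    define u where "u = E *v \<theta>"
    define X where "X = bilin \<theta> A u"
    have ReX: "a0 / 2 * (norm \<theta>)\<^sup>2 <= Re X"
    proof -
      define e where "e = (%k. \<Sum>j\<in>UNIV. cnj (A $ k $ j) * (cnj (v $ j) / v $ j * \<theta> $ j - cnj (\<theta> $ j)))"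
      have uk: "u $ k = cnj ((A *v \<theta>) $ k) + e k" for k
        unfolding u_def E_def rotation_gen_def matrix_vector_mult_def vec_lambda_beta e_def cnj_sum sum.distrib[symmetric]
        by (rule sum.cong) (simp_all add: algebra_simps)
      have ek: "cmod (e k) <= SA * \<omega> * norm \<theta>" for k
      proof -
        have "cmod (e k) <= (\<Sum>j\<in>UNIV. cmod (A $ k $ j) * (\<omega> * norm \<theta>))"
          unfolding e_def
        proof (intro order_trans[OF norm_sum] sum_mono)
          fix j
          have "cmod (cnj (v $ j) / v $ j * \<theta> $ j - cnj (\<theta> $ j)) <= \<omega> * norm \<theta>"
            using near[of j] mult_left_mono[OF Finite_Cartesian_Product.norm_nth_le[of \<theta> j], of \<omega>] \<omega> by linarith
          from mult_left_mono[OF this, of "cmod (A $ k $ j)"]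
          show "cmod (cnj (A $ k $ j) * (cnj (v $ j) / v $ j * \<theta> $ j - cnj (\<theta> $ j))) <= cmod (A $ k $ j) * (\<omega> * norm \<theta>)"
            by (simp add: norm_mult)
        qed
        also have "\<dots> = (\<Sum>j\<in>UNIV. cmod (A $ k $ j)) * (\<omega> * norm \<theta>)" by (simp add: sum_distrib_right)
        also have "\<dots> <= SA * (\<omega> * norm \<theta>)"
          unfolding SA_def using \<omega> by (intro mult_right_mono member_le_sum) (auto intro: sum_nonneg)
        finally show ?thesis by (simp add: mult.assoc)
      qed
      have "X = bilin u A \<theta>" unfolding X_def using bilin_transpose[of \<theta> A u] sym by simp
      also have "\<dots> = (\<Sum>k\<in>UNIV. of_real ((cmod ((A *v \<theta>) $ k))\<^sup>2)) + (\<Sum>k\<in>UNIV. e k * (A *v \<theta>) $ k)"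
        unfolding bilin_eq_sum uk sum.distrib[symmetric]
        by (rule sum.cong) (simp_all only: distrib_left distrib_right complex_norm_square mult.commute)
      finally have X: "X = of_real ((norm (A *v \<theta>))\<^sup>2) + (\<Sum>k\<in>UNIV. e k * (A *v \<theta>) $ k)"
        by (simp add: norm_vec_def L2_set_def sum_nonneg)
      have "cmod (\<Sum>k\<in>UNIV. e k * (A *v \<theta>) $ k) <= (\<Sum>k\<in>(UNIV::'m set). (SA * \<omega> * norm \<theta>) * (NA * norm \<theta>))"
      proof (intro order_trans[OF norm_sum] sum_mono)
        fix k
        have "cmod ((A *v \<theta>) $ k) <= NA * norm \<theta>"
          using Finite_Cartesian_Product.norm_nth_le[of "A *v \<theta>" k] NA(2)[of \<theta>] by linarith
        then show "cmod (e k * (A *v \<theta>) $ k) <= (SA * \<omega> * norm \<theta>) * (NA * norm \<theta>)"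
          unfolding norm_mult using ek[of k] SA \<omega> by (intro mult_mono) auto
      qed
      also have "\<dots> = (n * NA * SA) * (\<omega> * (norm \<theta>)\<^sup>2)" by (simp add: n_def power2_eq_square mult_ac)
      also have "\<dots> <= L1 * (\<omega> * (norm \<theta>)\<^sup>2)" using \<omega> by (intro mult_right_mono) (auto simp: L1_def)
      also have "\<dots> = a0 / 2 * (norm \<theta>)\<^sup>2" using L1 by (simp add: \<omega>_def)
      finally have "cmod (\<Sum>k\<in>UNIV. e k * (A *v \<theta>) $ k) <= a0 / 2 * (norm \<theta>)\<^sup>2" .
      then have "- (a0 / 2 * (norm \<theta>)\<^sup>2) <= Re (\<Sum>k\<in>UNIV. e k * (A *v \<theta>) $ k)"
        by (meson abs_Re_le_cmod abs_le_D2 minus_le_iff order_trans)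
      moreover have "a0 * (norm \<theta>)\<^sup>2 <= (norm (A *v \<theta>))\<^sup>2"
      proof -
        have "(norm \<theta>)\<^sup>2 <= (CA * norm (A *v \<theta>))\<^sup>2" by (intro power_mono lowA) simp
        then show ?thesis using CA by (simp add: a0_def power_mult_distrib divide_le_eq mult.commute)
      qed
      ultimately show ?thesis unfolding X by simp
    qed
    have in2: "norm (\<theta> + w *s u) <= 2 * norm \<theta>" if "cmod w <= \<rho>" for w
    proof -
      have "norm (w *s u) <= \<rho> * (NE * norm \<theta>)"
        unfolding norm_vector_scalar_mult u_def using that \<rho> NE(2)[of \<theta>] by (intro mult_mono) auto
      also have "\<dots> <= 1 * norm \<theta>"
        unfolding mult.assoc[symmetric] using NE by (intro mult_right_mono) (auto simp: \<rho>_def field_simps)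
      finally show ?thesis using norm_triangle_ineq[of \<theta> "w *s u"] by simp
    qed
    define quad where "quad = (%w. bilin \<theta> A \<theta> / 2 + w * X + w\<^sup>2 * (bilin u A u / 2))"
    have quad: "bilin (\<theta> + w *s u) A (\<theta> + w *s u) / 2 = quad w" for w
    proof -
      have "bilin u A \<theta> = X" unfolding X_def using bilin_transpose[of \<theta> A u] sym by simp
      then show ?thesis unfolding quad_def
        by (simp add: bilin_add_left bilin_add_right bilin_scale_left bilin_scale_right X_def[symmetric] power2_eq_square field_simps)
    qed
    \<comment> \<open>The cubic remainder as a holomorphic function of a complex displacement
      \<open>w\<close>. Its size alone would give an error of order \<open>|\<theta>|^3\<close>
      without the factor \<open>t\<close>; Cauchy's estimate for its derivative gives
      \<open>t |\<theta>|^3\<close>, which the gain \<open>t |\<theta>|^2\<close> absorbs for small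
      \<open>\<theta>\<close>.\<close>
    define \<phi> where "\<phi> = (%w. P (\<theta> + w *s u) - quad w)"
    have in_R: "\<theta> + w *s u \<in> ball 0 R" if "cmod w <= \<rho>" for w
      using in2[OF that] \<theta> r0(3) by simp
    have hol: "\<phi> holomorphic_on ball 0 \<rho>"
      unfolding \<phi>_def quad_def using in_R
      by (intro holomorphic_intros holomorphic_vec_on_line[OF P]) auto
    have \<phi>b: "cmod (\<phi> w) <= 8 * K * norm \<theta> ^ 3" if "cmod w <= \<rho>" for w
    proof -
      have "cmod (\<phi> w) <= K * norm (\<theta> + w *s u) ^ 3"
        unfolding \<phi>_def quad[symmetric] using in2[OF that] \<theta> r0(2) by (intro exp) linarith
      also have "\<dots> <= K * (2 * norm \<theta>) ^ 3" using in2[OF that] K by (intro mult_left_mono power_mono) auto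
      finally show ?thesis by (simp add: power_mult_distrib)
    qed
    have d\<phi>: "cmod (deriv \<phi> w) <= 16 * K * norm \<theta> ^ 3 / \<rho>" if w: "w \<in> cball 0 (\<rho> / 4)" for w
    proof -
      have sub: "cmod y < \<rho>" if "cmod (w - y) <= \<rho> / 2" for y
        using that w \<rho> norm_triangle_ineq2[of y w] by (simp add: norm_minus_commute)
      have "cmod ((deriv ^^ 1) \<phi> w) <= fact 1 * (8 * K * norm \<theta> ^ 3) / (\<rho> / 2) ^ 1"
      proof (rule Cauchy_inequality)
        show "\<phi> holomorphic_on ball w (\<rho> / 2)"
          by (rule holomorphic_on_subset[OF hol]) (use sub in \<open>auto simp: dist_norm\<close>)
        show "continuous_on (cball w (\<rho> / 2)) \<phi>"
          by (rule continuous_on_subset[OF holomorphic_on_imp_continuous_on[OF hol]]) (use sub in \<open>auto simp: dist_norm\<close>)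
        show "cmod (\<phi> y) <= 8 * K * norm \<theta> ^ 3" if "cmod (w - y) = \<rho> / 2" for y
          using sub[of y] that by (intro \<phi>b) simp
      qed (use \<rho> in simp)
      then show ?thesis by (simp add: field_simps)
    qed
    have "cmod (\<phi> (of_real t) - \<phi> 0) <= 16 * K * norm \<theta> ^ 3 / \<rho> * cmod (of_real t - 0)"
    proof (rule field_differentiable_bound[of "cball 0 (\<rho> / 4)"])
      show "(\<phi> has_field_derivative deriv \<phi> w) (at w within cball 0 (\<rho> / 4))" if "w \<in> cball 0 (\<rho> / 4)" for w
        using that \<rho> by (intro has_field_derivative_at_within[OF holomorphic_derivI[OF hol open_ball]]) auto
    qed (use d\<phi> t \<kappa> \<rho> in auto)
    then have R1: "cmod (\<phi> (of_real t) - \<phi> 0) <= t * (16 * K / \<rho> * norm \<theta>) * (norm \<theta>)\<^sup>2"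
      using t by (simp add: power3_eq_cube power2_eq_square mult_ac)
    have "16 * K / \<rho> * norm \<theta> <= L3 * r0" using \<theta> K \<rho> by (intro mult_mono) (auto simp: L3_def)
    also have "\<dots> <= a0 / 8" using r0(4) by (simp add: mult.commute)
    finally have "t * (16 * K / \<rho> * norm \<theta>) * (norm \<theta>)\<^sup>2 <= t * (a0 / 8) * (norm \<theta>)\<^sup>2"
      using t by (intro mult_right_mono mult_left_mono) auto
    with R1 have R2: "cmod (\<phi> (of_real t) - \<phi> 0) <= t * (a0 / 8) * (norm \<theta>)\<^sup>2" by linarith
    have "cmod (bilin u A u) <= SA * norm u * norm u" unfolding SA_def by (rule bilin_bound)
    also have "\<dots> <= SA * (NE * norm \<theta>) * (NE * norm \<theta>)"
      using SA NE(2)[of \<theta>] NE(1) unfolding u_def by (intro mult_mono) auto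
    also have "\<dots> <= L2 * (norm \<theta>)\<^sup>2"
    proof -
      have "SA * (NE * norm \<theta>) * (NE * norm \<theta>) = (SA * NE\<^sup>2) * (norm \<theta>)\<^sup>2" by (simp add: power2_eq_square mult_ac)
      moreover have "(SA * NE\<^sup>2) * (norm \<theta>)\<^sup>2 <= L2 * (norm \<theta>)\<^sup>2" by (intro mult_right_mono) (auto simp: L2_def)
      ultimately show ?thesis by linarith
    qed
    finally have bu: "cmod (bilin u A u) <= L2 * (norm \<theta>)\<^sup>2" .
    have tL: "t * L2 <= a0 / 4" using mult_right_mono[OF t(2), of L2] L2 \<kappa>(3) by linarith
    have R3: "cmod ((of_real t)\<^sup>2 * (bilin u A u / 2)) <= t * (a0 / 8) * (norm \<theta>)\<^sup>2"
    proof -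
      have "cmod ((of_real t)\<^sup>2 * (bilin u A u / 2)) = t\<^sup>2 * (cmod (bilin u A u) / 2)"
        using t by (simp add: norm_mult norm_power norm_divide)
      also have "\<dots> <= t\<^sup>2 * (L2 * (norm \<theta>)\<^sup>2 / 2)" using bu by (intro mult_left_mono) auto
      also have "\<dots> = t * ((t * L2) / 2) * (norm \<theta>)\<^sup>2" by (simp add: power2_eq_square)
      also have "\<dots> <= t * (a0 / 8) * (norm \<theta>)\<^sup>2" using t tL by (intro mult_right_mono mult_left_mono) (auto simp: mult_ac)
      finally show ?thesis .
    qed
    have "P (pert E (of_real t) *v \<theta>) - P \<theta> = of_real t * X + (of_real t)\<^sup>2 * (bilin u A u / 2) + (\<phi> (of_real t) - \<phi> 0)"
      by (simp add: pert_mult_vec \<phi>_def quad_def u_def)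
    then have "Re (P (pert E (of_real t) *v \<theta>)) - Re (P \<theta>) = t * Re X + Re ((of_real t)\<^sup>2 * (bilin u A u / 2)) + Re (\<phi> (of_real t) - \<phi> 0)"
    proof -
      assume eq: "P (pert E (of_real t) *v \<theta>) - P \<theta> = of_real t * X + (of_real t)\<^sup>2 * (bilin u A u / 2) + (\<phi> (of_real t) - \<phi> 0)"
      have "Re (of_real t * X) = t * Re X" by simp
      then show ?thesis using arg_cong[OF eq, of Re] by (simp only: minus_complex.sel plus_complex.sel)
    qed
    moreover have "- (t * (a0 / 8) * (norm \<theta>)\<^sup>2) <= Re ((of_real t)\<^sup>2 * (bilin u A u / 2))"
      using R3 abs_Re_le_cmod[of "(of_real t)\<^sup>2 * (bilin u A u / 2)"] by linarith
    moreover have "- (t * (a0 / 8) * (norm \<theta>)\<^sup>2) <= Re (\<phi> (of_real t) - \<phi> 0)"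
      using R2 abs_Re_le_cmod[of "\<phi> (of_real t) - \<phi> 0"] by linarith
    moreover have "t * (a0 / 2 * (norm \<theta>)\<^sup>2) <= t * Re X" using t ReX by (intro mult_left_mono) auto
    ultimately have "t * (a0 / 2 * (norm \<theta>)\<^sup>2) - 2 * (t * (a0 / 8) * (norm \<theta>)\<^sup>2) <= Re (P (pert E (of_real t) *v \<theta>)) - Re (P \<theta>)"
      by linarith
    then show "Re (P \<theta>) + t * (a0 / 4) * (norm \<theta>)\<^sup>2 <= Re (P (pert (rotation_gen A v) (of_real t) *v \<theta>))"
      unfolding E_def[symmetric] by (simp add: algebra_simps)
  qed (use \<omega> r0 a0 \<kappa> in auto)
qed

section \<open>Rescaling at the saddle and the limiting Gaussian integral\<close>

lemma holomorphic_vec_lipschitz: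
  assumes F: "holomorphic_vec F (ball 0 R)" and R: "0 < R" "\<rho> < R"
  obtains B where "0 <= B" "!!x y. norm x <= \<rho> ==> norm y <= \<rho> ==> cmod (F x - F y) <= B * norm (x - y)"
proof -
  have sub: "cball (0 :: complex ^ 'a) \<rho> \<subseteq> ball 0 R" using R by auto
  have "bounded ((%\<theta>. dir_deriv F \<theta> (axis k 1)) ` cball 0 \<rho>)" for k
    by (intro compact_imp_bounded compact_continuous_image continuous_on_subset[OF continuous_on_dir_deriv[OF F open_ball] sub] compact_cball)
  then have "\<forall>k. \<exists>b. \<forall>\<theta>\<in>cball 0 \<rho>. cmod (dir_deriv F \<theta> (axis k 1)) <= b" unfolding bounded_iff by blast
  then obtain b where b: "!!k \<theta>. \<theta> \<in> cball 0 \<rho> ==> cmod (dir_deriv F \<theta> (axis k 1)) <= b k" by metis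
  define B where "B = (\<Sum>k\<in>UNIV. \<bar>b k\<bar>)"
  show ?thesis
  proof (rule that[of B])
    show "0 <= B" unfolding B_def by (intro sum_nonneg) simp
    fix x y :: "complex ^ 'a" assume xy: "norm x <= \<rho>" "norm y <= \<rho>"
    show "cmod (F x - F y) <= B * norm (x - y)"
    proof (rule differentiable_bound[of "cball 0 \<rho>" F "%\<theta>. dir_deriv F \<theta>"])
      fix \<theta> :: "complex ^ 'a" assume \<theta>: "\<theta> \<in> cball 0 \<rho>"
      then have \<theta>R: "\<theta> \<in> ball 0 R" using sub by blast
      show "(F has_derivative dir_deriv F \<theta>) (at \<theta> within cball 0 \<rho>)"
        by (rule has_derivative_at_withinI[OF holomorphic_vec_derivative(1)[OF F \<theta>R]])
      show "onorm (dir_deriv F \<theta>) <= B"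
      proof (rule onorm_le)
        fix u :: "complex ^ 'a"
        have "cmod (dir_deriv F \<theta> u) <= (\<Sum>k\<in>UNIV. cmod (u $ k) * cmod (dir_deriv F \<theta> (axis k 1)))"
          unfolding holomorphic_vec_derivative(3)[OF F \<theta>R, of u] by (rule order_trans[OF norm_sum]) (simp add: norm_mult)
        also have "\<dots> <= (\<Sum>k\<in>UNIV. norm u * \<bar>b k\<bar>)"
          using b[OF \<theta>] by (intro sum_mono mult_mono Finite_Cartesian_Product.norm_nth_le) (auto intro: order_trans abs_ge_self)
        also have "\<dots> = B * norm u" by (simp add: B_def sum_distrib_left sum_distrib_right mult.commute)
        finally show "norm (dir_deriv F \<theta> u) <= B * norm u" .
      qed
    qed (use xy in auto)
  qed
qed

lemma integral_lborel_affine: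
  fixes f :: "'a::euclidean_space => complex"
  assumes f: "f \<in> borel_measurable borel" and s: "0 < s"
  shows "of_real (s ^ DIM('a)) * (\<integral>x. f x \<partial>lborel) = (\<integral>y. f (x0 + y /\<^sub>R s) \<partial>lborel)"
proof -
  have L: "(lborel :: 'a measure) = density (distr lborel borel (%x. x0 + (1 / s) *\<^sub>R x)) (%_. ennreal (\<bar>1 / s\<bar> ^ DIM('a)))"
    using lborel_affine[of "1 / s" x0] s by simp
  have m: "(%x. x0 + (1 / s) *\<^sub>R x) \<in> measurable lborel borel" by simp
  have "(\<integral>x. f x \<partial>lborel) = (\<integral>x. (\<bar>1 / s\<bar> ^ DIM('a)) *\<^sub>R f x \<partial>distr lborel borel (%x. x0 + (1 / s) *\<^sub>R x))"
    by (subst L, rule integral_density) (use f in auto)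
  also have "\<dots> = (\<integral>y. (\<bar>1 / s\<bar> ^ DIM('a)) *\<^sub>R f (x0 + (1 / s) *\<^sub>R y) \<partial>lborel)"
    by (rule integral_distr[OF m]) (use f in simp)
  also have "\<dots> = of_real ((1 / s) ^ DIM('a)) * (\<integral>y. f (x0 + (1 / s) *\<^sub>R y) \<partial>lborel)"
    using s by (simp add: scaleR_conv_of_real)
  finally have "(\<integral>x. f x \<partial>lborel) = of_real ((1 / s) ^ DIM('a)) * (\<integral>y. f (x0 + y /\<^sub>R s) \<partial>lborel)"
    by (simp add: divide_inverse)
  then have "of_real (s ^ DIM('a)) * (\<integral>x. f x \<partial>lborel) = of_real (s ^ DIM('a) * (1 / s) ^ DIM('a)) * (\<integral>y. f (x0 + y /\<^sub>R s) \<partial>lborel)"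
    by (simp only: of_real_mult mult.assoc)
  also have "s ^ DIM('a) * (1 / s) ^ DIM('a) = 1"
    unfolding power_mult_distrib[symmetric] using s by simp
  finally show ?thesis by simp
qed

lemma bounded_linear_matrix_vector_mult:
  fixes A :: "complex ^ 'n::finite ^ 'n"
  shows "bounded_linear ((*v) A)"
proof -
  obtain K where "!!v. norm (A *v v) <= K * norm v" using norm_matrix_vector_mult_le by blast
  then have "norm (A *v v) <= norm v * K" for v by (simp add: mult.commute)
  moreover have "A *v (r *\<^sub>R x) = r *\<^sub>R (A *v x)" for r x
    by (simp add: matrix_vector_mult_def vec_eq_iff scaleR_sum_right)
  ultimately show ?thesis
    by (intro bounded_linear_intro[of _ K] matrix_vector_right_distrib)
qed

definition saddle_map :: "complex ^ 'm::finite ^ 'm => complex ^ 'm => real => complex ^ 'm ^ 'm" where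
  "saddle_map A v t = pert (rotation_gen A v) (of_real t) ** diag_mat v"

text \<open>The integral of \<open>exp (- bilin \<theta> A \<theta> / 2)\<close> over the tangent
  space tilted by \<open>t\<close>, with the determinant as Jacobian. The tilt makes the integral
  converge; the value selects one of the two square roots of
  \<open>(2 \<pi>)^m / det A\<close>.\<close>

definition gauss_branch :: "complex ^ 'm::finite ^ 'm => complex ^ 'm => real => complex" where
  "gauss_branch A v t = det (saddle_map A v t) *
     (\<integral>y. gauss_exp (transpose (saddle_map A v t) ** A ** saddle_map A v t) 0 y \<partial>lborel)"

lemma gauss_exp_substitute:
  fixes V A :: "complex ^ 'm::finite ^ 'm"
  shows "exp (- bilin (V *v cvec y) A (V *v cvec y) / 2 - (\<Sum>k\<in>UNIV. \<eta> $ k * (V *v cvec y) $ k)) =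
     gauss_exp (transpose V ** A ** V) (transpose V *v \<eta>) y"
proof -
  have "(\<Sum>k\<in>UNIV. \<eta> $ k * (V *v cvec y) $ k) = bilin \<eta> (mat 1) (V *v cvec y)"
    by (simp add: bilin_eq_sum)
  also have "\<dots> = bilin \<eta> V (cvec y)"
    by (simp add: bilin_eq_sum)
  also have "\<dots> = bilin (cvec y) (transpose V) \<eta>" by (rule bilin_transpose)
  also have "\<dots> = (\<Sum>k\<in>UNIV. (transpose V *v \<eta>) $ k * of_real (y $ k))"
    by (simp add: bilin_eq_sum mult.commute)
  finally show ?thesis unfolding gauss_exp_def bilin_mult_vec by simp
qed

text \<open>The congruence by \<open>V\<close> drops out of both results: it leaves the value of the
  inverse form at \<open>\<eta>\<close> unchanged, and
  \<open>det B = (det V)^2 det A\<close>.\<close>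

lemma gauss_integral_saddle:
  fixes A V :: "complex ^ 'm::finite ^ 'm"
  assumes sym: "transpose A = A" and detA: "det A ~= 0" and c: "0 < c"
    and pos: "!!y. c * (norm y)\<^sup>2 <= Re (bilin (cvec y) (transpose V ** A ** V) (cvec y))"
  shows "(\<integral>y. gauss_exp (transpose V ** A ** V) (transpose V *v \<eta>) y \<partial>lborel) =
      exp (bilin \<eta> (matrix_inv A) \<eta> / 2) * (\<integral>y. gauss_exp (transpose V ** A ** V) 0 y \<partial>lborel)"
    and "(det V * (\<integral>y. gauss_exp (transpose V ** A ** V) 0 y \<partial>lborel))\<^sup>2 * det A = (2 * pi) ^ CARD('m)"
proof -
  define B where "B = transpose V ** A ** V"
  have symB: "transpose B = B"
    by (simp add: B_def matrix_transpose_mul sym matrix_mul_assoc)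
  have detB: "det B ~= 0" using det_nonzero_if_Re_pos[OF symB c] pos by (simp add: B_def)
  have detBV: "det B = (det V)\<^sup>2 * det A" by (simp add: B_def det_mul det_transpose power2_eq_square)
  then have detV: "det V ~= 0" using detB by auto
  have "bilin (transpose V *v \<eta>) (matrix_inv B) (transpose V *v \<eta>) = bilin \<eta> (matrix_inv A) \<eta>"
  proof -
    define x where "x = matrix_inv B *v (transpose V *v \<eta>)"
    have "B *v x = transpose V *v \<eta>"
      by (simp add: x_def matrix_vector_mul_assoc matrix_mul_assoc matrix_inv_left_right[OF detB])
    then have "transpose V *v (A *v (V *v x)) = transpose V *v \<eta>"
      by (simp add: B_def matrix_vector_mul_assoc matrix_mul_assoc)
    then have "matrix_inv (transpose V) *v (transpose V *v (A *v (V *v x))) = matrix_inv (transpose V) *v (transpose V *v \<eta>)"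
      by simp
    then have "A *v (V *v x) = \<eta>"
    proof -
      assume eq: "matrix_inv (transpose V) *v (transpose V *v (A *v (V *v x))) = matrix_inv (transpose V) *v (transpose V *v \<eta>)"
      have "matrix_inv (transpose V) ** transpose V = mat 1"
        using matrix_inv_left_right(1)[of "transpose V"] detV by (simp add: det_transpose)
      with eq show ?thesis by (simp only: matrix_vector_mul_assoc matrix_mul_assoc matrix_mul_lid matrix_vector_mul_lid)
    qed
    then have Vx: "V *v x = matrix_inv A *v \<eta>"
      using matrix_inv_left_right[OF detA] by (metis matrix_vector_mul_assoc matrix_vector_mul_lid)
    have "bilin (transpose V *v \<eta>) (matrix_inv B) (transpose V *v \<eta>) = bilin (transpose V *v \<eta>) (mat 1) x"
      by (simp add: bilin_eq_sum x_def)
    also have "\<dots> = bilin x (mat 1) (transpose V *v \<eta>)"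
      using bilin_transpose[of "transpose V *v \<eta>" "mat 1" x] by (simp add: transpose_mat)
    also have "\<dots> = bilin x (transpose V) \<eta>" by (simp add: bilin_eq_sum)
    also have "\<dots> = bilin \<eta> V x" using bilin_transpose[of \<eta> V x] by simp
    also have "\<dots> = bilin \<eta> (matrix_inv A) \<eta>" by (simp add: bilin_eq_sum Vx)
    finally show ?thesis .
  qed
  then show "(\<integral>y. gauss_exp (transpose V ** A ** V) (transpose V *v \<eta>) y \<partial>lborel) =
      exp (bilin \<eta> (matrix_inv A) \<eta> / 2) * (\<integral>y. gauss_exp (transpose V ** A ** V) 0 y \<partial>lborel)"
    using gauss_shift[OF symB c, of "transpose V *v \<eta>"] pos by (simp add: B_def)
  have "(\<integral>y. gauss_exp B 0 y \<partial>lborel)\<^sup>2 * det B = (2 * pi) ^ CARD('m)"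
    by (rule gauss_square[OF symB c]) (use pos in \<open>simp add: B_def\<close>)
  then show "(det V * (\<integral>y. gauss_exp (transpose V ** A ** V) 0 y \<partial>lborel))\<^sup>2 * det A = (2 * pi) ^ CARD('m)"
    unfolding detBV by (simp add: B_def power_mult_distrib mult_ac)
qed

lemma power_times_gaussian_tendsto_0:
  fixes d f :: real
  assumes "0 < d"
  shows "((%s. s ^ n * exp (- s\<^sup>2 * d + s * f)) \<longlongrightarrow> 0) at_top"
proof (rule Lim_null_comparison)
  have "((%s::real. - s\<^sup>2 * d + s * f + s) \<longlongrightarrow> - \<infinity>) at_top \<or> True" by simp
  have "eventually (%s::real. - s\<^sup>2 * d + s * f <= - s) at_top"
  proof (rule eventually_mono[OF eventually_ge_at_top[of "max 0 ((\<bar>f\<bar> + 1) / d)"]])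
    fix s :: real assume s: "max 0 ((\<bar>f\<bar> + 1) / d) <= s"
    then have "\<bar>f\<bar> + 1 <= s * d" using assms by (simp add: divide_le_eq)
    then have "s * (\<bar>f\<bar> + 1) <= s * (s * d)" using s by (intro mult_left_mono) auto
    moreover have "s * f <= s * \<bar>f\<bar>" using s by (intro mult_left_mono) auto
    ultimately show "- s\<^sup>2 * d + s * f <= - s" by (simp add: power2_eq_square algebra_simps)
  qed
  then show "\<forall>\<^sub>F s in at_top. norm (s ^ n * exp (- s\<^sup>2 * d + s * f)) <= s ^ n / exp s"
    using eventually_ge_at_top[of 0]
  proof eventually_elim
    case (elim s)
    have "exp (- s\<^sup>2 * d + s * f) <= exp (- s)" using elim by simp
    then have "s ^ n * exp (- s\<^sup>2 * d + s * f) <= s ^ n * exp (- s)" using elim by (intro mult_left_mono) auto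
    then show ?case using elim by (simp add: exp_minus divide_inverse abs_mult)
  qed
  show "((%s::real. s ^ n / exp s) \<longlongrightarrow> 0) at_top" by (rule tendsto_power_div_exp_0)
qed

context arc_box
begin

lemma jac_bound: obtains J where "0 <= J" "!!x. x \<in> cbox a b ==> cmod (jac x) <= J"
proof -
  have "bounded (jac ` cbox a b)" by (intro compact_imp_bounded compact_continuous_image continuous_on_jac compact_cbox)
  then obtain J where J: "\<forall>y\<in>jac ` cbox a b. cmod y <= J" unfolding bounded_iff by blast
  show ?thesis
  proof (rule that[of "max 0 J"])
    show "cmod (jac x) <= max 0 J" if "x \<in> cbox a b" for x using J that by (simp add: max.coboundedI2)
  qed simp
qed

text \<open>Substitute \<open>x = x0 + y / s\<close> and use dominated convergence. \<open>V\<close>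
  is the derivative of the deformed arc at \<open>x0\<close>. The bound \<open>low\<close> plays two
  parts: before the limit it provides the dominating Gaussian, and in the limit it gives positivity
  of the quadratic form, which is the second claim.\<close>

lemma laplace_deformed:
  fixes P F Q :: "complex ^ 'm => complex"
  assumes P: "holomorphic_vec P (ball 0 R)" and F: "holomorphic_vec F (ball 0 R)" and Q: "holomorphic_vec Q (ball 0 R)" and R: "0 < R"
    and expP: "!!\<theta>. norm \<theta> <= r ==> cmod (P \<theta> - bilin \<theta> A \<theta> / 2) <= K * norm \<theta> ^ 3" and r: "0 < r" and K: "0 <= K"
    and F0: "F 0 = 0" and \<eta>: "!!k. dir_deriv F 0 (axis k 1) = \<eta> $ k"
    and x0: "!!k. a $ k < x0 $ k" "!!k. x0 $ k < b $ k" "arc x0 = 0"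
    and v: "!!k. v $ k = c' k (x0 $ k)"
    and k12: "0 < k1" "!!x. x \<in> cbox a b ==> k1 * norm (x - x0) <= norm (arc x)" "!!x. x \<in> cbox a b ==> norm (arc x) <= k2 * norm (x - x0)"
    and small: "!!x. x \<in> cbox a b ==> norm (U *v arc x) <= R / 2"
    and Ub: "!!u. norm (U *v u) <= 2 * norm u"
    and low: "0 < \<mu>" "!!x. x \<in> cbox a b ==> \<mu> * (norm (arc x))\<^sup>2 <= Re (P (U *v arc x))"
  defines "V \<equiv> U ** diag_mat v"
  shows "((%s. of_real (s ^ CARD('m)) * integral (cbox a b) (%x. exp (- of_real (s\<^sup>2) * P (U *v arc x) - of_real s * F (U *v arc x)) * Q (U *v arc x) * jac x))
     \<longlongrightarrow> Q 0 * (\<Prod>k\<in>UNIV. v $ k) * (\<integral>y. gauss_exp (transpose V ** A ** V) (transpose V *v \<eta>) y \<partial>lborel)) at_top"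
    and "2 * \<mu> * k1\<^sup>2 * (norm y)\<^sup>2 <= Re (bilin (cvec y) (transpose V ** A ** V) (cvec y))"
proof -
  define g where "g = (%s x. exp (- of_real (s\<^sup>2) * P (U *v arc x) - of_real s * F (U *v arc x)) * Q (U *v arc x) * jac x)"
  have UR: "U *v arc x \<in> ball 0 R" if "x \<in> cbox a b" for x using small[OF that] R by simp
  have cU: "continuous_on (cbox a b) (%x. U *v arc x)" by (intro continuous_on_matrix_vector_mult continuous_on_arc)
  have comp: "continuous_on (cbox a b) (%x. f (U *v arc x))" if "holomorphic_vec f (ball 0 R)" for f
    by (rule continuous_on_compose2[OF holomorphic_vec_continuous[OF that] cU]) (simp add: image_subset_iff UR[simplified])
  have cg: "continuous_on (cbox a b) (g s)" for s
    unfolding g_def by (intro continuous_intros comp P F Q continuous_on_jac)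
  define f where "f = (%s x. indicator (cbox a b) x *\<^sub>R g s x)"
  have fi: "integrable lborel (f s)" for s unfolding f_def by (rule borel_integrable_compact[OF compact_cbox cg])
  then have fm: "f s \<in> borel_measurable borel" for s by (auto dest: borel_measurable_integrable)
  have int_eq: "integral (cbox a b) (g s) = (\<integral>x. f s x \<partial>lborel)" for s
    using set_borel_integral_eq_integral(2)[of "cbox a b" "g s"] fi[of s]
    unfolding set_lebesgue_integral_def set_integrable_def f_def by simp
  define Dy where "Dy = (%y :: real ^ 'm. (\<chi> k. v $ k * of_real (y $ k)) :: complex ^ 'm)"
  have Dy: "U *v Dy y = V *v cvec y" for y
    by (simp add: V_def matrix_vector_mul_assoc[symmetric] diag_mat_mult_vec Dy_def)
  have x0in: "x0 \<in> cbox a b" using x0 by (simp add: mem_box_cart less_imp_le)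
  have near: "\<forall>\<^sub>F s in at_top. x0 + y /\<^sub>R s \<in> cbox a b" for y
  proof -
    have "((%s. x0 + y /\<^sub>R s) \<longlongrightarrow> x0 + 0 *\<^sub>R y) at_top"
      by (intro tendsto_intros tendsto_inverse_0_at_top filterlim_ident)
    then have "((%s. x0 + y /\<^sub>R s) \<longlongrightarrow> x0) at_top" by simp
    moreover have "x0 \<in> box a b" using x0 by (simp add: mem_box_cart)
    ultimately have "\<forall>\<^sub>F s in at_top. x0 + y /\<^sub>R s \<in> box a b" by (rule topological_tendstoD[OF _ open_box])
    then show ?thesis by (rule eventually_mono) (use box_subset_cbox in blast)
  qed
  have arc_der: "((%h. arc (x0 + h *\<^sub>R y)) has_vector_derivative Dy y) (at 0)" for y
  proof -
    have 1: "((%h. c k ((x0 + h *\<^sub>R y) $ k)) has_vector_derivative y $ k *\<^sub>R v $ k) (at 0)" for k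
    proof -
      have "(c k has_vector_derivative v $ k) (at (x0 $ k))"
        using der[of "x0 $ k" k] x0(1,2)[of k] v[of k] at_within_Icc_at[of "a $ k" "x0 $ k" "b $ k"] by simp
      then have "(c k has_vector_derivative v $ k) (at (x0 $ k + 0 * y $ k))" by simp
      moreover have "((%h. x0 $ k + h * y $ k) has_vector_derivative y $ k) (at 0)"
        by (auto intro!: derivative_eq_intros)
      ultimately show ?thesis
        using vector_diff_chain_at[of "%h. x0 $ k + h * y $ k" "y $ k" 0 "c k" "v $ k"] by (simp add: o_def)
    qed
    have "((%h. \<Sum>k\<in>UNIV. c k ((x0 + h *\<^sub>R y) $ k) *s axis k 1) has_vector_derivative (\<Sum>k\<in>UNIV. (y $ k *\<^sub>R v $ k) *s axis k (1::complex))) (at 0)"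
    proof (rule has_vector_derivative_sum)
      fix k
      have "((%h. c k ((x0 + h *\<^sub>R y) $ k) *s (axis k 1 :: complex ^ 'm)) has_derivative (%h. (h *\<^sub>R (y $ k *\<^sub>R v $ k)) *s axis k 1)) (at 0)"
        using has_derivative_compose[OF 1[unfolded has_vector_derivative_def] has_derivative_scalar_mult_vec[of "axis k 1" _ UNIV]] .
      moreover have "(%h. (h *\<^sub>R (y $ k *\<^sub>R v $ k)) *s (axis k 1 :: complex ^ 'm)) = (%h. h *\<^sub>R ((y $ k *\<^sub>R v $ k) *s axis k 1))"
        by (auto simp: fun_eq_iff vec_eq_iff)
      ultimately show "((%h. c k ((x0 + h *\<^sub>R y) $ k) *s (axis k 1 :: complex ^ 'm)) has_vector_derivative ((y $ k *\<^sub>R v $ k) *s axis k 1)) (at 0)"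
        unfolding has_vector_derivative_def by (simp only:)
    qed
    moreover have "(\<Sum>k\<in>UNIV. c k ((x0 + h *\<^sub>R y) $ k) *s axis k 1) = arc (x0 + h *\<^sub>R y)" for h
      using basis_expansion[of "arc (x0 + h *\<^sub>R y)"] by (simp add: arc_def)
    moreover have "(\<Sum>k\<in>UNIV. (y $ k *\<^sub>R v $ k) *s axis k 1) = Dy y"
      using basis_expansion[of "Dy y"] by (simp add: Dy_def scaleR_conv_of_real mult.commute)
    ultimately show ?thesis by simp
  qed
  have linU: "bounded_linear ((*v) U)"
    by (rule bounded_linear_matrix_vector_mult)
  have U_der: "((%h. U *v arc (x0 + h *\<^sub>R y)) has_vector_derivative V *v cvec y) (at 0)" for y
    using bounded_linear.has_vector_derivative[OF linU arc_der[of y]] by (simp add: Dy)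
  have U00: "U *v arc (x0 + 0 *\<^sub>R y) = 0" for y using x0(3) by simp
  have filt: "filterlim (%s::real. inverse s) (at 0) at_top"
    unfolding filterlim_at by (auto intro: tendsto_inverse_0_at_top filterlim_ident eventually_gt_at_top[of 0, THEN eventually_mono])
  have scale: "((%s. s *\<^sub>R \<phi> (inverse s)) \<longlongrightarrow> d) at_top"
    if "(\<phi> has_vector_derivative d) (at 0)" "\<phi> 0 = 0" for \<phi> :: "real => 'z::real_normed_vector" and d
  proof -
    have "((%h. (\<phi> h - \<phi> 0) /\<^sub>R (h - 0)) \<longlongrightarrow> d) (at 0)"
      using that(1) unfolding has_vector_derivative_iff_tendsto .
    from filterlim_compose[OF this filt] show ?thesis by (simp add: that(2))
  qed
  define w where "w = (%y. V *v cvec y)"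
  have lim_w: "((%s. s *\<^sub>R (U *v arc (x0 + y /\<^sub>R s))) \<longlongrightarrow> w y) at_top" for y
    using scale[OF U_der U00, of y] by (simp add: w_def)
  have lim_F: "((%s. s *\<^sub>R F (U *v arc (x0 + y /\<^sub>R s))) \<longlongrightarrow> (\<Sum>k\<in>UNIV. \<eta> $ k * w y $ k)) at_top" for y
  proof -
    have 0: "U *v arc (x0 + 0 *\<^sub>R y) \<in> ball 0 R" using U00 R by simp
    have "((%h. F (U *v arc (x0 + h *\<^sub>R y))) has_vector_derivative dir_deriv F 0 (w y)) (at 0)"
      using holomorphic_vec_chain[OF F 0 U_der] U00[of y] by (simp only: w_def)
    moreover have "F (U *v arc (x0 + 0 *\<^sub>R y)) = 0" unfolding U00 by (rule F0)
    ultimately have "((%s. s *\<^sub>R F (U *v arc (x0 + inverse s *\<^sub>R y))) \<longlongrightarrow> dir_deriv F 0 (w y)) at_top" by (rule scale)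
    moreover have "dir_deriv F 0 (w y) = (\<Sum>k\<in>UNIV. \<eta> $ k * w y $ k)"
      using holomorphic_vec_derivative(3)[OF F, of 0 "w y"] R by (simp add: \<eta> mult.commute)
    ultimately show ?thesis by simp
  qed
  have lim_arg: "((%s. U *v arc (x0 + y /\<^sub>R s)) \<longlongrightarrow> 0) at_top" for y
  proof -
    have "((%s. inverse s *\<^sub>R (s *\<^sub>R (U *v arc (x0 + y /\<^sub>R s)))) \<longlongrightarrow> 0 *\<^sub>R w y) at_top"
      by (intro tendsto_scaleR lim_w tendsto_inverse_0_at_top filterlim_ident)
    then have "((%s. inverse s *\<^sub>R (s *\<^sub>R (U *v arc (x0 + y /\<^sub>R s)))) \<longlongrightarrow> 0) at_top"
      by (simp only: scaleR_zero_left)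
    then show ?thesis
      by (rule Lim_transform_eventually) (rule eventually_mono[OF eventually_gt_at_top[of 0]], simp)
  qed
  have lim_P: "((%s. of_real (s\<^sup>2) * P (U *v arc (x0 + y /\<^sub>R s))) \<longlongrightarrow> bilin (w y) A (w y) / 2) at_top" for y
  proof -
    define \<theta> where "\<theta> = (%s. U *v arc (x0 + y /\<^sub>R s))"
    have cont_bil: "isCont (%u. bilin u A u / 2) (w y)"
      using continuous_on_bilin[OF continuous_on_id continuous_on_id, of UNIV A]
      by (intro continuous_intros) (auto simp: continuous_on_eq_continuous_at)
    have 1: "((%s. bilin (s *\<^sub>R \<theta> s) A (s *\<^sub>R \<theta> s) / 2) \<longlongrightarrow> bilin (w y) A (w y) / 2) at_top"
      using isCont_tendsto_compose[OF cont_bil lim_w[of y]] by (simp add: \<theta>_def)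
    \<comment> \<open>After magnification the cubic remainder is
      \<open>K |s \<theta>|^3 / s\<close>, and \<open>s \<theta>\<close> converges.\<close>
    have 2: "((%s. of_real (s\<^sup>2) * P (\<theta> s) - bilin (s *\<^sub>R \<theta> s) A (s *\<^sub>R \<theta> s) / 2) \<longlongrightarrow> 0) at_top"
    proof (rule Lim_null_comparison)
      have "((%s. K * norm (s *\<^sub>R \<theta> s) ^ 3 * inverse s) \<longlongrightarrow> K * norm (w y) ^ 3 * 0) at_top"
        using lim_w[of y] unfolding \<theta>_def by (intro tendsto_intros tendsto_inverse_0_at_top filterlim_ident)
      then show "((%s. K * norm (s *\<^sub>R \<theta> s) ^ 3 * inverse s) \<longlongrightarrow> 0) at_top" by simp
      have "\<forall>\<^sub>F s in at_top. norm (\<theta> s) < r"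
        using tendsto_norm[OF lim_arg[of y]] r order_tendstoD(2) unfolding \<theta>_def by fastforce
      then show "\<forall>\<^sub>F s in at_top. norm (of_real (s\<^sup>2) * P (\<theta> s) - bilin (s *\<^sub>R \<theta> s) A (s *\<^sub>R \<theta> s) / 2) <= K * norm (s *\<^sub>R \<theta> s) ^ 3 * inverse s"
        using eventually_gt_at_top[of 0]
      proof eventually_elim
        case (elim s)
        have sc: "s *\<^sub>R \<theta> s = of_real s *s \<theta> s" by (simp add: vec_eq_iff scaleR_conv_of_real[symmetric])
        have "of_real (s\<^sup>2) * P (\<theta> s) - bilin (s *\<^sub>R \<theta> s) A (s *\<^sub>R \<theta> s) / 2 = of_real (s\<^sup>2) * (P (\<theta> s) - bilin (\<theta> s) A (\<theta> s) / 2)"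
          unfolding sc bilin_scale_left bilin_scale_right by (simp add: power2_eq_square algebra_simps)
        then have "norm (of_real (s\<^sup>2) * P (\<theta> s) - bilin (s *\<^sub>R \<theta> s) A (s *\<^sub>R \<theta> s) / 2) <= s\<^sup>2 * (K * norm (\<theta> s) ^ 3)"
          using expP[of "\<theta> s"] elim by (simp add: norm_mult norm_power mult_left_mono)
        also have "\<dots> = K * norm (s *\<^sub>R \<theta> s) ^ 3 * inverse s"
          using elim by (simp add: power2_eq_square power3_eq_cube field_simps)
        finally show ?case .
      qed
    qed
    show ?thesis using tendsto_add[OF 2 1] by (simp add: \<theta>_def)
  qed
  show "2 * \<mu> * k1\<^sup>2 * (norm y)\<^sup>2 <= Re (bilin (cvec y) (transpose V ** A ** V) (cvec y))" for y
  proof -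
    have "\<mu> * (k1 * norm y)\<^sup>2 <= Re (bilin (w y) A (w y) / 2)"
    proof (rule tendsto_lowerbound[OF tendsto_Re[OF lim_P]])
      show "\<forall>\<^sub>F s in at_top. \<mu> * (k1 * norm y)\<^sup>2 <= Re (of_real (s\<^sup>2) * P (U *v arc (x0 + y /\<^sub>R s)))"
        using near[of y] eventually_gt_at_top[of 0]
      proof eventually_elim
        case (elim s)
        have "(k1 * norm (y /\<^sub>R s))\<^sup>2 <= (norm (arc (x0 + y /\<^sub>R s)))\<^sup>2"
          using k12(2)[OF elim(1)] k12(1) by (intro power_mono) auto
        then have "s\<^sup>2 * (\<mu> * (k1 * norm (y /\<^sub>R s))\<^sup>2) <= s\<^sup>2 * Re (P (U *v arc (x0 + y /\<^sub>R s)))"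
          using low(2)[OF elim(1)] low(1) by (intro mult_left_mono) (auto intro: order_trans[OF mult_left_mono])
        then show ?case using elim by (simp add: power_mult_distrib power_divide field_simps)
      qed
    qed simp
    then show ?thesis unfolding w_def bilin_mult_vec by (simp add: power_mult_distrib)
  qed
  obtain J where J: "0 <= J" "!!x. x \<in> cbox a b ==> cmod (jac x) <= J" using jac_bound by blast
  obtain BF where BF: "0 <= BF" "!!x y. norm x <= R / 2 ==> norm y <= R / 2 ==> cmod (F x - F y) <= BF * norm (x - y)"
    using holomorphic_vec_lipschitz[OF F R, of "R / 2"] R by auto
  obtain BQ where BQ: "0 <= BQ" "!!x y. norm x <= R / 2 ==> norm y <= R / 2 ==> cmod (Q x - Q y) <= BQ * norm (x - y)"
    using holomorphic_vec_lipschitz[OF Q R, of "R / 2"] R by auto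
  define QM where "QM = BQ * (R / 2) + cmod (Q 0)"
  have QM: "cmod (Q u) <= QM" if "norm u <= R / 2" for u
  proof -
    have "cmod (Q u) <= cmod (Q u - Q 0) + cmod (Q 0)" by (metis diff_add_cancel norm_triangle_ineq)
    also have "cmod (Q u - Q 0) <= BQ * norm u" using BQ(2)[of u 0] that R by simp
    also have "\<dots> <= BQ * (R / 2)" using that BQ(1) by (rule mult_left_mono)
    finally show ?thesis by (simp add: QM_def)
  qed
  have QM0: "0 <= QM" using BQ R by (simp add: QM_def)
  \<comment> \<open>\<open>gauss_poly_bound\<close> has half of its constant in the exponent, hence
    the factor 2. The 2 in \<open>\<beta>\<close> below is the norm bound \<open>Ub\<close> of the
    deformation.\<close>
  define cc where "cc = 2 * \<mu> * k1\<^sup>2"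
  have cc: "0 < cc" using low(1) k12(1) by (simp add: cc_def)
  define \<beta> where "\<beta> = BF * 2 * k2"
  define dom where "dom = (%y :: real ^ 'm. QM * J * (exp ((\<beta> + 2)\<^sup>2 / cc) * exp (- cc * (norm y)\<^sup>2 / 4)))"
  have dom_int: "integrable lborel dom"
    unfolding dom_def using gaussian_norm(1)[of "cc / 4"] cc by (intro integrable_mult_right) auto
  have bound: "cmod (f s (x0 + y /\<^sub>R s)) <= dom y" if s: "0 < s" for s y
  proof (cases "x0 + y /\<^sub>R s \<in> cbox a b")
    case True
    define x where "x = x0 + y /\<^sub>R s"
    have x: "x \<in> cbox a b" using True by (simp add: x_def)
    have nx: "norm (x - x0) = norm y / s" using s by (simp add: x_def divide_inverse mult.commute)
    have "cmod (g s x) = exp (- (s\<^sup>2 * Re (P (U *v arc x))) - s * Re (F (U *v arc x))) * cmod (Q (U *v arc x)) * cmod (jac x)"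
      by (simp add: g_def norm_mult)
    also have "\<dots> <= exp (- cc * (norm y)\<^sup>2 / 2 + \<beta> * norm y) * QM * J"
    proof (intro mult_mono)
      have 1: "cc * (norm y)\<^sup>2 / 2 <= s\<^sup>2 * Re (P (U *v arc x))"
      proof -
        have "(k1 * norm (x - x0))\<^sup>2 <= (norm (arc x))\<^sup>2" using k12(2)[OF x] k12(1) by (intro power_mono) auto
        then have "\<mu> * (k1 * norm (x - x0))\<^sup>2 <= Re (P (U *v arc x))"
          using low(2)[OF x] low(1) by (meson mult_left_mono less_imp_le order_trans)
        then have "s\<^sup>2 * (\<mu> * (k1 * (norm y / s))\<^sup>2) <= s\<^sup>2 * Re (P (U *v arc x))" unfolding nx by (intro mult_left_mono) auto
        then show ?thesis using s by (simp add: cc_def power_mult_distrib power_divide)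
      qed
      have "cmod (F (U *v arc x)) <= BF * norm (U *v arc x)"
        using BF(2)[of "U *v arc x" 0] small[OF x] R F0 by simp
      also have "\<dots> <= BF * (2 * (k2 * (norm y / s)))"
        using Ub[of "arc x"] k12(3)[OF x] BF(1) unfolding nx by (intro mult_left_mono) auto
      finally have "s * cmod (F (U *v arc x)) <= s * (BF * (2 * (k2 * (norm y / s))))" using s by (intro mult_left_mono) auto
      also have "\<dots> = \<beta> * norm y" using s by (simp add: \<beta>_def)
      finally have "- (s * Re (F (U *v arc x))) <= \<beta> * norm y"
        using abs_Re_le_cmod[of "F (U *v arc x)"] s mult_left_mono[of "- Re (F (U *v arc x))" "cmod (F (U *v arc x))" s] by linarith
      with 1 show "exp (- (s\<^sup>2 * Re (P (U *v arc x))) - s * Re (F (U *v arc x))) <= exp (- cc * (norm y)\<^sup>2 / 2 + \<beta> * norm y)" by simp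
    qed (use QM[OF small[OF x]] J x QM0 in auto)
    also have "\<dots> = QM * J * (1 * exp (- cc * (norm y)\<^sup>2 / 2 + \<beta> * norm y))" by simp
    also have "\<dots> <= QM * J * ((1 + norm y)\<^sup>2 * exp (- cc * (norm y)\<^sup>2 / 2 + \<beta> * norm y))"
      using QM0 J(1) by (intro mult_left_mono mult_right_mono one_le_power) auto
    also have "\<dots> <= dom y"
      unfolding dom_def using QM0 J(1) by (intro mult_left_mono gauss_poly_bound[OF cc norm_ge_zero]) auto
    finally show ?thesis using x unfolding f_def x_def by simp
  next
    case False
    then show ?thesis using QM0 J(1) by (simp add: f_def dom_def)
  qed
  have limf: "((%s. f s (x0 + y /\<^sub>R s)) \<longlongrightarrow> Q 0 * (\<Prod>k\<in>UNIV. v $ k) * gauss_exp (transpose V ** A ** V) (transpose V *v \<eta>) y) at_top" for y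
  proof -
    have "isCont Q 0"
      using holomorphic_vec_continuous[OF Q] R by (simp add: continuous_on_eq_continuous_at)
    from isCont_tendsto_compose[OF this lim_arg]
    have 1: "((%s. Q (U *v arc (x0 + y /\<^sub>R s))) \<longlongrightarrow> Q 0) at_top" .
    have 2: "((%s. jac (x0 + y /\<^sub>R s)) \<longlongrightarrow> (\<Prod>k\<in>UNIV. v $ k)) at_top"
    proof -
      have "((%s. x0 + y /\<^sub>R s) \<longlongrightarrow> x0 + 0 *\<^sub>R y) at_top"
        by (intro tendsto_intros tendsto_inverse_0_at_top filterlim_ident)
      then have "((%s. x0 + y /\<^sub>R s) \<longlongrightarrow> x0) at_top" by simp
      moreover have "isCont jac x0"
        using continuous_on_interior[OF continuous_on_jac] x0 by (simp add: interior_cbox mem_box_cart)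
      ultimately have "((%s. jac (x0 + y /\<^sub>R s)) \<longlongrightarrow> jac x0) at_top" by (rule isCont_tendsto_compose[rotated])
      then show ?thesis by (simp add: jac_def v)
    qed
    have 3: "((%s. exp (- (of_real (s\<^sup>2) * P (U *v arc (x0 + y /\<^sub>R s))) - s *\<^sub>R F (U *v arc (x0 + y /\<^sub>R s)))) \<longlongrightarrow>
        exp (- (bilin (w y) A (w y) / 2) - (\<Sum>k\<in>UNIV. \<eta> $ k * w y $ k))) at_top"
      by (intro tendsto_intros lim_P lim_F)
    have "((%s. g s (x0 + y /\<^sub>R s)) \<longlongrightarrow> exp (- (bilin (w y) A (w y) / 2) - (\<Sum>k\<in>UNIV. \<eta> $ k * w y $ k)) * Q 0 * (\<Prod>k\<in>UNIV. v $ k)) at_top"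
      unfolding g_def using tendsto_mult[OF tendsto_mult[OF 3 1] 2] by (simp add: scaleR_conv_of_real)
    then have "((%s. f s (x0 + y /\<^sub>R s)) \<longlongrightarrow> exp (- (bilin (w y) A (w y) / 2) - (\<Sum>k\<in>UNIV. \<eta> $ k * w y $ k)) * Q 0 * (\<Prod>k\<in>UNIV. v $ k)) at_top"
      by (rule Lim_transform_eventually) (rule eventually_mono[OF near[of y]], simp add: f_def)
    then show ?thesis
      using gauss_exp_substitute[of V y A \<eta>] by (simp add: w_def mult_ac)
  qed
  have "((%s. \<integral>y. f s (x0 + y /\<^sub>R s) \<partial>lborel) \<longlongrightarrow> (\<integral>y. Q 0 * (\<Prod>k\<in>UNIV. v $ k) * gauss_exp (transpose V ** A ** V) (transpose V *v \<eta>) y \<partial>lborel)) at_top"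
  proof (rule integral_dominated_convergence_at_top[where w=dom])
    show "(%y. Q 0 * (\<Prod>k\<in>UNIV. v $ k) * gauss_exp (transpose V ** A ** V) (transpose V *v \<eta>) y) \<in> borel_measurable lborel"
      by (intro borel_measurable_times borel_measurable_const) (simp add: borel_measurable_continuous_onI continuous_gauss_exp)
    show "(%y. f s (x0 + y /\<^sub>R s)) \<in> borel_measurable lborel" for s
      using fm[of s] by measurable
    show "\<forall>\<^sub>F s in at_top. AE y in lborel. norm (f s (x0 + y /\<^sub>R s)) <= dom y"
      using eventually_gt_at_top[of 0] by eventually_elim (use bound in auto)
  qed (use dom_int limf in auto)
  then have "((%s. \<integral>y. f s (x0 + y /\<^sub>R s) \<partial>lborel) \<longlongrightarrow> Q 0 * (\<Prod>k\<in>UNIV. v $ k) * (\<integral>y. gauss_exp (transpose V ** A ** V) (transpose V *v \<eta>) y \<partial>lborel)) at_top"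
    by simp
  then have "((%s. of_real (s ^ CARD('m)) * integral (cbox a b) (g s)) \<longlongrightarrow> Q 0 * (\<Prod>k\<in>UNIV. v $ k) * (\<integral>y. gauss_exp (transpose V ** A ** V) (transpose V *v \<eta>) y \<partial>lborel)) at_top"
  proof (rule Lim_transform_eventually)
    show "\<forall>\<^sub>F s in at_top. (\<integral>y. f s (x0 + y /\<^sub>R s) \<partial>lborel) = of_real (s ^ CARD('m)) * integral (cbox a b) (g s)"
      using eventually_gt_at_top[of 0]
      by eventually_elim (use integral_lborel_affine[OF fm] int_eq in simp)
  qed
  then show "((%s. of_real (s ^ CARD('m)) * integral (cbox a b) (%x. exp (- of_real (s\<^sup>2) * P (U *v arc x) - of_real s * F (U *v arc x)) * Q (U *v arc x) * jac x))
     \<longlongrightarrow> Q 0 * (\<Prod>k\<in>UNIV. v $ k) * (\<integral>y. gauss_exp (transpose V ** A ** V) (transpose V *v \<eta>) y \<partial>lborel)) at_top"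
    unfolding g_def .
qed

text \<open>For each fixed small \<open>t > 0\<close> the box is tilted: the lower bound on
  \<open>Re P\<close> becomes coercive, while on the faces \<open>Re P\<close> stays positive and
  makes the deformation error exponentially small. The integral on the left does not involve
  \<open>t\<close>, which later shows that \<open>gauss_branch\<close> is constant for small
  \<open>t\<close>.\<close>

lemma laplace_expansion:
  fixes P F Q :: "complex ^ 'm => complex"
  assumes P: "holomorphic_vec P (ball 0 R)" and F: "holomorphic_vec F (ball 0 R)" and Q: "holomorphic_vec Q (ball 0 R)" and R: "0 < R"
    and expP: "!!\<theta>. norm \<theta> <= r ==> cmod (P \<theta> - bilin \<theta> A \<theta> / 2) <= K * norm \<theta> ^ 3" and r: "0 < r" and K: "0 <= K"
    and sym: "transpose A = A" and detA: "det A ~= 0"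
    and F0: "F 0 = 0" and \<eta>: "!!k. dir_deriv F 0 (axis k 1) = \<eta> $ k"
    and x0: "!!k. a $ k < x0 $ k" "!!k. x0 $ k < b $ k" "arc x0 = 0"
    and v: "!!k. v $ k = c' k (x0 $ k)"
    and k12: "0 < k1" "!!x. x \<in> cbox a b ==> k1 * norm (x - x0) <= norm (arc x)" "!!x. x \<in> cbox a b ==> norm (arc x) <= k2 * norm (x - x0)"
    and small: "!!x. x \<in> cbox a b ==> norm (arc x) <= R / 4"
    and grow: "0 < c0" "0 < \<kappa>0" "!!x t. x \<in> cbox a b ==> 0 <= t ==> t <= \<kappa>0 ==>
        Re (P (arc x)) + t * c0 * (norm (arc x))\<^sup>2 <= Re (P (pert (rotation_gen A v) (of_real t) *v arc x))"
    and nonneg: "!!x. x \<in> cbox a b ==> 0 <= Re (P (arc x))"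
    and face: "0 < \<delta>" "!!x k. x \<in> cbox a b ==> x $ k = a $ k \<or> x $ k = b $ k ==> \<delta> <= Re (P (arc x))"
  shows "\<forall>\<^sub>F t in at_right 0.
     ((%s. of_real (s ^ CARD('m)) * integral (cbox a b) (%x. exp (- of_real (s\<^sup>2) * P (arc x) - of_real s * F (arc x)) * Q (arc x) * jac x))
       \<longlongrightarrow> Q 0 * exp (bilin \<eta> (matrix_inv A) \<eta> / 2) * gauss_branch A v t) at_top \<and>
     (gauss_branch A v t)\<^sup>2 * det A = (2 * pi) ^ CARD('m)"
proof -
  define E where "E = rotation_gen A v"
  obtain NE where NE: "0 <= NE" "!!u. norm (E *v u) <= NE * norm u" using norm_matrix_vector_mult_le by blast
  have lip: "\<exists>B\<ge>0. \<forall>x y. norm x <= R / 2 --> norm y <= R / 2 --> cmod (f x - f y) <= B * norm (x - y)"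
    if "holomorphic_vec f (ball 0 R)" for f :: "complex ^ 'm => complex"
    using holomorphic_vec_lipschitz[OF that R, of "R / 2"] R by (metis half_gt_zero_iff field_sum_of_halves less_add_same_cancel1)
  obtain BP where BP: "0 <= BP" "!!x y. norm x <= R / 2 ==> norm y <= R / 2 ==> cmod (P x - P y) <= BP * norm (x - y)"
    using lip[OF P] by blast
  obtain BF where BF: "0 <= BF" "!!x y. norm x <= R / 2 ==> norm y <= R / 2 ==> cmod (F x - F y) <= BF * norm (x - y)"
    using lip[OF F] by blast
  obtain BQ where BQ: "0 <= BQ" "!!x y. norm x <= R / 2 ==> norm y <= R / 2 ==> cmod (Q x - Q y) <= BQ * norm (x - y)"
    using lip[OF Q] by blast
  define L where "L = BP * NE * R + 1"
  have L: "0 < L" using BP NE R by (simp add: L_def add_nonneg_pos)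
  \<comment> \<open>Three demands: the tilt moves vectors by at most half their length, the growth
    hypothesis is available, and \<open>Re P\<close> on the faces drops from \<open>\<delta>\<close>
    to no less than \<open>\<delta> / 2\<close>.\<close>
  define \<kappa> where "\<kappa> = min (1 / (2 * (NE + 1))) (min \<kappa>0 (\<delta> / (2 * L)))"
  have \<kappa>: "0 < \<kappa>" using NE grow face L by (simp add: \<kappa>_def)
  have \<kappa>NE: "\<kappa> * NE <= 1 / 2"
  proof -
    define C where "C = NE + 1"
    have C: "0 < C" using NE by (simp add: C_def)
    have "\<kappa> <= 1 / (2 * C)" unfolding \<kappa>_def C_def by (rule min.cobounded1)
    then have "\<kappa> * C <= 1 / (2 * C) * C" using C by (intro mult_right_mono) auto
    then have "\<kappa> * C <= 1 / 2" using C by simp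
    moreover have "\<kappa> * NE <= \<kappa> * C" using \<kappa> by (simp add: C_def)
    ultimately show ?thesis by linarith
  qed
  have \<kappa>0: "\<kappa> <= \<kappa>0" unfolding \<kappa>_def by (meson min.cobounded1 min.cobounded2 order_trans)
  have \<kappa>L: "\<kappa> * L <= \<delta> / 2"
  proof -
    have "\<kappa> <= \<delta> / (2 * L)" unfolding \<kappa>_def by (meson min.cobounded2 order_trans)
    then have "\<kappa> * L <= \<delta> / (2 * L) * L" using L by (intro mult_right_mono) auto
    then show ?thesis using L by simp
  qed
  have zN: "cmod z * NE <= 1 / 2" if "cmod z <= \<kappa>" for z using mult_right_mono[OF that NE(1)] \<kappa>NE by linarith
  have Eu: "norm (z *s (E *v u)) <= norm u / 2" if "cmod z <= \<kappa>" for z u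
  proof -
    have "norm (z *s (E *v u)) <= cmod z * (NE * norm u)" unfolding norm_vector_scalar_mult by (intro mult_left_mono NE(2)) simp
    also have "\<dots> <= 1 / 2 * norm u" using mult_right_mono[OF zN[OF that], of "norm u"] by (simp add: mult_ac)
    finally show ?thesis by simp
  qed
  have U2: "norm (pert E z *v u) <= 2 * norm u" if "cmod z <= \<kappa>" for z u
    using norm_triangle_ineq[of u "z *s (E *v u)"] Eu[OF that, of u] norm_ge_zero[of u] unfolding pert_mult_vec by linarith
  have inR: "norm (pert E z *v arc x) <= R / 2" if "cmod z <= \<kappa>" "x \<in> cbox a b" for z x
    using U2[OF that(1), of "arc x"] small[OF that(2)] by linarith
  have faceP: "\<delta> / 2 <= Re (P (pert E z *v arc x))" if z: "cmod z <= \<kappa>" and x: "x \<in> cbox a b" "x $ k = a $ k \<or> x $ k = b $ k" for z x k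
  proof -
    have "cmod (P (pert E z *v arc x) - P (arc x)) <= BP * norm (pert E z *v arc x - arc x)"
      using inR[OF z x(1)] small[OF x(1)] R by (intro BP) auto
    also have "pert E z *v arc x - arc x = z *s (E *v arc x)" by (simp add: pert_mult_vec)
    also have "BP * norm (z *s (E *v arc x)) <= BP * (\<kappa> * (NE * R))"
    proof -
      have "norm (E *v arc x) <= NE * R"
        using NE(2)[of "arc x"] mult_left_mono[of "norm (arc x)" R NE] small[OF x(1)] NE(1) R by linarith
      then have "norm (z *s (E *v arc x)) <= \<kappa> * (NE * R)"
        unfolding norm_vector_scalar_mult using z \<kappa> by (intro mult_mono) auto
      then show ?thesis using BP(1) by (rule mult_left_mono)
    qed
    also have "\<dots> <= \<kappa> * L" using \<kappa> by (simp add: L_def algebra_simps)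
    finally have "cmod (P (pert E z *v arc x) - P (arc x)) <= \<delta> / 2" using \<kappa>L by linarith
    then have "Re (P (arc x)) - Re (P (pert E z *v arc x)) <= \<delta> / 2"
      using abs_Re_le_cmod[of "P (pert E z *v arc x) - P (arc x)"] by simp
    then show ?thesis using face(2)[OF x] by linarith
  qed
  obtain KE where KE: "0 <= KE"
    "!!h S \<epsilon> t. holomorphic_vec h S ==> open S ==> (!!z x. cmod z <= \<kappa> ==> x \<in> cbox a b ==> pert E z *v arc x \<in> S) ==>
      (!!z x k. cmod z <= \<kappa> ==> x \<in> cbox a b ==> x $ k = a $ k \<or> x $ k = b $ k ==> cmod (h (pert E z *v arc x)) <= \<epsilon>) ==>
      0 <= t ==> t < \<kappa> ==>
      cmod (det (pert E (of_real t)) * integral (cbox a b) (%x. h (pert E (of_real t) *v arc x) * jac x)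
            - integral (cbox a b) (%x. h (arc x) * jac x)) <= KE * \<epsilon>"
    using linear_deformation_error[OF NE \<kappa> \<kappa>NE] by blast
  define FM where "FM = BF * (R / 2)"
  define QM where "QM = BQ * (R / 2) + cmod (Q 0)"
  have FMb: "cmod (F u) <= FM" if "norm u <= R / 2" for u
    using BF(2)[of u 0] that R F0 mult_left_mono[OF that BF(1)] by (simp add: FM_def)
  have QMb: "cmod (Q u) <= QM" if "norm u <= R / 2" for u
  proof -
    have "cmod (Q u) <= cmod (Q u - Q 0) + cmod (Q 0)" by (metis diff_add_cancel norm_triangle_ineq)
    also have "cmod (Q u - Q 0) <= BQ * norm u" using BQ(2)[of u 0] that R by simp
    also have "\<dots> <= BQ * (R / 2)" using that BQ(1) by (rule mult_left_mono)
    finally show ?thesis by (simp add: QM_def)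
  qed
  define h where "h = (%s \<theta>. exp (- of_real (s\<^sup>2) * P \<theta> - of_real s * F \<theta>) * Q \<theta>)"
  have hh: "holomorphic_vec (h s) (ball 0 R)" for s
    unfolding holomorphic_vec_def
  proof
    fix z :: "complex ^ 'm" assume z: "z \<in> ball 0 R"
    define D where "D = (%u. exp (- of_real (s\<^sup>2) * P z - of_real s * F z) * (- of_real (s\<^sup>2) * dir_deriv P z u - of_real s * dir_deriv F z u) * Q z
        + exp (- of_real (s\<^sup>2) * P z - of_real s * F z) * dir_deriv Q z u)"
    note dP = holomorphic_vec_derivative(1)[OF P z] and dF = holomorphic_vec_derivative(1)[OF F z] and dQ = holomorphic_vec_derivative(1)[OF Q z]
    have "((%z. - of_real (s\<^sup>2) * P z - of_real s * F z) has_derivative (%u. - of_real (s\<^sup>2) * dir_deriv P z u - of_real s * dir_deriv F z u)) (at z)"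
      by (intro has_derivative_diff has_derivative_mult_right dP dF)
    from has_derivative_compose[OF this DERIV_exp[unfolded has_field_derivative_def]]
    have "((%z. exp (- of_real (s\<^sup>2) * P z - of_real s * F z)) has_derivative (%u. exp (- of_real (s\<^sup>2) * P z - of_real s * F z) * (- of_real (s\<^sup>2) * dir_deriv P z u - of_real s * dir_deriv F z u))) (at z)" .
    from has_derivative_mult[OF this dQ]
    have "(h s has_derivative D) (at z)" unfolding h_def D_def by (simp only: add.commute)
    moreover have "D (x *s u) = x * D u" for x u
      unfolding D_def holomorphic_vec_derivative(2)[OF P z] holomorphic_vec_derivative(2)[OF F z] holomorphic_vec_derivative(2)[OF Q z]
      by (simp add: algebra_simps)
    ultimately show "\<exists>L. (h s has_derivative L) (at z) \<and> (\<forall>x u. L (x *s u) = x * L u)" by blast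
  qed
  have hface: "cmod (h s (pert E z *v arc x)) <= exp (- s\<^sup>2 * (\<delta> / 2) + s * FM) * QM"
    if s: "0 < s" and z: "cmod z <= \<kappa>" and x: "x \<in> cbox a b" "x $ k = a $ k \<or> x $ k = b $ k" for s z x k
  proof -
    define u where "u = pert E z *v arc x"
    have u: "norm u <= R / 2" unfolding u_def by (rule inR[OF z x(1)])
    have "s\<^sup>2 * (\<delta> / 2) <= s\<^sup>2 * Re (P u)" unfolding u_def by (intro mult_left_mono faceP[OF z x]) simp
    moreover have "- (s * Re (F u)) <= s * FM"
      using mult_left_mono[of "- Re (F u)" FM s] FMb[OF u] abs_Re_le_cmod[of "F u"] s by simp
    ultimately have "exp (- (s\<^sup>2 * Re (P u)) - s * Re (F u)) <= exp (- s\<^sup>2 * (\<delta> / 2) + s * FM)" by simp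
    then have "exp (- (s\<^sup>2 * Re (P u)) - s * Re (F u)) * cmod (Q u) <= exp (- s\<^sup>2 * (\<delta> / 2) + s * FM) * QM"
      using QMb[OF u] by (intro mult_mono) auto
    then show ?thesis unfolding u_def[symmetric] by (simp add: h_def norm_mult)
  qed
  have "((%s. of_real (s ^ CARD('m)) * integral (cbox a b) (%x. exp (- of_real (s\<^sup>2) * P (arc x) - of_real s * F (arc x)) * Q (arc x) * jac x))
       \<longlongrightarrow> Q 0 * exp (bilin \<eta> (matrix_inv A) \<eta> / 2) * gauss_branch A v t) at_top \<and>
     (gauss_branch A v t)\<^sup>2 * det A = (2 * pi) ^ CARD('m)" if t: "0 < t" "t < \<kappa>" for t
  proof -
    define U where "U = pert E (of_real t)"
    define V where "V = U ** diag_mat v"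
    have tk: "cmod (of_real t) <= \<kappa>" using t by simp
    have ct: "0 < t * c0" using t grow(1) by simp
    have low: "t * c0 * (norm (arc x))\<^sup>2 <= Re (P (U *v arc x))" if "x \<in> cbox a b" for x
      using grow(3)[OF that, of t] nonneg[OF that] t \<kappa>0 unfolding U_def E_def by simp
    have lap: "((%s. of_real (s ^ CARD('m)) * integral (cbox a b) (%x. exp (- of_real (s\<^sup>2) * P (U *v arc x) - of_real s * F (U *v arc x)) * Q (U *v arc x) * jac x))
     \<longlongrightarrow> Q 0 * (\<Prod>k\<in>UNIV. v $ k) * (\<integral>y. gauss_exp (transpose V ** A ** V) (transpose V *v \<eta>) y \<partial>lborel)) at_top"
      and pos: "2 * (t * c0) * k1\<^sup>2 * (norm y)\<^sup>2 <= Re (bilin (cvec y) (transpose V ** A ** V) (cvec y))" for y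
      using laplace_deformed[OF P F Q R expP r K F0 \<eta> x0 v k12 inR[OF tk, folded U_def] U2[OF tk, folded U_def] ct low] unfolding V_def by blast+
    have cpos: "0 < 2 * (t * c0) * k1\<^sup>2" using ct k12(1) by simp
    note gi = gauss_integral_saddle[OF sym detA cpos pos]
    have detV: "det V = det U * (\<Prod>k\<in>UNIV. v $ k)" by (simp add: V_def det_mul det_diag_mat)
    have gb: "gauss_branch A v t = det V * (\<integral>y. gauss_exp (transpose V ** A ** V) 0 y \<partial>lborel)"
      by (simp add: gauss_branch_def saddle_map_def V_def U_def E_def)
    define I0 where "I0 = (%s. integral (cbox a b) (%x. h s (arc x) * jac x))"
    define I1 where "I1 = (%s. integral (cbox a b) (%x. h s (U *v arc x) * jac x))"
    have diff0: "((%s. of_real (s ^ CARD('m)) * (det U * I1 s - I0 s)) \<longlongrightarrow> 0) at_top"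
    proof (rule Lim_null_comparison)
      show "((%s. KE * QM * (s ^ CARD('m) * exp (- s\<^sup>2 * (\<delta> / 2) + s * FM))) \<longlongrightarrow> 0) at_top"
        using tendsto_mult_left[OF power_times_gaussian_tendsto_0[of "\<delta> / 2" "CARD('m)" FM], of "KE * QM"] face(1) by simp
      show "\<forall>\<^sub>F s in at_top. norm (of_real (s ^ CARD('m)) * (det U * I1 s - I0 s)) <= KE * QM * (s ^ CARD('m) * exp (- s\<^sup>2 * (\<delta> / 2) + s * FM))"
        using eventually_gt_at_top[of 0]
      proof eventually_elim
        case (elim s)
        have "cmod (det U * I1 s - I0 s) <= KE * (exp (- s\<^sup>2 * (\<delta> / 2) + s * FM) * QM)"
          unfolding U_def I1_def I0_def
        proof (rule KE(2)[OF hh open_ball])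
          show "pert E z *v arc x \<in> ball 0 R" if "cmod z <= \<kappa>" "x \<in> cbox a b" for z x
            using inR[OF that] R by simp
        qed (use hface[OF elim] t in auto)
        from mult_left_mono[OF this, of "s ^ CARD('m)"] show ?case
          using elim by (simp add: norm_mult norm_power mult_ac)
      qed
    qed
    have "((%s. of_real (s ^ CARD('m)) * I1 s) \<longlongrightarrow> Q 0 * (\<Prod>k\<in>UNIV. v $ k) * (\<integral>y. gauss_exp (transpose V ** A ** V) (transpose V *v \<eta>) y \<partial>lborel)) at_top"
      using lap unfolding I1_def h_def .
    from tendsto_diff[OF tendsto_mult_left[OF this, of "det U"] diff0]
    have "((%s. of_real (s ^ CARD('m)) * I0 s) \<longlongrightarrow> det U * (Q 0 * (\<Prod>k\<in>UNIV. v $ k) * (\<integral>y. gauss_exp (transpose V ** A ** V) (transpose V *v \<eta>) y \<partial>lborel))) at_top"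
      by (simp add: algebra_simps)
    then have "((%s. of_real (s ^ CARD('m)) * I0 s) \<longlongrightarrow> Q 0 * exp (bilin \<eta> (matrix_inv A) \<eta> / 2) * gauss_branch A v t) at_top"
      unfolding gi(1) gb detV by (simp add: mult_ac)
    then show ?thesis using gi(2) unfolding gb I0_def h_def by blast
  qed
  then show ?thesis
    unfolding eventually_at_right_field using \<kappa> by blast
qed

end

section \<open>The principal value in one variable\<close>

text \<open>Bridges Lebesgue integrals over half-open windows and integrals of continuous functions
  on closed intervals, where primitives are used. The exceptional set \<open>X\<close> will hold the
  parameter of the pole.\<close>

lemma set_integral_eq_HK:
  fixes f g :: "real => complex"
  assumes g: "continuous_on {a..b} g" and S: "{a<..<b} \<subseteq> S" "S \<subseteq> {a..b}" and X: "finite X" and eq: "!!s. a < s ==> s < b ==> s \<notin> X ==> f s = g s"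
    and Sm: "S \<in> sets borel" and fm: "(%s. indicator S s *\<^sub>R f s) \<in> borel_measurable borel"
  shows "set_integrable lborel S f" "set_lebesgue_integral lborel S f = integral {a..b} g"
proof -
  have gi: "integrable lborel (%s. indicator {a..b} s *\<^sub>R g s)"
    by (rule borel_integrable_compact[OF compact_Icc g])
  have nX: "X \<union> {a, b} \<in> null_sets lborel"
    using X by (intro finite_imp_null_set_lborel) auto
  have ae: "AE s in lborel. indicator {a..b} s *\<^sub>R g s = indicator S s *\<^sub>R f s"
  proof (rule AE_I'[OF nX], rule subsetI, rule ccontr)
    fix s assume s: "s \<in> {s \<in> space lborel. \<not> indicator {a..b} s *\<^sub>R g s = indicator S s *\<^sub>R f s}" "s \<notin> X \<union> {a, b}"
    show False
    proof (cases "a < s \<and> s < b")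
      case True
      then have "s \<in> S" "f s = g s" using S s eq by auto
      then show False using s True by simp
    next
      case False
      then have "s \<notin> {a..b}" using s by auto
      then have "s \<notin> {a..b}" "s \<notin> S" using S(2) by blast+
      then show False using s by simp
    qed
  qed
  have fm': "(%s. indicator S s *\<^sub>R f s) \<in> borel_measurable lborel" using fm by simp
  show "set_integrable lborel S f"
    unfolding set_integrable_def using integrable_cong_AE_imp[OF gi fm'] ae by (simp add: eq_commute)
  have "set_lebesgue_integral lborel S f = (\<integral>s. indicator {a..b} s *\<^sub>R g s \<partial>lborel)"
    unfolding set_lebesgue_integral_def using ae gi fm' by (intro integral_cong_AE) (auto simp: eq_commute dest: borel_measurable_integrable)
  also have "\<dots> = integral {a..b} g"
    using set_borel_integral_eq_integral(2)[of "{a..b}" g] gi unfolding set_lebesgue_integral_def set_integrable_def by simp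
  finally show "set_lebesgue_integral lborel S f = integral {a..b} g" .
qed

text \<open>After multiplication by \<open>\<alpha>\<close> the curve stays in a narrow double cone
  about the imaginary axis. The constant 1/8 gives \<open>Im (\<alpha> * g s) ~= 0\<close> away from
  the pole and \<open>7 * \<bar>Re (\<alpha> * g s)\<bar> <= cmod (\<alpha> * g s)\<close>.\<close>

locale crossing_arc =
  fixes \<gamma> :: curve and s0 :: real and \<alpha> :: complex and \<beta> :: real and d :: real
  assumes curve: "smooth_simple_curve \<gamma>" and s0: "s0 \<in> interior (fst \<gamma>)" and z0: "snd \<gamma> s0 = 0"
    and \<alpha>: "\<alpha> ~= 0" and \<beta>: "\<beta> ~= 0" and tangent: "\<alpha> * speed \<gamma> s0 = \<i> * of_real \<beta>"
    and d: "0 < d" "{s0-d..s0+d} \<subseteq> interior (fst \<gamma>)"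
    and near: "!!s. \<bar>s - s0\<bar> <= d ==> cmod (\<alpha> * snd \<gamma> s - \<i> * of_real (\<beta> * (s - s0))) <= \<bar>\<beta>\<bar> / 8 * \<bar>s - s0\<bar>"
begin

abbreviation g where "g \<equiv> snd \<gamma>"
abbreviation J where "J \<equiv> fst \<gamma>"

lemma abs_dI: "s \<in> {s0-d..s0+d} ==> \<bar>s - s0\<bar> <= d"
  by (auto simp: abs_le_iff)

lemma Im_pos:
  assumes "\<bar>s - s0\<bar> <= d" "s ~= s0"
  shows "Im (\<alpha> * g s) ~= 0" "g s ~= 0"
proof -
  have "\<bar>Im (\<alpha> * g s) - \<beta> * (s - s0)\<bar> <= \<bar>\<beta>\<bar> / 8 * \<bar>s - s0\<bar>"
    using order_trans[OF abs_Im_le_cmod near[OF assms(1)]] by simp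
  moreover have "0 < \<bar>\<beta> * (s - s0)\<bar>" using \<beta> assms(2) by simp
  ultimately show "Im (\<alpha> * g s) ~= 0" by (auto simp: abs_mult)
  then show "g s ~= 0" by auto
qed

lemma Re_bound:
  assumes "\<bar>s - s0\<bar> <= d"
  shows "7 * \<bar>Re (\<alpha> * g s)\<bar> <= cmod (\<alpha> * g s)"
proof -
  define x where "x = \<bar>\<beta>\<bar> * \<bar>s - s0\<bar>"
  have n: "cmod (\<alpha> * g s - \<i> * of_real (\<beta> * (s - s0))) <= x / 8" using near[OF assms] by (simp add: x_def)
  have "Re (\<alpha> * g s) = Re (\<alpha> * g s - \<i> * of_real (\<beta> * (s - s0)))" by simp
  then have "\<bar>Re (\<alpha> * g s)\<bar> <= x / 8" using n abs_Re_le_cmod by (metis order_trans)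
  moreover have "cmod (\<i> * of_real (\<beta> * (s - s0))) <= cmod (\<alpha> * g s) + x / 8"
    using n norm_triangle_ineq2[of "\<i> * of_real (\<beta> * (s - s0))" "\<alpha> * g s"] by (simp add: norm_minus_commute)
  moreover have "cmod (\<i> * of_real (\<beta> * (s - s0))) = x"
    unfolding norm_mult norm_of_real by (simp add: x_def abs_mult)
  ultimately show ?thesis by linarith
qed

lemma g_derivative:
  assumes "s \<in> {s0-d..s0+d}" shows "(g has_vector_derivative speed \<gamma> s) (at s within X)"
proof -
  have "s \<in> interior J" using assms d by blast
  then have "(g has_vector_derivative speed \<gamma> s) (at s)"
    using smooth_simple_curve_speed(2)[OF curve, of s] interior_subset[of J] at_within_interior[of s J] by auto
  then show ?thesis by (rule has_vector_derivative_at_within)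
qed

lemma Ln_derivative:
  assumes "s \<in> {s0-d..s0+d}" "s ~= s0"
  shows "((%s. Ln (\<alpha> * g s)) has_vector_derivative speed \<gamma> s / g s) (at s within X)"
proof -
  have "\<bar>s - s0\<bar> <= d" using assms by auto
  from Im_pos[OF this assms(2)] have "\<alpha> * g s \<notin> \<real>\<^sub>\<le>\<^sub>0" "g s ~= 0" by (auto simp: complex_nonpos_Reals_iff)
  then have "((%t. Ln (\<alpha> * t)) has_field_derivative inverse (g s)) (at (g s))"
    using \<alpha> by (auto intro!: derivative_eq_intros simp: field_simps)
  from field_vector_diff_chain_within[OF g_derivative[OF assms(1), of X] has_field_derivative_at_within[OF this]]
  show ?thesis by (simp add: o_def divide_inverse)
qed

lemma speed_continuous: "continuous_on {s0-d..s0+d} (speed \<gamma>)" "continuous_on {s0-d..s0+d} g"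
  using smooth_simple_curve_speed(1)[OF curve] smooth_simple_curve_continuous[OF curve] d(2) interior_subset[of J]
  by (auto elim!: continuous_on_subset)

definition is_window :: "real => real => real => bool" where
  "is_window r a b \<longleftrightarrow> s0 - d < a \<and> a < s0 \<and> s0 < b \<and> b < s0 + d \<and> cmod (g a) = r \<and> cmod (g b) = r \<and>
      {s \<in> J. cmod (g s) < r} = {a<..<b} \<and> {s \<in> J. cmod (g s) <= r} = {a..b}"

lemma window_exists:
  obtains \<rho> where "0 < \<rho>" "!!r. 0 < r ==> r <= \<rho> ==> \<exists>a b. is_window r a b"
proof -
  obtain \<rho> where \<rho>: "0 < \<rho>" and w: "!!r. 0 < r ==> r <= \<rho> ==>
    \<exists>a b. s0 - d < a \<and> a < s0 \<and> s0 < b \<and> b < s0 + d \<and> {a..b} \<subseteq> interior (fst \<gamma>) \<and>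
      cmod (snd \<gamma> a) = r \<and> cmod (snd \<gamma> b) = r \<and>
      {s \<in> fst \<gamma>. cmod (snd \<gamma> s) < r} = {a<..<b} \<and> {s \<in> fst \<gamma>. cmod (snd \<gamma> s) <= r} = {a..b}"
    using smooth_simple_curve_window[OF curve s0 z0 d(1)] by blast
  show ?thesis
  proof (rule that[OF \<rho>])
    fix r assume "0 < r" "r <= \<rho>"
    from w[OF this] show "\<exists>a b. is_window r a b" unfolding is_window_def by (elim exE conjE) (intro exI conjI; assumption)
  qed
qed

text \<open>The principal value of the integral of \<open>dt / t\<close> over the window.
  \<open>Ln (\<alpha> * t)\<close> has its cut where \<open>\<alpha> t\<close> is negative, so it is
  a primitive on each half of the curve; the last summand is the limit of its jump between the two
  cut-off points.\<close>

definition pv_const :: "real => real => complex" where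
  "pv_const a b = Ln (\<alpha> * g b) - Ln (\<alpha> * g a) - \<i> * of_real (pi * sgn \<beta>)"

text \<open>The two cut-off points lie at equal distance from \<open>0\<close>, so that only their arguments survive.\<close>

lemma pv_inverse:
  assumes win: "is_window e a b" and e: "0 < e"
  shows "((%r. set_lebesgue_integral lborel {s \<in> J. r <= cmod (g s) \<and> cmod (g s) < e} (%s. speed \<gamma> s / g s)) \<longlongrightarrow> pv_const a b) (at_right 0)"
    and "!!r. 0 < r ==> set_integrable lborel {s \<in> J. r <= cmod (g s) \<and> cmod (g s) < e} (%s. speed \<gamma> s / g s)"
proof -
  obtain \<rho>0 where \<rho>0: "0 < \<rho>0" "!!r. 0 < r ==> r <= \<rho>0 ==> \<exists>a b. is_window r a b" using window_exists by blast
  define \<rho> where "\<rho> = min \<rho>0 (e / 2)"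
  have \<rho>: "0 < \<rho>" "\<rho> < e" using \<rho>0 e by (auto simp: \<rho>_def)
  have "\<forall>r. \<exists>a b. 0 < r \<and> r <= \<rho> --> is_window r a b" using \<rho>0(2) by (auto simp: \<rho>_def)
  then obtain A B where AB: "!!r. 0 < r ==> r <= \<rho> ==> is_window r (A r) (B r)" by metis
  have w: "s0 - d < a" "a < s0" "s0 < b" "b < s0 + d" "{s \<in> J. cmod (g s) < e} = {a<..<b}" using win by (auto simp: is_window_def)
  have wr: "s0 - d < A r" "A r < s0" "s0 < B r" "B r < s0 + d" "cmod (g (A r)) = r" "cmod (g (B r)) = r" "{s \<in> J. cmod (g s) < r} = {A r<..<B r}"
    if "0 < r" "r <= \<rho>" for r using AB[OF that] by (auto simp: is_window_def)
  have inJ: "s \<in> J" if "s0 - d < s" "s < s0 + d" for s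
  proof -
    have "s \<in> interior J" using that by (intro subsetD[OF d(2)]) auto
    then show ?thesis using interior_subset by blast
  qed
  have set_eq: "{s \<in> J. r <= cmod (g s) \<and> cmod (g s) < e} = {a<..A r} \<union> {B r..<b}" and ord: "a < A r" "B r < b" if r: "0 < r" "r <= \<rho>" for r
  proof -
    have "{s \<in> J. cmod (g s) < r} \<subseteq> {s \<in> J. cmod (g s) < e}" using r \<rho> by auto
    then have sub: "{A r<..<B r} \<subseteq> {a<..<b}" unfolding w(5) wr(7)[OF r] .
    then have le: "a <= A r" "B r <= b"
      using wr(2,3)[OF r] greaterThanLessThan_subseteq_greaterThanLessThan[of "A r" "B r" a b] by auto
    have "{s \<in> J. r <= cmod (g s) \<and> cmod (g s) < e} = {s \<in> J. cmod (g s) < e} - {s \<in> J. cmod (g s) < r}" by auto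
    also have "\<dots> = {a<..<b} - {A r<..<B r}" by (simp only: w(5) wr(7)[OF r])
    also have "\<dots> = {a<..A r} \<union> {B r..<b}"
      using le wr(2,3)[OF r] w(2,3) by auto
    finally show "{s \<in> J. r <= cmod (g s) \<and> cmod (g s) < e} = {a<..A r} \<union> {B r..<b}" .
    have "A r \<in> {s \<in> J. cmod (g s) < e}" "B r \<in> {s \<in> J. cmod (g s) < e}"
      using wr(1-6)[OF r] r \<rho> inJ by auto
    then show "a < A r" "B r < b" unfolding w(5) by auto
  qed
  have gm: "(%s. indicator S s *\<^sub>R (speed \<gamma> s / g s)) \<in> borel_measurable borel"
    if "S \<subseteq> {s0-d..s0+d}" "s0 \<notin> S" "S \<in> sets borel" for S
  proof (rule borel_measurable_continuous_on_indicator[OF that(3)])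
    have "g s ~= 0" if "s \<in> S" for s
      using Im_pos(2)[OF abs_dI[of s]] that \<open>S \<subseteq> _\<close> \<open>s0 \<notin> S\<close> by blast
    then show "continuous_on S (%s. speed \<gamma> s / g s)"
      using that(1) by (intro continuous_on_divide continuous_on_subset[OF speed_continuous(1)] continuous_on_subset[OF speed_continuous(2)]) auto
  qed
  have piece: "set_integrable lborel S (%s. speed \<gamma> s / g s) \<and> set_lebesgue_integral lborel S (%s. speed \<gamma> s / g s) = Ln (\<alpha> * g y) - Ln (\<alpha> * g x)"
    if "s0 - d <= x" "x <= y" "y <= s0 + d" "s0 \<notin> {x..y}" "{x<..<y} \<subseteq> S" "S \<subseteq> {x..y}" "S \<in> sets borel" for x y S
  proof -
    have sub: "{x..y} \<subseteq> {s0-d..s0+d}" using that by auto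
    have nz: "g s ~= 0" if "s \<in> {x..y}" for s
      using Im_pos(2)[OF abs_dI[of s]] that sub \<open>s0 \<notin> {x..y}\<close> by blast
    have c: "continuous_on {x..y} (%s. speed \<gamma> s / g s)"
      using nz by (intro continuous_on_divide continuous_on_subset[OF speed_continuous(1) sub] continuous_on_subset[OF speed_continuous(2) sub]) auto
    have "s0 \<notin> S" "S \<subseteq> {s0-d..s0+d}" using that sub by auto
    note 1 = set_integral_eq_HK[OF c that(5,6) finite.emptyI refl that(7) gm[OF this(2,1) that(7)]]
    have "((%s. speed \<gamma> s / g s) has_integral Ln (\<alpha> * g y) - Ln (\<alpha> * g x)) {x..y}"
      using that sub by (intro fundamental_theorem_of_calculus Ln_derivative) auto
    then show ?thesis using 1 by (simp add: integral_unique)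
  qed
  have val: "set_integrable lborel {s \<in> J. r <= cmod (g s) \<and> cmod (g s) < e} (%s. speed \<gamma> s / g s) \<and>
     set_lebesgue_integral lborel {s \<in> J. r <= cmod (g s) \<and> cmod (g s) < e} (%s. speed \<gamma> s / g s) =
     Ln (\<alpha> * g b) - Ln (\<alpha> * g a) + (Ln (\<alpha> * g (A r)) - Ln (\<alpha> * g (B r)))" if r: "0 < r" "r <= \<rho>" for r
  proof -
    have 1: "set_integrable lborel {a<..A r} (%s. speed \<gamma> s / g s) \<and> set_lebesgue_integral lborel {a<..A r} (%s. speed \<gamma> s / g s) = Ln (\<alpha> * g (A r)) - Ln (\<alpha> * g a)"
      using w wr[OF r] ord[OF r] by (intro piece) auto
    have 2: "set_integrable lborel {B r..<b} (%s. speed \<gamma> s / g s) \<and> set_lebesgue_integral lborel {B r..<b} (%s. speed \<gamma> s / g s) = Ln (\<alpha> * g b) - Ln (\<alpha> * g (B r))"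
      using w wr[OF r] ord[OF r] by (intro piece) auto
    have dis: "{a<..A r} \<inter> {B r..<b} = {}" using wr[OF r] by auto
    have "set_integrable lborel ({a<..A r} \<union> {B r..<b}) (%s. speed \<gamma> s / g s)"
      by (rule set_integrable_Un[OF conjunct1[OF 1] conjunct1[OF 2]]) auto
    moreover have "set_lebesgue_integral lborel ({a<..A r} \<union> {B r..<b}) (%s. speed \<gamma> s / g s) =
        (Ln (\<alpha> * g (A r)) - Ln (\<alpha> * g a)) + (Ln (\<alpha> * g b) - Ln (\<alpha> * g (B r)))"
      using set_integral_Un[OF dis conjunct1[OF 1] conjunct1[OF 2]] conjunct2[OF 1] conjunct2[OF 2] by (simp only:)
    ultimately show ?thesis
      unfolding set_eq[OF r] by simp
  qed
  \<comment> \<open>\<open>val\<close> covers cut-offs up to \<open>\<rho>\<close>; for a larger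
    \<open>r\<close> the set lies inside the one for \<open>min r \<rho>\<close>.\<close>
  show "set_integrable lborel {s \<in> J. r <= cmod (g s) \<and> cmod (g s) < e} (%s. speed \<gamma> s / g s)" if r: "0 < r" for r
  proof (rule set_integrable_subset[OF conjunct1[OF val[of "min r \<rho>"]]])
    have "{s \<in> J. r <= cmod (g s) \<and> cmod (g s) < e} = {s \<in> {a<..<b}. r <= cmod (g s)}"
    proof (rule set_eqI)
      fix s
      have "s \<in> J \<and> cmod (g s) < e \<longleftrightarrow> s \<in> {a<..<b}" unfolding w(5)[symmetric] by simp
      then show "s \<in> {s \<in> J. r <= cmod (g s) \<and> cmod (g s) < e} \<longleftrightarrow> s \<in> {s \<in> {a<..<b}. r <= cmod (g s)}" by blast
    qed
    also have "\<dots> = {a<..<b} \<inter> {s \<in> {s0-d..s0+d}. r <= cmod (g s)}" using w(1-4) by auto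
    also have "closed {s \<in> {s0-d..s0+d}. r <= cmod (g s)}"
      using continuous_closed_preimage[of "{s0-d..s0+d}" "%s. cmod (g s)" "{r..}"] continuous_on_norm[OF speed_continuous(2)]
      by (simp add: vimage_def Int_def)
    then have "{a<..<b} \<inter> {s \<in> {s0-d..s0+d}. r <= cmod (g s)} \<in> sets lborel" by (intro sets.Int) auto
    finally show "{s \<in> J. r <= cmod (g s) \<and> cmod (g s) < e} \<in> sets lborel" .
  qed (use r \<rho> in auto)
  have conv: "(X \<longlongrightarrow> s0) (at_right 0)" if X: "!!r. 0 < r ==> r <= \<rho> ==> X r \<in> J \<and> cmod (g (X r)) = r" for X
    unfolding tendsto_iff
  proof (intro allI impI)
    fix \<epsilon> :: real assume "0 < \<epsilon>"
    then obtain \<delta> where \<delta>: "0 < \<delta>" "!!s. s \<in> J ==> cmod (g s - g s0) < \<delta> ==> \<bar>s - s0\<bar> < \<epsilon>"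
      using smooth_simple_curve_far_from_point[of J g s0 \<epsilon>] curve s0 by auto
    have "dist (X r) s0 < \<epsilon>" if "0 < r" "r < min \<delta> \<rho>" for r
      using \<delta>(2)[of "X r"] X[of r] that z0 by (simp add: dist_real_def)
    then show "\<forall>\<^sub>F r in at_right 0. dist (X r) s0 < \<epsilon>"
      unfolding eventually_at_right_field using \<delta>(1) \<rho>(1) by (intro exI[of _ "min \<delta> \<rho>"]) auto
  qed
  have limA: "(A \<longlongrightarrow> s0) (at_right 0)" and limB: "(B \<longlongrightarrow> s0) (at_right 0)"
    using wr inJ by (intro conv; force)+
  have dir: "((%s. (\<alpha> * g s) /\<^sub>R (s - s0)) \<longlongrightarrow> \<i> * of_real \<beta>) (at s0)"
  proof -
    have "((%s. (g s - g s0) /\<^sub>R (s - s0)) \<longlongrightarrow> speed \<gamma> s0) (at s0)"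
      using g_derivative[of s0 UNIV] d(1) unfolding has_vector_derivative_iff_tendsto by simp
    from tendsto_mult_left[OF this, of \<alpha>] show ?thesis using z0 tangent by simp
  qed
  \<comment> \<open>\<open>\<alpha> g s / (s - s0)\<close> tends to \<open>\<i> \<beta>\<close>, so
    the direction of \<open>\<alpha> g\<close> tends to \<open>\<i> sgn \<beta>\<close> from the
    right of \<open>s0\<close> and to its negative from the left.\<close>
  have unit_lim: "((%r. sgn (\<alpha> * g (X r))) \<longlongrightarrow> \<i> * of_real (\<sigma> * sgn \<beta>)) (at_right 0)"
    if X: "(X \<longlongrightarrow> s0) (at_right 0)" and \<sigma>: "\<sigma> = 1 \<or> \<sigma> = -1" "!!r. 0 < r ==> r <= \<rho> ==> sgn (X r - s0) = \<sigma>" for X \<sigma>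
  proof -
    have ev: "\<forall>\<^sub>F r in at_right 0. X r ~= s0"
      unfolding eventually_at_right_field using \<rho>(1) \<sigma> by (intro exI[of _ \<rho>]) (force simp: sgn_if)
    have "filterlim X (at s0) (at_right 0)" using X ev by (simp add: filterlim_at)
    from filterlim_compose[OF dir this]
    have "((%r. (\<alpha> * g (X r)) /\<^sub>R (X r - s0)) \<longlongrightarrow> \<i> * of_real \<beta>) (at_right 0)" .
    from tendsto_sgn[OF this] \<beta>
    have "((%r. sgn ((\<alpha> * g (X r)) /\<^sub>R (X r - s0))) \<longlongrightarrow> sgn (\<i> * of_real \<beta>)) (at_right 0)" by simp
    from tendsto_mult_left[OF this, of "of_real \<sigma>"]
    have "((%r. of_real \<sigma> * sgn ((\<alpha> * g (X r)) /\<^sub>R (X r - s0))) \<longlongrightarrow> of_real \<sigma> * sgn (\<i> * of_real \<beta>)) (at_right 0)" .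
    moreover have "of_real \<sigma> * sgn (\<i> * of_real \<beta>) = \<i> * of_real (\<sigma> * sgn \<beta>)"
      using \<beta> by (simp add: sgn_eq norm_mult real_sgn_eq)
    moreover have "\<forall>\<^sub>F r in at_right 0. of_real \<sigma> * sgn ((\<alpha> * g (X r)) /\<^sub>R (X r - s0)) = sgn (\<alpha> * g (X r))"
      unfolding eventually_at_right_field
    proof (intro exI[of _ \<rho>] conjI allI impI)
      fix r assume r: "0 < r" "r < \<rho>"
      have "sgn ((\<alpha> * g (X r)) /\<^sub>R (X r - s0)) = of_real (sgn (inverse (X r - s0))) * sgn (\<alpha> * g (X r))"
        by (subst sgn_scaleR) (rule scaleR_conv_of_real)
      also have "sgn (inverse (X r - s0)) = sgn (X r - s0)" by (auto simp: sgn_if)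
      also have "sgn (X r - s0) = \<sigma>" using r by (intro \<sigma>(2)) auto
      finally show "of_real \<sigma> * sgn ((\<alpha> * g (X r)) /\<^sub>R (X r - s0)) = sgn (\<alpha> * g (X r))"
        using \<sigma>(1) by auto
    qed (use \<rho> in auto)
    ultimately show ?thesis by (simp add: tendsto_cong)
  qed
  have nz: "\<i> * of_real (\<sigma> * sgn \<beta>) \<notin> \<real>\<^sub>\<le>\<^sub>0" if "\<sigma> = 1 \<or> \<sigma> = -1" for \<sigma> :: real
    using that \<beta> by (auto simp: complex_nonpos_Reals_iff sgn_if)
  have sA: "sgn (A r - s0) = -1" and sB: "sgn (B r - s0) = 1" if "0 < r" "r <= \<rho>" for r
    using wr(2)[OF that] wr(3)[OF that] by (simp_all add: sgn_if)
  note uA = unit_lim[OF limA, of "-1", OF disjI2[OF refl] sA]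
  note uB = unit_lim[OF limB, of 1, OF disjI1[OF refl] sB]
  have "((%r. Ln (sgn (\<alpha> * g (A r))) - Ln (sgn (\<alpha> * g (B r)))) \<longlongrightarrow> Ln (\<i> * of_real ((-1) * sgn \<beta>)) - Ln (\<i> * of_real (1 * sgn \<beta>))) (at_right 0)"
    by (rule tendsto_diff[OF tendsto_Ln[OF uA nz[of "-1", OF disjI2[OF refl]]] tendsto_Ln[OF uB nz[of 1, OF disjI1[OF refl]]]])
  moreover have "Ln (\<i> * of_real ((-1) * sgn \<beta>)) - Ln (\<i> * of_real (1 * sgn \<beta>)) = - \<i> * of_real (pi * sgn \<beta>)"
    using \<beta> by (auto simp: sgn_if field_simps)
  ultimately have lim: "((%r. Ln (sgn (\<alpha> * g (A r))) - Ln (sgn (\<alpha> * g (B r)))) \<longlongrightarrow> - \<i> * of_real (pi * sgn \<beta>)) (at_right 0)" by simp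
  have Ln_eq: "Ln (\<alpha> * g (A r)) - Ln (\<alpha> * g (B r)) = Ln (sgn (\<alpha> * g (A r))) - Ln (sgn (\<alpha> * g (B r)))" if r: "0 < r" "r <= \<rho>" for r
  proof -
    have "Ln z = of_real (ln (cmod \<alpha> * r)) + Ln (sgn z)" if "cmod z = cmod \<alpha> * r" for z
    proof -
      have "z = of_real (cmod \<alpha> * r) * sgn z" using that \<alpha> r by (simp add: sgn_eq)
      moreover have "sgn z ~= 0" using that \<alpha> r by (auto simp: sgn_zero_iff)
      moreover have "Ln (of_real (cmod \<alpha> * r) * sgn z) = of_real (ln (cmod \<alpha> * r)) + Ln (sgn z)"
        if "sgn z ~= 0" using Ln_times_of_real[OF _ that, of "cmod \<alpha> * r"] Ln_of_real[of "cmod \<alpha> * r"] \<alpha> r by (simp del: of_real_mult)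
      ultimately show ?thesis by metis
    qed
    from this[of "\<alpha> * g (A r)"] this[of "\<alpha> * g (B r)"] wr[OF r] show ?thesis by (simp add: norm_mult)
  qed
  have "((%r. Ln (\<alpha> * g b) - Ln (\<alpha> * g a) + (Ln (sgn (\<alpha> * g (A r))) - Ln (sgn (\<alpha> * g (B r))))) \<longlongrightarrow> pv_const a b) (at_right 0)"
    unfolding pv_const_def using tendsto_add[OF tendsto_const lim] by simp
  then show "((%r. set_lebesgue_integral lborel {s \<in> J. r <= cmod (g s) \<and> cmod (g s) < e} (%s. speed \<gamma> s / g s)) \<longlongrightarrow> pv_const a b) (at_right 0)"
  proof (rule Lim_transform_eventually)
    show "\<forall>\<^sub>F r in at_right 0. Ln (\<alpha> * g b) - Ln (\<alpha> * g a) + (Ln (sgn (\<alpha> * g (A r))) - Ln (sgn (\<alpha> * g (B r)))) =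
        set_lebesgue_integral lborel {s \<in> J. r <= cmod (g s) \<and> cmod (g s) < e} (%s. speed \<gamma> s / g s)"
      unfolding eventually_at_right_field using \<rho>(1) val Ln_eq by (intro exI[of _ \<rho>]) auto
  qed
qed

text \<open>The point of modulus \<open>e\<close> at which \<open>\<alpha> t\<close> is positive: on
  that circle the linear part of \<open>Re P\<close> is largest there.\<close>

definition apex :: "real => complex" where "apex e = of_real (e / cmod \<alpha>) * cnj \<alpha>"

lemma apex: "0 <= e ==> cmod (apex e) = e" "\<alpha> * apex e = of_real (e * cmod \<alpha>)"
proof -
  show "0 <= e ==> cmod (apex e) = e" using \<alpha> by (simp add: apex_def norm_mult norm_divide)
  have "\<alpha> * apex e = of_real (e / cmod \<alpha>) * (\<alpha> * cnj \<alpha>)" by (simp add: apex_def)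
  also have "\<dots> = of_real (e / cmod \<alpha> * (cmod \<alpha>)\<^sup>2)" by (simp only: complex_norm_square[symmetric] of_real_mult)
  also have "e / cmod \<alpha> * (cmod \<alpha>)\<^sup>2 = e * cmod \<alpha>" using \<alpha> by (simp add: power2_eq_square)
  finally show "\<alpha> * apex e = of_real (e * cmod \<alpha>)" .
qed

text \<open>\<open>\<alpha> t\<close> is a convex combination of a non-real number and a positive
  one, so it never meets the cut of \<open>Ln\<close>.\<close>

lemma detour_avoids_cut:
  assumes s: "\<bar>s - s0\<bar> <= d" "s ~= s0" and e: "0 < e" and t: "t \<in> closed_segment (g s) (apex e)"
  shows "\<alpha> * t \<notin> \<real>\<^sub>\<le>\<^sub>0"
proof -
  obtain u where u: "0 <= u" "u <= 1" "t = (1 - u) *\<^sub>R g s + u *\<^sub>R apex e" using t by (auto simp: in_segment)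
  have eq: "\<alpha> * t = of_real (1 - u) * (\<alpha> * g s) + of_real (u * (e * cmod \<alpha>))"
    unfolding u(3) using apex(2)[of e] by (simp add: scaleR_conv_of_real distrib_left mult.left_commute)
  show ?thesis
  proof (cases "u = 1")
    case True
    have "\<alpha> * t = of_real (e * cmod \<alpha>)" using eq True by simp
    moreover have "0 < e * cmod \<alpha>" using e \<alpha> by simp
    ultimately show ?thesis by (simp add: complex_nonpos_Reals_iff)
  next
    case False
    have "Im (\<alpha> * t) = (1 - u) * Im (\<alpha> * g s)" unfolding eq by simp
    then have "Im (\<alpha> * t) ~= 0" using Im_pos(1)[OF s] False by simp
    then show ?thesis by (auto simp: complex_nonpos_Reals_iff)
  qed
qed

text \<open>A fraction \<open>u\<close> of the way to the apex the linear term gains at least 6/7 of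
  \<open>u e |\<alpha>|\<close>. The remainder changes by at most \<open>|\<alpha>| / 4\<close>
  times a distance of at most \<open>2 e u\<close>, that is by half of
  \<open>u e |\<alpha>|\<close>, so 5/14 of it remains.\<close>

lemma detour_Re_pos:
  assumes s: "\<bar>s - s0\<bar> <= d" "cmod (g s) = e" and e: "0 < e"
    and P: "P holomorphic_on ball 0 R" and R: "e < R" and dP: "!!t. cmod t <= e ==> cmod (deriv P t - \<alpha>) <= cmod \<alpha> / 4"
    and t: "t \<in> closed_segment (g s) (apex e)"
  shows "Re (P (g s)) <= Re (P t)"
proof -
  obtain u where u: "0 <= u" "u <= 1" "t = (1 - u) *\<^sub>R g s + u *\<^sub>R apex e" using t by (auto simp: in_segment)
  have tn: "cmod t <= e"
  proof -
    have "closed_segment (g s) (apex e) \<subseteq> cball 0 e"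
      using s e apex(1)[of e] by (intro closed_segment_subset) auto
    then show ?thesis using t by auto
  qed
  define \<psi> where "\<psi> = (%t. P t - \<alpha> * t)"
  have "cmod (\<psi> t - \<psi> (g s)) <= cmod \<alpha> / 4 * cmod (t - g s)"
  proof (rule field_differentiable_bound[of "cball 0 e"])
    fix x :: complex assume x: "x \<in> cball 0 e"
    have "(P has_field_derivative deriv P x) (at x)" using x R by (intro holomorphic_derivI[OF P open_ball]) auto
    then show "(\<psi> has_field_derivative deriv P x - \<alpha>) (at x within cball 0 e)"
      unfolding \<psi>_def by (intro DERIV_diff[OF has_field_derivative_at_within]) (auto intro!: derivative_eq_intros)
    show "cmod (deriv P x - \<alpha>) <= cmod \<alpha> / 4" using x by (intro dP) simp
  qed (use tn s in auto)
  then have 1: "- (cmod \<alpha> / 4 * cmod (t - g s)) <= Re (\<psi> t - \<psi> (g s))"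
    using abs_Re_le_cmod[of "\<psi> t - \<psi> (g s)"] by linarith
  have tg: "t - g s = of_real u * (apex e - g s)" unfolding u(3) by (simp add: scaleR_conv_of_real algebra_simps)
  have r1: "Re (\<alpha> * (t - g s)) = u * (e * cmod \<alpha> - Re (\<alpha> * g s))"
  proof -
    have "\<alpha> * (t - g s) = of_real u * (of_real (e * cmod \<alpha>) - \<alpha> * g s)" unfolding tg apex(2)[symmetric] by (simp add: algebra_simps)
    then show ?thesis by simp
  qed
  have "Re (\<alpha> * g s) <= e * cmod \<alpha> / 7"
    using Re_bound[OF s(1), unfolded norm_mult s(2)] abs_ge_self[of "Re (\<alpha> * g s)"] mult.commute[of e "cmod \<alpha>"] by linarith
  then have "e * cmod \<alpha> - e * cmod \<alpha> / 7 <= e * cmod \<alpha> - Re (\<alpha> * g s)" by linarith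
  from mult_left_mono[OF this u(1)] have r2: "u * (e * cmod \<alpha> - e * cmod \<alpha> / 7) <= Re (\<alpha> * (t - g s))" unfolding r1 .
  have "cmod (t - g s) <= u * (2 * e)"
    unfolding tg norm_mult using u norm_triangle_ineq4[of "apex e" "g s"] apex(1)[of e] e s by (intro mult_mono) auto
  then have r3: "cmod \<alpha> / 4 * cmod (t - g s) <= cmod \<alpha> / 4 * (u * (2 * e))" by (intro mult_left_mono) auto
  from diff_mono[OF r2 r3]
  have "u * (e * cmod \<alpha> - e * cmod \<alpha> / 7) - cmod \<alpha> / 4 * (u * (2 * e)) <= Re (\<alpha> * (t - g s)) - cmod \<alpha> / 4 * cmod (t - g s)" .
  moreover have "0 <= u * (e * cmod \<alpha> - e * cmod \<alpha> / 7) - cmod \<alpha> / 4 * (u * (2 * e))"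
  proof -
    have "u * (e * cmod \<alpha> - e * cmod \<alpha> / 7) - cmod \<alpha> / 4 * (u * (2 * e)) = 5 / 14 * (u * e * cmod \<alpha>)"
      by (simp add: field_simps)
    then show ?thesis using u e by simp
  qed
  moreover have "P t - P (g s) = \<psi> t - \<psi> (g s) + \<alpha> * (t - g s)" by (simp add: \<psi>_def algebra_simps)
  then have "Re (P t) - Re (P (g s)) = Re (\<psi> t - \<psi> (g s)) + Re (\<alpha> * (t - g s))"
    by (metis minus_complex.sel(1) plus_complex.sel(1))
  ultimately show ?thesis using 1 by linarith
qed

text \<open>The regular part has a primitive \<open>\<Phi>\<close> on the disc, and
  \<open>1 / t\<close> has the primitive \<open>Ln (\<alpha> * t)\<close> along the detour. Both
  contributions depend only on the end points of the window, so the window may be replaced by two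
  chords meeting at the apex, each of length at most \<open>2 e\<close>. The half residue is the
  summand of \<open>pv_const\<close> that the primitives do not account for.\<close>

lemma inner_pv_bound:
  assumes win: "is_window e a b" and e: "0 < e" and h: "h holomorphic_on ball 0 R" and R: "e < R"
    and B: "!!t. t \<in> closed_segment (g a) (apex e) \<union> closed_segment (g b) (apex e) ==> cmod (h t / t) <= B"
  shows "cmod (set_lebesgue_integral lborel {a<..<b} (%s. (h (g s) - h 0) / g s * speed \<gamma> s) + h 0 * pv_const a b + \<i> * of_real (pi * sgn \<beta>) * h 0) <= 4 * e * B"
proof -
  have w: "s0 - d < a" "a < s0" "s0 < b" "b < s0 + d" "cmod (g a) = e" "cmod (g b) = e" "{s \<in> J. cmod (g s) <= e} = {a..b}" using win by (auto simp: is_window_def)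
  have sub: "{a..b} \<subseteq> {s0-d..s0+d}" using w by auto
  define k where "k = (%t. if t = 0 then deriv h 0 else (h t - h 0) / t)"
  have kh: "k holomorphic_on ball 0 R"
  proof (rule pole_theorem_open_0[of "%t. h t - h 0" _ 0])
    show "(%t. h t - h 0) holomorphic_on ball 0 R" using h by (intro holomorphic_intros)
    show "k 0 = deriv (%t. h t - h 0) 0"
      using h R e holomorphic_on_imp_differentiable_at[OF h open_ball, of 0] by (simp add: k_def deriv_diff)
  qed (auto simp: k_def)
  obtain \<Phi> where \<Phi>: "!!t. t \<in> ball 0 R ==> (\<Phi> has_field_derivative k t) (at t within ball 0 R)"
    using holomorphic_convex_primitive'[OF convex_ball open_ball kh] by blast
  have gR: "g s \<in> ball 0 R" if "s \<in> {a..b}" for s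
  proof -
    have "s \<in> {s \<in> J. cmod (g s) <= e}" unfolding w(7) by (rule that)
    then show ?thesis using R by simp
  qed
  have kc: "continuous_on {a..b} (%s. k (g s) * speed \<gamma> s)"
    by (intro continuous_on_mult continuous_on_compose2[OF holomorphic_on_imp_continuous_on[OF kh]] continuous_on_subset[OF speed_continuous(1) sub] continuous_on_subset[OF speed_continuous(2) sub])
      (use gR in auto)
  have "((%s. k (g s) * speed \<gamma> s) has_integral \<Phi> (g b) - \<Phi> (g a)) {a..b}"
  proof (rule fundamental_theorem_of_calculus)
    fix s assume s: "s \<in> {a..b}"
    have "(\<Phi> has_field_derivative k (g s)) (at (g s))" using \<Phi>[OF gR[OF s]] gR[OF s] by (simp add: at_within_open[OF _ open_ball])
    from field_vector_diff_chain_within[OF g_derivative[of s "{a..b}"] has_field_derivative_at_within[OF this]] s sub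
    show "((%s. \<Phi> (g s)) has_vector_derivative k (g s) * speed \<gamma> s) (at s within {a..b})"
      by (auto simp: o_def mult.commute)
  qed (use w in auto)
  then have HK: "integral {a..b} (%s. k (g s) * speed \<gamma> s) = \<Phi> (g b) - \<Phi> (g a)" by (rule integral_unique)
  \<comment> \<open>At \<open>s0\<close> the quotient is a division by zero and equals 0, whereas
    \<open>k\<close> takes the derivative of \<open>h\<close>; this is the one exceptional
    point.\<close>
  have eqk: "(h (g s) - h 0) / g s * speed \<gamma> s = (if s = s0 then 0 else k (g s) * speed \<gamma> s)" if "s \<in> {a<..<b}" for s
  proof (cases "s = s0")
    case False
    have "\<bar>s - s0\<bar> <= d" using that w by (auto simp: abs_le_iff)
    from Im_pos(2)[OF this False] show ?thesis using False by (simp add: k_def)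
  qed (simp add: z0)
  have "set_lebesgue_integral lborel {a<..<b} (%s. (h (g s) - h 0) / g s * speed \<gamma> s) = integral {a..b} (%s. k (g s) * speed \<gamma> s)"
  proof (rule set_integral_eq_HK(2)[where X="{s0}", OF kc order_refl])
    have "(%s. indicator ({a<..<b} - {s0}) s *\<^sub>R (k (g s) * speed \<gamma> s)) \<in> borel_measurable borel"
      by (rule borel_measurable_continuous_on_indicator) (auto intro: continuous_on_subset[OF kc])
    moreover have "(%s. indicator ({a<..<b} - {s0}) s *\<^sub>R (k (g s) * speed \<gamma> s)) = (%s. indicator {a<..<b} s *\<^sub>R ((h (g s) - h 0) / g s * speed \<gamma> s))"
    proof
      fix s
      show "indicator ({a<..<b} - {s0}) s *\<^sub>R (k (g s) * speed \<gamma> s) = indicator {a<..<b} s *\<^sub>R ((h (g s) - h 0) / g s * speed \<gamma> s)"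
      proof (cases "s \<in> {a<..<b}")
        case True
        then show ?thesis unfolding eqk[OF True] by (simp add: indicator_def)
      next
        case False
        then have out: "s \<notin> {a<..<b} - {s0}" by blast
        show ?thesis unfolding indicator_simps(2)[OF False] indicator_simps(2)[OF out] by simp
      qed
    qed
    ultimately show "(%s. indicator {a<..<b} s *\<^sub>R ((h (g s) - h 0) / g s * speed \<gamma> s)) \<in> borel_measurable borel" by simp
    show "(h (g s) - h 0) / g s * speed \<gamma> s = k (g s) * speed \<gamma> s" if "a < s" "s < b" "s \<notin> {s0}" for s
      using eqk[of s] that by simp
  qed auto
  then have I1: "set_lebesgue_integral lborel {a<..<b} (%s. (h (g s) - h 0) / g s * speed \<gamma> s) = \<Phi> (g b) - \<Phi> (g a)" by (simp only: HK)
  have seg: "((%t. h t / t) has_contour_integral (\<Phi> (apex e) - \<Phi> (g s)) + h 0 * (Ln (\<alpha> * apex e) - Ln (\<alpha> * g s))) (linepath (g s) (apex e))"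
    if s: "s = a \<or> s = b" for s
  proof -
    have sd: "\<bar>s - s0\<bar> <= d" "s ~= s0" using s w(1-4) by auto
    have sd: "\<bar>s - s0\<bar> <= d" "s ~= s0" "cmod (g s) = e" using s w(5,6) sd by (blast, blast, blast)
    have in_ball: "closed_segment (g s) (apex e) \<subseteq> ball 0 R"
    proof (rule closed_segment_subset[OF _ _ convex_ball])
      show "g s \<in> ball 0 R" using sd(3) R by simp
      show "apex e \<in> ball 0 R" using apex(1)[of e] e R by simp
    qed
    have 1: "(k has_contour_integral \<Phi> (apex e) - \<Phi> (g s)) (linepath (g s) (apex e))"
      using contour_integral_primitive[of "ball 0 R" \<Phi> k "linepath (g s) (apex e)", OF \<Phi>] in_ball
      by (simp only: valid_path_linepath path_image_linepath pathfinish_linepath pathstart_linepath simp_thms)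
    have 2: "((%t. 1 / t) has_contour_integral Ln (\<alpha> * apex e) - Ln (\<alpha> * g s)) (linepath (g s) (apex e))"
    proof -
      have "((%t. Ln (\<alpha> * t)) has_field_derivative 1 / t) (at t within closed_segment (g s) (apex e))" if "t \<in> closed_segment (g s) (apex e)" for t
      proof -
        have nc: "\<alpha> * t \<notin> \<real>\<^sub>\<le>\<^sub>0" by (rule detour_avoids_cut[OF sd(1,2) e that])
        then have "t ~= 0" by auto
        have "((%t. \<alpha> * t) has_field_derivative \<alpha>) (at t)" using DERIV_cmult_Id by blast
        from DERIV_chain2[OF has_field_derivative_Ln[OF nc] this]
        have "((%t. Ln (\<alpha> * t)) has_field_derivative inverse (\<alpha> * t) * \<alpha>) (at t)" .
        moreover have "inverse (\<alpha> * t) * \<alpha> = 1 / t" using \<open>t ~= 0\<close> \<alpha> by (simp add: field_simps)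
        ultimately show ?thesis using has_field_derivative_at_within by metis
      qed
      from contour_integral_primitive[of "closed_segment (g s) (apex e)" "%t. Ln (\<alpha> * t)" "%t. 1 / t" "linepath (g s) (apex e)", OF this]
      show ?thesis by (simp only: valid_path_linepath path_image_linepath pathfinish_linepath pathstart_linepath order_refl)
    qed
    have 3: "((%t. k t + h 0 * (1 / t)) has_contour_integral (\<Phi> (apex e) - \<Phi> (g s)) + h 0 * (Ln (\<alpha> * apex e) - Ln (\<alpha> * g s))) (linepath (g s) (apex e))"
      by (intro has_contour_integral_add 1 has_contour_integral_lmul 2)
    show ?thesis
    proof (rule has_contour_integral_eq[OF 3])
      fix t assume "t \<in> path_image (linepath (g s) (apex e))"
      then have "t \<in> closed_segment (g s) (apex e)" by simp
      from detour_avoids_cut[OF sd(1,2) e this] have "t ~= 0" by auto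
      then show "k t + h 0 * (1 / t) = h t / t" by (simp add: k_def field_simps)
    qed
  qed
  have bnd: "cmod ((\<Phi> (apex e) - \<Phi> (g s)) + h 0 * (Ln (\<alpha> * apex e) - Ln (\<alpha> * g s))) <= B * (2 * e)" if s: "s = a \<or> s = b" for s
  proof -
    have B0: "0 <= B" by (rule order_trans[OF norm_ge_zero B[of "g a"]]) simp
    have "cmod ((\<Phi> (apex e) - \<Phi> (g s)) + h 0 * (Ln (\<alpha> * apex e) - Ln (\<alpha> * g s))) <= B * cmod (apex e - g s)"
    proof (rule has_contour_integral_bound_linepath[OF seg[OF s] B0])
      fix x assume "x \<in> closed_segment (g s) (apex e)"
      then have "x \<in> closed_segment (g a) (apex e) \<union> closed_segment (g b) (apex e)" using s by blast
      then show "cmod (h x / x) <= B" by (rule B)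
    qed
    also have "cmod (apex e - g s) <= 2 * e"
      using norm_triangle_ineq4[of "apex e" "g s"] apex(1)[of e] e s w(5,6) by auto
    then have "B * cmod (apex e - g s) <= B * (2 * e)" using B0 by (rule mult_left_mono)
    finally show ?thesis .
  qed
  define X where "X = (%s. (\<Phi> (apex e) - \<Phi> (g s)) + h 0 * (Ln (\<alpha> * apex e) - Ln (\<alpha> * g s)))"
  have "set_lebesgue_integral lborel {a<..<b} (%s. (h (g s) - h 0) / g s * speed \<gamma> s) + h 0 * pv_const a b + \<i> * of_real (pi * sgn \<beta>) * h 0 = X a - X b"
    unfolding I1 X_def pv_const_def by (simp add: algebra_simps)
  moreover have "cmod (X a - X b) <= B * (2 * e) + B * (2 * e)"
    unfolding X_def by (intro order_trans[OF norm_triangle_ineq4] add_mono bnd) auto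
  ultimately show ?thesis by (simp add: mult_ac)
qed

end

section \<open>The principal value over the product\<close>

lemma holomorphic_several_continuous: "holomorphic_several h T ==> continuous_on T h"
  unfolding holomorphic_several_def by (meson continuous_at_imp_continuous_on has_derivative_continuous)

lemma holomorphic_several_section:
  assumes "holomorphic_several h T" "!!\<theta>. \<theta> \<in> S ==> (\<theta>, t) \<in> T"
  shows "holomorphic_vec (%\<theta>. h (\<theta>, t)) S"
  unfolding holomorphic_vec_def
proof
  fix \<theta> assume "\<theta> \<in> S"
  then obtain L where L: "(h has_derivative L) (at (\<theta>, t))" "!!a v w. L (a *s v, a * w) = a * L (v, w)"
    using assms unfolding holomorphic_several_def by blast
  have "((%\<theta>. (\<theta>, t)) has_derivative (%v. (v, 0))) (at \<theta>)"
    by (intro has_derivative_Pair has_derivative_ident has_derivative_const)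
  from has_derivative_compose[OF this L(1)]
  have "((%\<theta>. h (\<theta>, t)) has_derivative (%v. L (v, 0))) (at \<theta>)" .
  moreover have "L (a *s v, 0) = a * L (v, 0)" for a v using L(2)[of a v 0] by simp
  ultimately show "\<exists>L. ((%\<theta>. h (\<theta>, t)) has_derivative L) (at \<theta>) \<and> (\<forall>a v. L (a *s v) = a * L v)"
    by (intro exI[of _ "%v. L (v, 0)"]) simp
qed

lemma holomorphic_several_fibre:
  assumes "holomorphic_several h T" "!!t. t \<in> S ==> (\<theta>, t) \<in> T"
  shows "(%t. h (\<theta>, t)) holomorphic_on S"
  unfolding holomorphic_on_def
proof
  fix t assume "t \<in> S"
  then obtain L where L: "(h has_derivative L) (at (\<theta>, t))" "!!a v w. L (a *s v, a * w) = a * L (v, w)"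
    using assms unfolding holomorphic_several_def by blast
  have "((%t. (\<theta>, t)) has_derivative (%w. (0, w))) (at t)"
    by (intro has_derivative_Pair has_derivative_ident has_derivative_const)
  from has_derivative_compose[OF this L(1)]
  have "((%t. h (\<theta>, t)) has_derivative (%w. L (0, w))) (at t)" .
  moreover have "(%w. L (0, w)) = (*) (L (0, 1))" 
  proof
    fix w show "L (0, w) = L (0, 1) * w" using L(2)[of w 0 1] by (simp add: mult.commute)
  qed
  ultimately have "((%t. h (\<theta>, t)) has_field_derivative L (0, 1)) (at t)" by (simp add: has_field_derivative_def)
  then show "(%t. h (\<theta>, t)) field_differentiable at t within S"
    unfolding field_differentiable_def using has_field_derivative_at_within by blast
qed

lemma holomorphic_several_exp_mult:
  assumes p: "holomorphic_several p T" and f: "holomorphic_several f T" and q: "holomorphic_several q T"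
  shows "holomorphic_several (%z. exp (a * p z + b * f z) * q z) T"
  unfolding holomorphic_several_def
proof
  fix z assume z: "z \<in> T"
  obtain L1 where L1: "(p has_derivative L1) (at z)" "!!a v w. L1 (a *s v, a * w) = a * L1 (v, w)"
    using p z unfolding holomorphic_several_def by blast
  obtain L2 where L2: "(f has_derivative L2) (at z)" "!!a v w. L2 (a *s v, a * w) = a * L2 (v, w)"
    using f z unfolding holomorphic_several_def by blast
  obtain L3 where L3: "(q has_derivative L3) (at z)" "!!a v w. L3 (a *s v, a * w) = a * L3 (v, w)"
    using q z unfolding holomorphic_several_def by blast
  have "((%z. a * p z + b * f z) has_derivative (%h. a * L1 h + b * L2 h)) (at z)"
    by (intro has_derivative_add has_derivative_mult_right L1 L2)
  moreover have "(exp has_derivative (*) (exp (a * p z + b * f z))) (at (a * p z + b * f z))"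
    using DERIV_exp[of "a * p z + b * f z"] unfolding has_field_derivative_def .
  ultimately have e: "((%z. exp (a * p z + b * f z)) has_derivative (%h. exp (a * p z + b * f z) * (a * L1 h + b * L2 h))) (at z)"
    using has_derivative_compose by blast
  define L where "L = (%h. exp (a * p z + b * f z) * L3 h + exp (a * p z + b * f z) * (a * L1 h + b * L2 h) * q z)"
  have "((%z. exp (a * p z + b * f z) * q z) has_derivative L) (at z)"
    unfolding L_def by (rule has_derivative_mult[OF e L3(1)])
  moreover have "L (c *s v, c * w) = c * L (v, w)" for c v w
    unfolding L_def L1(2) L2(2) L3(2) by (simp add: algebra_simps)
  ultimately show "\<exists>L. ((%z. exp (a * p z + b * f z) * q z) has_derivative L) (at z) \<and> (\<forall>a v w. L (a *s v, a * w) = a * L (v, w))"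
    by blast
qed

text \<open>Near \<open>t = 0\<close> the mean value inequality applies, with the derivative bounded
  by Cauchy's estimate on a tube around \<open>K \<times> {0}\<close> of uniform radius; farther out
  the denominator is at least \<open>R / 2\<close>.\<close>

lemma difference_quotient_bounded:
  assumes h: "holomorphic_several h T" and T: "open T" and K: "compact K" and C: "compact C"
    and sub: "K \<times> C \<subseteq> T" "K \<times> {0} \<subseteq> T"
  obtains B where "!!\<theta> t. \<theta> \<in> K ==> t \<in> C ==> cmod ((h (\<theta>, t) - h (\<theta>, 0)) / t) <= B"
proof -
  note hc = holomorphic_several_continuous[OF h]
  have "compact (K \<times> {0 :: complex})" using K by (intro compact_Times) auto
  then obtain R where R: "0 < R" and "(\<Union>z\<in>K \<times> {0 :: complex}. cball z R) \<subseteq> T"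
    using compact_subset_open_imp_cball_epsilon_subset[OF _ T sub(2)] by blast
  then have tube: "K \<times> cball 0 R \<subseteq> T" by (fastforce simp: dist_Pair_Pair)
  have "compact (h ` (K \<times> cball 0 R))" "compact (h ` (K \<times> C))"
    using K C by (auto intro!: compact_continuous_image continuous_on_subset[OF hc] tube sub compact_Times)
  then have "bounded (h ` (K \<times> cball 0 R) \<union> h ` (K \<times> C))" by (simp add: compact_imp_bounded)
  then obtain M where M: "0 < M" "!!y. y \<in> h ` (K \<times> cball 0 R) \<union> h ` (K \<times> C) ==> cmod y <= M"
    unfolding bounded_pos by blast
  have "cmod ((h (\<theta>, t) - h (\<theta>, 0)) / t) <= 4 * M / R" if \<theta>: "\<theta> \<in> K" and t: "t \<in> C" for \<theta> t
  proof (cases "cmod t <= R / 2")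
    case True
    define f where "f = (%t. h (\<theta>, t))"
    have fh: "f holomorphic_on S" if "S \<subseteq> cball 0 R" for S
      unfolding f_def using tube \<theta> that by (intro holomorphic_several_fibre[OF h]) auto
    have "cmod (f t - f 0) <= (2 * M / R) * cmod (t - 0)"
    proof (rule field_differentiable_bound[of "cball 0 (R/2)"])
      fix x :: complex assume x: "x \<in> cball 0 (R/2)"
      have sub: "cball x (R/2) \<subseteq> cball 0 R"
      proof
        fix y assume "y \<in> cball x (R/2)"
        then have "cmod (x - y) <= R / 2" "cmod x <= R / 2" using x by (auto simp: dist_norm)
        then show "y \<in> cball 0 R" using norm_triangle_ineq4[of x "x - y"] by simp
      qed
      have "cmod ((deriv ^^ 1) f x) <= fact 1 * M / (R / 2) ^ 1"
      proof (rule Cauchy_inequality)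
        show "f holomorphic_on ball x (R/2)" using sub ball_subset_cball by (intro fh) blast
        show "continuous_on (cball x (R/2)) f" by (rule holomorphic_on_imp_continuous_on[OF fh[OF sub]])
        fix y assume "cmod (x - y) = R / 2"
        then have "y \<in> cball x (R/2)" by (simp add: dist_norm)
        then have "f y \<in> h ` (K \<times> cball 0 R)" using sub \<theta> unfolding f_def by blast
        then show "cmod (f y) <= M" using M(2) by blast
      qed (use R in auto)
      then show "cmod (deriv f x) <= 2 * M / R" by (simp add: mult.commute)
      have "f holomorphic_on ball 0 R" by (rule fh) auto
      then have "(f has_field_derivative deriv f x) (at x)" using x R by (intro holomorphic_derivI[OF _ open_ball]) auto
      then show "(f has_field_derivative deriv f x) (at x within cball 0 (R/2))" by (rule has_field_derivative_at_within)
    qed (use True R in auto)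
    also have "(2 * M / R) * cmod (t - 0) <= (4 * M / R) * cmod t"
      using M(1) R by (simp add: divide_right_mono mult_right_mono)
    finally show ?thesis using M(1) R unfolding f_def by (cases "t = 0") (simp_all add: norm_divide divide_le_eq)
  next
    case False
    have "cmod (h (\<theta>, t)) <= M" "cmod (h (\<theta>, 0)) <= M" using \<theta> t R by (auto intro!: M(2))
    then have "cmod (h (\<theta>, t) - h (\<theta>, 0)) <= 2 * M" using norm_triangle_ineq4[of "h (\<theta>, t)" "h (\<theta>, 0)"] by linarith
    then have "cmod ((h (\<theta>, t) - h (\<theta>, 0)) / t) <= 2 * M / (R / 2)"
      unfolding norm_divide using False R M(1) by (intro frac_le) auto
    then show ?thesis by simp
  qed
  then show ?thesis by (rule that)
qed

text \<open>Excludes parameters that run off to infinity or to a missing end point. For an arc the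
  set is the image of \<open>C\<close> under the continuous inverse; for a Jordan curve the
  parameter interval is itself compact.\<close>

lemma smooth_simple_curve_compact_preimage:
  assumes c: "smooth_simple_curve \<gamma>" and C: "compact C" "C \<subseteq> curve_trace \<gamma>"
  shows "compact {s \<in> fst \<gamma>. snd \<gamma> s \<in> C}"
proof -
  obtain J c where g: "\<gamma> = (J, c)" by (cases \<gamma>)
  have cont: "continuous_on J c" using smooth_simple_curve_continuous[OF assms(1)] by (simp add: g)
  have alt: "(\<exists>g. homeomorphism J (c ` J) c g) \<or> (\<exists>a b. J = {a..b})"
    using c unfolding smooth_simple_curve_def g by auto
  then show ?thesis
  proof
    assume "\<exists>g. homeomorphism J (c ` J) c g"
    then obtain k where k: "homeomorphism J (c ` J) c k" by blast
    have "{s \<in> J. c s \<in> C} = k ` C"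
    proof (intro equalityI subsetI)
      fix s assume "s \<in> {s \<in> J. c s \<in> C}"
      then have "s = k (c s)" "c s \<in> C" using k by (auto simp: homeomorphism_def)
      then show "s \<in> k ` C" by blast
    next
      fix s assume "s \<in> k ` C"
      then obtain z where z: "z \<in> C" "s = k z" by blast
      then have "z \<in> c ` J" using C(2) by (auto simp: g)
      then have "c s = z" "s \<in> J" using k z by (auto simp: homeomorphism_def)
      then show "s \<in> {s \<in> J. c s \<in> C}" using z by simp
    qed
    moreover have "continuous_on C k" using k C(2) unfolding homeomorphism_def g by (auto elim: continuous_on_subset)
    ultimately show ?thesis using compact_continuous_image[OF _ C(1)] by (simp add: g)
  next
    assume "\<exists>a b. J = {a..b}"
    then have J: "compact J" by auto
    have "closed {s \<in> J. c s \<in> C}"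
      using continuous_closed_preimage[OF cont compact_imp_closed[OF J] compact_imp_closed[OF C(1)]]
      by (simp add: vimage_def Int_def)
    from compact_Int_closed[OF J this] have "compact {s \<in> J. c s \<in> C}" by (simp add: Int_def)
    then show ?thesis by (simp add: g)
  qed
qed

lemma compact_vec_product:
  assumes "!!k. compact (S k)" shows "compact {x :: real ^ 'm::finite. \<forall>k. x $ k \<in> S k}"
proof -
  have "\<exists>B. \<forall>y\<in>S k. \<bar>y\<bar> <= B" for k
    using compact_imp_bounded[OF assms[of k]] unfolding bounded_iff by simp
  then obtain B where B: "!!k y. y \<in> S k ==> \<bar>y\<bar> <= B k" by metis
  have "closed (\<Inter>k. {x :: real ^ 'm. x $ k \<in> S k})"
  proof (intro closed_INT ballI)
    fix k
    have "closed ((%x :: real ^ 'm. x $ k) -` S k)"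
      by (intro continuous_closed_vimage compact_imp_closed assms) simp
    then show "closed {x :: real ^ 'm. x $ k \<in> S k}" by (simp add: vimage_def)
  qed
  moreover have "(\<Inter>k. {x :: real ^ 'm. x $ k \<in> S k}) = {x. \<forall>k. x $ k \<in> S k}" by blast
  moreover have "{x :: real ^ 'm. \<forall>k. x $ k \<in> S k} \<subseteq> cbox (\<chi> k. - B k) (\<chi> k. B k)"
  proof
    fix x assume "x \<in> {x :: real ^ 'm. \<forall>k. x $ k \<in> S k}"
    then have "\<bar>x $ k\<bar> <= B k" for k using B by blast
    then have "- B k <= x $ k \<and> x $ k <= B k" for k using abs_le_D1 abs_le_D2 minus_le_iff by metis
    then show "x \<in> cbox (\<chi> k. - B k) (\<chi> k. B k)" by (simp add: mem_box_cart)
  qed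
  ultimately show ?thesis
    using bounded_subset[OF bounded_cbox] unfolding compact_eq_bounded_closed by auto
qed

lemma is_interval_borel:
  fixes J :: "real set" assumes "is_interval J" shows "J \<in> sets borel"
  using is_real_interval[OF assms] by (elim exE disjE) (simp_all only: sets.empty_sets sets.top borel_comp, auto)

lemma set_integrable_times:
  fixes f :: "'a::euclidean_space => complex" and g :: "'b::euclidean_space => complex"
  assumes f: "set_integrable lborel A f" and g: "set_integrable lborel B g"
  shows "set_integrable lborel (A \<times> B) (%(x, s). f x * g s)"
    and "set_lebesgue_integral lborel (A \<times> B) (%(x, s). f x * g s) = set_lebesgue_integral lborel A f * set_lebesgue_integral lborel B g"
proof -
  define F where "F = (%x. indicator A x *\<^sub>R f x)"
  define G where "G = (%x. indicator B x *\<^sub>R g x)"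
  have F: "integrable lborel F" and G: "integrable lborel G" using f g by (simp_all add: F_def G_def set_integrable_def)
  have [measurable]: "F \<in> borel_measurable lborel" "G \<in> borel_measurable lborel" using F G by simp_all
  have eq: "indicator (A \<times> B) z *\<^sub>R (case z of (x, s) => f x * g s) = (case z of (x, s) => F x * G s)" for z
    by (cases z) (simp add: F_def G_def indicator_times)
  have int: "integrable (lborel \<Otimes>\<^sub>M lborel) (%(x, s). F x * G s)"
  proof (rule lborel_pair.Fubini_integrable)
    show "integrable lborel (%x. \<integral>y. cmod (case (x, y) of (x, s) => F x * G s) \<partial>lborel)"
      using F by (simp add: norm_mult)
    show "AE x in lborel. integrable lborel (%y. case (x, y) of (x, s) => F x * G s)" using G by simp
  qed measurable
  then show "set_integrable lborel (A \<times> B) (%(x, s). f x * g s)"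
    unfolding set_integrable_def eq by (simp add: lborel_prod)
  have "(\<integral>(x, s). F x * G s \<partial>(lborel \<Otimes>\<^sub>M lborel)) = (\<integral>x. (\<integral>s. F x * G s \<partial>lborel) \<partial>lborel)"
    using lborel_pair.integral_fst[OF int] by simp
  then show "set_lebesgue_integral lborel (A \<times> B) (%(x, s). f x * g s) = set_lebesgue_integral lborel A f * set_lebesgue_integral lborel B g"
    unfolding set_lebesgue_integral_def eq by (simp add: lborel_prod F_def[symmetric] G_def[symmetric])
qed

locale curve_setting = crossing_arc +
  fixes \<Gamma> :: "'m::finite => curve" and x0 :: "real ^ 'm"
  assumes curves: "!!k. smooth_simple_curve (\<Gamma> k)"
    and x0: "!!k. x0 $ k \<in> interior (fst (\<Gamma> k))" "!!k. snd (\<Gamma> k) (x0 $ k) = 0"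
begin

abbreviation \<Theta> :: "real ^ 'm => complex ^ 'm" where "\<Theta> \<equiv> theta_param \<Gamma>"
abbreviation X :: "(real ^ 'm) set" where "X \<equiv> {x. \<forall>k. x $ k \<in> fst (\<Gamma> k)}"
abbreviation D :: "((complex ^ 'm) \<times> complex) set" where "D \<equiv> curve_product \<Gamma> \<gamma>"

definition w :: "real ^ 'm => complex" where "w x = (\<Prod>k\<in>UNIV. speed (\<Gamma> k) (x $ k))"

lemma s0_J: "s0 \<in> J" using s0 interior_subset by blast

lemma param_in_D: "x \<in> X ==> s \<in> J ==> (\<Theta> x, g s) \<in> D"
  by (auto simp: curve_product_def theta_set_def theta_param_def)

lemma param_0_in_D: "x \<in> X ==> (\<Theta> x, 0) \<in> D"
  using param_in_D[OF _ s0_J] z0 by simp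

lemma X_borel [measurable]: "X \<in> sets borel"
proof -
  have "(%x :: real ^ 'm. x $ k) -` fst (\<Gamma> k) \<inter> space borel \<in> sets borel" for k
    by (intro measurable_sets[of _ _ borel] is_interval_borel smooth_simple_curve_speed(4) curves) simp
  then have "(\<Inter>k. (%x :: real ^ 'm. x $ k) -` fst (\<Gamma> k)) \<in> sets borel"
    by (intro sets.countable_INT') auto
  moreover have "(\<Inter>k. (%x :: real ^ 'm. x $ k) -` fst (\<Gamma> k)) = X" by auto
  ultimately show ?thesis by simp
qed

lemma J_borel [measurable]: "J \<in> sets borel"
  by (intro is_interval_borel smooth_simple_curve_speed(4) curve)

lemma continuous_on_theta: "continuous_on X \<Theta>"
  unfolding theta_param_def
  by (intro continuous_on_vec_lambda continuous_on_compose2[OF smooth_simple_curve_continuous[OF curves]] continuous_intros) auto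

lemma continuous_on_w: "continuous_on X w"
  unfolding w_def
  by (intro continuous_on_prod continuous_on_compose2[OF smooth_simple_curve_speed(1)[OF curves]] continuous_intros) auto

lemmas continuous_on_g = smooth_simple_curve_continuous[OF curve]
lemmas continuous_on_speed = smooth_simple_curve_speed(1)[OF curve]

lemma J_preimage_borel [measurable]:
  assumes "C \<in> sets borel" shows "{s \<in> J. cmod (g s) \<in> C} \<in> sets borel"
proof -
  have "(%s. cmod (g s)) \<in> borel_measurable (restrict_space borel J)"
    by (intro borel_measurable_continuous_on_restrict continuous_on_norm continuous_on_g)
  from measurable_sets[OF this assms]
  have "(%s. cmod (g s)) -` C \<inter> J \<in> sets (restrict_space borel J)" by (simp add: space_restrict_space)
  then have "(%s. cmod (g s)) -` C \<inter> J \<in> sets borel"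
    using sets_restrict_space_iff[of J borel] by simp
  moreover have "(%s. cmod (g s)) -` C \<inter> J = {s \<in> J. cmod (g s) \<in> C}" by blast
  ultimately show ?thesis by simp
qed

lemma J_ranges_borel:
  "{s \<in> J. r <= cmod (g s)} \<in> sets borel" "{s \<in> J. cmod (g s) < r} \<in> sets borel" "{s \<in> J. r <= cmod (g s) \<and> cmod (g s) < e} \<in> sets borel"
  using J_preimage_borel[of "{r..}"] J_preimage_borel[of "{..<r}"] J_preimage_borel[of "{r..<e}"] by simp_all

lemma Times_borel: "A \<in> sets borel ==> B \<in> sets borel ==> A \<times> B \<in> sets (lborel :: ((real ^ 'm) \<times> real) measure)"
proof -
  assume "A \<in> sets borel" "B \<in> sets borel"
  then have "A \<times> B \<in> sets (borel \<Otimes>\<^sub>M borel)" by (rule pair_measureI)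
  then show "A \<times> B \<in> sets (lborel :: ((real ^ 'm) \<times> real) measure)" unfolding borel_prod sets_lborel .
qed

lemma preimage_eq: "preimage \<Gamma> \<gamma> {(\<theta>, t) \<in> D. r <= cmod t} = X \<times> {s \<in> J. r <= cmod (g s)}"
  unfolding preimage_def by (auto simp: param_in_D)

lemma pullback_eq: "pullback \<Gamma> \<gamma> h = (%(x, s). h (\<Theta> x, g s) * w x * speed \<gamma> s)"
  unfolding pullback_def w_def ..

text \<open>Where \<open>g s = 0\<close> the quotient is 0 by the convention for division. This
  makes \<open>full_eq\<close> hold at every point, the pole included.\<close>

definition quot :: "((complex ^ 'm) \<times> complex => complex) => (real ^ 'm) \<times> real => complex" where
  "quot h = (%(x, s). (h (\<Theta> x, g s) - h (\<Theta> x, 0)) / g s * w x * speed \<gamma> s)"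

definition full :: "((complex ^ 'm) \<times> complex => complex) => (real ^ 'm) \<times> real => complex" where
  "full h = (%(x, s). h (\<Theta> x, g s) / g s * w x * speed \<gamma> s)"

definition residue :: "((complex ^ 'm) \<times> complex => complex) => real ^ 'm => complex" where
  "residue h = (%x. h (\<Theta> x, 0) * w x)"

lemma full_eq: "full h z = quot h z + (case z of (x, s) => residue h x * (speed \<gamma> s / g s))"
  by (cases z) (simp add: full_def quot_def residue_def diff_divide_distrib algebra_simps)

context
  fixes T h
  assumes T: "open T" and D_T: "D \<subseteq> T" and h: "holomorphic_several h T"
begin

lemma continuous_on_param: "continuous_on (X \<times> J) (%(x, s). h (\<Theta> x, g s))" "continuous_on X (%x. h (\<Theta> x, 0))"
proof -
  have "continuous_on (X \<times> J) (%z. h (\<Theta> (fst z), g (snd z)))"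
    using D_T param_in_D
    by (intro continuous_on_compose2[OF holomorphic_several_continuous[OF h]] continuous_on_Pair
        continuous_on_compose2[OF continuous_on_theta] continuous_on_compose2[OF continuous_on_g] continuous_on_fst continuous_on_snd continuous_on_id) auto
  then show "continuous_on (X \<times> J) (%(x, s). h (\<Theta> x, g s))" by (simp add: case_prod_beta)
  show "continuous_on X (%x. h (\<Theta> x, 0))"
    using D_T param_0_in_D
    by (intro continuous_on_compose2[OF holomorphic_several_continuous[OF h]] continuous_on_Pair continuous_on_theta continuous_on_const) auto
qed

lemma residue_continuous: "continuous_on X (residue h)"
  unfolding residue_def by (intro continuous_on_mult continuous_on_param continuous_on_w)

lemma quot_measurable: "(%z. indicator (X \<times> J) z *\<^sub>R quot h z) \<in> borel_measurable borel"
proof -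
  have XJ: "X \<times> J \<in> sets borel" using Times_borel[OF X_borel J_borel] by simp
  have cont: "continuous_on (X \<times> J) (%z. h (\<Theta> (fst z), 0))" "continuous_on (X \<times> J) (%z. g (snd z))"
      "continuous_on (X \<times> J) (%z. w (fst z))" "continuous_on (X \<times> J) (%z. speed \<gamma> (snd z))"
    by (rule continuous_on_compose2[OF continuous_on_param(2)] continuous_on_compose2[OF continuous_on_g]
        continuous_on_compose2[OF continuous_on_w] continuous_on_compose2[OF continuous_on_speed]; auto intro: continuous_on_fst continuous_on_snd continuous_on_id)+
  note m = borel_measurable_continuous_on_indicator[OF XJ cont(1)] borel_measurable_continuous_on_indicator[OF XJ cont(2)]
    borel_measurable_continuous_on_indicator[OF XJ cont(3)] borel_measurable_continuous_on_indicator[OF XJ cont(4)]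
    borel_measurable_continuous_on_indicator[OF XJ continuous_on_param(1)]
  have "(%z. (indicator (X \<times> J) z *\<^sub>R (case z of (x, s) => h (\<Theta> x, g s)) - indicator (X \<times> J) z *\<^sub>R h (\<Theta> (fst z), 0)) /
     (indicator (X \<times> J) z *\<^sub>R g (snd z)) * (indicator (X \<times> J) z *\<^sub>R w (fst z)) * (indicator (X \<times> J) z *\<^sub>R speed \<gamma> (snd z))) \<in> borel_measurable borel"
    by (intro borel_measurable_times borel_measurable_divide borel_measurable_diff m)
  moreover have "(indicator (X \<times> J) z *\<^sub>R (case z of (x, s) => h (\<Theta> x, g s)) - indicator (X \<times> J) z *\<^sub>R h (\<Theta> (fst z), 0)) /
     (indicator (X \<times> J) z *\<^sub>R g (snd z)) * (indicator (X \<times> J) z *\<^sub>R w (fst z)) * (indicator (X \<times> J) z *\<^sub>R speed \<gamma> (snd z)) =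
     indicator (X \<times> J) z *\<^sub>R quot h z" for z
    by (cases "z \<in> X \<times> J") (simp_all add: quot_def case_prod_beta)
  ultimately show ?thesis by simp
qed

text \<open>The convergence hypothesis comes with some radius \<open>\<epsilon>\<close>, while the
  evaluation uses the window radius \<open>e\<close>. Near the origin everything is bounded on a
  compact set; away from it the hypothesis applies; and a change of radius adds or removes the
  residue times \<open>dt / t\<close> over a ring.\<close>

lemma normal_form:
  assumes pv: "pv_abs_convergent_away_from_origin \<Gamma> \<gamma> h"
    and e: "!!r. 0 < r ==> set_integrable lborel {s \<in> J. r <= cmod (g s) \<and> cmod (g s) < e} (%s. speed \<gamma> s / g s)"
  shows "set_integrable lborel X (residue h)"
    and "!!r. 0 < r ==> set_integrable lborel (X \<times> {s \<in> J. r <= cmod (g s)}) (full h)"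
    and "set_integrable lborel (X \<times> {s \<in> J. cmod (g s) < e}) (quot h)"
proof -
  obtain \<epsilon> where \<epsilon>: "0 < \<epsilon>" and comp: "compact {(\<theta>, t) \<in> D. (\<forall>k. cmod (\<theta> $ k) <= \<epsilon>) \<and> cmod t <= \<epsilon>}"
    and A1: "abs_integrable \<Gamma> \<gamma> (D - origin_box \<Gamma> \<gamma> \<epsilon>) (%(\<theta>, t). if cmod t < \<epsilon> then (h (\<theta>, t) - h (\<theta>, 0)) / t else h (\<theta>, t) / t)"
    and A2: "theta_abs_integrable \<Gamma> {\<theta> \<in> theta_set \<Gamma>. (\<theta>, 0) \<notin> origin_box \<Gamma> \<gamma> \<epsilon>} (%\<theta>. h (\<theta>, 0))"
    using pv unfolding pv_abs_convergent_away_from_origin_def by blast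
  \<comment> \<open>\<open>Y\<close> has the strict inequalities of \<open>origin_box\<close>, so
    its complement is where the hypothesis speaks; \<open>Yc\<close> is its compact companion, and
    \<open>Yc\<close> together with \<open>X - Y\<close> covers \<open>X\<close>.\<close>
  define Y where "Y = {x \<in> X. \<forall>k. cmod (\<Theta> x $ k) < \<epsilon>}"
  define Yc where "Yc = {x \<in> X. \<forall>k. cmod (\<Theta> x $ k) <= \<epsilon>}"
  define Jc where "Jc = {s \<in> J. cmod (g s) <= \<epsilon>}"
  have x0X: "x0 \<in> X" using x0(1) interior_subset by blast
  have \<Theta>0: "\<Theta> x0 = 0" by (simp add: theta_param_def vec_eq_iff x0)
  have zt: "0 \<in> curve_trace \<gamma>" using s0_J z0 by force
  have "compact (snd ` {(\<theta>, t) \<in> D. (\<forall>k. cmod (\<theta> $ k) <= \<epsilon>) \<and> cmod t <= \<epsilon>})"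
    by (intro compact_continuous_image[OF _ comp] continuous_intros)
  also have "snd ` {(\<theta>, t) \<in> D. (\<forall>k. cmod (\<theta> $ k) <= \<epsilon>) \<and> cmod t <= \<epsilon>} = {t \<in> curve_trace \<gamma>. cmod t <= \<epsilon>}" (is "?l = ?r")
  proof (intro equalityI subsetI)
    fix t assume "t \<in> ?r"
    then have "(\<Theta> x0, t) \<in> {(\<theta>, t) \<in> D. (\<forall>k. cmod (\<theta> $ k) <= \<epsilon>) \<and> cmod t <= \<epsilon>}"
      using param_in_D[OF x0X] \<Theta>0 \<epsilon> by auto
    then show "t \<in> ?l" by force
  qed (auto simp: curve_product_def)
  finally have ct: "compact {t \<in> curve_trace \<gamma>. cmod t <= \<epsilon>}" .
  have ck: "compact {z \<in> curve_trace (\<Gamma> k). cmod z <= \<epsilon>}" for k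
  proof -
    have "compact ((%z. fst z $ k) ` {(\<theta>, t) \<in> D. (\<forall>k. cmod (\<theta> $ k) <= \<epsilon>) \<and> cmod t <= \<epsilon>})"
      by (intro compact_continuous_image[OF _ comp] continuous_intros)
    also have "(%z. fst z $ k) ` {(\<theta>, t) \<in> D. (\<forall>k. cmod (\<theta> $ k) <= \<epsilon>) \<and> cmod t <= \<epsilon>} = {z \<in> curve_trace (\<Gamma> k). cmod z <= \<epsilon>}" (is "?l = ?r")
    proof (intro equalityI subsetI)
      fix z assume z: "z \<in> ?r"
      have "0 \<in> curve_trace (\<Gamma> j)" for j using x0X x0(2)[of j] by force
      \<comment> \<open>To recover the piece of a single curve by projection, all other coordinates
        are placed at the pole 0, which lies on every curve.\<close>
      then have "((\<chi> j. if j = k then z else 0), 0) \<in> {(\<theta>, t) \<in> D. (\<forall>k. cmod (\<theta> $ k) <= \<epsilon>) \<and> cmod t <= \<epsilon>}"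
        using z zt \<epsilon> by (auto simp: curve_product_def theta_set_def)
      then have "fst ((\<chi> j. if j = k then z else 0), 0 :: complex) $ k \<in> ?l" by (rule imageI)
      then show "z \<in> ?l" by simp
    qed (auto simp: curve_product_def theta_set_def)
    finally show ?thesis .
  qed
  have Jcc: "compact Jc"
  proof -
    have "Jc = {s \<in> J. g s \<in> {t \<in> curve_trace \<gamma>. cmod t <= \<epsilon>}}" by (auto simp: Jc_def)
    then show ?thesis using smooth_simple_curve_compact_preimage[OF curve ct] by auto
  qed
  have Ycc: "compact Yc"
  proof -
    have "compact {s \<in> fst (\<Gamma> k). snd (\<Gamma> k) s \<in> {z \<in> curve_trace (\<Gamma> k). cmod z <= \<epsilon>}}" for k
      by (rule smooth_simple_curve_compact_preimage[OF curves ck]) auto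
    from compact_vec_product[OF this]
    have "compact {x :: real ^ 'm. \<forall>k. x $ k \<in> {s \<in> fst (\<Gamma> k). snd (\<Gamma> k) s \<in> {z \<in> curve_trace (\<Gamma> k). cmod z <= \<epsilon>}}}" .
    moreover have "{x :: real ^ 'm. \<forall>k. x $ k \<in> {s \<in> fst (\<Gamma> k). snd (\<Gamma> k) s \<in> {z \<in> curve_trace (\<Gamma> k). cmod z <= \<epsilon>}}} = Yc"
      by (auto simp: Yc_def theta_param_def)
    ultimately show ?thesis by simp
  qed
  have YX: "Yc \<subseteq> X" "Jc \<subseteq> J" "Y \<subseteq> Yc" by (auto simp: Yc_def Jc_def Y_def less_imp_le)
  have Yb: "X - Y \<in> sets borel"
  proof -
    have "{x \<in> X. cmod (\<Theta> x $ k) < \<epsilon>} \<in> sets borel" for k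
    proof -
      have "continuous_on X (%x. cmod (\<Theta> x $ k))" by (intro continuous_on_norm continuous_on_component continuous_on_theta)
      from continuous_openin_preimage_gen[OF this open_lessThan]
      obtain U where U: "open U" "X \<inter> (%x. cmod (\<Theta> x $ k)) -` {..<\<epsilon>} = X \<inter> U" unfolding openin_open by blast
      have "X \<inter> U \<in> sets borel" using U(1) by (intro sets.Int X_borel borel_open)
      moreover have "{x \<in> X. cmod (\<Theta> x $ k) < \<epsilon>} = X \<inter> U" unfolding U(2)[symmetric] by (simp add: vimage_def Int_def)
      ultimately show ?thesis by (simp only:)
    qed
    then have "X \<inter> (\<Inter>k. {x \<in> X. cmod (\<Theta> x $ k) < \<epsilon>}) \<in> sets borel"
      by (intro sets.Int X_borel sets.countable_INT') auto
    moreover have "X \<inter> (\<Inter>k. {x \<in> X. cmod (\<Theta> x $ k) < \<epsilon>}) = Y" by (auto simp: Y_def)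
    ultimately show ?thesis by (intro sets.Diff X_borel) simp
  qed
  have box: "(\<Theta> x, t) \<in> origin_box \<Gamma> \<gamma> \<epsilon> \<longleftrightarrow> x \<in> Y \<and> cmod t < \<epsilon>" if "x \<in> X" "t \<in> curve_trace \<gamma>" for x t
    using that by (auto simp: origin_box_def Y_def curve_product_def theta_set_def theta_param_def)
  have X_split: "X = Yc \<union> (X - Y)" using YX by blast
  have r1: "set_integrable lborel (X - Y) (residue h)"
  proof -
    have "theta_preimage \<Gamma> {\<theta> \<in> theta_set \<Gamma>. (\<theta>, 0) \<notin> origin_box \<Gamma> \<gamma> \<epsilon>} = X - Y"
      using box[OF _ zt] \<epsilon> by (auto simp: theta_preimage_def theta_set_def theta_param_def[of \<Gamma>, THEN arg_cong, of "%v. v $ _"])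
    moreover have "theta_pullback \<Gamma> (%\<theta>. h (\<theta>, 0)) = residue h"
      by (simp add: fun_eq_iff theta_pullback_def residue_def w_def)
    ultimately show ?thesis using A2 unfolding theta_abs_integrable_def by simp
  qed
  have "set_integrable lborel Yc (residue h)"
    unfolding set_integrable_def by (rule borel_integrable_compact[OF Ycc continuous_on_subset[OF residue_continuous YX(1)]])
  from set_integrable_Un[OF this r1] show res: "set_integrable lborel X (residue h)"
    using X_split Yb Ycc by (simp add: borel_compact)
  have A1': "set_integrable lborel (preimage \<Gamma> \<gamma> (D - origin_box \<Gamma> \<gamma> \<epsilon>)) (%z. if cmod (g (snd z)) < \<epsilon> then quot h z else full h z)"
  proof -
    have "pullback \<Gamma> \<gamma> (%(\<theta>, t). if cmod t < \<epsilon> then (h (\<theta>, t) - h (\<theta>, 0)) / t else h (\<theta>, t) / t) = (%z. if cmod (g (snd z)) < \<epsilon> then quot h z else full h z)"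
      by (auto simp: fun_eq_iff pullback_eq quot_def full_def)
    then show ?thesis using A1 unfolding abs_integrable_def by simp
  qed
  have pre: "preimage \<Gamma> \<gamma> (D - origin_box \<Gamma> \<gamma> \<epsilon>) = {(x, s). x \<in> X \<and> s \<in> J \<and> \<not> (x \<in> Y \<and> cmod (g s) < \<epsilon>)}"
    using box param_in_D by (auto simp: preimage_def)
  have full1: "set_integrable lborel (X \<times> {s \<in> J. \<epsilon> <= cmod (g s)}) (full h)"
  proof -
    have "set_integrable lborel (X \<times> {s \<in> J. \<epsilon> <= cmod (g s)}) (%z. if cmod (g (snd z)) < \<epsilon> then quot h z else full h z)"
      by (rule set_integrable_subset[OF A1' Times_borel[OF X_borel J_ranges_borel(1)]]) (auto simp: pre)
    then show ?thesis by (subst (asm) set_integrable_cong[OF refl refl, of _ _ "full h"]) auto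
  qed
  have quot1: "set_integrable lborel ((X - Y) \<times> {s \<in> J. cmod (g s) < \<epsilon>}) (quot h)"
  proof -
    have "set_integrable lborel ((X - Y) \<times> {s \<in> J. cmod (g s) < \<epsilon>}) (%z. if cmod (g (snd z)) < \<epsilon> then quot h z else full h z)"
      by (rule set_integrable_subset[OF A1' Times_borel[OF Yb J_ranges_borel(2)]]) (auto simp: pre)
    then show ?thesis by (subst (asm) set_integrable_cong[OF refl refl, of _ _ "quot h"]) auto
  qed
  have quot2: "set_integrable lborel (Yc \<times> Jc) (quot h)"
  proof -
    have "compact (\<Theta> ` Yc)" "compact (g ` Jc)"
      using Ycc Jcc YX continuous_on_theta continuous_on_g by (auto intro!: compact_continuous_image elim: continuous_on_subset)
    moreover have "\<Theta> ` Yc \<times> g ` Jc \<subseteq> T" "\<Theta> ` Yc \<times> {0} \<subseteq> T" using YX D_T param_in_D param_0_in_D by blast+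
    ultimately obtain B where B: "!!\<theta> t. \<theta> \<in> \<Theta> ` Yc ==> t \<in> g ` Jc ==> cmod ((h (\<theta>, t) - h (\<theta>, 0)) / t) <= B"
      using difference_quotient_bounded[OF h T] by blast
    have "bounded (w ` Yc)" "bounded (speed \<gamma> ` Jc)"
      using Ycc Jcc YX continuous_on_w continuous_on_speed by (auto intro!: compact_imp_bounded compact_continuous_image elim: continuous_on_subset)
    from this(1)[unfolded bounded_iff] this(2)[unfolded bounded_iff]
    obtain B1 B2 where B1: "\<forall>y\<in>w ` Yc. cmod y <= B1" and B2: "\<forall>y\<in>speed \<gamma> ` Jc. cmod y <= B2" by (elim exE)
    have B12: "!!x. x \<in> Yc ==> cmod (w x) <= B1" "!!s. s \<in> Jc ==> cmod (speed \<gamma> s) <= B2"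
      by (rule bspec[OF B1 imageI], assumption) (rule bspec[OF B2 imageI])
    have cYJ: "compact (Yc \<times> Jc)" using Ycc Jcc by (rule compact_Times)
    have YJb: "Yc \<times> Jc \<in> sets lborel" using cYJ by (simp add: borel_compact)
    have bnd: "cmod (quot h z) <= \<bar>B\<bar> * \<bar>B1\<bar> * \<bar>B2\<bar>" if z: "z \<in> Yc \<times> Jc" for z
    proof -
      obtain x s where xs: "z = (x, s)" "x \<in> Yc" "s \<in> Jc" using z by blast
      have "cmod ((h (\<Theta> x, g s) - h (\<Theta> x, 0)) / g s) <= \<bar>B\<bar>" "cmod (w x) <= \<bar>B1\<bar>" "cmod (speed \<gamma> s) <= \<bar>B2\<bar>"
        using order_trans[OF B[OF imageI[OF xs(2)] imageI[OF xs(3)]] abs_ge_self] order_trans[OF B12(1)[OF xs(2)] abs_ge_self]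
          order_trans[OF B12(2)[OF xs(3)] abs_ge_self] by simp_all
      then show ?thesis unfolding xs(1) quot_def split norm_mult
        by (intro mult_mono mult_nonneg_nonneg abs_ge_zero norm_ge_zero)
    qed
    have eq: "indicator (Yc \<times> Jc) z *\<^sub>R (indicator (X \<times> J) z *\<^sub>R quot h z) = indicator (Yc \<times> Jc) z *\<^sub>R quot h z" for z
      using YX by (auto simp: indicator_def)
    have m: "(%z. indicator (Yc \<times> Jc) z *\<^sub>R quot h z) \<in> borel_measurable lborel"
      unfolding eq[symmetric] by (rule borel_measurable_scaleR[OF borel_measurable_indicator[OF YJb]]) (use quot_measurable in simp)
    show ?thesis
      unfolding set_integrable_def
      by (rule integrableI_bounded_set[OF YJb m emeasure_compact_finite[OF cYJ], of "\<bar>B\<bar> * \<bar>B1\<bar> * \<bar>B2\<bar>"]) (use bnd in \<open>auto simp: indicator_def\<close>)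
  qed
  have quot\<epsilon>: "set_integrable lborel (X \<times> {s \<in> J. cmod (g s) < \<epsilon>}) (quot h)"
  proof (rule set_integrable_subset[OF set_integrable_Un[OF quot2 quot1]])
    show "Yc \<times> Jc \<in> sets lborel" using compact_Times[OF Ycc Jcc] by (simp add: borel_compact)
    show "(X - Y) \<times> {s \<in> J. cmod (g s) < \<epsilon>} \<in> sets lborel" by (intro Times_borel Yb J_ranges_borel)
    show "X \<times> {s \<in> J. cmod (g s) < \<epsilon>} \<in> sets lborel" by (intro Times_borel X_borel J_ranges_borel)
    show "X \<times> {s \<in> J. cmod (g s) < \<epsilon>} \<subseteq> Yc \<times> Jc \<union> (X - Y) \<times> {s \<in> J. cmod (g s) < \<epsilon>}"
      using X_split by (auto simp: Jc_def)
  qed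
  show full: "set_integrable lborel (X \<times> {s \<in> J. r <= cmod (g s)}) (full h)" if r: "0 < r" for r
  proof -
    define K where "K = {s \<in> J. r <= cmod (g s) \<and> cmod (g s) < \<epsilon>}"
    have "compact {s \<in> J. g s \<in> {t \<in> curve_trace \<gamma>. cmod t <= \<epsilon>} \<inter> {t. r <= cmod t}}"
      by (intro smooth_simple_curve_compact_preimage[OF curve] compact_Int_closed ct closed_Collect_le continuous_intros) auto
    then have "integrable lborel (%s. indicator {s \<in> J. g s \<in> {t \<in> curve_trace \<gamma>. cmod t <= \<epsilon>} \<inter> {t. r <= cmod t}} s *\<^sub>R (speed \<gamma> s / g s))"
      by (rule borel_integrable_compact)
        (use r in \<open>auto intro!: continuous_on_divide continuous_on_subset[OF continuous_on_speed] continuous_on_subset[OF continuous_on_g]\<close>)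
    then have "set_integrable lborel K (%s. speed \<gamma> s / g s)"
      unfolding set_integrable_def[symmetric]
      by (rule set_integrable_subset) (auto simp: K_def J_ranges_borel)
    from set_integral_add(1)[OF set_integrable_subset[OF quot\<epsilon>, of "X \<times> K"] set_integrable_times(1)[OF res this]]
    have "set_integrable lborel (X \<times> K) (full h)"
      using Times_borel[OF X_borel J_ranges_borel(3)] unfolding full_eq[abs_def] by (auto simp: K_def)
    from set_integrable_Un[OF full1 this]
    have "set_integrable lborel (X \<times> {s \<in> J. \<epsilon> <= cmod (g s)} \<union> X \<times> K) (full h)"
      using Times_borel[OF X_borel J_ranges_borel(1)] Times_borel[OF X_borel J_ranges_borel(3)] by (simp add: K_def)
    then show ?thesis
      by (rule set_integrable_subset[OF _ Times_borel[OF X_borel J_ranges_borel(1)]]) (auto simp: K_def)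
  qed
  \<comment> \<open>On the ring between \<open>\<epsilon>\<close> and \<open>e\<close> the regular
    part is the full integrand minus the residue times \<open>dt / t\<close>. For
    \<open>e <= \<epsilon>\<close> the ring is empty.\<close>
  have "set_integrable lborel (X \<times> {s \<in> J. \<epsilon> <= cmod (g s) \<and> cmod (g s) < e}) (quot h)"
  proof -
    have 1: "set_integrable lborel (X \<times> {s \<in> J. \<epsilon> <= cmod (g s) \<and> cmod (g s) < e}) (full h)"
      by (rule set_integrable_subset[OF full[OF \<epsilon>] Times_borel[OF X_borel J_ranges_borel(3)]]) auto
    from set_integral_diff(1)[OF this set_integrable_times(1)[OF res e[OF \<epsilon>]]]
    show ?thesis unfolding full_eq[abs_def] by simp
  qed
  from set_integrable_Un[OF quot\<epsilon> this]
  have "set_integrable lborel (X \<times> {s \<in> J. cmod (g s) < \<epsilon>} \<union> X \<times> {s \<in> J. \<epsilon> <= cmod (g s) \<and> cmod (g s) < e}) (quot h)"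
    using Times_borel[OF X_borel J_ranges_borel(2)] Times_borel[OF X_borel J_ranges_borel(3)] by simp
  then show "set_integrable lborel (X \<times> {s \<in> J. cmod (g s) < e}) (quot h)"
    by (rule set_integrable_subset[OF _ Times_borel[OF X_borel J_ranges_borel(2)]]) auto
qed

end

end

context curve_setting
begin

context
  fixes T h e a b
  assumes T: "open T" and D_T: "D \<subseteq> T" and h: "holomorphic_several h T"
    and pv: "pv_abs_convergent_away_from_origin \<Gamma> \<gamma> h"
    and win: "is_window e a b" and e: "0 < e"
begin

lemma pv_normal_form:
  "set_integrable lborel X (residue h)"
  "!!r. 0 < r ==> set_integrable lborel (X \<times> {s \<in> J. r <= cmod (g s)}) (full h)"
  "set_integrable lborel (X \<times> {s \<in> J. cmod (g s) < e}) (quot h)"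
  by (rule normal_form[OF T D_T h pv], rule pv_inverse(2)[OF win e], assumption+)+

lemma window_eq: "{s \<in> J. cmod (g s) < e} = {a<..<b}"
  using win by (simp only: is_window_def)

lemma quot_cutoff_tendsto:
  "((%r. set_lebesgue_integral lborel (X \<times> {s \<in> J. r <= cmod (g s) \<and> cmod (g s) < e}) (quot h)) \<longlongrightarrow>
     set_lebesgue_integral lborel (X \<times> {a<..<b}) (quot h)) (at_right 0)"
  unfolding filterlim_at_right_to_top set_lebesgue_integral_def window_eq[symmetric]
proof (rule integral_dominated_convergence_at_top)
  let ?S = "X \<times> {s \<in> J. cmod (g s) < e}"
  have int: "integrable lborel (%z. indicator ?S z *\<^sub>R quot h z)"
    using pv_normal_form(3) unfolding set_integrable_def .
  show "(%z. indicator ?S z *\<^sub>R quot h z) \<in> borel_measurable lborel" using int by (rule borel_measurable_integrable)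
  show "integrable lborel (%z. norm (indicator ?S z *\<^sub>R quot h z))" using int by (rule integrable_norm)
  fix r :: real
  have "set_integrable lborel (X \<times> {s \<in> J. inverse r <= cmod (g s) \<and> cmod (g s) < e}) (quot h)"
    by (rule set_integrable_subset[OF pv_normal_form(3) Times_borel[OF X_borel J_ranges_borel(3)]]) auto
  then show "(%z. indicator (X \<times> {s \<in> J. inverse r <= cmod (g s) \<and> cmod (g s) < e}) z *\<^sub>R quot h z) \<in> borel_measurable lborel"
    unfolding set_integrable_def by (rule borel_measurable_integrable)
next
  let ?S = "X \<times> {s \<in> J. cmod (g s) < e}"
  show "\<forall>\<^sub>F r in at_top. AE z in lborel. norm (indicator (X \<times> {s \<in> J. inverse r <= cmod (g s) \<and> cmod (g s) < e}) z *\<^sub>R quot h z) <= norm (indicator ?S z *\<^sub>R quot h z)"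
    by (intro always_eventually allI AE_I2) (auto simp: indicator_def)
  show "AE z in lborel. ((%r. indicator (X \<times> {s \<in> J. inverse r <= cmod (g s) \<and> cmod (g s) < e}) z *\<^sub>R quot h z) \<longlongrightarrow> indicator ?S z *\<^sub>R quot h z) at_top"
  proof (rule AE_I2)
    fix z :: "(real ^ 'm) \<times> real"
    obtain x s where z: "z = (x, s)" by (cases z)
    show "((%r. indicator (X \<times> {s \<in> J. inverse r <= cmod (g s) \<and> cmod (g s) < e}) z *\<^sub>R quot h z) \<longlongrightarrow> indicator ?S z *\<^sub>R quot h z) at_top"
    proof (cases "g s = 0")
      \<comment> \<open>Here \<open>quot\<close> is 0 on both sides by the division convention, so
        the pointwise limit holds at the pole as well.\<close>
      case True
      then show ?thesis by (simp add: z quot_def)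
    next
      case False
      have "\<forall>\<^sub>F r in at_top. inverse r < cmod (g s)"
        using order_tendstoD(2)[OF tendsto_inverse_0_at_top[OF filterlim_ident]] False by simp
      then have "\<forall>\<^sub>F r in at_top. indicator (X \<times> {s \<in> J. inverse r <= cmod (g s) \<and> cmod (g s) < e}) z *\<^sub>R quot h z = indicator ?S z *\<^sub>R quot h z"
        by eventually_elim (auto simp: z indicator_def)
      then show ?thesis by (rule tendsto_eventually)
    qed
  qed
qed

text \<open>Below the radius \<open>e\<close> the integrand is split by \<open>full_eq\<close>. The
  regular part converges by dominated convergence, and the singular part factors into the residue
  integral and the one-variable principal value.\<close>

lemma has_pv:
  "has_pv_integral \<Gamma> \<gamma> h (set_lebesgue_integral lborel (X \<times> {s \<in> J. e <= cmod (g s)}) (full h) +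
     set_lebesgue_integral lborel (X \<times> {a<..<b}) (quot h) + set_lebesgue_integral lborel X (residue h) * pv_const a b)"
  unfolding has_pv_integral_def
proof (intro conjI allI impI)
  have pb: "pullback \<Gamma> \<gamma> (%(\<theta>, t). h (\<theta>, t) / t) = full h" by (simp add: pullback_eq full_def)
  fix r :: real assume "0 < r"
  then show "abs_integrable \<Gamma> \<gamma> {(\<theta>, t) \<in> D. r <= cmod t} (%(\<theta>, t). h (\<theta>, t) / t)"
    unfolding abs_integrable_def preimage_eq pb by (rule pv_normal_form(2))
next
  have pb: "pullback \<Gamma> \<gamma> (%(\<theta>, t). h (\<theta>, t) / t) = full h" by (simp add: pullback_eq full_def)
  let ?K = "%r. {s \<in> J. r <= cmod (g s) \<and> cmod (g s) < e}"
  let ?I1 = "set_lebesgue_integral lborel (X \<times> {s \<in> J. e <= cmod (g s)}) (full h)"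
  have eq: "?I1 + set_lebesgue_integral lborel (X \<times> ?K r) (quot h) + set_lebesgue_integral lborel X (residue h) * set_lebesgue_integral lborel (?K r) (%s. speed \<gamma> s / g s) =
     product_integral \<Gamma> \<gamma> {(\<theta>, t) \<in> D. r <= cmod t} (%(\<theta>, t). h (\<theta>, t) / t)" if r: "0 < r" "r < e" for r
  proof -
    have q: "set_integrable lborel (X \<times> ?K r) (quot h)"
      by (rule set_integrable_subset[OF pv_normal_form(3) Times_borel[OF X_borel J_ranges_borel(3)]]) auto
    note p = set_integrable_times[OF pv_normal_form(1) pv_inverse(2)[OF win e r(1)]]
    have f: "set_integrable lborel (X \<times> ?K r) (full h)"
      "set_lebesgue_integral lborel (X \<times> ?K r) (full h) = set_lebesgue_integral lborel (X \<times> ?K r) (quot h) + set_lebesgue_integral lborel X (residue h) * set_lebesgue_integral lborel (?K r) (%s. speed \<gamma> s / g s)"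
      using set_integral_add[OF q p(1)] p(2) unfolding full_eq[abs_def] by simp_all
    have un: "X \<times> {s \<in> J. r <= cmod (g s)} = X \<times> {s \<in> J. e <= cmod (g s)} \<union> X \<times> ?K r" using r by auto
    have "X \<times> {s \<in> J. e <= cmod (g s)} \<inter> X \<times> ?K r = {}" by auto
    from set_integral_Un[OF this pv_normal_form(2)[OF e] f(1)] show ?thesis
      unfolding product_integral_def preimage_eq pb un f(2) by (simp only: add.assoc)
  qed
  have "((%r. ?I1 + set_lebesgue_integral lborel (X \<times> ?K r) (quot h) + set_lebesgue_integral lborel X (residue h) * set_lebesgue_integral lborel (?K r) (%s. speed \<gamma> s / g s)) \<longlongrightarrow>
     ?I1 + set_lebesgue_integral lborel (X \<times> {a<..<b}) (quot h) + set_lebesgue_integral lborel X (residue h) * pv_const a b) (at_right 0)"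
    by (intro tendsto_add tendsto_mult tendsto_const quot_cutoff_tendsto pv_inverse(1)[OF win e])
  then show "((%r. product_integral \<Gamma> \<gamma> {(\<theta>, t) \<in> D. r <= cmod t} (%(\<theta>, t). h (\<theta>, t) / t)) \<longlongrightarrow>
     ?I1 + set_lebesgue_integral lborel (X \<times> {a<..<b}) (quot h) + set_lebesgue_integral lborel X (residue h) * pv_const a b) (at_right 0)"
  proof (rule Lim_transform_eventually)
    show "\<forall>\<^sub>F r in at_right 0. ?I1 + set_lebesgue_integral lborel (X \<times> ?K r) (quot h) + set_lebesgue_integral lborel X (residue h) * set_lebesgue_integral lborel (?K r) (%s. speed \<gamma> s / g s) =
       product_integral \<Gamma> \<gamma> {(\<theta>, t) \<in> D. r <= cmod t} (%(\<theta>, t). h (\<theta>, t) / t)"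
      unfolding eventually_at_right_field
    proof (rule exI[of _ e], intro conjI allI impI e)
      fix r assume "0 < r" "r < e" then show "?I1 + set_lebesgue_integral lborel (X \<times> ?K r) (quot h) + set_lebesgue_integral lborel X (residue h) * set_lebesgue_integral lborel (?K r) (%s. speed \<gamma> s / g s) =
       product_integral \<Gamma> \<gamma> {(\<theta>, t) \<in> D. r <= cmod t} (%(\<theta>, t). h (\<theta>, t) / t)" by (rule eq)
    qed
  qed
qed

text \<open>\<open>C\<close> will be a small box at the saddle. All other contributions are errors:
  large \<open>|t|\<close>, then the regular part and the residue for \<open>\<theta>\<close>
  outside \<open>C\<close>, and the contour shift carried out separately for each
  \<open>\<theta>\<close> in \<open>C\<close>.\<close>

lemma has_pv_near_residue:
  assumes C: "C \<in> sets borel" "C \<subseteq> X" and wC: "set_integrable lborel C w"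
    and R: "e < R" and hR: "!!x. x \<in> C ==> (%t. h (\<Theta> x, t)) holomorphic_on ball 0 R"
    and B: "!!x t. x \<in> C ==> t \<in> closed_segment (g a) (apex e) \<union> closed_segment (g b) (apex e) ==> cmod (h (\<Theta> x, t) / t) <= B"
  obtains L where "has_pv_integral \<Gamma> \<gamma> h L"
    "cmod (L + \<i> * of_real (pi * sgn \<beta>) * set_lebesgue_integral lborel C (residue h)) \<le>
       cmod (set_lebesgue_integral lborel (X \<times> {s \<in> J. e <= cmod (g s)}) (full h)) +
       cmod (set_lebesgue_integral lborel ((X - C) \<times> {a<..<b}) (quot h)) +
       cmod (set_lebesgue_integral lborel (X - C) (residue h)) * cmod (pv_const a b) +
       4 * e * B * (\<integral>x. indicator C x * cmod (w x) \<partial>lborel)"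
proof -
  let ?I1 = "set_lebesgue_integral lborel (X \<times> {s \<in> J. e <= cmod (g s)}) (full h)"
  let ?I2 = "set_lebesgue_integral lborel ((X - C) \<times> {a<..<b}) (quot h)"
  let ?I3 = "set_lebesgue_integral lborel (X - C) (residue h)"
  define inner where "inner = (%x. set_lebesgue_integral lborel {a<..<b} (%s. (h (\<Theta> x, g s) - h (\<Theta> x, 0)) / g s * speed \<gamma> s))"
  have q: "set_integrable lborel (X \<times> {a<..<b}) (quot h)" using pv_normal_form(3) unfolding window_eq .
  have I: "{a<..<b} \<in> sets borel" by simp
  have qC: "set_integrable lborel (C \<times> {a<..<b}) (quot h)" "set_integrable lborel ((X - C) \<times> {a<..<b}) (quot h)"
    by (rule set_integrable_subset[OF q Times_borel[OF C(1) I]], use C(2) in blast)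
      (rule set_integrable_subset[OF q Times_borel[OF sets.Diff[OF X_borel C(1)] I]], blast)
  have CL: "C \<in> sets lborel" "X - C \<in> sets lborel" using C(1) sets.Diff[OF X_borel C(1)] by simp_all
  have rC: "set_integrable lborel C (residue h)" "set_integrable lborel (X - C) (residue h)"
    by (rule set_integrable_subset[OF pv_normal_form(1) CL(1) C(2)]) (rule set_integrable_subset[OF pv_normal_form(1) CL(2) Diff_subset])
  have XC: "C \<union> (X - C) = X" "C \<times> {a<..<b} \<union> (X - C) \<times> {a<..<b} = X \<times> {a<..<b}" using C(2) by blast+
  have i2: "set_lebesgue_integral lborel (X \<times> {a<..<b}) (quot h) = set_lebesgue_integral lborel (C \<times> {a<..<b}) (quot h) + ?I2"
    using set_integral_Un[OF _ qC] unfolding XC by blast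
  have i3: "set_lebesgue_integral lborel X (residue h) = set_lebesgue_integral lborel C (residue h) + ?I3"
    using set_integral_Un[OF _ rC] unfolding XC by blast
  have eq: "indicator (C \<times> {a<..<b}) z *\<^sub>R quot h z =
     (case z of (x, s) => (indicator C x *\<^sub>R w x) * (indicator {a<..<b} s *\<^sub>R ((h (\<Theta> x, g s) - h (\<Theta> x, 0)) / g s * speed \<gamma> s)))" for z
  proof (cases z)
    case (Pair x s)
    then show ?thesis by (cases "x \<in> C"; cases "s \<in> {a<..<b}") (simp_all add: quot_def indicator_times mult_ac)
  qed
  have int: "integrable (lborel \<Otimes>\<^sub>M lborel) (%(x, s). (indicator C x *\<^sub>R w x) * (indicator {a<..<b} s *\<^sub>R ((h (\<Theta> x, g s) - h (\<Theta> x, 0)) / g s * speed \<gamma> s)))"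
    using qC(1) unfolding set_integrable_def eq lborel_prod .
  have inner: "(\<integral>s. (indicator C x *\<^sub>R w x) * (indicator {a<..<b} s *\<^sub>R ((h (\<Theta> x, g s) - h (\<Theta> x, 0)) / g s * speed \<gamma> s)) \<partial>lborel) = indicator C x *\<^sub>R (inner x * w x)" for x
    unfolding inner_def set_lebesgue_integral_def integral_mult_right_zero by (simp only: mult_scaleR_left mult.commute)
  have F1: "integrable lborel (%x. indicator C x *\<^sub>R (inner x * w x))"
    using lborel_pair.integrable_fst[OF int] unfolding inner .
  have F2: "set_lebesgue_integral lborel (C \<times> {a<..<b}) (quot h) = (\<integral>x. indicator C x *\<^sub>R (inner x * w x) \<partial>lborel)"
    using lborel_pair.integral_fst[OF int] unfolding inner set_lebesgue_integral_def eq lborel_prod by simp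
  \<comment> \<open>The error of the contour shift at fixed \<open>\<theta>\<close>, in the form
    bounded by \<open>inner_pv_bound\<close>; Fubini lets it be estimated pointwise.\<close>
  define E where "E = (%x. inner x + h (\<Theta> x, 0) * pv_const a b + \<i> * of_real (pi * sgn \<beta>) * h (\<Theta> x, 0))"
  have rC': "integrable lborel (%x. indicator C x *\<^sub>R residue h x)" using rC(1) unfolding set_integrable_def .
  have E_split: "indicator C x *\<^sub>R (E x * w x) = indicator C x *\<^sub>R (inner x * w x) + (pv_const a b + \<i> * of_real (pi * sgn \<beta>)) * (indicator C x *\<^sub>R residue h x)" for x
    by (simp add: E_def residue_def algebra_simps)
  have Eint: "integrable lborel (%x. indicator C x *\<^sub>R (E x * w x))"
    unfolding E_split by (intro Bochner_Integration.integrable_add F1 integrable_mult_right rC')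
  have Eval: "(\<integral>x. indicator C x *\<^sub>R (E x * w x) \<partial>lborel) = set_lebesgue_integral lborel (C \<times> {a<..<b}) (quot h) + (pv_const a b + \<i> * of_real (pi * sgn \<beta>)) * set_lebesgue_integral lborel C (residue h)"
    unfolding E_split F2 using Bochner_Integration.integral_add[OF F1 integrable_mult_right[OF rC']]
    by (simp only: integral_mult_right_zero set_lebesgue_integral_def)
  have wint: "integrable lborel (%x. indicator C x * cmod (w x))"
    using integrable_norm[OF wC[unfolded set_integrable_def]] by simp
  have Ebnd: "cmod (\<integral>x. indicator C x *\<^sub>R (E x * w x) \<partial>lborel) <= 4 * e * B * (\<integral>x. indicator C x * cmod (w x) \<partial>lborel)"
  proof -
    have "cmod (\<integral>x. indicator C x *\<^sub>R (E x * w x) \<partial>lborel) <= (\<integral>x. 4 * e * B * (indicator C x * cmod (w x)) \<partial>lborel)"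
    proof (rule Bochner_Integration.integral_norm_bound_integral[OF Eint integrable_mult_right[OF wint]])
      fix x
      have "cmod (E x) <= 4 * e * B" if "x \<in> C"
        unfolding E_def inner_def by (rule inner_pv_bound[OF win e hR[OF that] R B[OF that]])
      then show "cmod (indicator C x *\<^sub>R (E x * w x)) <= 4 * e * B * (indicator C x * cmod (w x))"
        by (cases "x \<in> C") (simp_all add: norm_mult mult_right_mono)
    qed
    then show ?thesis by (simp only: integral_mult_right_zero)
  qed
  let ?L = "?I1 + set_lebesgue_integral lborel (X \<times> {a<..<b}) (quot h) + set_lebesgue_integral lborel X (residue h) * pv_const a b"
  define Y where "Y = (\<integral>x. indicator C x *\<^sub>R (E x * w x) \<partial>lborel)"
  have eqL: "?L + \<i> * of_real (pi * sgn \<beta>) * set_lebesgue_integral lborel C (residue h) = ?I1 + ?I2 + ?I3 * pv_const a b + Y"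
    unfolding Y_def Eval i2 i3 by (simp add: algebra_simps)
  have tri: "cmod (u1 + u2 + u3 * u4 + Y) <= cmod u1 + cmod u2 + cmod u3 * cmod u4 + cmod Y" for u1 u2 u3 u4
    using norm_triangle_ineq[of "u1 + u2 + u3 * u4" Y] norm_triangle_ineq[of "u1 + u2" "u3 * u4"] norm_triangle_ineq[of u1 u2]
    unfolding norm_mult by linarith
  have "cmod (?L + \<i> * of_real (pi * sgn \<beta>) * set_lebesgue_integral lborel C (residue h)) \<le>
     cmod ?I1 + cmod ?I2 + cmod ?I3 * cmod (pv_const a b) + 4 * e * B * (\<integral>x. indicator C x * cmod (w x) \<partial>lborel)"
    unfolding eqL by (rule order_trans[OF tri add_left_mono[OF Ebnd[folded Y_def]]])
  then show ?thesis by (rule that[OF has_pv])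
qed

end

end

section \<open>The leading term\<close>

text \<open>Passing to \<open>restrict_space\<close> makes functions that are continuous only on
  \<open>\<Omega>\<close> measurable. A tail with a single exponential is the case
  \<open>Q0 = 0\<close>.\<close>

lemma set_integral_tail_decay:
  fixes \<Phi> :: "real => 'a::euclidean_space => complex"
  assumes \<Omega>: "\<Omega> \<in> sets borel"
    and meas: "P1 \<in> borel_measurable (restrict_space borel \<Omega>)" "F1 \<in> borel_measurable (restrict_space borel \<Omega>)" "Q1 \<in> borel_measurable (restrict_space borel \<Omega>)"
      "P0 \<in> borel_measurable (restrict_space borel \<Omega>)" "F0 \<in> borel_measurable (restrict_space borel \<Omega>)" "Q0 \<in> borel_measurable (restrict_space borel \<Omega>)" "W \<in> borel_measurable (restrict_space borel \<Omega>)"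
    and W: "!!\<omega>. 0 <= W \<omega>" and s1: "0 < s1" and \<delta>: "0 < \<delta>"
    and pos1: "!!\<omega> s. \<omega> \<in> \<Omega> ==> s1 <= s ==> \<delta> <= Re (P1 \<omega> + F1 \<omega> / of_real s)"
    and pos0: "!!\<omega> s. \<omega> \<in> \<Omega> ==> s1 <= s ==> \<delta> <= Re (P0 \<omega> + F0 \<omega> / of_real s)"
    and int: "!!s. s1 <= s ==> set_integrable lborel \<Omega> (\<Phi> s)"
    and norm: "!!s \<omega>. s1 <= s ==> \<omega> \<in> \<Omega> ==> cmod (\<Phi> s \<omega>) = W \<omega> * cmod (Q1 \<omega> * exp (- of_real (s\<^sup>2) * P1 \<omega> - of_real s * F1 \<omega>) - Q0 \<omega> * exp (- of_real (s\<^sup>2) * P0 \<omega> - of_real s * F0 \<omega>))"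
  shows "((%s. s ^ k * cmod (set_lebesgue_integral lborel \<Omega> (\<Phi> s))) \<longlongrightarrow> 0) at_top"
proof -
  define M where "M = restrict_space (lborel :: 'a measure) \<Omega>"
  define G where "G = (%s \<omega>. W \<omega> * cmod (Q1 \<omega> * exp (- of_real (s\<^sup>2) * P1 \<omega> - of_real s * F1 \<omega>) - Q0 \<omega> * exp (- of_real (s\<^sup>2) * P0 \<omega> - of_real s * F0 \<omega>)))"
  have sM: "space M = \<Omega>" by (simp add: M_def space_restrict_space)
  have sets: "sets M = sets (restrict_space borel \<Omega>)" by (simp add: M_def sets_restrict_space)
  have mM: "f \<in> borel_measurable M \<longleftrightarrow> f \<in> borel_measurable (restrict_space borel \<Omega>)" for f :: "'a => 'b::topological_space"
    by (rule iffD1[OF eq_commute], subst measurable_cong_sets[OF sets refl]) (rule refl)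
  have \<Omega>': "\<Omega> \<inter> space (lborel :: 'a measure) \<in> sets lborel" using \<Omega> by simp
  have IM: "integrable M (\<Phi> s)" if "s1 <= s" for s
    using int[OF that] unfolding M_def integrable_restrict_space[OF \<Omega>'] set_integrable_def .
  have cong: "G s \<omega> = cmod (\<Phi> s \<omega>)" if "s1 <= s" "\<omega> \<in> space M" for s \<omega>
    using norm[OF that(1)] that(2) by (simp add: G_def sM)
  have fin: "(\<integral>\<^sup>+\<omega>. ennreal (G s \<omega>) \<partial>M) < \<infinity>" if s: "s1 <= s" for s
  proof -
    have "(\<integral>\<^sup>+\<omega>. ennreal (G s \<omega>) \<partial>M) = (\<integral>\<^sup>+\<omega>. ennreal (cmod (\<Phi> s \<omega>)) \<partial>M)"
      by (rule nn_integral_cong) (simp only: cong[OF s])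
    also have "\<dots> < \<infinity>" using IM[OF s] unfolding integrable_iff_bounded by blast
    finally show ?thesis .
  qed
  have lim: "((%s. s ^ k * (\<integral>\<omega>. G s \<omega> \<partial>M)) \<longlongrightarrow> 0) at_top"
    unfolding G_def
  proof (rule pole_difference_tail_decay[where ?s1.0 = s1 and \<delta> = \<delta>])
    show "(\<integral>\<^sup>+\<omega>. ennreal (W \<omega> * cmod (Q1 \<omega> * exp (- of_real (s\<^sup>2) * P1 \<omega> - of_real s * F1 \<omega>) - Q0 \<omega> * exp (- of_real (s\<^sup>2) * P0 \<omega> - of_real s * F0 \<omega>))) \<partial>M) < \<infinity>" if "s1 <= s" for s
      using fin[OF that] unfolding G_def .
  qed (use meas W s1 \<delta> pos1 pos0 in \<open>simp_all add: mM sM\<close>)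
  show ?thesis
  proof (rule Lim_null_comparison[OF _ lim])
    show "\<forall>\<^sub>F s in at_top. norm (s ^ k * cmod (set_lebesgue_integral lborel \<Omega> (\<Phi> s))) <= s ^ k * (\<integral>\<omega>. G s \<omega> \<partial>M)"
      using eventually_ge_at_top[of s1]
    proof eventually_elim
      case (elim s)
      have "cmod (set_lebesgue_integral lborel \<Omega> (\<Phi> s)) = cmod (\<integral>\<omega>. \<Phi> s \<omega> \<partial>M)"
        unfolding M_def integral_restrict_space[OF \<Omega>'] set_lebesgue_integral_def ..
      also have "\<dots> <= (\<integral>\<omega>. cmod (\<Phi> s \<omega>) \<partial>M)" by (rule integral_norm_bound)
      also have "\<dots> = (\<integral>\<omega>. G s \<omega> \<partial>M)" by (rule Bochner_Integration.integral_cong) (simp_all add: cong[OF elim])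
      finally show ?case using elim s1 by (simp add: mult_left_mono)
    qed
  qed
qed

lemma Re_lower_bound_limit:
  assumes "!!s. s1 <= s ==> \<delta> <= Re (a + b / of_real s)" shows "\<delta> <= Re a"
proof (rule tendsto_lowerbound)
  have "((%s. inverse s) \<longlongrightarrow> (0::real)) at_top" by (rule tendsto_inverse_0_at_top[OF filterlim_ident])
  then have "((%s. Re a + Re b * inverse s) \<longlongrightarrow> Re a + Re b * 0) at_top"
    by (intro tendsto_add tendsto_mult tendsto_const)
  then show "((%s. Re a + Re b * inverse s) \<longlongrightarrow> Re a) at_top" by simp
  show "\<forall>\<^sub>F s in at_top. \<delta> <= Re a + Re b * inverse s"
    using eventually_ge_at_top[of s1]
  proof eventually_elim
    case (elim s)
    have "Re (b / of_real s) = Re b * inverse s"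
      using Re_divide_of_real[of b s] by (simp only: divide_inverse)
    then show ?case using assms[OF elim] by simp
  qed
qed simp

text \<open>\<open>P\<close> and \<open>F\<close> are the exponents minus their values at the
  origin, and \<open>lam = s^2\<close>. The assumption \<open>gap\<close> is (iv) with the infimum
  replaced by a positive real lower bound.\<close>

locale saddle_setting = curve_setting \<gamma> s0 \<alpha> \<beta> d \<Gamma> x0
  for \<gamma> s0 \<alpha> \<beta> d and \<Gamma> :: "'m::finite => curve" and x0 +
  fixes T P F q A \<eta> lam0
  assumes T: "open T" and D_T: "D \<subseteq> T"
    and P: "holomorphic_several P T" and F: "holomorphic_several F T" and q: "holomorphic_several q T"
    and P0: "P (0, 0) = 0" and F0: "F (0, 0) = 0"
    and \<alpha>P: "partial_t P (0, 0) = \<alpha>" and gradP: "grad_theta P (0, 0) = 0"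
    and A: "A = hessian_theta P (0, 0)" and detA: "det A ~= 0" and \<eta>: "\<eta> = grad_theta F (0, 0)"
    and lam0: "0 < lam0" and conv: "!!lam. lam0 <= lam ==> pv_abs_convergent_away_from_origin \<Gamma> \<gamma> (numerator P F q lam)"
    and gap: "!!\<epsilon>. 0 < \<epsilon> ==> \<exists>\<delta> s1. 0 < \<delta> \<and> 0 < s1 \<and>
        (\<forall>z\<in>D - origin_box \<Gamma> \<gamma> \<epsilon>. \<forall>s\<ge>s1. \<delta> <= Re (P z + F z / of_real s))"
begin

abbreviation N where "N s \<equiv> numerator P F q (s\<^sup>2)"

lemma N_eq: "0 <= s ==> N s z = q z * exp (- of_real (s\<^sup>2) * P z - of_real s * F z)"
  by (simp add: numerator_def mult.commute)

lemma N_holomorphic: "holomorphic_several (numerator P F q lam) T"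
  using holomorphic_several_exp_mult[OF P F q, of "- of_real lam" "- of_real (sqrt lam)"]
  unfolding numerator_def[abs_def] by simp

lemma x0_X: "x0 \<in> X" using x0(1) interior_subset by blast

lemma theta_x0: "\<Theta> x0 = 0" by (simp add: theta_param_def vec_eq_iff x0)

lemma gap_P:
  assumes "0 < \<epsilon>" obtains \<delta> where "0 < \<delta>" "!!z. z \<in> D - origin_box \<Gamma> \<gamma> \<epsilon> ==> \<delta> <= Re (P z)"
proof -
  obtain \<delta> s1 where \<delta>: "0 < \<delta>" "0 < s1" "!!z s. z \<in> D - origin_box \<Gamma> \<gamma> \<epsilon> ==> s1 <= s ==> \<delta> <= Re (P z + F z / of_real s)"
    using gap[OF assms] by blast
  then have "\<delta> <= Re (P z)" if "z \<in> D - origin_box \<Gamma> \<gamma> \<epsilon>" for z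
    using that by (intro Re_lower_bound_limit[of s1 \<delta> "P z" "F z"]) auto
  with \<delta>(1) show ?thesis by (rule that)
qed

lemma Re_P_pos: assumes "z \<in> D" "z ~= 0" shows "0 < Re (P z)"
proof -
  obtain \<theta> t where z: "z = (\<theta>, t)" by (cases z)
  have "\<exists>\<epsilon>>0. z \<notin> origin_box \<Gamma> \<gamma> \<epsilon>"
  proof (cases "t = 0")
    case True
    then obtain k where "\<theta> $ k ~= 0" using assms z by (auto simp: vec_eq_iff zero_prod_def)
    then show ?thesis by (intro exI[of _ "cmod (\<theta> $ k)"]) (auto simp: z origin_box_def)
  next
    case False
    then show ?thesis by (intro exI[of _ "cmod t"]) (auto simp: z origin_box_def)
  qed
  then obtain \<epsilon> where "0 < \<epsilon>" "z \<notin> origin_box \<Gamma> \<gamma> \<epsilon>" by blast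
  then show ?thesis using gap_P[of \<epsilon>] assms(1) by (metis DiffI less_le_trans)
qed

lemma polydisc: obtains R where "0 < R" "!!\<theta> t. norm \<theta> < R ==> cmod t < R ==> (\<theta>, t) \<in> T"
proof -
  have "(0, 0) \<in> D" using param_0_in_D[OF x0_X] by (simp add: theta_x0)
  then obtain R0 where R0: "0 < R0" "ball (0, 0) R0 \<subseteq> T" using T D_T unfolding open_contains_ball by blast
  have "(\<theta>, t) \<in> T" if "norm \<theta> < R0 / 2" "cmod t < R0 / 2" for \<theta> t
  proof -
    have "norm (\<theta>, t) <= norm \<theta> + norm t" by (rule norm_Pair_le)
    then have "dist (\<theta>, t) (0, 0) < R0" using that by (simp add: dist_norm)
    then have "(\<theta>, t) \<in> ball (0, 0) R0" by (simp add: dist_commute)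
    then show ?thesis using R0(2) by blast
  qed
  then show ?thesis using R0(1) by (intro that[of "R0 / 2"]) auto
qed

lemma full_tail:
  assumes win: "is_window e a b" and e: "0 < e"
  shows "((%s. s ^ k * cmod (set_lebesgue_integral lborel (X \<times> {s \<in> J. e <= cmod (g s)}) (full (N s)))) \<longlongrightarrow> 0) at_top"
proof -
  obtain \<delta> s1 where \<delta>: "0 < \<delta>" "0 < s1" "!!z s. z \<in> D - origin_box \<Gamma> \<gamma> e ==> s1 <= s ==> \<delta> <= Re (P z + F z / of_real s)"
    using gap[OF e] by blast
  define \<Omega> where "\<Omega> = X \<times> {s \<in> J. e <= cmod (g s)}"
  have sub: "\<Omega> \<subseteq> X \<times> J" by (auto simp: \<Omega>_def)
  have out: "(\<Theta> (fst z), g (snd z)) \<in> D - origin_box \<Gamma> \<gamma> e" if "z \<in> \<Omega>" for z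
    using that param_in_D[of "fst z" "snd z"] by (auto simp: \<Omega>_def origin_box_def)
  have cont: "continuous_on \<Omega> (%z. H (\<Theta> (fst z), g (snd z)))" if "holomorphic_several H T" for H
    using continuous_on_subset[OF continuous_on_param(1)[OF T D_T that] sub] by (simp add: case_prod_beta)
  have cw: "continuous_on \<Omega> (%z. w (fst z))" "continuous_on \<Omega> (%z. speed \<gamma> (snd z))" "continuous_on \<Omega> (%z. g (snd z))"
    using sub by (auto intro!: continuous_on_compose2[OF continuous_on_w] continuous_on_compose2[OF continuous_on_speed] continuous_on_compose2[OF continuous_on_g] continuous_on_fst continuous_on_snd continuous_on_id)
  note m = borel_measurable_continuous_on_restrict[OF cont] borel_measurable_continuous_on_restrict[OF cw(1)] borel_measurable_continuous_on_restrict[OF cw(2)] borel_measurable_continuous_on_restrict[OF cw(3)]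
  show ?thesis
    unfolding \<Omega>_def[symmetric]
  proof (rule set_integral_tail_decay[where ?P1.0="%z. P (\<Theta> (fst z), g (snd z))" and ?F1.0="%z. F (\<Theta> (fst z), g (snd z))" and ?Q1.0="%z. q (\<Theta> (fst z), g (snd z))"
        and ?P0.0="%z. P (\<Theta> (fst z), g (snd z))" and ?F0.0="%z. F (\<Theta> (fst z), g (snd z))" and ?Q0.0="%_. 0"
        and W="%z. cmod (w (fst z) * speed \<gamma> (snd z) / g (snd z))" and \<delta>=\<delta> and ?s1.0="max s1 (sqrt lam0)"])
    show "\<Omega> \<in> sets borel" using Times_borel[OF X_borel J_ranges_borel(1)] by (simp add: \<Omega>_def)
    show "(%z. cmod (w (fst z) * speed \<gamma> (snd z) / g (snd z))) \<in> borel_measurable (restrict_space borel \<Omega>)"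
      by (rule measurable_compose[OF borel_measurable_divide[OF borel_measurable_times[OF m(2) m(3)] m(4)] borel_measurable_norm])
    fix s assume s: "max s1 (sqrt lam0) <= s"
    have "sqrt lam0 <= s" "0 <= s" using s \<delta>(2) by auto
    from sqrt_le_D[OF this(1)] have "lam0 <= s\<^sup>2" .
    from pv_normal_form(2)[OF T D_T N_holomorphic conv[OF this] win e e]
    show "set_integrable lborel \<Omega> (full (N s))" by (simp add: \<Omega>_def)
    show "cmod (full (N s) z) = cmod (w (fst z) * speed \<gamma> (snd z) / g (snd z)) *
        cmod (q (\<Theta> (fst z), g (snd z)) * exp (- of_real (s\<^sup>2) * P (\<Theta> (fst z), g (snd z)) - of_real s * F (\<Theta> (fst z), g (snd z))) -
          0 * exp (- of_real (s\<^sup>2) * P (\<Theta> (fst z), g (snd z)) - of_real s * F (\<Theta> (fst z), g (snd z))))" for z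
      unfolding full_def case_prod_beta N_eq[OF \<open>0 <= s\<close>] norm_mult[symmetric] by (rule arg_cong[where f=cmod]) (simp add: field_simps)
  next
    fix z s assume "z \<in> \<Omega>" "max s1 (sqrt lam0) <= s"
    then show "\<delta> <= Re (P (\<Theta> (fst z), g (snd z)) + F (\<Theta> (fst z), g (snd z)) / of_real s)"
      using \<delta>(3)[OF out] by simp
    then show "\<delta> <= Re (P (\<Theta> (fst z), g (snd z)) + F (\<Theta> (fst z), g (snd z)) / of_real s)" .
  qed (rule m(1)[OF P] m(1)[OF F] m(1)[OF q] \<delta>(1) norm_ge_zero less_le_trans[OF \<delta>(2) max.cobounded1] borel_measurable_const)+
qed

text \<open>The window contains the pole, so the two exponentials of the difference quotient are not
  integrable separately and enter the tail estimate as a pair. \<open>far\<close> is demanded for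
  all \<open>t\<close> because the gap is used both at \<open>(\<theta>, t)\<close> and at
  \<open>(\<theta>, 0)\<close>.\<close>

lemma quot_tail:
  assumes win: "is_window e a b" and e: "0 < e" and C: "C \<in> sets borel" and \<epsilon>: "0 < \<epsilon>"
    and far: "!!x t. x \<in> X - C ==> (\<Theta> x, t) \<notin> origin_box \<Gamma> \<gamma> \<epsilon>"
  shows "((%s. s ^ k * cmod (set_lebesgue_integral lborel ((X - C) \<times> {a<..<b}) (quot (N s)))) \<longlongrightarrow> 0) at_top" (is ?Q)
    and "((%s. s ^ k * cmod (set_lebesgue_integral lborel (X - C) (residue (N s)))) \<longlongrightarrow> 0) at_top" (is ?R)
proof -
  obtain \<delta> s1 where \<delta>: "0 < \<delta>" "0 < s1" "!!z s. z \<in> D - origin_box \<Gamma> \<gamma> \<epsilon> ==> s1 <= s ==> \<delta> <= Re (P z + F z / of_real s)"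
    using gap[OF \<epsilon>] by blast
  have wJ: "{a<..<b} = {s \<in> J. cmod (g s) < e}" using win by (simp only: is_window_def)
  define \<Omega> where "\<Omega> = (X - C) \<times> {a<..<b}"
  have sub: "\<Omega> \<subseteq> X \<times> J" unfolding \<Omega>_def wJ by blast
  have out: "(\<Theta> (fst z), g (snd z)) \<in> D - origin_box \<Gamma> \<gamma> \<epsilon>" if "z \<in> \<Omega>" for z
  proof -
    have "fst z \<in> X - C" "snd z \<in> J" using that unfolding \<Omega>_def wJ by auto
    then show ?thesis using far[of "fst z"] param_in_D[of "fst z" "snd z"] by blast
  qed
  have out0: "(\<Theta> x, 0) \<in> D - origin_box \<Gamma> \<gamma> \<epsilon>" if "x \<in> X - C" for x
    using that far[OF that] param_0_in_D[of x] by blast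
  have out1: "(\<Theta> (fst z), 0) \<in> D - origin_box \<Gamma> \<gamma> \<epsilon>" if "z \<in> \<Omega>" for z
    using that unfolding \<Omega>_def by (intro out0) auto
  have cont: "continuous_on \<Omega> (%z. H (\<Theta> (fst z), g (snd z)))" "continuous_on \<Omega> (%z. H (\<Theta> (fst z), 0))"
    "continuous_on (X - C) (%x. H (\<Theta> x, 0))" if "holomorphic_several H T" for H
  proof -
    show "continuous_on \<Omega> (%z. H (\<Theta> (fst z), g (snd z)))"
      using continuous_on_subset[OF continuous_on_param(1)[OF T D_T that] sub] by (simp add: case_prod_beta)
    show "continuous_on \<Omega> (%z. H (\<Theta> (fst z), 0))"
      by (rule continuous_on_compose2[OF continuous_on_param(2)[OF T D_T that]]) (auto simp: \<Omega>_def intro: continuous_on_fst continuous_on_id)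
    show "continuous_on (X - C) (%x. H (\<Theta> x, 0))"
      by (rule continuous_on_subset[OF continuous_on_param(2)[OF T D_T that]]) auto
  qed
  have cw: "continuous_on \<Omega> (%z. w (fst z))" "continuous_on \<Omega> (%z. speed \<gamma> (snd z))" "continuous_on \<Omega> (%z. g (snd z))"
    using sub by (auto intro!: continuous_on_compose2[OF continuous_on_w] continuous_on_compose2[OF continuous_on_speed] continuous_on_compose2[OF continuous_on_g] continuous_on_fst continuous_on_snd continuous_on_id)
  have cw0: "continuous_on (X - C) w" by (rule continuous_on_subset[OF continuous_on_w]) auto
  note m = borel_measurable_continuous_on_restrict[OF cw(1)] borel_measurable_continuous_on_restrict[OF cw(2)] borel_measurable_continuous_on_restrict[OF cw(3)]
  note r = borel_measurable_continuous_on_restrict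
  have nf: "0 <= s" "pv_abs_convergent_away_from_origin \<Gamma> \<gamma> (N s)" if "max s1 (sqrt lam0) <= s" for s
  proof -
    have "sqrt lam0 <= s" "0 <= s" using that \<delta>(2) by auto
    then show "0 <= s" "pv_abs_convergent_away_from_origin \<Gamma> \<gamma> (N s)" using conv[OF sqrt_le_D] by auto
  qed
  have \<Omega>b: "\<Omega> \<in> sets lborel" unfolding \<Omega>_def by (intro Times_borel sets.Diff X_borel C) auto
  show ?Q
    unfolding \<Omega>_def[symmetric]
  proof (rule set_integral_tail_decay[where ?P1.0="%z. P (\<Theta> (fst z), g (snd z))" and ?F1.0="%z. F (\<Theta> (fst z), g (snd z))" and ?Q1.0="%z. q (\<Theta> (fst z), g (snd z))"
        and ?P0.0="%z. P (\<Theta> (fst z), 0)" and ?F0.0="%z. F (\<Theta> (fst z), 0)" and ?Q0.0="%z. q (\<Theta> (fst z), 0)"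
        and W="%z. cmod (w (fst z) * speed \<gamma> (snd z) / g (snd z))" and \<delta>=\<delta> and ?s1.0="max s1 (sqrt lam0)"])
    show "\<Omega> \<in> sets borel" using \<Omega>b by simp
    show "(%z. cmod (w (fst z) * speed \<gamma> (snd z) / g (snd z))) \<in> borel_measurable (restrict_space borel \<Omega>)"
      by (rule measurable_compose[OF borel_measurable_divide[OF borel_measurable_times[OF m(1) m(2)] m(3)] borel_measurable_norm])
    fix s assume s: "max s1 (sqrt lam0) <= s"
    from pv_normal_form(3)[OF T D_T N_holomorphic nf(2)[OF s] win e]
    have "set_integrable lborel (X \<times> {a<..<b}) (quot (N s))" unfolding wJ .
    then show "set_integrable lborel \<Omega> (quot (N s))"
      by (rule set_integrable_subset[OF _ \<Omega>b]) (auto simp: \<Omega>_def)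
    show "cmod (quot (N s) z) = cmod (w (fst z) * speed \<gamma> (snd z) / g (snd z)) *
        cmod (q (\<Theta> (fst z), g (snd z)) * exp (- of_real (s\<^sup>2) * P (\<Theta> (fst z), g (snd z)) - of_real s * F (\<Theta> (fst z), g (snd z))) -
          q (\<Theta> (fst z), 0) * exp (- of_real (s\<^sup>2) * P (\<Theta> (fst z), 0) - of_real s * F (\<Theta> (fst z), 0)))" for z
      unfolding quot_def case_prod_beta N_eq[OF nf(1)[OF s]] norm_mult[symmetric] by (rule arg_cong[where f=cmod]) (simp only: divide_inverse mult_ac)
  next
    fix z s assume z: "z \<in> \<Omega>" "max s1 (sqrt lam0) <= s"
    show "\<delta> <= Re (P (\<Theta> (fst z), g (snd z)) + F (\<Theta> (fst z), g (snd z)) / of_real s)"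
      using \<delta>(3)[OF out[OF z(1)]] z(2) by simp
    show "\<delta> <= Re (P (\<Theta> (fst z), 0) + F (\<Theta> (fst z), 0) / of_real s)"
      using \<delta>(3)[OF out1[OF z(1)]] z(2) by simp
  qed (rule r[OF cont(1)[OF P]] r[OF cont(1)[OF F]] r[OF cont(1)[OF q]] r[OF cont(2)[OF P]] r[OF cont(2)[OF F]] r[OF cont(2)[OF q]]
      \<delta>(1) norm_ge_zero less_le_trans[OF \<delta>(2) max.cobounded1])+
  show ?R
  proof (rule set_integral_tail_decay[where ?P1.0="%x. P (\<Theta> x, 0)" and ?F1.0="%x. F (\<Theta> x, 0)" and ?Q1.0="%x. q (\<Theta> x, 0)"
        and ?P0.0="%x. P (\<Theta> x, 0)" and ?F0.0="%x. F (\<Theta> x, 0)" and ?Q0.0="%_. 0" and W="%x. cmod (w x)" and \<delta>=\<delta> and ?s1.0="max s1 (sqrt lam0)"])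
    show "X - C \<in> sets borel" by (intro sets.Diff X_borel C)
    show "(%x. cmod (w x)) \<in> borel_measurable (restrict_space borel (X - C))"
      by (rule measurable_compose[OF r[OF cw0] borel_measurable_norm])
    fix s assume s: "max s1 (sqrt lam0) <= s"
    show "set_integrable lborel (X - C) (residue (N s))"
      by (rule set_integrable_subset[OF pv_normal_form(1)[OF T D_T N_holomorphic nf(2)[OF s] win e]])
        (use sets.Diff[OF X_borel C] in auto)
    show "cmod (residue (N s) x) = cmod (w x) * cmod (q (\<Theta> x, 0) * exp (- of_real (s\<^sup>2) * P (\<Theta> x, 0) - of_real s * F (\<Theta> x, 0)) -
          0 * exp (- of_real (s\<^sup>2) * P (\<Theta> x, 0) - of_real s * F (\<Theta> x, 0)))" for x
      unfolding residue_def N_eq[OF nf(1)[OF s]] norm_mult[symmetric] by (rule arg_cong[where f=cmod]) (simp add: mult_ac)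
  next
    fix x s assume z: "x \<in> X - C" "max s1 (sqrt lam0) <= s"
    show "\<delta> <= Re (P (\<Theta> x, 0) + F (\<Theta> x, 0) / of_real s)"
      using \<delta>(3)[OF out0[OF z(1)]] z(2) by simp
    then show "\<delta> <= Re (P (\<Theta> x, 0) + F (\<Theta> x, 0) / of_real s)" .
  qed (rule r[OF cont(3)[OF P]] r[OF cont(3)[OF F]] r[OF cont(3)[OF q]] \<delta>(1) norm_ge_zero less_le_trans[OF \<delta>(2) max.cobounded1] borel_measurable_const)+
qed

end

context saddle_setting
begin

text \<open>At \<open>\<theta> = 0\<close> the real part of \<open>P\<close> is positive at the ends
  of the window by (iv), and it does not decrease along the chords to the apex. By compactness it
  has a positive minimum there, and uniform continuity keeps half of it for small
  \<open>\<theta>\<close>.\<close>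

lemma detour_data:
  obtains R e a b \<rho> c B C where "0 < R" "!!\<theta> t. norm \<theta> < R ==> cmod t < R ==> (\<theta>, t) \<in> T"
    "0 < e" "e < R" "is_window e a b" "0 < \<rho>" "\<rho> < R" "0 < c"
    "!!\<theta> t. norm \<theta> <= \<rho> ==> t \<in> closed_segment (g a) (apex e) \<union> closed_segment (g b) (apex e) ==>
       c <= Re (P (\<theta>, t)) \<and> cmod (F (\<theta>, t)) <= B \<and> cmod (q (\<theta>, t) / t) <= C"
proof -
  obtain R where R: "0 < R" and RT: "!!\<theta> t. norm \<theta> < R ==> cmod t < R ==> (\<theta>, t) \<in> T"
    using polydisc by blast
  define Pt where "Pt = (%t. P (0, t))"
  have Pt: "Pt holomorphic_on ball 0 R"
    unfolding Pt_def using R RT by (intro holomorphic_several_fibre[OF P]) auto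
  have d0: "deriv Pt 0 = \<alpha>" using \<alpha>P by (simp add: partial_t_def Pt_def)
  have "isCont (deriv Pt) 0"
    using holomorphic_on_imp_continuous_on[OF holomorphic_deriv[OF Pt open_ball]] R
    by (simp add: continuous_on_eq_continuous_at)
  then obtain R1 where R1: "0 < R1" "!!t. dist t 0 < R1 ==> dist (deriv Pt t) (deriv Pt 0) < cmod \<alpha> / 4"
    using \<alpha> unfolding continuous_at_eps_delta by (metis zero_less_divide_iff zero_less_norm_iff zero_less_numeral)
  obtain \<rho>0 where \<rho>0: "0 < \<rho>0" "!!r. 0 < r ==> r <= \<rho>0 ==> \<exists>a b. is_window r a b" using window_exists by blast
  \<comment> \<open>Small enough for a window to exist, for the disc to stay in the domain, and for
    the derivative of \<open>P (0, t)\<close> to stay within \<open>|\<alpha>| / 4\<close> of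
    \<open>\<alpha>\<close>.\<close>
  define e where "e = min \<rho>0 (min R R1 / 2)"
  have e: "0 < e" "e <= \<rho>0" "e < R" "e < R1" using \<rho>0(1) R R1(1) by (auto simp: e_def min_less_iff_disj)
  obtain a b where win: "is_window e a b" using \<rho>0(2)[OF e(1,2)] by blast
  have wd: "s0 - d < a" "a < s0" "s0 < b" "b < s0 + d" "cmod (g a) = e" "cmod (g b) = e" using win by (auto simp: is_window_def)
  define S where "S = closed_segment (g a) (apex e) \<union> closed_segment (g b) (apex e)"
  have S_cases: "\<exists>s. \<bar>s - s0\<bar> <= d \<and> s ~= s0 \<and> cmod (g s) = e \<and> t \<in> closed_segment (g s) (apex e)" if "t \<in> S" for t
  proof -
    have "\<bar>a - s0\<bar> <= d" "\<bar>b - s0\<bar> <= d" "a ~= s0" "b ~= s0" using wd by auto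
    then show ?thesis using that wd(5,6) unfolding S_def by blast
  qed
  have S: "compact S" unfolding S_def by (intro compact_Un) auto
  have Snz: "t ~= 0" "cmod t <= e" "0 < Re (P (0, t))" if t: "t \<in> S" for t
  proof -
    obtain s where s: "\<bar>s - s0\<bar> <= d" "s ~= s0" "cmod (g s) = e" "t \<in> closed_segment (g s) (apex e)" using S_cases[OF t] by blast
    from detour_avoids_cut[OF s(1,2) e(1) s(4)] show "t ~= 0" by auto
    have "closed_segment (g s) (apex e) \<subseteq> cball 0 e"
      by (rule closed_segment_subset[OF _ _ convex_cball]) (use s(3) apex(1)[of e] e(1) in auto)
    then show "cmod t <= e" using s(4) by auto
    have "s \<in> {s0 - d..s0 + d}" using s(1) by (auto simp: abs_le_iff)
    then have "s \<in> J" using d(2) interior_subset by blast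
    then have "(0, g s) \<in> D" using param_in_D[OF x0_X] by (simp add: theta_x0)
    moreover have "(0, g s) ~= 0" using s(3) e(1) by (auto simp: zero_prod_def)
    ultimately have "0 < Re (Pt (g s))" unfolding Pt_def by (rule Re_P_pos)
    also have "Re (Pt (g s)) <= Re (Pt t)"
    proof (rule detour_Re_pos[OF s(1,3) e(1) Pt e(3) _ s(4)])
      fix t assume "cmod t <= e"
      then show "cmod (deriv Pt t - \<alpha>) <= cmod \<alpha> / 4" using R1(2)[of t] e(4) unfolding d0 by (simp add: dist_norm)
    qed
    finally show "0 < Re (P (0, t))" by (simp add: Pt_def)
  qed
  define K where "K = cball (0 :: complex ^ 'm) (R / 2) \<times> S"
  have K: "compact K" unfolding K_def by (intro compact_Times S) auto
  have KT: "K \<subseteq> T"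
  proof
    fix z assume "z \<in> K"
    then have "norm (fst z) <= R / 2" "snd z \<in> S" by (auto simp: K_def)
    then have "(fst z, snd z) \<in> T" using Snz(2)[of "snd z"] e(3) R by (intro RT) auto
    then show "z \<in> T" by simp
  qed
  note cont = continuous_on_subset[OF holomorphic_several_continuous KT]
  have "g a \<in> S" by (simp add: S_def)
  then have Sne: "S ~= {}" by blast
  have "continuous_on S (%t. Re (P (0, t)))"
    using R by (intro continuous_on_Re continuous_on_compose2[OF cont[OF P]] continuous_on_Pair continuous_on_const continuous_on_id) (auto simp: K_def)
  from continuous_attains_inf[OF S Sne this]
  obtain t0 where t0: "t0 \<in> S" "!!t. t \<in> S ==> Re (P (0, t0)) <= Re (P (0, t))" by blast
  define c where "c = Re (P (0, t0)) / 2"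
  have c: "0 < c" using Snz(3)[OF t0(1)] by (simp add: c_def)
  obtain \<rho>1 where \<rho>1: "0 < \<rho>1" "!!z z'. z \<in> K ==> z' \<in> K ==> dist z' z < \<rho>1 ==> dist (P z') (P z) < c"
    using compact_uniformly_continuous[OF cont[OF P] K] c unfolding uniformly_continuous_on_def by blast
  define \<rho> where "\<rho> = min (R / 2) (\<rho>1 / 2)"
  have \<rho>: "0 < \<rho>" "\<rho> < R" "\<rho> <= R / 2" "\<rho> < \<rho>1" using R \<rho>1(1) by (auto simp: \<rho>_def min_less_iff_disj)
  have "bounded (F ` K)" by (intro compact_imp_bounded compact_continuous_image cont[OF F] K)
  then obtain B where B: "\<forall>y\<in>F ` K. cmod y <= B" unfolding bounded_iff by blast
  have "continuous_on K (%z. q z / snd z)"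
    by (rule continuous_on_divide[OF cont[OF q] continuous_on_snd[OF continuous_on_id]]) (use Snz(1) in \<open>auto simp: K_def\<close>)
  then have "bounded ((%z. q z / snd z) ` K)" by (intro compact_imp_bounded compact_continuous_image K)
  then obtain C where C: "\<forall>y\<in>(%z. q z / snd z) ` K. cmod y <= C" unfolding bounded_iff by blast
  have "c <= Re (P (\<theta>, t)) \<and> cmod (F (\<theta>, t)) <= B \<and> cmod (q (\<theta>, t) / t) <= C" if \<theta>: "norm \<theta> <= \<rho>" and t: "t \<in> S" for \<theta> t
  proof (intro conjI)
    have in_K: "(\<theta>, t) \<in> K" "(0, t) \<in> K" using \<theta> t \<rho> R by (auto simp: K_def)
    have "dist (\<theta>, t) (0, t) < \<rho>1" using \<theta> \<rho>(4) by (simp add: dist_Pair_Pair)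
    then have "dist (P (\<theta>, t)) (P (0, t)) < c" by (rule \<rho>1(2)[OF in_K(2,1)])
    then have "\<bar>Re (P (\<theta>, t) - P (0, t))\<bar> < c" using abs_Re_le_cmod[of "P (\<theta>, t) - P (0, t)"] by (simp add: dist_norm)
    then show "c <= Re (P (\<theta>, t))" using t0(2)[OF t] unfolding c_def minus_complex.sel abs_less_iff by linarith
    show "cmod (F (\<theta>, t)) <= B" by (rule bspec[OF B imageI[OF in_K(1)]])
    show "cmod (q (\<theta>, t) / t) <= C" using bspec[OF C imageI[OF in_K(1)]] by simp
  qed
  then have "\<forall>\<theta> t. norm \<theta> <= \<rho> --> t \<in> closed_segment (g a) (apex e) \<union> closed_segment (g b) (apex e) -->
      c <= Re (P (\<theta>, t)) \<and> cmod (F (\<theta>, t)) <= B \<and> cmod (q (\<theta>, t) / t) <= C"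
    unfolding S_def by blast
  then show ?thesis
    by (intro that[OF R _ e(1,3) win \<rho>(1,2) c, of B C]) (rule RT, assumption+, blast)
qed

lemma tangent_box:
  assumes \<rho>: "0 < \<rho>" and \<tau>: "0 < \<tau>"
  obtains l where "0 < l" "l <= \<rho>" "!!k. {x0 $ k - l..x0 $ k + l} \<subseteq> interior (fst (\<Gamma> k))"
    "!!k y. \<bar>y - x0 $ k\<bar> <= l ==> cmod (snd (\<Gamma> k) y - of_real (y - x0 $ k) * speed (\<Gamma> k) (x0 $ k)) <= \<tau> * cmod (speed (\<Gamma> k) (x0 $ k)) * \<bar>y - x0 $ k\<bar>"
proof -
  define G where "G = (%k h. 0 < h \<and> {x0 $ k - h..x0 $ k + h} \<subseteq> interior (fst (\<Gamma> k)) \<and>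
      (\<forall>y. \<bar>y - x0 $ k\<bar> <= h --> cmod (snd (\<Gamma> k) y - of_real (y - x0 $ k) * speed (\<Gamma> k) (x0 $ k)) <= \<tau> * cmod (speed (\<Gamma> k) (x0 $ k)) * \<bar>y - x0 $ k\<bar>))"
  have ex: "\<exists>h. G k h" for k
  proof -
    have "x0 $ k \<in> fst (\<Gamma> k)" using x0_X by blast
    then have "0 < \<tau> * cmod (speed (\<Gamma> k) (x0 $ k))" using smooth_simple_curve_speed(3)[OF curves] \<tau> by simp
    then obtain h where h: "0 < h" "{x0 $ k - h..x0 $ k + h} \<subseteq> interior (fst (\<Gamma> k))"
      "!!s t. \<bar>s - x0 $ k\<bar> <= h ==> \<bar>t - x0 $ k\<bar> <= h ==>
        cmod (snd (\<Gamma> k) t - snd (\<Gamma> k) s - of_real (t - s) * speed (\<Gamma> k) (x0 $ k)) <= \<tau> * cmod (speed (\<Gamma> k) (x0 $ k)) * \<bar>t - s\<bar>"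
      using smooth_simple_curve_near_tangent[OF curves x0(1)] by blast
    have "cmod (snd (\<Gamma> k) y - of_real (y - x0 $ k) * speed (\<Gamma> k) (x0 $ k)) <= \<tau> * cmod (speed (\<Gamma> k) (x0 $ k)) * \<bar>y - x0 $ k\<bar>"
      if "\<bar>y - x0 $ k\<bar> <= h" for y
      using h(3)[of "x0 $ k" y] h(1) that x0(2)[of k] by (simp del: of_real_diff)
    then show ?thesis using h(1,2) unfolding G_def by blast
  qed
  have "\<forall>k. \<exists>h. G k h" using ex by blast
  from choice[OF this] obtain h where "\<forall>k. G k (h k)" by blast
  then have h: "!!k. 0 < h k" "!!k. {x0 $ k - h k..x0 $ k + h k} \<subseteq> interior (fst (\<Gamma> k))"
      "!!k y. \<bar>y - x0 $ k\<bar> <= h k ==> cmod (snd (\<Gamma> k) y - of_real (y - x0 $ k) * speed (\<Gamma> k) (x0 $ k)) <= \<tau> * cmod (speed (\<Gamma> k) (x0 $ k)) * \<bar>y - x0 $ k\<bar>"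
    unfolding G_def by blast+
  define l where "l = min \<rho> (Min (range h))"
  have "0 < Min (range h)" using h(1) by (subst Min_gr_iff) auto
  then have l: "0 < l" "l <= \<rho>" using \<rho> by (auto simp: l_def)
  have lh: "l <= h k" for k unfolding l_def by (rule min.coboundedI2[OF Min_le]) auto
  show ?thesis
  proof (rule that[OF l])
    fix k
    show "{x0 $ k - l..x0 $ k + l} \<subseteq> interior (fst (\<Gamma> k))"
      by (rule subset_trans[OF _ h(2)]) (use lh[of k] in auto)
    fix y assume "\<bar>y - x0 $ k\<bar> <= l"
    then show "cmod (snd (\<Gamma> k) y - of_real (y - x0 $ k) * speed (\<Gamma> k) (x0 $ k)) <= \<tau> * cmod (speed (\<Gamma> k) (x0 $ k)) * \<bar>y - x0 $ k\<bar>"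
      using lh[of k] by (intro h(3)) linarith
  qed
qed

text \<open>A parameter that leaves the box in one coordinate has left the neighbourhood of the pole
  on that curve, since the curve does not return. This supplies \<open>far\<close> for the tail
  estimates.\<close>

lemma box_isolates:
  assumes l: "0 < l"
  obtains \<epsilon> where "0 < \<epsilon>" "!!x t. x \<in> X - cbox (\<chi> k. x0 $ k - l) (\<chi> k. x0 $ k + l) ==> (\<Theta> x, t) \<notin> origin_box \<Gamma> \<gamma> \<epsilon>"
proof -
  define G where "G = (%k e. 0 < e \<and> (\<forall>s. s \<in> fst (\<Gamma> k) --> cmod (snd (\<Gamma> k) s) < e --> \<bar>s - x0 $ k\<bar> < l))"
  have ex: "\<exists>e. G k e" for k
  proof -
    have c: "smooth_simple_curve (fst (\<Gamma> k), snd (\<Gamma> k))" using curves[of k] by simp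
    obtain e where "0 < e" "!!s. s \<in> fst (\<Gamma> k) ==> cmod (snd (\<Gamma> k) s - snd (\<Gamma> k) (x0 $ k)) < e ==> \<bar>s - x0 $ k\<bar> < l"
      using smooth_simple_curve_far_from_point[OF c x0(1) l] by blast
    then show ?thesis unfolding G_def x0(2)[of k] diff_zero by blast
  qed
  have "\<forall>k. \<exists>e. G k e" using ex by blast
  from choice[OF this] obtain e where "\<forall>k. G k (e k)" by blast
  then have e: "!!k. 0 < e k" "!!k s. s \<in> fst (\<Gamma> k) ==> cmod (snd (\<Gamma> k) s) < e k ==> \<bar>s - x0 $ k\<bar> < l"
    unfolding G_def by blast+
  show ?thesis
  proof (rule that[of "Min (range e)"])
    show "0 < Min (range e)" using e(1) by (subst Min_gr_iff) auto
    fix x t assume x: "x \<in> X - cbox (\<chi> k. x0 $ k - l) (\<chi> k. x0 $ k + l)"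
    show "(\<Theta> x, t) \<notin> origin_box \<Gamma> \<gamma> (Min (range e))"
    proof
      assume "(\<Theta> x, t) \<in> origin_box \<Gamma> \<gamma> (Min (range e))"
      then have "cmod (snd (\<Gamma> k) (x $ k)) < Min (range e)" for k by (auto simp: origin_box_def theta_param_def)
      then have "cmod (snd (\<Gamma> k) (x $ k)) < e k" for k by (rule less_le_trans) (rule Min_le, auto)
      then have "\<bar>x $ k - x0 $ k\<bar> < l" for k using x by (intro e(2)) auto
      then have "x0 $ k - l <= x $ k \<and> x $ k <= x0 $ k + l" for k by (smt (verit))
      then have "x \<in> cbox (\<chi> k. x0 $ k - l) (\<chi> k. x0 $ k + l)" by (simp add: mem_box_cart)
      then show False using x by blast
    qed
  qed
qed

text \<open>Chooses the parameter box so small that the curves are nearly straight. The tangent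
  deviation then meets the tolerance of \<open>rotation_increases_Re\<close>, and (iv) provides both
  nonnegativity of \<open>Re P\<close> on the box and a positive bound on its faces.\<close>

lemma residue_laplace:
  assumes R: "0 < R" and RT: "!!\<theta> t. norm \<theta> < R ==> cmod t < R ==> (\<theta>, t) \<in> T" and \<rho>: "0 < \<rho>"
  defines "v \<equiv> (\<chi> k. speed (\<Gamma> k) (x0 $ k))"
  obtains l where "0 < l" "!!k. {x0 $ k - l..x0 $ k + l} \<subseteq> interior (fst (\<Gamma> k))"
    "!!x. x \<in> cbox (\<chi> k. x0 $ k - l) (\<chi> k. x0 $ k + l) ==> norm (\<Theta> x) <= \<rho>"
    "\<forall>\<^sub>F \<kappa> in at_right 0.
     ((%s. of_real (s ^ CARD('m)) * set_lebesgue_integral lborel (cbox (\<chi> k. x0 $ k - l) (\<chi> k. x0 $ k + l)) (residue (N s)))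
       \<longlongrightarrow> q (0, 0) * exp (bilin \<eta> (matrix_inv A) \<eta> / 2) * gauss_branch A v \<kappa>) at_top \<and>
     (gauss_branch A v \<kappa>)\<^sup>2 * det A = (2 * pi) ^ CARD('m)"
proof -
  have sec: "holomorphic_vec (%\<theta>. H (\<theta>, 0)) (ball 0 R)" if "holomorphic_several H T" for H
    using RT R by (intro holomorphic_several_section[OF that]) auto
  note hP = sec[OF P] and hF = sec[OF F] and hq = sec[OF q]
  have Aeq: "A = (\<chi> k j. deriv (%z. deriv (%w. P (axis k z + axis j w, 0)) 0) 0)"
    by (simp add: A hessian_theta_def partial_theta_def)
  have grad: "deriv (%z. P (axis k z, 0)) 0 = 0" for k
    using arg_cong[OF gradP, of "%u. u $ k"] by (simp add: grad_theta_def partial_theta_def)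
  obtain K r where r: "0 < r" and K: "0 <= K" and expP: "!!\<theta>. norm \<theta> <= r ==> cmod (P (\<theta>, 0) - bilin \<theta> A \<theta> / 2) <= K * norm \<theta> ^ 3"
    using second_order_expansion[OF hP R P0 grad, folded Aeq] by blast
  have sym: "transpose A = A" using hessian_symmetric[OF hP R, folded Aeq] .
  have \<eta>k: "dir_deriv (%\<theta>. F (\<theta>, 0)) 0 (axis k 1) = \<eta> $ k" for k
  proof -
    have "((%z. F (0 + z *s axis k 1, 0)) has_field_derivative dir_deriv (%\<theta>. F (\<theta>, 0)) (0 + 0 *s axis k 1) (axis k 1)) (at 0)"
      using R by (intro holomorphic_vec_line[OF hF]) simp
    then have "deriv (%z. F (axis k z, 0)) 0 = dir_deriv (%\<theta>. F (\<theta>, 0)) 0 (axis k 1)"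
      by (intro DERIV_imp_deriv) (simp add: axis_eq_scalar_mult[of k, symmetric] axis_zero)
    then show ?thesis by (simp add: \<eta> grad_theta_def partial_theta_def)
  qed
  obtain \<omega> r0 c \<kappa> where \<omega>: "0 < \<omega>" and r0: "0 < r0" and c: "0 < c" and \<kappa>: "0 < \<kappa>"
    and rot: "!!\<theta> t. norm \<theta> <= r0 ==> (!!k. cmod (cnj (v $ k) / v $ k * \<theta> $ k - cnj (\<theta> $ k)) <= \<omega> * cmod (\<theta> $ k)) ==> 0 <= t ==> t <= \<kappa> ==>
      Re (P (\<theta>, 0)) + t * c * (norm \<theta>)\<^sup>2 <= Re (P (pert (rotation_gen A v) (of_real t) *v \<theta>, 0))"
    using rotation_increases_Re[OF hP R expP r K sym detA] by blast
  have v0: "0 < cmod (v $ k)" for k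
  proof -
    have "x0 $ k \<in> fst (\<Gamma> k)" using x0_X by blast
    then show ?thesis using smooth_simple_curve_speed(3)[OF curves] by (simp add: v_def)
  qed
  define vm where "vm = Min (range (%k. cmod (v $ k)))"
  have vm: "0 < vm" unfolding vm_def using v0 by (subst Min_gr_iff) auto
  have vmk: "vm <= cmod (v $ k)" for k unfolding vm_def by (rule Min_le) auto
  \<comment> \<open>Each chord has between half and twice the length of its tangent vector;
    \<open>vm\<close> is the slowest speed, \<open>norm v\<close> bounds the fastest.\<close>
  define k1 k2 where "k1 = vm / 2" and "k2 = 2 * norm v"
  have k1: "0 < k1" using vm by (simp add: k1_def)
  have vn: "cmod (v $ k) <= norm v" for k using Finite_Cartesian_Product.norm_nth_le[of v k] .
  have k2: "0 < k2" using vm vmk vn by (auto simp: k2_def intro: less_le_trans)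
  \<comment> \<open>The bound 1/2 gives the comparison of chord and tangent. With
    \<open>\<omega> / 4\<close> the deviation, counted twice because its conjugate also occurs, is
    at most \<open>\<omega> / 2\<close> of the tangent length and hence at most
    \<open>\<omega>\<close> of the chord.\<close>
  define \<tau> where "\<tau> = min (1 / 2) (\<omega> / 4)"
  have \<tau>: "0 < \<tau>" "\<tau> <= 1 / 2" "\<tau> <= \<omega> / 4" using \<omega> by (auto simp: \<tau>_def)
  define D0 where "D0 = min r0 (min (R / 4) \<rho>)"
  have D0: "0 < D0" "D0 <= r0" "D0 <= R / 4" "D0 <= \<rho>" using r0 R \<rho> by (auto simp: D0_def)
  \<comment> \<open>\<open>CARD('m)\<close> enters because the Euclidean norm is bounded by the sum
    of the moduli of the coordinates.\<close>
  have l0: "0 < D0 / (k2 * real CARD('m))" using D0 k2 by simp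
  obtain l where l: "0 < l" "l <= D0 / (k2 * real CARD('m))" and lint: "!!k. {x0 $ k - l..x0 $ k + l} \<subseteq> interior (fst (\<Gamma> k))"
    and near': "!!k y. \<bar>y - x0 $ k\<bar> <= l ==> cmod (snd (\<Gamma> k) y - of_real (y - x0 $ k) * speed (\<Gamma> k) (x0 $ k)) <= \<tau> * cmod (speed (\<Gamma> k) (x0 $ k)) * \<bar>y - x0 $ k\<bar>"
    using tangent_box[OF l0 \<tau>(1)] by blast
  define a b where "a = (\<chi> k. x0 $ k - l)" and "b = (\<chi> k. x0 $ k + l)"
  have ink: "{a $ k..b $ k} \<subseteq> fst (\<Gamma> k)" for k using lint[of k] interior_subset by (auto simp: a_def b_def)
  have inX: "x \<in> X" if "x \<in> cbox a b" for x
  proof -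
    have "x $ k \<in> {a $ k..b $ k}" for k using that by (simp add: mem_box_cart)
    then show ?thesis using subsetD[OF ink] by blast
  qed
  interpret B: arc_box "%k. snd (\<Gamma> k)" "%k. speed (\<Gamma> k)" a b
  proof
    show "a $ k < b $ k" for k using l by (simp add: a_def b_def)
    show "continuous_on {a $ k..b $ k} (speed (\<Gamma> k))" for k
      by (rule continuous_on_subset[OF smooth_simple_curve_speed(1)[OF curves] ink])
    show "(snd (\<Gamma> k) has_vector_derivative speed (\<Gamma> k) y) (at y within {a $ k..b $ k})" if "y \<in> {a $ k..b $ k}" for k y
      by (rule has_vector_derivative_within_subset[OF smooth_simple_curve_speed(2)[OF curves] ink]) (use that ink in blast)
  qed
  have arc: "B.arc x = \<Theta> x" for x by (simp add: B.arc_def theta_param_def)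
  have jac: "B.jac x = w x" for x by (simp add: B.jac_def w_def)
  have box: "\<bar>x $ k - x0 $ k\<bar> <= l" if "x \<in> cbox a b" for x k
    using that by (simp add: mem_box_cart a_def b_def abs_le_iff algebra_simps)
  have comp: "cmod (\<Theta> x $ k - of_real (x $ k - x0 $ k) * v $ k) <= \<tau> * (cmod (v $ k) * \<bar>x $ k - x0 $ k\<bar>)" if "x \<in> cbox a b" for x k
    using near'[OF box[OF that, of k]] by (simp add: theta_param_def v_def mult.assoc)
  have nrm: "cmod (of_real (x $ k - x0 $ k) * v $ k) = cmod (v $ k) * \<bar>x $ k - x0 $ k\<bar>" for x k
    by (simp only: norm_mult norm_of_real mult.commute)
  have low: "cmod (v $ k) * \<bar>x $ k - x0 $ k\<bar> / 2 <= cmod (\<Theta> x $ k)" "cmod (\<Theta> x $ k) <= 2 * (cmod (v $ k) * \<bar>x $ k - x0 $ k\<bar>)" if x: "x \<in> cbox a b" for x k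
  proof -
    define n where "n = cmod (v $ k) * \<bar>x $ k - x0 $ k\<bar>"
    have n0: "0 <= n" by (simp add: n_def)
    have "cmod (\<Theta> x $ k - of_real (x $ k - x0 $ k) * v $ k) <= n / 2"
      using order_trans[OF comp[OF x] mult_right_mono[OF \<tau>(2)]] n0 by (simp add: n_def)
    moreover have "cmod (of_real (x $ k - x0 $ k) * v $ k) = n" unfolding n_def by (rule nrm)
    ultimately show "n / 2 <= cmod (\<Theta> x $ k)" "cmod (\<Theta> x $ k) <= 2 * n"
      using norm_triangle_ineq2[of "of_real (x $ k - x0 $ k) * v $ k" "\<Theta> x $ k"] norm_triangle_ineq2[of "\<Theta> x $ k" "of_real (x $ k - x0 $ k) * v $ k"] n0
      unfolding norm_minus_commute[of "of_real (x $ k - x0 $ k) * v $ k" "\<Theta> x $ k"] by linarith+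
  qed
  have k1le: "k1 * \<bar>x $ k - x0 $ k\<bar> <= cmod (\<Theta> x $ k)" if "x \<in> cbox a b" for x k
    using mult_right_mono[OF vmk[of k], of "\<bar>x $ k - x0 $ k\<bar> / 2"] low(1)[OF that, of k] by (simp add: k1_def)
  have k2le: "cmod (\<Theta> x $ k) <= k2 * \<bar>x $ k - x0 $ k\<bar>" if "x \<in> cbox a b" for x k
    using mult_right_mono[OF vn[of k], of "\<bar>x $ k - x0 $ k\<bar>"] low(2)[OF that, of k] by (simp add: k2_def)
  have sc: "norm (C *\<^sub>R y) = L2_set (%k. C * \<bar>y $ k\<bar>) UNIV" if "0 <= C" for C and y :: "real ^ 'm"
    using that by (simp add: norm_vec_def abs_mult)
  have K1: "k1 * norm (x - x0) <= norm (B.arc x)" if "x \<in> cbox a b" for x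
  proof -
    have "norm (k1 *\<^sub>R (x - x0)) <= norm (\<Theta> x)"
      unfolding sc[OF less_imp_le[OF k1]] norm_vec_def[of "\<Theta> x"] using k1le[OF that] k1 by (intro L2_set_mono) auto
    then show ?thesis using k1 by (simp add: arc)
  qed
  have K2: "norm (B.arc x) <= k2 * norm (x - x0)" if "x \<in> cbox a b" for x
  proof -
    have "norm (\<Theta> x) <= norm (k2 *\<^sub>R (x - x0))"
      unfolding sc[OF less_imp_le[OF k2]] norm_vec_def[of "\<Theta> x"] using k2le[OF that] by (intro L2_set_mono) auto
    then show ?thesis using k2 by (simp add: arc)
  qed
  have small: "norm (\<Theta> x) <= D0" if x: "x \<in> cbox a b" for x
  proof -
    have "norm (x - x0) <= (\<Sum>k\<in>UNIV. \<bar>(x - x0) $ k\<bar>)" by (rule norm_le_l1_cart)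
    also have "\<dots> <= (\<Sum>k\<in>(UNIV :: 'm set). l)" using box[OF x] by (intro sum_mono) simp
    finally have "norm (x - x0) <= real CARD('m) * l" by simp
    from order_trans[OF K2[OF x] mult_left_mono[OF this less_imp_le[OF k2]]]
    have "norm (\<Theta> x) <= k2 * (real CARD('m) * l)" unfolding arc .
    also have "\<dots> <= D0" using l(2) k2 by (simp add: field_simps)
    finally show ?thesis .
  qed
  have grow: "Re (P (B.arc x, 0)) + t * c * (norm (B.arc x))\<^sup>2 <= Re (P (pert (rotation_gen A v) (of_real t) *v B.arc x, 0))"
    if x: "x \<in> cbox a b" and t: "0 <= t" "t <= \<kappa>" for x t
    unfolding arc
  proof (rule rot[OF _ _ t])
    show "norm (\<Theta> x) <= r0" using small[OF x] D0 by simp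
    fix k
    define E where "E = \<Theta> x $ k - of_real (x $ k - x0 $ k) * v $ k"
    have th: "\<Theta> x $ k = of_real (x $ k - x0 $ k) * v $ k + E" by (simp add: E_def)
    have "v $ k ~= 0" using v0[of k] by auto
    then have "cnj (v $ k) / v $ k * \<Theta> x $ k - cnj (\<Theta> x $ k) = cnj (v $ k) / v $ k * E - cnj E"
      unfolding th by (simp add: field_simps del: of_real_diff)
    moreover have "cmod (cnj (v $ k) / v $ k * E - cnj E) <= cmod E + cmod E"
      using norm_triangle_ineq4[of "cnj (v $ k) / v $ k * E" "cnj E"] v0[of k] by (simp add: norm_mult norm_divide)
    moreover have "cmod E <= \<omega> / 4 * (cmod (v $ k) * \<bar>x $ k - x0 $ k\<bar>)"
      using order_trans[OF comp[OF x] mult_right_mono[OF \<tau>(3)]] by (simp add: E_def)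
    moreover have "\<omega> * (cmod (v $ k) * \<bar>x $ k - x0 $ k\<bar> / 2) <= \<omega> * cmod (\<Theta> x $ k)"
      using \<omega> by (intro mult_left_mono low(1)[OF x]) auto
    ultimately show "cmod (cnj (v $ k) / v $ k * \<Theta> x $ k - cnj (\<Theta> x $ k)) <= \<omega> * cmod (\<Theta> x $ k)" by simp
  qed
  have nonneg: "0 <= Re (P (B.arc x, 0))" if x: "x \<in> cbox a b" for x
  proof (cases "(\<Theta> x, 0 :: complex) = 0")
    case True
    then show ?thesis by (simp add: arc P0 zero_prod_def)
  next
    case False
    then show ?thesis using Re_P_pos[OF param_0_in_D[OF inX[OF x]]] by (simp add: arc)
  qed
  have kl: "0 < k1 * l" using k1 l by simp
  obtain \<delta> where \<delta>: "0 < \<delta>" "!!z. z \<in> D - origin_box \<Gamma> \<gamma> (k1 * l) ==> \<delta> <= Re (P z)"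
    using gap_P[OF kl] by blast
  \<comment> \<open>On a face one parameter is exactly \<open>l\<close> away from the saddle, so
    that coordinate has modulus at least \<open>k1 * l\<close> and the point lies outside the origin
    box of this radius.\<close>
  have face: "\<delta> <= Re (P (B.arc x, 0))" if x: "x \<in> cbox a b" and k: "x $ k = a $ k \<or> x $ k = b $ k" for x k
    unfolding arc
  proof (rule \<delta>(2))
    have "\<bar>x $ k - x0 $ k\<bar> = l" using k l by (auto simp: a_def b_def)
    then have "k1 * l <= cmod (\<Theta> x $ k)" using k1le[OF x, of k] by simp
    then have "(\<Theta> x, 0) \<notin> origin_box \<Gamma> \<gamma> (k1 * l)" by (auto simp: origin_box_def not_less)
    then show "(\<Theta> x, 0) \<in> D - origin_box \<Gamma> \<gamma> (k1 * l)" using param_0_in_D[OF inX[OF x]] by blast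
  qed
  have lap: "\<forall>\<^sub>F t in at_right 0.
     ((%s. of_real (s ^ CARD('m)) * integral (cbox a b) (%x. exp (- of_real (s\<^sup>2) * P (B.arc x, 0) - of_real s * F (B.arc x, 0)) * q (B.arc x, 0) * B.jac x))
       \<longlongrightarrow> q (0, 0) * exp (bilin \<eta> (matrix_inv A) \<eta> / 2) * gauss_branch A v t) at_top \<and>
     (gauss_branch A v t)\<^sup>2 * det A = (2 * pi) ^ CARD('m)"
  proof (rule B.laplace_expansion[OF hP hF hq R, where r=r and K=K and ?x0.0=x0 and ?k1.0=k1 and ?k2.0=k2 and ?c0.0=c and ?\<kappa>0.0=\<kappa> and \<delta>=\<delta>])
    show "cmod (P (\<theta>, 0) - bilin \<theta> A \<theta> / 2) <= K * norm \<theta> ^ 3" if "norm \<theta> <= r" for \<theta> by (rule expP[OF that])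
    show "a $ k < x0 $ k" "x0 $ k < b $ k" for k using l by (simp_all add: a_def b_def)
    show "B.arc x0 = 0" by (simp add: arc theta_x0)
    show "v $ k = speed (\<Gamma> k) (x0 $ k)" for k by (simp add: v_def)
    show "norm (B.arc x) <= R / 4" if "x \<in> cbox a b" for x using small[OF that] D0 by (simp add: arc)
  qed (rule r K sym detA F0 \<eta>k k1 c \<kappa> \<delta>(1) | erule (2) grow | erule nonneg K1 K2 | erule (1) face)+
  have eq: "integral (cbox a b) (%x. exp (- of_real (s\<^sup>2) * P (B.arc x, 0) - of_real s * F (B.arc x, 0)) * q (B.arc x, 0) * B.jac x) =
      set_lebesgue_integral lborel (cbox a b) (residue (N s))" if s: "0 <= s" for s
  proof -
    have "set_integrable lborel (cbox a b) (residue (N s))"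
      unfolding set_integrable_def
      by (rule borel_integrable_compact[OF compact_cbox continuous_on_subset[OF residue_continuous[OF T D_T N_holomorphic]]]) (use inX in blast)
    from set_borel_integral_eq_integral(2)[OF this]
    show ?thesis by (simp add: residue_def N_eq[OF s] arc jac mult_ac)
  qed
  have "\<forall>\<^sub>F t in at_right 0.
     ((%s. of_real (s ^ CARD('m)) * set_lebesgue_integral lborel (cbox a b) (residue (N s)))
       \<longlongrightarrow> q (0, 0) * exp (bilin \<eta> (matrix_inv A) \<eta> / 2) * gauss_branch A v t) at_top \<and>
     (gauss_branch A v t)\<^sup>2 * det A = (2 * pi) ^ CARD('m)"
    using lap
  proof eventually_elim
    case (elim t)
    have "\<forall>\<^sub>F s in at_top. of_real (s ^ CARD('m)) * integral (cbox a b) (%x. exp (- of_real (s\<^sup>2) * P (B.arc x, 0) - of_real s * F (B.arc x, 0)) * q (B.arc x, 0) * B.jac x) =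
        of_real (s ^ CARD('m)) * set_lebesgue_integral lborel (cbox a b) (residue (N s))"
      using eventually_ge_at_top[of "0::real"] by eventually_elim (simp only: eq)
    from Lim_transform_eventually[OF conjunct1[OF elim] this] conjunct2[OF elim] show ?case by blast
  qed
  moreover have "norm (\<Theta> x) <= \<rho>" if "x \<in> cbox a b" for x using small[OF that] D0 by simp
  ultimately show ?thesis using l(1) lint unfolding a_def b_def by (intro that) auto
qed

text \<open>For each large \<open>s\<close> the principal value is the half residue integrated over
  the small box, up to errors that vanish faster than every power of \<open>s\<close>. Multiplied by
  \<open>s^m\<close> it inherits the Laplace limit of the residue.\<close>

lemma main_limit:
  defines "v \<equiv> (\<chi> k. speed (\<Gamma> k) (x0 $ k))"
  obtains I where "\<forall>\<^sub>F s in at_top. has_pv_integral \<Gamma> \<gamma> (N s) (I s)"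
    "\<forall>\<^sub>F \<kappa> in at_right 0.
     ((%s. of_real (s ^ CARD('m)) * I s) \<longlongrightarrow> - \<i> * of_real (pi * sgn \<beta>) * (q (0, 0) * exp (bilin \<eta> (matrix_inv A) \<eta> / 2) * gauss_branch A v \<kappa>)) at_top \<and>
     (gauss_branch A v \<kappa>)\<^sup>2 * det A = (2 * pi) ^ CARD('m)"
proof -
  obtain R e a b \<rho> c B C where R: "0 < R" and RT: "!!\<theta> t. norm \<theta> < R ==> cmod t < R ==> (\<theta>, t) \<in> T"
    and e: "0 < e" "e < R" and win: "is_window e a b" and \<rho>: "0 < \<rho>" "\<rho> < R" and c: "0 < c"
    and bnd: "!!\<theta> t. norm \<theta> <= \<rho> ==> t \<in> closed_segment (g a) (apex e) \<union> closed_segment (g b) (apex e) ==>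
       c <= Re (P (\<theta>, t)) \<and> cmod (F (\<theta>, t)) <= B \<and> cmod (q (\<theta>, t) / t) <= C"
    using detour_data by blast
  obtain l where l: "0 < l" and lint: "!!k. {x0 $ k - l..x0 $ k + l} \<subseteq> interior (fst (\<Gamma> k))"
    and small: "!!x. x \<in> cbox (\<chi> k. x0 $ k - l) (\<chi> k. x0 $ k + l) ==> norm (\<Theta> x) <= \<rho>"
    and lap: "\<forall>\<^sub>F \<kappa> in at_right 0.
     ((%s. of_real (s ^ CARD('m)) * set_lebesgue_integral lborel (cbox (\<chi> k. x0 $ k - l) (\<chi> k. x0 $ k + l)) (residue (N s)))
       \<longlongrightarrow> q (0, 0) * exp (bilin \<eta> (matrix_inv A) \<eta> / 2) * gauss_branch A v \<kappa>) at_top \<and>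
     (gauss_branch A v \<kappa>)\<^sup>2 * det A = (2 * pi) ^ CARD('m)"
    unfolding v_def using residue_laplace[OF R RT \<rho>(1)] by blast
  define Q where "Q = cbox (\<chi> k. x0 $ k - l) (\<chi> k. x0 $ k + l)"
  obtain \<epsilon> where \<epsilon>: "0 < \<epsilon>" and far: "!!x t. x \<in> X - Q ==> (\<Theta> x, t) \<notin> origin_box \<Gamma> \<gamma> \<epsilon>"
    unfolding Q_def using box_isolates[OF l] by blast
  have Qb: "Q \<in> sets borel" by (simp add: Q_def)
  have QX: "Q \<subseteq> X"
  proof
    fix x assume "x \<in> Q"
    then have "x $ k \<in> {x0 $ k - l..x0 $ k + l}" for k by (simp add: Q_def mem_box_cart)
    then have "x $ k \<in> fst (\<Gamma> k)" for k using lint[of k] interior_subset by blast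
    then show "x \<in> X" by blast
  qed
  have wQ: "set_integrable lborel Q w"
    unfolding set_integrable_def Q_def by (rule borel_integrable_compact[OF compact_cbox continuous_on_subset[OF continuous_on_w QX[unfolded Q_def]]])
  define W where "W = (\<integral>x. indicator Q x * cmod (w x) \<partial>lborel)"
  define Bs where "Bs = (%s. exp (- s\<^sup>2 * c + s * B) * C)"
  define err where "err = (%s. cmod (set_lebesgue_integral lborel (X \<times> {s \<in> J. e <= cmod (g s)}) (full (N s))) +
       cmod (set_lebesgue_integral lborel ((X - Q) \<times> {a<..<b}) (quot (N s))) +
       cmod (set_lebesgue_integral lborel (X - Q) (residue (N s))) * cmod (pv_const a b) + 4 * e * Bs s * W)"
  have ex: "\<exists>L. has_pv_integral \<Gamma> \<gamma> (N s) L \<and> cmod (L + \<i> * of_real (pi * sgn \<beta>) * set_lebesgue_integral lborel Q (residue (N s))) <= err s"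
    if s: "max 0 (sqrt lam0) <= s" for s
  proof -
    have s0': "0 <= s" and "sqrt lam0 <= s" using s by auto
    then have pv: "pv_abs_convergent_away_from_origin \<Gamma> \<gamma> (N s)" using conv[OF sqrt_le_D] by blast
    have hR: "(%t. N s (\<Theta> x, t)) holomorphic_on ball 0 R" if "x \<in> Q" for x
    proof (rule holomorphic_several_fibre[OF N_holomorphic])
      fix t :: complex assume "t \<in> ball 0 R"
      then show "(\<Theta> x, t) \<in> T" using small[of x] that \<rho> by (intro RT) (auto simp: Q_def)
    qed
    have Bb: "cmod (N s (\<Theta> x, t) / t) <= Bs s" if x: "x \<in> Q" and t: "t \<in> closed_segment (g a) (apex e) \<union> closed_segment (g b) (apex e)" for x t
    proof -
      note bd = bnd[OF small[OF x[unfolded Q_def]] t]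
      have "N s (\<Theta> x, t) / t = exp (- of_real (s\<^sup>2) * P (\<Theta> x, t) - of_real s * F (\<Theta> x, t)) * (q (\<Theta> x, t) / t)"
        by (simp add: N_eq[OF s0'])
      then have "cmod (N s (\<Theta> x, t) / t) = exp (Re (- of_real (s\<^sup>2) * P (\<Theta> x, t) - of_real s * F (\<Theta> x, t))) * cmod (q (\<Theta> x, t) / t)"
        by (simp only: norm_mult norm_exp_eq_Re)
      also have "\<dots> <= exp (- s\<^sup>2 * c + s * B) * C"
      proof (intro mult_mono)
        have "Re (- of_real u * y - of_real u' * z) = - (u * Re y) + u' * (- Re z)" for u u' y z by simp
        then have "Re (- of_real (s\<^sup>2) * P (\<Theta> x, t) - of_real s * F (\<Theta> x, t)) = - (s\<^sup>2 * Re (P (\<Theta> x, t))) + s * (- Re (F (\<Theta> x, t)))" .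
        moreover have "s\<^sup>2 * c <= s\<^sup>2 * Re (P (\<Theta> x, t))" using bd by (intro mult_left_mono) auto
        moreover have "- Re (F (\<Theta> x, t)) <= B" using bd abs_Re_le_cmod[of "F (\<Theta> x, t)"] by linarith
        then have "s * (- Re (F (\<Theta> x, t))) <= s * B" using s0' by (rule mult_left_mono)
        ultimately show "exp (Re (- of_real (s\<^sup>2) * P (\<Theta> x, t) - of_real s * F (\<Theta> x, t))) <= exp (- s\<^sup>2 * c + s * B)" by simp
      qed (use bd in auto)
      finally show ?thesis by (simp add: Bs_def)
    qed
    obtain L where L: "has_pv_integral \<Gamma> \<gamma> (N s) L" "cmod (L + \<i> * of_real (pi * sgn \<beta>) * set_lebesgue_integral lborel Q (residue (N s))) <= err s"
      unfolding err_def W_def by (rule has_pv_near_residue[OF T D_T N_holomorphic pv win e(1) Qb QX wQ e(2) hR Bb])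
    then show ?thesis by blast
  qed
  \<comment> \<open>The principal value and its error bound are obtained for each \<open>s\<close>
    separately; one choice function combines them.\<close>
  define I where "I = (%s. SOME L. has_pv_integral \<Gamma> \<gamma> (N s) L \<and> cmod (L + \<i> * of_real (pi * sgn \<beta>) * set_lebesgue_integral lborel Q (residue (N s))) <= err s)"
  have I: "has_pv_integral \<Gamma> \<gamma> (N s) (I s)" "cmod (I s + \<i> * of_real (pi * sgn \<beta>) * set_lebesgue_integral lborel Q (residue (N s))) <= err s"
    if "max 0 (sqrt lam0) <= s" for s
    using someI_ex[OF ex[OF that]] unfolding I_def by blast+
  have err0: "((%s. s ^ CARD('m) * err s) \<longlongrightarrow> 0) at_top"
  proof -
    note t1 = full_tail[OF win e(1), of "CARD('m)"] and t23 = quot_tail[OF win e(1) Qb \<epsilon> far, of "CARD('m)"]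
    have t4: "((%s. 4 * e * C * W * (s ^ CARD('m) * exp (- s\<^sup>2 * c + s * B))) \<longlongrightarrow> 4 * e * C * W * 0) at_top"
      by (intro tendsto_mult_left power_times_gaussian_tendsto_0 c)
    from tendsto_add[OF tendsto_add[OF tendsto_add[OF t1 t23(1)] tendsto_mult_right[OF t23(2), of "cmod (pv_const a b)"]] t4]
    show ?thesis by (simp add: err_def Bs_def algebra_simps)
  qed
  have diff0: "((%s. of_real (s ^ CARD('m)) * I s + \<i> * of_real (pi * sgn \<beta>) * (of_real (s ^ CARD('m)) * set_lebesgue_integral lborel Q (residue (N s)))) \<longlongrightarrow> 0) at_top"
  proof (rule Lim_null_comparison[OF _ err0])
    show "\<forall>\<^sub>F s in at_top. cmod (of_real (s ^ CARD('m)) * I s + \<i> * of_real (pi * sgn \<beta>) * (of_real (s ^ CARD('m)) * set_lebesgue_integral lborel Q (residue (N s)))) <= s ^ CARD('m) * err s"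
      using eventually_ge_at_top[of "max 0 (sqrt lam0)"]
    proof eventually_elim
      case (elim s)
      have "of_real (s ^ CARD('m)) * I s + \<i> * of_real (pi * sgn \<beta>) * (of_real (s ^ CARD('m)) * set_lebesgue_integral lborel Q (residue (N s))) =
          of_real (s ^ CARD('m)) * (I s + \<i> * of_real (pi * sgn \<beta>) * set_lebesgue_integral lborel Q (residue (N s)))"
        by (simp only: distrib_left mult_ac)
      moreover have "\<bar>s ^ CARD('m)\<bar> = s ^ CARD('m)" using elim by simp
      ultimately show ?case
        using mult_left_mono[OF I(2)[OF elim], of "s ^ CARD('m)"] elim by (simp only: norm_mult norm_of_real)
    qed
  qed
  show ?thesis
  proof (rule that[of I])
    show "\<forall>\<^sub>F s in at_top. has_pv_integral \<Gamma> \<gamma> (N s) (I s)"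
      using eventually_ge_at_top[of "max 0 (sqrt lam0)"] by eventually_elim (rule I(1))
    show "\<forall>\<^sub>F \<kappa> in at_right 0.
     ((%s. of_real (s ^ CARD('m)) * I s) \<longlongrightarrow> - \<i> * of_real (pi * sgn \<beta>) * (q (0, 0) * exp (bilin \<eta> (matrix_inv A) \<eta> / 2) * gauss_branch A v \<kappa>)) at_top \<and>
     (gauss_branch A v \<kappa>)\<^sup>2 * det A = (2 * pi) ^ CARD('m)"
      using lap unfolding Q_def[symmetric]
    proof eventually_elim
      case (elim \<kappa>)
      from tendsto_diff[OF diff0 tendsto_mult_left[OF conjunct1[OF elim], of "\<i> * of_real (pi * sgn \<beta>)"]] conjunct2[OF elim]
      show ?case by (simp only: add_diff_cancel_right' diff_0 mult_minus_left)
    qed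
  qed
qed

end

section \<open>Uniqueness, normalisation at the origin, and the choice of the sign\<close>

lemma pv_integral_unique: "has_pv_integral \<Gamma> \<gamma> h L \<Longrightarrow> pv_integral \<Gamma> \<gamma> h = L"
  unfolding pv_integral_def
  by (rule the_equality, assumption) (auto simp: has_pv_integral_def intro: tendsto_unique[OF trivial_limit_at_right_real])

lemma has_pv_integral_scale:
  fixes \<Gamma> :: "'a::finite \<Rightarrow> curve"
  assumes "has_pv_integral \<Gamma> \<gamma> h L" shows "has_pv_integral \<Gamma> \<gamma> (\<lambda>z. c * h z) (c * L)"
proof -
  have eq: "pullback \<Gamma> \<gamma> (\<lambda>(\<theta>, t). c * h (\<theta>, t) / t) = (\<lambda>z. c * pullback \<Gamma> \<gamma> (\<lambda>(\<theta>, t). h (\<theta>, t) / t) z)"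
    by (auto simp: fun_eq_iff pullback_def)
  have int: "set_lebesgue_integral lborel S (\<lambda>z. c * k z) = c * set_lebesgue_integral lborel S k" for S and k :: "(real ^ 'a) \<times> real \<Rightarrow> complex"
    by (simp add: set_lebesgue_integral_def)
  show ?thesis
    using assms unfolding has_pv_integral_def abs_integrable_def product_integral_def eq int
    by (auto intro: tendsto_mult_left set_integrable_mult_right)
qed

lemma pv_abs_convergent_scale:
  assumes "pv_abs_convergent_away_from_origin \<Gamma> \<gamma> h"
  shows "pv_abs_convergent_away_from_origin \<Gamma> \<gamma> (\<lambda>z. c * h z)"
proof -
  have 1: "pullback \<Gamma> \<gamma> (\<lambda>(\<theta>, t). if cmod t < \<epsilon> then (c * h (\<theta>, t) - c * h (\<theta>, 0)) / t else c * h (\<theta>, t) / t) =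
      (\<lambda>z. c * pullback \<Gamma> \<gamma> (\<lambda>(\<theta>, t). if cmod t < \<epsilon> then (h (\<theta>, t) - h (\<theta>, 0)) / t else h (\<theta>, t) / t) z)" for \<epsilon>
    by (auto simp: fun_eq_iff pullback_def right_diff_distrib[symmetric])
  have 2: "theta_pullback \<Gamma> (\<lambda>\<theta>. c * h (\<theta>, 0)) = (\<lambda>x. c * theta_pullback \<Gamma> (\<lambda>\<theta>. h (\<theta>, 0)) x)"
    by (auto simp: fun_eq_iff theta_pullback_def)
  show ?thesis
    using assms unfolding pv_abs_convergent_away_from_origin_def abs_integrable_def theta_abs_integrable_def 1 2
    by (blast intro: set_integrable_mult_right)
qed

lemma holomorphic_several_diff_const:
  assumes "holomorphic_several h T" shows "holomorphic_several (\<lambda>z. h z - c) T"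
  unfolding holomorphic_several_def
proof
  fix z assume "z \<in> T"
  then obtain L where L: "(h has_derivative L) (at z)" "\<forall>a v w. L (a *s v, a * w) = a * L (v, w)"
    using assms unfolding holomorphic_several_def by blast
  have "((\<lambda>z. h z - c) has_derivative L) (at z)" using has_derivative_diff[OF L(1) has_derivative_const[of c]] by simp
  with L(2) show "\<exists>L. ((\<lambda>z. h z - c) has_derivative L) (at z) \<and> (\<forall>a v w. L (a *s v, a * w) = a * L (v, w))" by blast
qed

lemma deriv_diff_const: "deriv (\<lambda>z. f z - c) x = deriv f (x :: complex)"
proof -
  have "((\<lambda>z. f z - c) has_field_derivative D) (at x) \<longleftrightarrow> (f has_field_derivative D) (at x)" for D
    using DERIV_diff[of f D x UNIV "\<lambda>_. c" 0] DERIV_add[of "\<lambda>z. f z - c" D x UNIV "\<lambda>_. c" 0] by auto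
  then show ?thesis by (simp add: deriv_def)
qed

text \<open>The real part of \<open>P\<close> along the curve has a minimum at \<open>s0\<close>, so
  its derivative \<open>Re (\<alpha> * speed \<gamma> s0)\<close> vanishes. The parameter is
  interior, so the derivative is two-sided.\<close>

lemma tangent_imaginary:
  assumes c: "smooth_simple_curve \<gamma>" and s0: "s0 \<in> interior (fst \<gamma>)" and z0: "snd \<gamma> s0 = 0"
    and P: "(P has_field_derivative \<alpha>) (at 0)" and P0: "P 0 = 0" and nonneg: "\<And>s. s \<in> fst \<gamma> \<Longrightarrow> 0 \<le> Re (P (snd \<gamma> s))"
  shows "\<alpha> * speed \<gamma> s0 = \<i> * of_real (Im (\<alpha> * speed \<gamma> s0))"
proof -
  have s0J: "s0 \<in> fst \<gamma>" using s0 interior_subset by blast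
  have "(snd \<gamma> has_vector_derivative speed \<gamma> s0) (at s0)"
    using smooth_simple_curve_speed(2)[OF c s0J] at_within_interior[OF s0] by simp
  from field_vector_diff_chain_at[OF this] P z0
  have "((\<lambda>s. P (snd \<gamma> s)) has_vector_derivative speed \<gamma> s0 * \<alpha>) (at s0)" by (simp add: o_def)
  then have "((\<lambda>s. Re (P (snd \<gamma> s))) has_vector_derivative Re (speed \<gamma> s0 * \<alpha>)) (at s0)"
    by (rule bounded_linear.has_vector_derivative[OF bounded_linear_Re])
  then have D: "((\<lambda>s. Re (P (snd \<gamma> s))) has_real_derivative Re (speed \<gamma> s0 * \<alpha>)) (at s0)"
    by (simp add: has_real_derivative_iff_has_vector_derivative)
  obtain h where h: "0 < h" "ball s0 h \<subseteq> fst \<gamma>" using s0 unfolding mem_interior by blast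
  have "Re (speed \<gamma> s0 * \<alpha>) = 0"
  proof (rule DERIV_local_min[OF D h(1)], intro allI impI)
    fix y assume "\<bar>s0 - y\<bar> < h"
    then have "y \<in> ball s0 h" by (simp add: dist_real_def)
    then show "Re (P (snd \<gamma> s0)) \<le> Re (P (snd \<gamma> y))" using nonneg[of y] h(2) z0 P0 by auto
  qed
  then show ?thesis by (simp add: complex_eq_iff mult.commute)
qed

text \<open>
  The branch factor \<open>gauss_branch A v \<kappa>\<close> is a fixed square root of \<open>(2\<pi>)\<^sup>m / det A\<close> for all small
  \<open>\<kappa> > 0\<close>, because it is determined by the limit of one and the same integral; this fixes the sign
  relative to a given square root \<open>r\<close> of \<open>det A\<close>.
\<close>

definition branch_sign :: "complex ^ 'm::finite ^ 'm \<Rightarrow> complex ^ 'm \<Rightarrow> complex \<Rightarrow> complex" where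
  "branch_sign A v r = (SOME \<sigma>. \<sigma> \<in> {1, -1} \<and>
     (\<forall>\<^sub>F \<kappa> in at_right 0. gauss_branch A v \<kappa> * r = \<sigma> * of_real (sqrt ((2 * pi) ^ CARD('m)))))"

lemma branch_sign:
  fixes A :: "complex ^ 'm::finite ^ 'm"
  assumes lim: "\<forall>\<^sub>F \<kappa> in at_right 0. (f \<longlongrightarrow> (K :: complex) * gauss_branch A v \<kappa>) at_top \<and> (gauss_branch A v \<kappa>)\<^sup>2 * det A = (2 * pi) ^ CARD('m)"
    and K: "K \<noteq> 0" and r: "r\<^sup>2 = det A" "det A \<noteq> 0"
  shows "branch_sign A v r \<in> {1, -1}"
    and "(f \<longlongrightarrow> K * (branch_sign A v r * of_real (sqrt ((2 * pi) ^ CARD('m))) / r)) (at_top :: real filter)"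
proof -
  let ?Z = "complex_of_real (sqrt ((2 * pi) ^ CARD('m)))"
  have "(sqrt ((2 * pi) ^ CARD('m)))\<^sup>2 = (2 * pi) ^ CARD('m)" by (rule real_sqrt_pow2) simp
  then have Z2: "?Z\<^sup>2 = (2 * pi) ^ CARD('m)" by (simp only: of_real_power[symmetric])
  have r0: "r \<noteq> 0" using r by auto
  obtain \<kappa>0 where k0: "(f \<longlongrightarrow> K * gauss_branch A v \<kappa>0) at_top" "(gauss_branch A v \<kappa>0)\<^sup>2 * det A = (2 * pi) ^ CARD('m)"
    using eventually_happens'[OF _ lim] by auto
  have "(gauss_branch A v \<kappa>0 * r)\<^sup>2 = ?Z\<^sup>2"
    using power_mult_distrib[of "gauss_branch A v \<kappa>0" r 2] r(1) k0(2) Z2 by (simp only:)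
  then have "gauss_branch A v \<kappa>0 * r = 1 * ?Z \<or> gauss_branch A v \<kappa>0 * r = (-1) * ?Z" unfolding power2_eq_iff by simp
  then obtain \<sigma> where \<sigma>: "\<sigma> \<in> {1, -1 :: complex}" "gauss_branch A v \<kappa>0 * r = \<sigma> * ?Z" by blast
  have "\<forall>\<^sub>F \<kappa> in at_right 0. gauss_branch A v \<kappa> * r = \<sigma> * ?Z"
    using lim
  proof eventually_elim
    case (elim \<kappa>)
    have "K * gauss_branch A v \<kappa> = K * gauss_branch A v \<kappa>0"
      by (rule tendsto_unique[OF trivial_limit_at_top_linorder conjunct1[OF elim] k0(1)])
    then show ?case using K \<sigma>(2) by simp
  qed
  then have "\<exists>\<sigma>. \<sigma> \<in> {1, -1} \<and> (\<forall>\<^sub>F \<kappa> in at_right 0. gauss_branch A v \<kappa> * r = \<sigma> * ?Z)" using \<sigma>(1) by blast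
  from someI_ex[OF this] have b: "branch_sign A v r \<in> {1, -1}" "\<forall>\<^sub>F \<kappa> in at_right 0. gauss_branch A v \<kappa> * r = branch_sign A v r * ?Z"
    unfolding branch_sign_def by blast+
  show "branch_sign A v r \<in> {1, -1}" by (rule b(1))
  obtain \<kappa>1 where "(f \<longlongrightarrow> K * gauss_branch A v \<kappa>1) at_top" "gauss_branch A v \<kappa>1 * r = branch_sign A v r * ?Z"
    using eventually_happens'[OF _ eventually_conj[OF lim b(2)]] by auto
  moreover from this(2) have "gauss_branch A v \<kappa>1 = branch_sign A v r * ?Z / r" using r0 by (simp add: field_simps)
  ultimately show "(f \<longlongrightarrow> K * (branch_sign A v r * ?Z / r)) at_top" by simp
qed

lemma sqrt_power_mult_powr:
  assumes "0 < lam"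
  shows "(2 * pi / lam) powr (real n / 2) * sqrt lam ^ n = sqrt ((2 * pi) ^ n)"
proof -
  have p: "x powr (real n / 2) = sqrt x ^ n" if "0 < x" for x :: real
    using that powr_powr[of x "1 / 2" "real n"] by (simp add: powr_half_sqrt powr_realpow)
  have "(2 * pi / lam) powr (real n / 2) = sqrt (2 * pi / lam) ^ n" using assms by (intro p) simp
  then show ?thesis
    unfolding real_sqrt_power using assms by (simp only: power_mult_distrib[symmetric] real_sqrt_mult[symmetric]) simp
qed

text \<open>The sign is quantified before \<open>T\<close>, \<open>p\<close>, \<open>f\<close> and
  \<open>q\<close>. It may use the tangents of the given curves, but the integrand enters it only
  through the argument of \<open>\<alpha>\<close>, the matrix \<open>A\<close> and the chosen root
  \<open>r\<close>.\<close>

theorem theorem2p1: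
  fixes \<Gamma> :: "'m::finite \<Rightarrow> curve" and \<gamma> :: curve
  assumes "\<And>k. smooth_simple_curve (\<Gamma> k)" and "smooth_simple_curve \<gamma>"
    and "\<And>k. interior_point (\<Gamma> k) 0" and "interior_point \<gamma> 0"
  shows "\<exists>sign :: real \<Rightarrow> complex ^ 'm ^ 'm \<Rightarrow> complex \<Rightarrow> complex.
    (\<forall>a A r. sign a A r \<in> {1, -1}) \<and>
    (\<forall>(T :: ((complex ^ 'm) \<times> complex) set) p f q \<alpha> \<eta> A.
       open T \<and> connected T \<and> curve_product \<Gamma> \<gamma> \<subseteq> T \<and>
       holomorphic_several p T \<and> holomorphic_several f T \<and> holomorphic_several q T \<and>
       \<alpha> = partial_t p (0, 0) \<and> \<eta> = grad_theta f (0, 0) \<and> A = hessian_theta p (0, 0) \<and>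
       \<alpha> \<noteq> 0 \<and> grad_theta p (0, 0) = 0 \<and>
       det A \<noteq> 0 \<and>
       (\<exists>lam0>0. \<forall>lam\<ge>lam0. pv_abs_convergent_away_from_origin \<Gamma> \<gamma> (numerator p f q lam)) \<and>
       (\<forall>\<epsilon>>0. \<exists>lam1>0.
          (INF (z, lam) \<in> (curve_product \<Gamma> \<gamma> - origin_box \<Gamma> \<gamma> \<epsilon>) \<times> {lam1..}.
             ereal (Re (p z - p (0, 0) + (f z - f (0, 0)) / of_real (sqrt lam)))) > 0) \<and>
       q (0, 0) \<noteq> 0
       \<longrightarrow>
       (\<forall>r. r ^ 2 = det A \<longrightarrow>
          (\<forall>\<^sub>F lam in at_top. \<exists>L. has_pv_integral \<Gamma> \<gamma> (numerator p f q lam) L) \<and>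
          asymp_equiv (\<lambda>lam. pv_integral \<Gamma> \<gamma> (numerator p f q lam)) at_top
            (\<lambda>lam. \<i> * of_real pi * of_real ((2 * pi / lam) powr (real CARD('m) / 2)) * q (0, 0) *
                 exp (- of_real lam * p (0, 0) - of_real (sqrt lam) * f (0, 0)) *
                 exp (bilin \<eta> (matrix_inv A) \<eta> / 2) * (sign (Arg \<alpha>) A r / r))))"
proof -
  obtain s0 where s0: "s0 \<in> interior (fst \<gamma>)" "snd \<gamma> s0 = 0" using assms(4) unfolding interior_point_def by (metis imageE)
  have "\<forall>k. \<exists>x. x \<in> interior (fst (\<Gamma> k)) \<and> snd (\<Gamma> k) x = 0" using assms(3) unfolding interior_point_def by (metis imageE)
  from choice[OF this] obtain y where y: "\<And>k. y k \<in> interior (fst (\<Gamma> k))" "\<And>k. snd (\<Gamma> k) (y k) = 0" by blast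
  define x0 :: "real ^ 'm" where "x0 = (\<chi> k. y k)"
  have x0: "\<And>k. x0 $ k \<in> interior (fst (\<Gamma> k))" "\<And>k. snd (\<Gamma> k) (x0 $ k) = 0" using y by (simp_all add: x0_def)
  define v :: "complex ^ 'm" where "v = (\<chi> k. speed (\<Gamma> k) (x0 $ k))"
  \<comment> \<open>\<open>cis a\<close> with \<open>a = Arg \<alpha>\<close> differs from
    \<open>\<alpha>\<close> by a positive factor, so it yields the same sign of
    \<open>\<beta>\<close>. The minus sign turns the half residue
    \<open>- \<i> \<pi> sgn \<beta>\<close> into the \<open>\<i> \<pi>\<close> of the claim. The
    default 1 covers arguments for which the product is not a sign, for instance where the imaginary
    part is 0.\<close>
  define sign where "sign = (\<lambda>a A r. let c = - of_real (sgn (Im (cis a * speed \<gamma> s0))) * branch_sign A v r in if c \<in> {1, -1} then c else 1)"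
  show ?thesis
  proof (intro exI[of _ sign] conjI allI impI)
    show "sign a A r \<in> {1, -1}" for a A r by (simp add: sign_def Let_def)
  next
    fix T :: "((complex ^ 'm) \<times> complex) set" and p f q \<alpha> \<eta> A r
    assume hyp: "open T \<and> connected T \<and> curve_product \<Gamma> \<gamma> \<subseteq> T \<and>
       holomorphic_several p T \<and> holomorphic_several f T \<and> holomorphic_several q T \<and>
       \<alpha> = partial_t p (0, 0) \<and> \<eta> = grad_theta f (0, 0) \<and> A = hessian_theta p (0, 0) \<and>
       \<alpha> \<noteq> 0 \<and> grad_theta p (0, 0) = 0 \<and>
       det A \<noteq> 0 \<and>
       (\<exists>lam0>0. \<forall>lam\<ge>lam0. pv_abs_convergent_away_from_origin \<Gamma> \<gamma> (numerator p f q lam)) \<and>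
       (\<forall>\<epsilon>>0. \<exists>lam1>0.
          (INF (z, lam) \<in> (curve_product \<Gamma> \<gamma> - origin_box \<Gamma> \<gamma> \<epsilon>) \<times> {lam1..}.
             ereal (Re (p z - p (0, 0) + (f z - f (0, 0)) / of_real (sqrt lam)))) > 0) \<and>
       q (0, 0) \<noteq> 0" and r: "r ^ 2 = det A"
    then have T: "open T" "curve_product \<Gamma> \<gamma> \<subseteq> T" and hol: "holomorphic_several p T" "holomorphic_several f T" "holomorphic_several q T"
      and \<alpha>: "\<alpha> = partial_t p (0, 0)" "\<alpha> \<noteq> 0" and \<eta>: "\<eta> = grad_theta f (0, 0)" and A: "A = hessian_theta p (0, 0)" "det A \<noteq> 0"
      and grad: "grad_theta p (0, 0) = 0" and q0: "q (0, 0) \<noteq> 0"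
      by blast+
    from hyp obtain lam0 where lam0: "0 < lam0" and conv: "\<And>lam. lam0 \<le> lam \<Longrightarrow> pv_abs_convergent_away_from_origin \<Gamma> \<gamma> (numerator p f q lam)" by blast
    from hyp have inf: "\<And>\<epsilon>. 0 < \<epsilon> \<Longrightarrow> \<exists>lam1>0.
          (INF (z, lam) \<in> (curve_product \<Gamma> \<gamma> - origin_box \<Gamma> \<gamma> \<epsilon>) \<times> {lam1..}.
             ereal (Re (p z - p (0, 0) + (f z - f (0, 0)) / of_real (sqrt lam)))) > 0" by blast
    define P where "P = (\<lambda>z. p z - p (0, 0))"
    define F where "F = (\<lambda>z. f z - f (0, 0))"
    \<comment> \<open>A real number strictly between 0 and the infimum also exists when the infimum
      is infinite, as for an empty index set. The threshold becomes \<open>sqrt lam1\<close> because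
      \<open>s\<close> stands for the square root of the parameter.\<close>
    have gap: "\<exists>\<delta> s1. 0 < \<delta> \<and> 0 < s1 \<and> (\<forall>z\<in>curve_product \<Gamma> \<gamma> - origin_box \<Gamma> \<gamma> \<epsilon>. \<forall>s\<ge>s1. \<delta> \<le> Re (P z + F z / of_real s))" if "0 < \<epsilon>" for \<epsilon>
    proof -
      from inf[OF that] obtain lam1 where lam1: "0 < lam1" and pos: "(INF (z, lam) \<in> (curve_product \<Gamma> \<gamma> - origin_box \<Gamma> \<gamma> \<epsilon>) \<times> {lam1..}.
             ereal (Re (p z - p (0, 0) + (f z - f (0, 0)) / of_real (sqrt lam)))) > 0" by blast
      from ereal_dense2[OF pos] obtain \<delta> where \<delta>: "0 < ereal \<delta>" "ereal \<delta> < (INF (z, lam) \<in> (curve_product \<Gamma> \<gamma> - origin_box \<Gamma> \<gamma> \<epsilon>) \<times> {lam1..}.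
             ereal (Re (p z - p (0, 0) + (f z - f (0, 0)) / of_real (sqrt lam))))" by blast
      have "\<delta> \<le> Re (P z + F z / of_real s)" if z: "z \<in> curve_product \<Gamma> \<gamma> - origin_box \<Gamma> \<gamma> \<epsilon>" and s: "sqrt lam1 \<le> s" for z s
      proof -
        have s0: "0 \<le> s" using s lam1 real_sqrt_ge_zero[of lam1] by linarith
        have "(z, s\<^sup>2) \<in> (curve_product \<Gamma> \<gamma> - origin_box \<Gamma> \<gamma> \<epsilon>) \<times> {lam1..}" using z sqrt_le_D[OF s] by simp
        from less_le_trans[OF \<delta>(2) INF_lower[OF this]] show ?thesis using s0 by (simp add: P_def F_def)
      qed
      then show ?thesis using \<delta>(1) lam1 by (intro exI[of _ \<delta>] exI[of _ "sqrt lam1"]) auto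
    qed
    \<comment> \<open>The factor split off by subtracting the values at the origin. It occurs in the
      integral and in the leading term, and cancels in their quotient.\<close>
    define E where "E = (\<lambda>lam. exp (- of_real lam * p (0, 0) - of_real (sqrt lam) * f (0, 0)))"
    have num: "numerator p f q lam = (\<lambda>z. E lam * numerator P F q lam z)" "numerator P F q lam = (\<lambda>z. inverse (E lam) * numerator p f q lam z)" for lam
    proof -
      have "numerator p f q lam z = E lam * numerator P F q lam z" for z
        unfolding numerator_def E_def P_def F_def mult.assoc[symmetric] exp_add[symmetric] by (simp add: algebra_simps)
      moreover have "E lam \<noteq> 0" by (simp add: E_def)
      ultimately show "numerator p f q lam = (\<lambda>z. E lam * numerator P F q lam z)" "numerator P F q lam = (\<lambda>z. inverse (E lam) * numerator p f q lam z)"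
        by (simp_all add: fun_eq_iff)
    qed
    have hP: "holomorphic_several P T" "holomorphic_several F T"
      unfolding P_def F_def by (intro holomorphic_several_diff_const hol)+
    have dP: "partial_t P (0, 0) = \<alpha>" "grad_theta P (0, 0) = 0" "A = hessian_theta P (0, 0)" "\<eta> = grad_theta F (0, 0)"
      using grad by (simp_all add: \<alpha>(1) A(1) \<eta> P_def F_def partial_t_def grad_theta_def hessian_theta_def partial_theta_def deriv_diff_const)
    have s0J: "s0 \<in> fst \<gamma>" using s0(1) interior_subset by blast
    have inD: "(0, snd \<gamma> s) \<in> curve_product \<Gamma> \<gamma>" if "s \<in> fst \<gamma>" for s
    proof -
      have "0 \<in> curve_trace (\<Gamma> k)" for k using x0[of k] interior_subset by (metis imageI subsetD)
      then show ?thesis using that by (simp add: curve_product_def theta_set_def)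
    qed
    have P00: "P (0, 0) = 0" "F (0, 0) = 0" by (simp_all add: P_def F_def)
    define \<beta> where "\<beta> = Im (\<alpha> * speed \<gamma> s0)"
    have tangent: "\<alpha> * speed \<gamma> s0 = \<i> * of_real \<beta>"
      unfolding \<beta>_def
    proof (rule tangent_imaginary[OF assms(2) s0, of "\<lambda>t. P (0, t)"])
      have "(0, 0) \<in> T" using inD[OF s0J] s0(2) T(2) by auto
      have "continuous_on UNIV (Pair (0 :: complex ^ 'm) :: complex \<Rightarrow> _)"
        by (intro continuous_on_Pair continuous_on_const continuous_on_id)
      from open_vimage[OF T(1) this] \<open>(0, 0) \<in> T\<close> have "open {t. (0, t) \<in> T}" "0 \<in> {t. (0, t) \<in> T}"
        by (simp_all add: vimage_def)
      moreover have "(\<lambda>t. P (0, t)) holomorphic_on {t. (0, t) \<in> T}" by (rule holomorphic_several_fibre[OF hP(1)]) simp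
      ultimately have "((\<lambda>t. P (0, t)) has_field_derivative deriv (\<lambda>t. P (0, t)) 0) (at 0)" by (intro holomorphic_derivI)
      then show "((\<lambda>t. P (0, t)) has_field_derivative \<alpha>) (at 0)" using dP(1) by (simp add: partial_t_def)
      fix s assume s: "s \<in> fst \<gamma>"
      show "0 \<le> Re (P (0, snd \<gamma> s))"
      proof (cases "snd \<gamma> s = 0")
        case False
        then obtain \<delta> s1 where \<delta>: "0 < \<delta>" "\<forall>z\<in>curve_product \<Gamma> \<gamma> - origin_box \<Gamma> \<gamma> (cmod (snd \<gamma> s)). \<forall>s\<ge>s1. \<delta> \<le> Re (P z + F z / of_real s)"
          using gap[of "cmod (snd \<gamma> s)"] by auto
        have mem: "(0, snd \<gamma> s) \<in> curve_product \<Gamma> \<gamma> - origin_box \<Gamma> \<gamma> (cmod (snd \<gamma> s))"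
          using inD[OF s] by (simp add: origin_box_def)
        have "\<delta> \<le> Re (P (0, snd \<gamma> s))"
          by (rule Re_lower_bound_limit) (rule mp[OF spec[OF bspec[OF \<delta>(2) mem]]])
        then show ?thesis using \<delta>(1) by simp
      qed (simp add: P00)
    qed (rule P00)
    have speed0: "speed \<gamma> s0 \<noteq> 0" by (rule smooth_simple_curve_speed(3)[OF assms(2) s0J])
    then have \<beta>0: "\<beta> \<noteq> 0" using tangent \<alpha>(2) by auto
    \<comment> \<open>Multiplication by \<open>\<alpha>\<close> turns this tolerance into the
      \<open>\<bar>\<beta>\<bar> / 8\<close> demanded by \<open>crossing_arc\<close>.\<close>
    have w: "0 < \<bar>\<beta>\<bar> / (8 * cmod \<alpha>)" using \<beta>0 \<alpha>(2) by simp
    obtain d where d: "0 < d" "{s0-d..s0+d} \<subseteq> interior (fst \<gamma>)"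
      and nr: "\<And>s t. \<bar>s - s0\<bar> \<le> d \<Longrightarrow> \<bar>t - s0\<bar> \<le> d \<Longrightarrow> cmod (snd \<gamma> t - snd \<gamma> s - of_real (t - s) * speed \<gamma> s0) \<le> \<bar>\<beta>\<bar> / (8 * cmod \<alpha>) * \<bar>t - s\<bar>"
      using smooth_simple_curve_near_tangent[OF assms(2) s0(1) w] by blast
    have near: "cmod (\<alpha> * snd \<gamma> s - \<i> * of_real (\<beta> * (s - s0))) \<le> \<bar>\<beta>\<bar> / 8 * \<bar>s - s0\<bar>" if "\<bar>s - s0\<bar> \<le> d" for s
    proof -
      have "\<i> * of_real (\<beta> * (s - s0)) = of_real (s - s0) * (\<alpha> * speed \<gamma> s0)"
        unfolding tangent of_real_mult by (simp only: mult_ac)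
      then have "\<alpha> * snd \<gamma> s - \<i> * of_real (\<beta> * (s - s0)) = \<alpha> * (snd \<gamma> s - of_real (s - s0) * speed \<gamma> s0)"
        by (simp only: right_diff_distrib mult.left_commute)
      then have "cmod (\<alpha> * snd \<gamma> s - \<i> * of_real (\<beta> * (s - s0))) = cmod \<alpha> * cmod (snd \<gamma> s - of_real (s - s0) * speed \<gamma> s0)"
        by (simp only: norm_mult)
      also have "\<dots> \<le> cmod \<alpha> * (\<bar>\<beta>\<bar> / (8 * cmod \<alpha>) * \<bar>s - s0\<bar>)"
        using nr[of s0 s] that d(1) s0(2) by (intro mult_left_mono) (simp_all del: of_real_diff)
      also have "\<dots> = \<bar>\<beta>\<bar> / 8 * \<bar>s - s0\<bar>" using \<alpha>(2) by simp
      finally show ?thesis .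
    qed
    interpret S: saddle_setting \<gamma> s0 \<alpha> \<beta> d \<Gamma> x0 T P F q A \<eta> lam0
    proof
      fix lam assume "lam0 \<le> lam"
      then show "pv_abs_convergent_away_from_origin \<Gamma> \<gamma> (numerator P F q lam)"
        unfolding num(2) by (rule pv_abs_convergent_scale[OF conv])
    qed (rule assms s0 x0 \<alpha>(2) \<beta>0 tangent d near T hP hol(3) P00 dP A(2) lam0 gap, assumption?)+
    obtain I where I: "\<forall>\<^sub>F s in at_top. has_pv_integral \<Gamma> \<gamma> (numerator P F q (s\<^sup>2)) (I s)"
      and lim: "\<forall>\<^sub>F \<kappa> in at_right 0.
       ((\<lambda>s. of_real (s ^ CARD('m)) * I s) \<longlongrightarrow> - \<i> * of_real (pi * sgn \<beta>) * (q (0, 0) * exp (bilin \<eta> (matrix_inv A) \<eta> / 2) * gauss_branch A v \<kappa>)) at_top \<and>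
       (gauss_branch A v \<kappa>)\<^sup>2 * det A = (2 * pi) ^ CARD('m)"
      using S.main_limit[folded v_def] by blast
    define K where "K = - \<i> * of_real (pi * sgn \<beta>) * (q (0, 0) * exp (bilin \<eta> (matrix_inv A) \<eta> / 2))"
    have K: "K \<noteq> 0" using q0 \<beta>0 by (simp add: K_def sgn_zero_iff)
    have lim': "\<forall>\<^sub>F \<kappa> in at_right 0. ((\<lambda>s. of_real (s ^ CARD('m)) * I s) \<longlongrightarrow> K * gauss_branch A v \<kappa>) at_top \<and> (gauss_branch A v \<kappa>)\<^sup>2 * det A = (2 * pi) ^ CARD('m)"
      using lim unfolding K_def by (simp only: mult.assoc)
    note br = branch_sign[OF lim' K r A(2)]
    let ?Z = "complex_of_real (sqrt ((2 * pi) ^ CARD('m)))"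
    have r0: "r \<noteq> 0" using r A(2) by auto
    have sgn\<beta>: "sgn \<beta> = sgn (Im (cis (Arg \<alpha>) * speed \<gamma> s0))"
    proof -
      have "\<alpha> = of_real (cmod \<alpha>) * cis (Arg \<alpha>)" using rcis_cmod_Arg[of \<alpha>] by (simp add: rcis_def)
      then have "\<beta> = Im (of_real (cmod \<alpha>) * cis (Arg \<alpha>) * speed \<gamma> s0)" unfolding \<beta>_def by metis
      also have "\<dots> = cmod \<alpha> * Im (cis (Arg \<alpha>) * speed \<gamma> s0)" by (simp add: mult.assoc distrib_left)
      finally show ?thesis using \<alpha>(2) by (simp add: sgn_mult)
    qed
    have "- of_real (sgn \<beta>) * branch_sign A v r \<in> {1, -1 :: complex}"
      using br(1) \<beta>0 by (auto simp: sgn_if)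
    then have sign: "sign (Arg \<alpha>) A r = - of_real (sgn \<beta>) * branch_sign A v r"
      unfolding sign_def Let_def sgn\<beta>[symmetric] by (rule if_P)
    define L0 where "L0 = K * (branch_sign A v r * ?Z / r)"
    have L0: "L0 \<noteq> 0" using K br(1) r0 by (auto simp: L0_def)
    have L0': "L0 = \<i> * of_real pi * q (0, 0) * exp (bilin \<eta> (matrix_inv A) \<eta> / 2) * (sign (Arg \<alpha>) A r / r) * ?Z"
      unfolding L0_def K_def sign by (simp add: mult_ac)
    have I': "\<forall>\<^sub>F lam in at_top. has_pv_integral \<Gamma> \<gamma> (numerator p f q lam) (E lam * I (sqrt lam))"
      using eventually_compose_filterlim[OF I sqrt_at_top] eventually_gt_at_top[of 0]
    proof eventually_elim
      case (elim lam)
      then have "has_pv_integral \<Gamma> \<gamma> (numerator P F q lam) (I (sqrt lam))" by simp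
      then show ?case unfolding num(1) by (rule has_pv_integral_scale)
    qed
    have main: "(\<forall>\<^sub>F lam in at_top. \<exists>L. has_pv_integral \<Gamma> \<gamma> (numerator p f q lam) L) \<and>
      asymp_equiv (\<lambda>lam. pv_integral \<Gamma> \<gamma> (numerator p f q lam)) at_top
            (\<lambda>lam. \<i> * of_real pi * of_real ((2 * pi / lam) powr (real CARD('m) / 2)) * q (0, 0) *
                 exp (- of_real lam * p (0, 0) - of_real (sqrt lam) * f (0, 0)) *
                 exp (bilin \<eta> (matrix_inv A) \<eta> / 2) * (sign (Arg \<alpha>) A r / r))" (is "_ \<and> asymp_equiv ?f at_top ?g")
    proof
      show "\<forall>\<^sub>F lam in at_top. \<exists>L. has_pv_integral \<Gamma> \<gamma> (numerator p f q lam) L"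
        using I' by eventually_elim (rule exI)
      have g: "?g lam * of_real (sqrt lam ^ CARD('m)) = E lam * L0" if "0 < lam" for lam
      proof -
        have "complex_of_real ((2 * pi / lam) powr (real CARD('m) / 2)) * of_real (sqrt lam ^ CARD('m)) = ?Z"
          unfolding of_real_mult[symmetric] sqrt_power_mult_powr[OF that] ..
        then have "?Z = complex_of_real ((2 * pi / lam) powr (real CARD('m) / 2)) * of_real (sqrt lam ^ CARD('m))" ..
        then show ?thesis unfolding L0' E_def by (simp only: mult_ac)
      qed
      have "((\<lambda>s. of_real (s ^ CARD('m)) * I s / L0) \<longlongrightarrow> L0 / L0) at_top"
        using br(2)[folded L0_def] by (intro tendsto_divide tendsto_const L0)
      from filterlim_compose[OF this sqrt_at_top]
      have "((\<lambda>lam. of_real (sqrt lam ^ CARD('m)) * I (sqrt lam) / L0) \<longlongrightarrow> 1) at_top" using L0 by simp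
      then have "((\<lambda>lam. ?f lam / ?g lam) \<longlongrightarrow> 1) at_top"
      proof (rule Lim_transform_eventually)
        show "\<forall>\<^sub>F lam in at_top. of_real (sqrt lam ^ CARD('m)) * I (sqrt lam) / L0 = ?f lam / ?g lam"
          using I' eventually_gt_at_top[of 0]
        proof eventually_elim
          case (elim lam)
          have E0: "E lam \<noteq> 0" by (simp add: E_def)
          have s0: "complex_of_real (sqrt lam ^ CARD('m)) \<noteq> 0" using elim(2) by simp
          have quotient: "S * i / l = (e * i) / g'" if "g' * S = e * l" "S \<noteq> 0" "e \<noteq> 0" "l \<noteq> 0" for S i l e g' :: complex
          proof -
            have "g' = e * l / S" using that(1,2) by (simp add: eq_divide_eq)
            then show ?thesis using that(2-4) by simp
          qed
          show ?case
            unfolding pv_integral_unique[OF elim(1)] by (rule quotient[OF g[OF elim(2)] s0 E0 L0])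
        qed
      qed
      then show "asymp_equiv ?f at_top ?g" by (rule asymp_equivI')
    qed
    then show "\<forall>\<^sub>F lam in at_top. \<exists>L. has_pv_integral \<Gamma> \<gamma> (numerator p f q lam) L" by (rule conjunct1)
    from main show "asymp_equiv (\<lambda>lam. pv_integral \<Gamma> \<gamma> (numerator p f q lam)) at_top
            (\<lambda>lam. \<i> * of_real pi * of_real ((2 * pi / lam) powr (real CARD('m) / 2)) * q (0, 0) *
                 exp (- of_real lam * p (0, 0) - of_real (sqrt lam) * f (0, 0)) *
                 exp (bilin \<eta> (matrix_inv A) \<eta> / 2) * (sign (Arg \<alpha>) A r / r))" by (rule conjunct2)
  qed
qed

end
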